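(* There is an absolute constant $C>0$ such that the following holds. For any $T\in\mathbb N$ let $0\le\mu^{(T)}<\mu^{(T-1)}<\dots<\mu^{(1)}<\mu^{(0)}$ be such that for all $1\le i\le T$ the segment $\mathrm{CP}[\mu^{(i)},\mu^{(i-1)}]$ is $\gamma$-polarized with polarizing partition $B^{(i)}\cup N^{(i)}=[n]$ ($\gamma\in(0,1]$), and put $N^{(0)}:=\emptyset$. Let $\beta\in(0,1/6]$ and $\rho\ge1$. Then SLLS-IPM equipped with a $\rho$-SVD solver, starting from any point $z^{(0)}\in\mathcal N^2(\beta)$ such that $\overline\mu(z^{(0)})\le\mu^{(0)}$, finds a point $z\in\overline{\mathcal N}^2(\beta)$ such that $\overline\mu(z)\le\mu^{(T)}$ in at most $$C\,\frac{\sqrt n}{\beta}\log\Big(\frac{n\rho}{\beta\gamma}\Big)\sum_{i=1}^T\Big(\big|N^{(i)}\Delta N^{(i-1)}\big|+1\Big)$$ iterations.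
   Context: **Linear programs.** $A\in\mathbb R^{m\times n}$ has rank $m\le n$, $b\in\mathbb R^m$, $c\in\mathbb R^n$. The primal-dual pair is (LP): $\min\{\langle c,x\rangle: Ax=b,\ x\ge 0\}$ and $\max\{\langle b,y\rangle: A^\top y+s=c,\ s\ge 0\}$, assumed feasible and bounded. $\mathcal P=\{x\in\mathbb R^n: Ax=b,x\ge0\}$, $\mathcal D=\{s\in\mathbb R^n:\exists y,\ A^\top y+s=c,\ s\ge0\}$, and $\mathcal P_{++},\mathcal D_{++}$ are the subsets of coordinatewise strictly positive points, assumed nonempty. $W=\ker A$, $W^\perp=\operatorname{im}A^\top$. Products, quotients, square roots and inverses of vectors are coordinatewise; for a vector $x$ and subspace $V$, $xV=\{xv:v\in V\}$; $\|\cdot\|$ is the Euclidean norm and $\mathbf 1$ the all-ones vector. For $z=(x,s)$, $\overline\mu(z)=\langle x,s\rangle/n$. $\mathcal N^2(\beta)=\{z=(x,s)\in\mathcal P_{++}\times\mathcal D_{++}:\|xs/\overline\mu(z)-\mathbf 1\|\le\beta\}$, with closure $\overline{\mathcal N}^2(\beta)$. $S\Delta T$ denotes symmetric difference. **Central path and polarization.** For $\mu>0$, $z^{\mathrm{cp}}(\mu)=(x^{\mathrm{cp}}(\mu),s^{\mathrm{cp}}(\mu))$ is the unique $(x,s)\in\mathcal P_{++}\times\mathcal D_{++}$ with $xs=\mu\mathbf 1$; $z^{\mathrm{cp}}(0)$ is the limit as $\mu\searrow0$; $\mathrm{CP}[\mu_1,\mu_0]=\{z^{\mathrm{cp}}(\mu):\mu_1\le\mu\le\mu_0\}$.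 $\mathrm{CP}[\mu_1,\mu_0]$ is $\gamma$-polarized with partition $B\cup N=[n]$ if for all $\mu\in[\mu_1,\mu_0]$: $x^{\mathrm{cp}}_i(\mu)\ge\gamma x^{\mathrm{cp}}_i(\mu_0)$ for $i\in B$ and $s^{\mathrm{cp}}_i(\mu)\ge\gamma s^{\mathrm{cp}}_i(\mu_0)$ for $i\in N$. **$\rho$-SVD problem** ($\rho\ge1$). Input: a real $p\times q$ matrix $M$. Output: a matrix $C\in\mathbb R^{q\times q}$ whose columns are nonzero and pairwise orthogonal, and a non-increasing $t\in\mathbb R^q_+$, such that $\|Mu\|\le t_i\|u\|$ for all $u$ in the span of columns $i,\dots,q$ of $C$ and all $i\in[q]$, and $\rho^{-1}t\le\sigma(M)\le t$, where $\sigma(M)\in\mathbb R^q$ lists the singular values of $M$ in non-increasing order, padded by zeros. **Algorithm SLLS-IPM.** Parameters: $\beta\in(0,1/6]$ and $\rho\ge1$, with a $\rho$-SVD solver as subroutine. Start at $(x,s)=z^{(0)}\in\mathcal N^2(\beta)$ and repeat the following iteration while $\overline\mu(x,s)$ is larger than the target value. 1. (Corrector) Let $(\Delta x^c,\Delta s^c)\in W\times W^\perp$ be the unique solution of $s\Delta x+x\Delta s=\overline\mu(x,s)\mathbf 1-xs$; set $(x,s)\leftarrow(x+\Delta x^c,s+\Delta s^c)$. Let $\mu=\overline\mu(x,s)$. 2. (Affine scaling) Let $(\Delta x^a,\Delta s^a)\in W\times W^\perp$ be the unique solution of $s\Delta x+x\Delta s=-xs$, and choose $\alpha^a\in(0,1]$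 with $\max\{\frac{\beta}{3\sqrt n},1-\frac{3\|\Delta x^a\Delta s^a\|}{\beta\mu}\}\le\alpha^a\le\max\{\frac{\beta}{2\sqrt n},1-\frac{2\|\Delta x^a\Delta s^a\|}{\beta\mu}\}$. 3. (Partition) $B=\{i:|\Delta x^a_i/x_i|<|\Delta s^a_i/s_i|\}$, $N=[n]\setminus B$. 4. (Cheap lift subspaces $V\subseteq W$, $U\subseteq W^\perp$) If $B=\emptyset$: $V=W$, $U=\{0\}$. If $N=\emptyset$: $V=\{0\}$, $U=W^\perp$. Otherwise let $P$ and $P^\perp=I-P$ be the orthogonal projection matrices onto $x^{-1}W$ and $xW^\perp$; let $\bar L=P_{\cdot,N}(P_{N,N})^+$, $\bar L^\perp=P^\perp_{\cdot,B}(P^\perp_{B,B})^+$ ($^+$ is the Moore–Penrose pseudoinverse), $\bar\ell=\bar L_{B,\cdot}$, $\bar\ell^\perp=\bar L^\perp_{N,\cdot}$. Let $(C,t)$, $(C',t')$ be $\rho$-SVD outputs for $\bar\ell\in\mathbb R^{B\times N}$ and $\bar\ell^\perp\in\mathbb R^{N\times B}$, $p=|\{i:t_i\le1\}|$, $q=|\{i:t'_i\le1\}|$. Set $V=x\,\bar L(\text{span of the last }p\text{ columns of }C)$ and $U=x^{-1}\bar L^\perp(\text{span of the last }q\text{ columns of }C')$. 5. (Subspace layered least squares) With $\hat x=\sqrt{x\mu/s}$, $\hat s=\sqrt{s\mu/x}$, let $\Delta x^\ell=\arg\min_{\delta\in V}\|(x_N+\delta_N)/\hat x_N\|$ and $\Delta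 s^\ell=\arg\min_{\delta\in U}\|(s_B+\delta_B)/\hat s_B\|$ (minimizers are unique). Let $\epsilon=\|(x+\Delta x^\ell)(s+\Delta s^\ell)\|/\mu$. If $\max\{\|\Delta x^\ell\Delta s^\ell\|/\mu,\epsilon\}\le\beta/9$ choose $\alpha^\ell\in[1-\frac{9\epsilon}{\beta},1-\frac{8\epsilon}{\beta}]$, otherwise $\alpha^\ell=0$. 6. Replace $(x,s)$ by whichever of $(x+\alpha^a\Delta x^a,s+\alpha^a\Delta s^a)$ and $(x+\alpha^\ell\Delta x^\ell,s+\alpha^\ell\Delta s^\ell)$ has smaller $\overline\mu$ (the second one in case of a tie). *)

theory Defs
  imports
    Complex_Main
    "Jordan_Normal_Form.Matrix_Kernel"
    "Jordan_Normal_Form.DL_Rank"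
    "Jordan_Normal_Form.DL_Submatrix"
begin

text \<open>
  Vectors and matrices carry their dimensions as terms, not as types, so that a constant can be
  chosen uniformly in all dimensions. A linear program is given by \<open>A\<close>, \<open>b\<close>, \<open>c\<close> with
  \<open>m = dim_row A\<close> and \<open>n = dim_col A\<close>; the coordinates \<open>1, \<dots>, n\<close> are represented as \<open>{..<n}\<close>.
\<close>

definition vnorm :: "real vec \<Rightarrow> real" where
  "vnorm v = sqrt (v \<bullet> v)"

definition vnorm_on :: "nat set \<Rightarrow> real vec \<Rightarrow> real" where
  "vnorm_on I v = sqrt (\<Sum>i\<in>I. (v $ i)\<^sup>2)"

definition ones :: "nat \<Rightarrow> real vec" where
  "ones n = vec n (\<lambda>_. 1)"

abbreviation cmult :: "real vec \<Rightarrow> real vec \<Rightarrow> real vec" (infixl "\<odot>" 70) where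
  "x \<odot> y \<equiv> component_mult x y"

definition cinv :: "real vec \<Rightarrow> real vec" where
  "cinv x = map_vec inverse x"

definition cdiv :: "real vec \<Rightarrow> real vec \<Rightarrow> real vec" (infixl "\<oslash>" 70) where
  "x \<oslash> y = x \<odot> cinv y"

definition vsqrt :: "real vec \<Rightarrow> real vec" where
  "vsqrt x = map_vec sqrt x"

definition cscale :: "real vec \<Rightarrow> real vec set \<Rightarrow> real vec set" where
  "cscale x V = (\<lambda>v. x \<odot> v) ` V"

definition vec_span :: "nat \<Rightarrow> real vec set \<Rightarrow> real vec set" where
  "vec_span n S = LinearCombinations.module.span class_ring (module_vec TYPE(real) n) S"

definition mat_image :: "real mat \<Rightarrow> real vec set" where
  "mat_image M = {M *\<^sub>v y | y. y \<in> carrier_vec (dim_col M)}"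

definition orth_proj :: "nat \<Rightarrow> real vec set \<Rightarrow> real mat" where
  "orth_proj n S = (THE P. P \<in> carrier_mat n n \<and>
     (\<forall>v\<in>carrier_vec n. P *\<^sub>v v \<in> S \<and> (\<forall>w\<in>S. (v - P *\<^sub>v v) \<bullet> w = 0)))"

definition pinv :: "real mat \<Rightarrow> real mat" where
  "pinv M = (THE X. X \<in> carrier_mat (dim_col M) (dim_row M) \<and>
     M * X * M = M \<and> X * M * X = X \<and>
     transpose_mat (M * X) = M * X \<and> transpose_mat (X * M) = X * M)"

abbreviation kerW :: "real mat \<Rightarrow> real vec set" where
  "kerW A \<equiv> mat_kernel A"

abbreviation kerW_perp :: "real mat \<Rightarrow> real vec set" where
  "kerW_perp A \<equiv> mat_image (transpose_mat A)"

definition primal :: "real mat \<Rightarrow> real vec \<Rightarrow> real vec set" where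
  "primal A b = {x \<in> carrier_vec (dim_col A). A *\<^sub>v x = b \<and> (\<forall>i<dim_col A. 0 \<le> x $ i)}"

definition dual :: "real mat \<Rightarrow> real vec \<Rightarrow> real vec set" where
  "dual A c = {s \<in> carrier_vec (dim_col A).
     (\<exists>y\<in>carrier_vec (dim_row A). transpose_mat A *\<^sub>v y + s = c) \<and> (\<forall>i<dim_col A. 0 \<le> s $ i)}"

definition primal_pos :: "real mat \<Rightarrow> real vec \<Rightarrow> real vec set" where
  "primal_pos A b = {x \<in> primal A b. \<forall>i<dim_col A. 0 < x $ i}"

definition dual_pos :: "real mat \<Rightarrow> real vec \<Rightarrow> real vec set" where
  "dual_pos A c = {s \<in> dual A c. \<forall>i<dim_col A. 0 < s $ i}"

text \<open>
  Nonemptiness of both strictly positive feasible sets implies, by weak duality, that both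
  programs are feasible and bounded.
\<close>

definition lp_instance :: "nat \<Rightarrow> nat \<Rightarrow> real mat \<Rightarrow> real vec \<Rightarrow> real vec \<Rightarrow> bool" where
  "lp_instance n m A b c \<longleftrightarrow>
     0 < n \<and> m \<le> n \<and> A \<in> carrier_mat m n \<and> b \<in> carrier_vec m \<and> c \<in> carrier_vec n \<and>
     vec_space.rank m A = m \<and> primal_pos A b \<noteq> {} \<and> dual_pos A c \<noteq> {}"

type_synonym point = "real vec \<times> real vec"

definition mubar :: "point \<Rightarrow> real" where
  "mubar z = (fst z \<bullet> snd z) / real (dim_vec (fst z))"

definition nbhd :: "real mat \<Rightarrow> real vec \<Rightarrow> real vec \<Rightarrow> real \<Rightarrow> point set" where
  "nbhd A b c \<beta> = {(x, s). x \<in> primal_pos A b \<and> s \<in> dual_pos A c \<and>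
     vnorm (inverse (mubar (x, s)) \<cdot>\<^sub>v (x \<odot> s) - ones (dim_col A)) \<le> \<beta>}"

text \<open>
  The type of vectors carries no topology, so the closure in the product of two \<open>n\<close>-dimensional
  Euclidean spaces is spelled out.
\<close>

definition closure2 :: "nat \<Rightarrow> point set \<Rightarrow> point set" where
  "closure2 n S = {(x, s). x \<in> carrier_vec n \<and> s \<in> carrier_vec n \<and>
     (\<forall>e>0. \<exists>(x', s')\<in>S. vnorm (x' - x) < e \<and> vnorm (s' - s) < e)}"

definition nbhd_closure :: "real mat \<Rightarrow> real vec \<Rightarrow> real vec \<Rightarrow> real \<Rightarrow> point set" where
  "nbhd_closure A b c \<beta> = closure2 (dim_col A) (nbhd A b c \<beta>)"

definition cp_pos :: "real mat \<Rightarrow> real vec \<Rightarrow> real vec \<Rightarrow> real \<Rightarrow> point" where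
  "cp_pos A b c \<mu> = (THE z. fst z \<in> primal_pos A b \<and> snd z \<in> dual_pos A c \<and>
     fst z \<odot> snd z = \<mu> \<cdot>\<^sub>v ones (dim_col A))"

text \<open>Only used for \<open>\<mu> \<ge> 0\<close>; at \<open>0\<close> it is the coordinatewise limit as \<open>\<mu>\<close> decreases to \<open>0\<close>.\<close>

definition cp :: "real mat \<Rightarrow> real vec \<Rightarrow> real vec \<Rightarrow> real \<Rightarrow> point" where
  "cp A b c \<mu> = (if 0 < \<mu> then cp_pos A b c \<mu>
     else (vec (dim_col A) (\<lambda>i. Lim (at_right 0) (\<lambda>\<nu>. fst (cp_pos A b c \<nu>) $ i)),
           vec (dim_col A) (\<lambda>i. Lim (at_right 0) (\<lambda>\<nu>. snd (cp_pos A b c \<nu>) $ i))))"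

definition polarized ::
    "real mat \<Rightarrow> real vec \<Rightarrow> real vec \<Rightarrow> real \<Rightarrow> real \<Rightarrow> real \<Rightarrow> nat set \<Rightarrow> nat set \<Rightarrow> bool" where
  "polarized A b c \<gamma> \<mu>1 \<mu>0 B N \<longleftrightarrow>
     B \<union> N = {..<dim_col A} \<and> B \<inter> N = {} \<and>
     (\<forall>\<mu>\<in>{\<mu>1..\<mu>0}.
        (\<forall>i\<in>B. fst (cp A b c \<mu>) $ i \<ge> \<gamma> * fst (cp A b c \<mu>0) $ i) \<and>
        (\<forall>i\<in>N. snd (cp A b c \<mu>) $ i \<ge> \<gamma> * snd (cp A b c \<mu>0) $ i))"

text \<open>
  \<open>\<sigma>\<close> is the diagonal of some singular value decomposition of \<open>M\<close>, sorted non-increasingly; it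
  has one entry per column of \<open>M\<close>, and entries beyond the number of rows are zero padding.
\<close>

definition singular_values :: "real mat \<Rightarrow> real vec \<Rightarrow> bool" where
  "singular_values M \<sigma> \<longleftrightarrow>
     \<sigma> \<in> carrier_vec (dim_col M) \<and>
     (\<forall>i<dim_col M. 0 \<le> \<sigma> $ i) \<and>
     (\<forall>i j. i \<le> j \<and> j < dim_col M \<longrightarrow> \<sigma> $ j \<le> \<sigma> $ i) \<and>
     (\<forall>i<dim_col M. dim_row M \<le> i \<longrightarrow> \<sigma> $ i = 0) \<and>
     (\<exists>U\<in>carrier_mat (dim_row M) (dim_row M). \<exists>V\<in>carrier_mat (dim_col M) (dim_col M).
        transpose_mat U * U = 1\<^sub>m (dim_row M) \<and> transpose_mat V * V = 1\<^sub>m (dim_col M) \<and>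
        M = U * mat (dim_row M) (dim_col M) (\<lambda>(i, j). if i = j then \<sigma> $ i else 0)
              * transpose_mat V)"

text \<open>The library's \<^const>\<open>orthogonal_mat\<close> means nonzero, pairwise orthogonal columns.\<close>

definition rho_svd :: "real \<Rightarrow> real mat \<Rightarrow> real mat \<Rightarrow> real vec \<Rightarrow> bool" where
  "rho_svd \<rho> M C t \<longleftrightarrow> (let q = dim_col M in
     C \<in> carrier_mat q q \<and> orthogonal_mat C \<and>
     t \<in> carrier_vec q \<and> (\<forall>i<q. 0 \<le> t $ i) \<and> (\<forall>i j. i \<le> j \<and> j < q \<longrightarrow> t $ j \<le> t $ i) \<and>
     (\<forall>i<q. \<forall>u\<in>vec_span q (col C ` {i..<q}). vnorm (M *\<^sub>v u) \<le> t $ i * vnorm u) \<and>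
     (\<exists>\<sigma>. singular_values M \<sigma> \<and> (\<forall>i<q. inverse \<rho> * t $ i \<le> \<sigma> $ i \<and> \<sigma> $ i \<le> t $ i)))"

text \<open>
  A solver is given by the nonempty set of outputs it may return on each input, which covers
  nondeterministic and randomized solvers as well as functions.
\<close>

definition rho_svd_solver :: "real \<Rightarrow> (real mat \<Rightarrow> (real mat \<times> real vec) set) \<Rightarrow> bool" where
  "rho_svd_solver \<rho> svd \<longleftrightarrow>
     (\<forall>M. svd M \<noteq> {} \<and> (\<forall>(C, t)\<in>svd M. rho_svd \<rho> M C t))"

definition newton_dir ::
    "real mat \<Rightarrow> real vec \<Rightarrow> real vec \<Rightarrow> real vec \<Rightarrow> real vec \<Rightarrow> real vec \<Rightarrow> bool" where
  "newton_dir A x s r dx ds \<longleftrightarrow>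
     dx \<in> kerW A \<and> ds \<in> kerW_perp A \<and> s \<odot> dx + x \<odot> ds = r"

definition affine_step_length ::
    "nat \<Rightarrow> real \<Rightarrow> real \<Rightarrow> real vec \<Rightarrow> real vec \<Rightarrow> real \<Rightarrow> bool" where
  "affine_step_length n \<beta> \<mu> dxa dsa \<alpha> \<longleftrightarrow> 0 < \<alpha> \<and> \<alpha> \<le> 1 \<and>
     max (\<beta> / (3 * sqrt (real n))) (1 - 3 * vnorm (dxa \<odot> dsa) / (\<beta> * \<mu>)) \<le> \<alpha> \<and>
     \<alpha> \<le> max (\<beta> / (2 * sqrt (real n))) (1 - 2 * vnorm (dxa \<odot> dsa) / (\<beta> * \<mu>))"

definition partition_B ::
    "nat \<Rightarrow> real vec \<Rightarrow> real vec \<Rightarrow> real vec \<Rightarrow> real vec \<Rightarrow> nat set" where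
  "partition_B n x s dxa dsa = {i. i < n \<and> \<bar>dxa $ i / x $ i\<bar> < \<bar>dsa $ i / s $ i\<bar>}"

text \<open>Span of the last \<open>p\<close> columns of \<open>C\<close>, where \<open>p\<close> counts the entries of \<open>t\<close> that are at most 1.\<close>

definition small_span :: "real mat \<Rightarrow> real vec \<Rightarrow> real vec set" where
  "small_span C t = (let q = dim_col C; p = card {i. i < dim_vec t \<and> t $ i \<le> 1}
     in vec_span q (col C ` {q - p..<q}))"

text \<open>
  For a projection matrix \<open>P\<close>, \<open>lift_mat P N\<close> is \<open>P\<^bsub>\<cdot>,N\<^esub> (P\<^bsub>N,N\<^esub>)\<^sup>+\<close>. The matrix \<^term>\<open>submatrix P I J\<close>
  lists the selected rows and columns in increasing order of their indices.
\<close>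

definition lift_mat :: "real mat \<Rightarrow> nat set \<Rightarrow> real mat" where
  "lift_mat P N = submatrix P UNIV N * pinv (submatrix P N N)"

definition lift_subspaces ::
    "(real mat \<Rightarrow> (real mat \<times> real vec) set) \<Rightarrow> real mat \<Rightarrow> real vec \<Rightarrow> nat set \<Rightarrow> nat set
      \<Rightarrow> real vec set \<Rightarrow> real vec set \<Rightarrow> bool" where
  "lift_subspaces svd A x B N V U \<longleftrightarrow> (let n = dim_col A in
     if B = {} then V = kerW A \<and> U = {0\<^sub>v n}
     else if N = {} then V = {0\<^sub>v n} \<and> U = kerW_perp A
     else
       (let P = orth_proj n (cscale (cinv x) (kerW A));
            P' = 1\<^sub>m n - P;
            L = lift_mat P N;
            L' = lift_mat P' B
        in \<exists>(C, t)\<in>svd (submatrix L B UNIV). \<exists>(C', t')\<in>svd (submatrix L' N UNIV).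
             V = cscale x ((\<lambda>w. L *\<^sub>v w) ` small_span C t) \<and>
             U = cscale (cinv x) ((\<lambda>w. L' *\<^sub>v w) ` small_span C' t')))"

definition layered_dirs ::
    "real vec \<Rightarrow> real vec \<Rightarrow> real \<Rightarrow> nat set \<Rightarrow> nat set \<Rightarrow> real vec set \<Rightarrow> real vec set
      \<Rightarrow> real vec \<Rightarrow> real vec \<Rightarrow> bool" where
  "layered_dirs x s \<mu> B N V U dxl dsl \<longleftrightarrow>
     (let xh = vsqrt (\<mu> \<cdot>\<^sub>v (x \<oslash> s)); sh = vsqrt (\<mu> \<cdot>\<^sub>v (s \<oslash> x)) in
      is_arg_min (\<lambda>\<delta>. vnorm_on N ((x + \<delta>) \<oslash> xh)) (\<lambda>\<delta>. \<delta> \<in> V) dxl \<and>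
      is_arg_min (\<lambda>\<delta>. vnorm_on B ((s + \<delta>) \<oslash> sh)) (\<lambda>\<delta>. \<delta> \<in> U) dsl)"

definition layered_step_length ::
    "real \<Rightarrow> real \<Rightarrow> real vec \<Rightarrow> real vec \<Rightarrow> real vec \<Rightarrow> real vec \<Rightarrow> real \<Rightarrow> bool" where
  "layered_step_length \<beta> \<mu> x s dxl dsl \<alpha> \<longleftrightarrow>
     (let \<epsilon> = vnorm ((x + dxl) \<odot> (s + dsl)) / \<mu> in
      if max (vnorm (dxl \<odot> dsl) / \<mu>) \<epsilon> \<le> \<beta> / 9
      then \<alpha> \<in> {1 - 9 * \<epsilon> / \<beta>..1 - 8 * \<epsilon> / \<beta>}
      else \<alpha> = 0)"

text \<open>
  One iteration of the loop body as a relation, since the step lengths and the solver's outputs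
  are not determined by the current point. Here \<open>(x0, s0)\<close> is the current point and \<open>(x, s)\<close> the
  point after the corrector step.
\<close>

definition slls_step ::
    "(real mat \<Rightarrow> (real mat \<times> real vec) set) \<Rightarrow> real mat \<Rightarrow> real \<Rightarrow> point \<Rightarrow> point \<Rightarrow> bool" where
  "slls_step svd A \<beta> z z' \<longleftrightarrow>
     (let n = dim_col A; x0 = fst z; s0 = snd z in
      \<exists>dxc dsc. newton_dir A x0 s0 (mubar z \<cdot>\<^sub>v ones n - x0 \<odot> s0) dxc dsc \<and>
      (let x = x0 + dxc; s = s0 + dsc; \<mu> = mubar (x, s) in
       \<exists>dxa dsa \<alpha>a. newton_dir A x s (- (x \<odot> s)) dxa dsa \<and>
         affine_step_length n \<beta> \<mu> dxa dsa \<alpha>a \<and>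
       (let B = partition_B n x s dxa dsa; N = {..<n} - B in
        \<exists>V U dxl dsl \<alpha>l. lift_subspaces svd A x B N V U \<and>
          layered_dirs x s \<mu> B N V U dxl dsl \<and>
          layered_step_length \<beta> \<mu> x s dxl dsl \<alpha>l \<and>
          (let za = (x + \<alpha>a \<cdot>\<^sub>v dxa, s + \<alpha>a \<cdot>\<^sub>v dsa);
               zl = (x + \<alpha>l \<cdot>\<^sub>v dxl, s + \<alpha>l \<cdot>\<^sub>v dsl)
           in z' = (if mubar za < mubar zl then za else zl)))))"

definition slls_iter ::
    "(real mat \<Rightarrow> (real mat \<times> real vec) set) \<Rightarrow> real mat \<Rightarrow> real \<Rightarrow> real \<Rightarrow> point \<Rightarrow> point \<Rightarrow> bool"
    where
  "slls_iter svd A \<beta> target z z' \<longleftrightarrow> target < mubar z \<and> slls_step svd A \<beta> z z'"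

text \<open>
  Every execution from \<open>z0\<close>, whatever choices are made, performs at most \<open>K\<close> iterations, never
  gets stuck above the target, and stops at a point of \<open>G\<close> that reaches the target.
\<close>

definition slls_finds_within ::
    "(real mat \<Rightarrow> (real mat \<times> real vec) set) \<Rightarrow> real mat \<Rightarrow> real \<Rightarrow> real \<Rightarrow> point \<Rightarrow> point set
      \<Rightarrow> real \<Rightarrow> bool" where
  "slls_finds_within svd A \<beta> target z0 G K \<longleftrightarrow>
     (\<forall>k z. (slls_iter svd A \<beta> target ^^ k) z0 z \<longrightarrow>
        real k \<le> K \<and>
        ((\<exists>z'. slls_iter svd A \<beta> target z z') \<or> (z \<in> G \<and> mubar z \<le> target)))"

end

theory Submission
  imports Defs "HOL-Analysis.L2_Norm" "HOL-Analysis.Function_Topology"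
begin

text \<open>
  Vectors are identified with functions vanishing outside \<open>{..<n}\<close>. For a partition \<open>B\<close>, \<open>N\<close> and a
  positive scaling \<open>y\<close>, call \<open>f \<in> W\<close> cheap at level \<open>t\<close> if \<open>\<parallel>f/y\<parallel>\<^sub>B \<le> t \<cdot> \<parallel>f/y\<parallel>\<^sub>N\<close>; the relevant invariant
  is the largest dimension \<open>d\<close> of a subspace of cheap vectors, which plays the role of counting small
  singular values of the lifting map. On a polarized segment of the central path the cheapness level at
  \<open>x\<^sup>c\<^sup>p(\<mu>)\<close> is proportional to \<open>\<mu>\<close> up to the factor \<open>\<Gamma>\<^sup>2 = (2n/\<gamma>)\<^sup>2\<close>, and changing the polarizing partition
  lowers \<open>d\<close> by at most the number of indices leaving \<open>N\<close>.

  If no vector outside a very cheap \<open>d\<close>-dimensional subspace is cheap even at a large level \<open>H\<close>, then the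
  spectrum of the lifting map has a gap at 1. The affine scaling direction then finds the polarizing
  partition, the approximate singular value decomposition returns subspaces of the right dimensions, and a
  single layered step decreases \<open>\<mu>\<close> to about \<open>\<mu>/H\<close> or almost to the end of the segment. So, after short
  runs of affine steps, each step either makes a further dimension cheap at a moderate level, which happens
  at most \<open>|N|\<close> times, or leads to the next segment.
\<close>

subsection \<open>Dimensions of sets of vectors\<close>

text \<open>A change of scaling by a bounded factor only shifts the level of cheapness and leaves
  the dimension alone, so \<open>d\<close> can be followed along the central path and transferred to
  nearby iterates. Only \<open>W\<close> has to be tracked: orthogonality converts cheap dimensions
  of \<open>W\<close> into cheap dimensions of \<open>W'\<close> and back. The obstacle is that the
  algorithm never sees the polarizing partition, so every estimate of the layered step is
  conditional on the gap, and progress must also be made without one. All levels are powers of one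
  constant \<open>K\<close>, a power of n\<rho>/(\<beta>\<gamma>) large enough to absorb
  \<open>\<Gamma>^2\<close> and the losses of a layered step; dividing \<mu> by \<open>K^3\<close>
  takes about (sqrt n / \<beta>) ln K affine steps, which is where the logarithm of the bound comes
  from. The accuracy \<rho> enters through the level that the cheap subspace must reach before the
  gap can be exploited. A segment ending at 0 needs no separate count: with a gap, the layered step
  would beat every positive value. Steps of length 1 can reach \<mu> = 0, outside the neighbourhood,
  so such end points are treated as limits.\<close>

definition comb :: "nat \<Rightarrow> (nat \<Rightarrow> real) \<Rightarrow> (nat \<Rightarrow> nat \<Rightarrow> real) \<Rightarrow> nat \<Rightarrow> real" where
  "comb d c vs = (\<lambda>i. \<Sum>k<d. c k * vs k i)"

definition indep :: "nat \<Rightarrow> (nat \<Rightarrow> nat \<Rightarrow> real) \<Rightarrow> bool" where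
  "indep d vs \<longleftrightarrow> (\<forall>c. comb d c vs = (\<lambda>_. 0) \<longrightarrow> (\<forall>k<d. c k = 0))"

definition subsp :: "(nat \<Rightarrow> real) set \<Rightarrow> bool" where
  "subsp S \<longleftrightarrow> (\<lambda>_. 0) \<in> S \<and> (\<forall>f\<in>S. \<forall>g\<in>S. (\<lambda>i. f i + g i) \<in> S) \<and> (\<forall>f\<in>S. \<forall>a. (\<lambda>i. a * f i) \<in> S)"

text \<open>Says that \<open>S\<close> contains a linear subspace of dimension \<open>d\<close>. As
  \<open>S\<close> is often only a cone, this is a lower bound; a maximal dimension is expressed by
  additionally denying \<open>has_dim S (Suc d)\<close>.\<close>

definition has_dim :: "(nat \<Rightarrow> real) set \<Rightarrow> nat \<Rightarrow> bool" where
  "has_dim S d \<longleftrightarrow> (\<exists>vs. indep d vs \<and> (\<forall>c. comb d c vs \<in> S))"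

definition linfun :: "((nat \<Rightarrow> real) \<Rightarrow> real) \<Rightarrow> bool" where
  "linfun \<phi> \<longleftrightarrow> (\<forall>f g. \<phi> (\<lambda>i. f i + g i) = \<phi> f + \<phi> g) \<and> (\<forall>a f. \<phi> (\<lambda>i. a * f i) = a * \<phi> f)"

definition supp :: "nat \<Rightarrow> (nat \<Rightarrow> real) set" where
  "supp n = {f. \<forall>i\<ge>n. f i = 0}"

definition ip :: "nat \<Rightarrow> (nat \<Rightarrow> real) \<Rightarrow> (nat \<Rightarrow> real) \<Rightarrow> real" where
  "ip n f g = (\<Sum>i<n. f i * g i)"

definition perp :: "nat \<Rightarrow> (nat \<Rightarrow> real) set \<Rightarrow> (nat \<Rightarrow> real) set" where
  "perp n S = {f \<in> supp n. \<forall>g\<in>S. ip n f g = 0}"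

lemma indepD: "indep d vs \<Longrightarrow> comb d c vs = (\<lambda>_. 0) \<Longrightarrow> k < d \<Longrightarrow> c k = 0"
  by (auto simp: indep_def)

lemma comb_0 [simp]: "comb 0 c vs = (\<lambda>_. 0)"
  by (simp add: comb_def)

lemma comb_Suc: "comb (Suc d) c vs = (\<lambda>i. comb d c vs i + c d * vs d i)"
  by (simp add: comb_def)

lemma comb_cong: "(\<And>k. k < d \<Longrightarrow> c k = c' k) \<Longrightarrow> (\<And>k. k < d \<Longrightarrow> vs k = vs' k) \<Longrightarrow> comb d c vs = comb d c' vs'"
  by (auto simp: comb_def intro!: sum.cong)

lemma comb_add: "comb d (\<lambda>k. c k + c' k) vs = (\<lambda>i. comb d c vs i + comb d c' vs i)"
  by (simp add: comb_def algebra_simps sum.distrib)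

lemma comb_scale: "comb d (\<lambda>k. a * c k) vs = (\<lambda>i. a * comb d c vs i)"
  by (simp add: comb_def algebra_simps sum_distrib_left)

lemma comb_unit: "j < d \<Longrightarrow> comb d (\<lambda>k. if k = j then 1 else 0) vs = vs j"
  by (simp add: comb_def if_distrib if_distribR cong: if_cong)

lemma comb_zero: "(\<And>k. k < d \<Longrightarrow> c k = 0) \<Longrightarrow> comb d c vs = (\<lambda>_. 0)"
  by (simp add: comb_def)

lemma comb_append:
  "comb (d + e) c (\<lambda>k. if k < d then vs k else us (k - d)) = (\<lambda>i. comb d c vs i + comb e (\<lambda>k. c (d + k)) us i)"
proof (induction e)
  case 0 show ?case by (auto intro: comb_cong)
next
  case (Suc e) then show ?case by (simp add: comb_Suc add.assoc)
qed

lemma subspD: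
  assumes "subsp S"
  shows "(\<lambda>_. 0) \<in> S" "f \<in> S \<Longrightarrow> g \<in> S \<Longrightarrow> (\<lambda>i. f i + g i) \<in> S" "f \<in> S \<Longrightarrow> (\<lambda>i. a * f i) \<in> S"
    "f \<in> S \<Longrightarrow> g \<in> S \<Longrightarrow> (\<lambda>i. f i - g i) \<in> S" "f \<in> S \<Longrightarrow> (\<lambda>i. - f i) \<in> S"
proof -
  show 1: "(\<lambda>_. 0) \<in> S" "f \<in> S \<Longrightarrow> g \<in> S \<Longrightarrow> (\<lambda>i. f i + g i) \<in> S" "f \<in> S \<Longrightarrow> (\<lambda>i. a * f i) \<in> S" for f g a
    using assms by (auto simp: subsp_def)
  show 2: "f \<in> S \<Longrightarrow> (\<lambda>i. - f i) \<in> S" for f using 1(3)[of f "-1"] by simp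
  show "f \<in> S \<Longrightarrow> g \<in> S \<Longrightarrow> (\<lambda>i. f i - g i) \<in> S" using 1(2)[of f "\<lambda>i. - g i"] 2[of g] by simp
qed

lemma subsp_comb: "subsp S \<Longrightarrow> (\<And>k. k < d \<Longrightarrow> vs k \<in> S) \<Longrightarrow> comb d c vs \<in> S"
  by (induction d) (auto simp: comb_Suc intro!: subspD)

lemma linfun_comb: "linfun \<phi> \<Longrightarrow> \<phi> (comb d c vs) = (\<Sum>k<d. c k * \<phi> (vs k))"
proof (induction d)
  case 0
  then have "\<And>a f. \<phi> (\<lambda>i. a * f i) = a * \<phi> f" unfolding linfun_def by blast
  from this[of 0 "\<lambda>_. 0"] show ?case by simp
next
  case (Suc d) then show ?case by (simp add: comb_Suc linfun_def)
qed

lemma linfun_ip: "linfun (\<lambda>f. \<Sum>i\<in>I. g i * f i)"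
  by (simp add: linfun_def algebra_simps sum.distrib sum_distrib_left)

lemma linfun_coord: "linfun (\<lambda>f. f i)"
  by (simp add: linfun_def)

text \<open>Rank-nullity for one functional, by elimination. If \<open>\<phi>\<close> is nonzero on
  the last vector, multiples of that vector make \<open>\<phi>\<close> vanish on all others; if it
  is zero there, the last vector is kept and the earlier ones are treated recursively.\<close>

lemma indep_kernel_step:
  assumes "linfun \<phi>" "indep (Suc d) vs"
  shows "\<exists>us. indep d us \<and> (\<forall>c. \<exists>c'. comb d c us = comb (Suc d) c' vs) \<and> (\<forall>c. \<phi> (comb d c us) = 0)"
  using assms(2)
proof (induction d)
  case 0
  show ?case using linfun_comb[OF assms(1), of 0]
    by (auto simp: indep_def intro!: exI[of _ "\<lambda>_. 0"] comb_zero[symmetric])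
next
  case (Suc d)
  show ?case
  proof (cases "\<phi> (vs (Suc d)) = 0")
    case False
    define us where "us k = (\<lambda>i. vs k i - \<phi> (vs k) / \<phi> (vs (Suc d)) * vs (Suc d) i)" for k
    have 1: "comb (Suc d) c us = comb (Suc (Suc d)) (c(Suc d := - (\<Sum>k<Suc d. c k * \<phi> (vs k) / \<phi> (vs (Suc d))))) vs" (is "_ = comb _ ?c' _") for c
    proof -
      have "comb (Suc d) c us i = comb (Suc d) c vs i - (\<Sum>k<Suc d. c k * \<phi> (vs k) / \<phi> (vs (Suc d))) * vs (Suc d) i" for i
        unfolding comb_def us_def sum_distrib_right sum_subtractf[symmetric] by (intro sum.cong) (auto simp: algebra_simps)
      moreover have "comb (Suc d) (?c') vs = comb (Suc d) c vs" by (rule comb_cong) auto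
      ultimately show ?thesis unfolding comb_Suc[of "Suc d" ?c'] by (intro ext) (simp del: sum.lessThan_Suc)
    qed
    have 2: "\<phi> (comb (Suc d) c us) = 0" for c
    proof -
      define s where "s = (\<Sum>k<Suc d. c k * \<phi> (vs k))"
      have s: "(\<Sum>k<Suc d. c k * \<phi> (vs k) / \<phi> (vs (Suc d))) = s / \<phi> (vs (Suc d))"
        unfolding s_def sum_divide_distrib ..
      have "(\<Sum>k<Suc d. (c(Suc d := - (s / \<phi> (vs (Suc d))))) k * \<phi> (vs k)) = s" unfolding s_def by (rule sum.cong) auto
      then show ?thesis unfolding 1 linfun_comb[OF assms(1)] s sum.lessThan_Suc[of _ "Suc d"] using False by simp
    qed
    have "indep (Suc d) us" unfolding indep_def
    proof (intro allI impI)
      fix c k assume "comb (Suc d) c us = (\<lambda>_. 0)" "k < Suc d"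
      then show "c k = 0" using indepD[OF Suc.prems 1[of c, symmetric, THEN trans], of k] by (auto split: if_splits)
    qed
    then show ?thesis using 1 2 by blast
  next
    case True
    have "indep (Suc d) vs" unfolding indep_def
    proof (intro allI impI)
      fix c k assume a: "comb (Suc d) c vs = (\<lambda>_. 0)" "k < Suc d"
      have "comb (Suc (Suc d)) (c(Suc d := 0)) vs = comb (Suc d) c vs" unfolding comb_Suc[of "Suc d"] by (simp cong: comb_cong)
      from indepD[OF Suc.prems this[THEN trans], of k] a show "c k = 0" by (auto split: if_splits)
    qed
    from Suc.IH[OF this] obtain us where us: "indep d us" "\<And>c. \<exists>c'. comb d c us = comb (Suc d) c' vs" "\<And>c. \<phi> (comb d c us) = 0" by auto
    define ws where "ws = us(d := vs (Suc d))"
    have ws: "comb (Suc d) c ws = (\<lambda>i. comb d c us i + c d * vs (Suc d) i)" for c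
      unfolding comb_Suc ws_def by (simp cong: comb_cong)
    have 1: "\<exists>c'. comb (Suc d) c ws = comb (Suc (Suc d)) c' vs \<and> c' (Suc d) = c d \<and> comb d c us = comb (Suc d) c' vs" for c
    proof -
      obtain c' where c': "comb d c us = comb (Suc d) c' vs" using us(2) by blast
      have "comb (Suc d) (c'(Suc d := c d)) vs = comb (Suc d) c' vs" by (rule comb_cong) auto
      then show ?thesis using c' by (intro exI[of _ "c'(Suc d := c d)"]) (auto simp: ws comb_Suc[of "Suc d"])
    qed
    have 2: "indep (Suc d) ws" unfolding indep_def
    proof (intro allI impI)
      fix c k assume a: "comb (Suc d) c ws = (\<lambda>_. 0)" "k < Suc d"
      obtain c' where c': "comb (Suc d) c ws = comb (Suc (Suc d)) c' vs" "c' (Suc d) = c d" "comb d c us = comb (Suc d) c' vs" using 1 by blast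
      have z: "\<forall>k<Suc (Suc d). c' k = 0" using indepD[OF Suc.prems c'(1)[symmetric, THEN trans, OF a(1)]] by blast
      then have "comb d c us = (\<lambda>_. 0)" unfolding c'(3) by (intro comb_zero) auto
      then have "\<forall>k<d. c k = 0" using us(1) unfolding indep_def by blast
      then show "c k = 0" using a(2) z c'(2) by (auto simp: less_Suc_eq)
    qed
    have 3: "\<phi> (comb (Suc d) c ws) = 0" for c
      using us(3)[of c] True assms(1) unfolding ws by (simp add: linfun_def)
    show ?thesis using 1 2 3 by blast
  qed
qed

lemma has_dim_constraint:
  assumes "linfun \<phi>" "has_dim S (Suc d)"
  shows "has_dim {f\<in>S. \<phi> f = 0} d"
proof -
  from assms obtain vs where "indep (Suc d) vs" "\<forall>c. comb (Suc d) c vs \<in> S" by (auto simp: has_dim_def)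
  from indep_kernel_step[OF assms(1) this(1)] obtain us where us: "indep d us"
    "\<And>c. \<exists>c'. comb d c us = comb (Suc d) c' vs" "\<And>c. \<phi> (comb d c us) = 0" by blast
  have "comb d c us \<in> S" for c using us(2)[of c] \<open>\<forall>c. comb (Suc d) c vs \<in> S\<close> by auto
  with us show ?thesis unfolding has_dim_def by blast
qed

lemma has_dim_subset: "has_dim S d \<Longrightarrow> S \<subseteq> S' \<Longrightarrow> has_dim S' d"
  by (auto simp: has_dim_def)

lemma has_dim_constraints:
  assumes "\<And>r. r < m \<Longrightarrow> linfun (\<phi> r)" "has_dim S (d + m)"
  shows "has_dim {f\<in>S. \<forall>r<m. \<phi> r f = 0} d"
  using assms
proof (induction m arbitrary: S)
  case (Suc m)
  have "has_dim {f\<in>{f\<in>S. \<phi> m f = 0}. \<forall>r<m. \<phi> r f = 0} d"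
    using Suc by (intro Suc.IH has_dim_constraint) auto
  then show ?case by (rule has_dim_subset) (auto simp: less_Suc_eq)
qed auto

lemma has_dim_constraints_set:
  assumes "finite J" "\<And>r. r \<in> J \<Longrightarrow> linfun (\<phi> r)" "has_dim S d"
  shows "has_dim {f\<in>S. \<forall>r\<in>J. \<phi> r f = 0} (d - card J)"
proof -
  obtain h where h: "bij_betw h {..<card J} J" using assms(1) bij_betw_from_nat_into_finite by blast
  have le: "has_dim S d' \<Longrightarrow> e \<le> d' \<Longrightarrow> has_dim S e" for S d' e
    using has_dim_constraints[of "d' - e" "\<lambda>r f. 0" S e] by (auto simp: linfun_def)
  show ?thesis
  proof (cases "card J \<le> d")
    case True
    have "has_dim {f\<in>S. \<forall>r<card J. \<phi> (h r) f = 0} (d - card J)"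
      using assms h True by (intro has_dim_constraints) (auto simp: bij_betw_def)
    also have "{f\<in>S. \<forall>r<card J. \<phi> (h r) f = 0} = {f\<in>S. \<forall>r\<in>J. \<phi> r f = 0}"
      using h unfolding bij_betw_def by (metis (no_types, opaque_lifting) imageE image_eqI lessThan_iff)
    finally show ?thesis .
  next
    \<comment> \<open>More constraints than dimensions: truncated subtraction turns the claim into
      dimension 0, which only asks for the zero vector.\<close>
    case False
    obtain vs where "\<And>c. comb d c vs \<in> S" using assms(3) unfolding has_dim_def by blast
    from this[of "\<lambda>_. 0"] have "(\<lambda>_. 0) \<in> S" by (simp add: comb_def)
    moreover have "\<phi> r (\<lambda>_. 0) = 0" if "r \<in> J" for r using linfun_comb[OF assms(2)[OF that], of 0] by simp
    ultimately show ?thesis using False by (auto simp: has_dim_def indep_def)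
  qed
qed

lemma has_dim_mono: "has_dim S d \<Longrightarrow> e \<le> d \<Longrightarrow> has_dim S e"
  using has_dim_constraints_set[of "{..<d-e}" "\<lambda>r f. 0" S d] by (auto simp: linfun_def)

lemma has_dim_nonzero: "has_dim S (Suc d) \<Longrightarrow> \<exists>f\<in>S. f \<noteq> (\<lambda>_. 0)"
proof -
  assume "has_dim S (Suc d)"
  then obtain vs where vs: "indep (Suc d) vs" "\<And>c. comb (Suc d) c vs \<in> S" by (auto simp: has_dim_def)
  have "comb (Suc d) (\<lambda>_. 1) vs \<noteq> (\<lambda>_. 0)" using indepD[OF vs(1), of "\<lambda>_. 1" d] by auto
  with vs(2) show ?thesis by blast
qed

text \<open>If the coordinates in \<open>I\<close> determine the elements of \<open>S\<close>, then
  forcing them to be zero leaves no nonzero vector, although each condition removes only one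
  dimension.\<close>

lemma has_dim_le_card:
  assumes "has_dim S d" "finite I" "\<And>f. f \<in> S \<Longrightarrow> (\<forall>i\<in>I. f i = 0) \<Longrightarrow> f = (\<lambda>_. 0)"
  shows "d \<le> card I"
proof (rule ccontr)
  assume "\<not> ?thesis"
  then have "has_dim {f\<in>S. \<forall>r\<in>I. f r = 0} (Suc (d - card I - 1))"
    using has_dim_constraints_set[OF assms(2) _ assms(1), of "\<lambda>r f. f r"]
    by (simp add: linfun_coord Suc_diff_Suc)
  from has_dim_nonzero[OF this] assms(3) show False by auto
qed

lemma has_dim_supp: "has_dim (supp n) n"
proof -
  define e :: "nat \<Rightarrow> nat \<Rightarrow> real" where "e k i = (if i = k then 1 else 0)" for k i
  have c: "comb n c e = (\<lambda>i. if i < n then c i else 0)" for c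
    by (auto simp: comb_def e_def if_distrib cong: if_cong)
  have "indep n e" unfolding indep_def c by (auto simp: fun_eq_iff split: if_splits)
  moreover have "comb n c e \<in> supp n" for c unfolding c by (auto simp: supp_def)
  ultimately show ?thesis unfolding has_dim_def by blast
qed

text \<open>The dimension formula for intersections, for sets that merely contain subspaces of these
  dimensions. A common vector solves \<open>n\<close> homogeneous equations in the
  \<open>d1 + d2\<close> coefficients of two bases, and independence of the bases makes it
  nonzero.\<close>

lemma has_dim_inter:
  assumes "has_dim S1 d1" "has_dim S2 d2" "S1 \<subseteq> supp n" "S2 \<subseteq> supp n" "n < d1 + d2"
  shows "\<exists>f\<in>S1 \<inter> S2. f \<noteq> (\<lambda>_. 0)"
proof -
  obtain vs us where vs: "indep d1 vs" "\<And>c. comb d1 c vs \<in> S1" and us: "indep d2 us" "\<And>c. comb d2 c us \<in> S2"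
    using assms by (auto simp: has_dim_def)
  define \<phi> where "\<phi> r c = comb d1 c vs r - comb d2 (\<lambda>k. c (d1 + k)) us r" for r c
  have "linfun (\<phi> r)" for r
    unfolding linfun_def \<phi>_def comb_add comb_scale by (auto simp: algebra_simps)
  then have "has_dim {c \<in> supp (d1 + d2). \<forall>r\<in>{..<n}. \<phi> r c = 0} (Suc (d1 + d2 - n - 1))"
    using has_dim_constraints_set[OF _ _ has_dim_supp[of "d1 + d2"], of "{..<n}" \<phi>] assms(5) by (simp add: Suc_diff_Suc)
  from has_dim_nonzero[OF this] obtain c where c: "c \<in> supp (d1 + d2)" "\<forall>r<n. \<phi> r c = 0" "c \<noteq> (\<lambda>_. 0)" by auto
  have eq: "comb d1 c vs = comb d2 (\<lambda>k. c (d1 + k)) us"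
  proof
    fix r show "comb d1 c vs r = comb d2 (\<lambda>k. c (d1 + k)) us r"
      using c(2) vs(2)[of c] us(2)[of "\<lambda>k. c (d1 + k)"] assms(3,4) by (cases "r < n") (auto simp: \<phi>_def supp_def subset_iff)
  qed
  have "comb d1 c vs \<noteq> (\<lambda>_. 0)"
  proof
    assume z: "comb d1 c vs = (\<lambda>_. 0)"
    then have 1: "\<forall>k<d1. c k = 0" "\<forall>k<d2. c (d1 + k) = 0"
      using indepD[OF vs(1)] indepD[OF us(1), of "\<lambda>k. c (d1 + k)"] eq by auto
    have "c k = 0" for k
    proof -
      consider "k < d1" | "d1 \<le> k" "k < d1 + d2" | "d1 + d2 \<le> k" by linarith
      then show ?thesis
      proof cases
        case 2 then show ?thesis using 1(2)[rule_format, of "k - d1"] by auto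
      qed (use 1 c(1) in \<open>auto simp: supp_def\<close>)
    qed
    with c(3) show False by auto
  qed
  then show ?thesis using vs(2)[of c] us(2)[of "\<lambda>k. c (d1 + k)"] eq by auto
qed

lemma has_dim_le: "has_dim S d \<Longrightarrow> S \<subseteq> supp n \<Longrightarrow> d \<le> n"
proof -
  assume a: "has_dim S d" "S \<subseteq> supp n"
  have "f = (\<lambda>_. 0)" if "f \<in> S" "\<forall>i\<in>{..<n}. f i = 0" for f
    using that a(2) by (force simp: supp_def fun_eq_iff not_less[symmetric])
  from has_dim_le_card[OF a(1) finite_lessThan this] show "d \<le> n" by simp
qed

lemma indep_extend:
  assumes "indep d vs" "\<And>c. f \<noteq> comb d c vs"
  shows "indep (Suc d) (vs(d := f))"
  unfolding indep_def
proof (intro allI impI)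
  fix c k assume a: "comb (Suc d) c (vs(d := f)) = (\<lambda>_. 0)" "k < Suc d"
  have e: "comb (Suc d) c (vs(d := f)) = (\<lambda>i. comb d c vs i + c d * f i)"
    unfolding comb_Suc by (simp cong: comb_cong)
  have "c d = 0"
  proof (rule ccontr)
    assume n: "c d \<noteq> 0"
    have "f i = (- 1 / c d) * comb d c vs i" for i
      using fun_cong[OF a(1)[unfolded e], of i] n by (simp add: field_simps add_eq_0_iff)
    then have "f = comb d (\<lambda>k. (- 1 / c d) * c k) vs" unfolding comb_scale by blast
    with assms(2) show False by blast
  qed
  moreover from this have "\<forall>k<d. c k = 0" using a(1) assms(1) unfolding e indep_def by auto
  ultimately show "c k = 0" using a(2) by (auto simp: less_Suc_eq)
qed

lemma has_dim_add_vector: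
  assumes S: "subsp S" and vs: "indep d vs" "\<And>c. comb d c vs \<in> S" and f: "f \<in> S" "\<And>c. f \<noteq> comb d c vs"
  shows "has_dim S (Suc d)"
proof -
  have "vs k \<in> S" if "k < d" for k using vs(2)[of "\<lambda>j. if j = k then 1 else 0"] comb_unit[OF that] by simp
  then have "comb (Suc d) c (vs(d := f)) \<in> S" for c using S f(1) by (intro subsp_comb) auto
  with indep_extend[OF vs(1) f(2)] show ?thesis unfolding has_dim_def by blast
qed

text \<open>A largest independent family inside \<open>S\<close> spans it, since any vector outside
  its span could be appended; the ambient dimension \<open>n\<close> bounds the size.\<close>

lemma basis_exists:
  assumes S: "subsp S" and n: "S \<subseteq> supp n"
  shows "\<exists>d vs. indep d vs \<and> S = range (\<lambda>c. comb d c vs)"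
proof -
  define d where "d = (GREATEST d. has_dim S d)"
  have 0: "has_dim S 0" using subspD(1)[OF S] by (auto simp: has_dim_def indep_def)
  have bd: "\<And>d. has_dim S d \<Longrightarrow> d \<le> n" using has_dim_le n by blast
  have "has_dim S d" unfolding d_def using 0 bd by (rule GreatestI_nat)
  moreover have mx: "\<not> has_dim S (Suc d)"
    using Greatest_le_nat[of "has_dim S" "Suc d" n] bd unfolding d_def by auto
  ultimately obtain vs where vs: "indep d vs" "\<And>c. comb d c vs \<in> S" by (auto simp: has_dim_def)
  have "S = range (\<lambda>c. comb d c vs)" using vs has_dim_add_vector[OF S vs] mx by blast
  with vs show ?thesis by blast
qed

section \<open>Weighted least squares and orthogonal complements\<close>

text \<open>Solves the normal equations of weighted least squares by Gram-Schmidt. Because weights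
  may be zero and the family may be dependent, the same lemma yields orthogonal projections, Newton
  directions and best approximations on a subset of the coordinates.\<close>

lemma weighted_projection:
  fixes w :: "nat \<Rightarrow> real"
  assumes w: "\<And>i. i \<in> I \<Longrightarrow> 0 \<le> w i" and I: "finite I"
  shows "\<exists>c. \<forall>k<d. (\<Sum>i\<in>I. w i * (f i - comb d c vs i) * vs k i) = 0"
proof (induction d arbitrary: f)
  case (Suc d)
  define q where "q f g = (\<Sum>i\<in>I. w i * f i * g i)" for f g :: "nat \<Rightarrow> real"
  have IH: "\<exists>c. \<forall>k<d. q (\<lambda>i. f i - comb d c vs i) (vs k) = 0" for f
    using Suc.IH unfolding q_def .
  obtain a where a: "\<And>k. k < d \<Longrightarrow> q (\<lambda>i. f i - comb d a vs i) (vs k) = 0" using IH by blast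
  obtain e where e: "\<And>k. k < d \<Longrightarrow> q (\<lambda>i. vs d i - comb d e vs i) (vs k) = 0" using IH by blast
  define v where "v = (\<lambda>i. vs d i - comb d e vs i)"
  define h where "h = (\<lambda>i. f i - comb d a vs i)"
  define t where "t = q h v / q v v"
  have orth: "q u (comb d c vs) = 0" if "\<And>k. k < d \<Longrightarrow> q u (vs k) = 0" for u c
  proof -
    have "q u (comb d c vs) = (\<Sum>k<d. c k * q u (vs k))"
      unfolding q_def comb_def sum_distrib_left sum.swap[of _ I] by (intro sum.cong) (auto simp: algebra_simps)
    then show ?thesis using that by simp
  qed
  have qlin: "q (\<lambda>i. x i - t * y i) z = q x z - t * q y z" for x y z t
    unfolding q_def by (simp add: algebra_simps sum_subtractf sum_distrib_left)
  have qadd: "q x (\<lambda>i. y i + z i) = q x y + q x z" for x y z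
    unfolding q_def by (simp add: algebra_simps sum.distrib)
  \<comment> \<open>If \<open>v\<close> has weighted norm zero, \<open>t\<close> is 0 by division by
    zero; then \<open>v\<close> vanishes wherever the weight does not, so \<open>q h v\<close> is
    zero as well.\<close>
  have tv: "q h v - t * q v v = 0"
  proof (cases "q v v = 0")
    case True
    have "\<forall>i\<in>I. w i * v i * v i = 0" using True w I unfolding q_def
      by (subst (asm) sum_nonneg_eq_0_iff) (auto simp: mult.assoc)
    then have "q h v = 0" unfolding q_def by (intro sum.neutral) auto
    then show ?thesis using True by simp
  qed (simp add: t_def)
  define c where "c = (\<lambda>k. if k < d then a k - t * e k else t)"
  have cc: "comb (Suc d) c vs = (\<lambda>i. comb d a vs i + t * v i)"
  proof -
    have "comb d c vs = comb d (\<lambda>k. a k + (-t) * e k) vs" by (rule comb_cong) (auto simp: c_def)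
    also have "\<dots> = (\<lambda>i. comb d a vs i + (-t) * comb d e vs i)" unfolding comb_add comb_scale ..
    finally show ?thesis unfolding comb_Suc v_def by (auto simp: c_def algebra_simps)
  qed
  have res: "(\<lambda>i. f i - comb (Suc d) c vs i) = (\<lambda>i. h i - t * v i)" unfolding cc h_def by (auto simp: algebra_simps)
  have 1: "q (\<lambda>i. h i - t * v i) (vs k) = 0" if "k < d" for k
    unfolding qlin using a[OF that] e[OF that] unfolding h_def[symmetric] v_def[symmetric] by simp
  have vd: "vs d = (\<lambda>i. v i + comb d e vs i)" unfolding v_def by simp
  have 2: "q (\<lambda>i. h i - t * v i) (vs d) = 0"
    unfolding vd qadd using orth[of "\<lambda>i. h i - t * v i" e] 1 tv by (simp add: qlin)
  have "\<forall>k<Suc d. q (\<lambda>i. f i - comb (Suc d) c vs i) (vs k) = 0" unfolding res using 1 2 by (auto simp: less_Suc_eq)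
  then show ?case unfolding q_def by blast
qed auto

lemma ip_add: "ip n (\<lambda>i. f i + g i) h = ip n f h + ip n g h" "ip n h (\<lambda>i. f i + g i) = ip n h f + ip n h g"
  "ip n (\<lambda>i. f i - g i) h = ip n f h - ip n g h" "ip n h (\<lambda>i. f i - g i) = ip n h f - ip n h g"
  "ip n (\<lambda>i. a * f i) h = a * ip n f h" "ip n h (\<lambda>i. a * f i) = a * ip n h f"
  by (auto simp: ip_def algebra_simps sum.distrib sum_subtractf sum_distrib_left)

lemma ip_commute: "ip n f g = ip n g f" by (simp add: ip_def mult.commute)

lemma ip_comb: "ip n f (comb d c vs) = (\<Sum>k<d. c k * ip n f (vs k))"
  unfolding ip_def comb_def sum_distrib_left sum.swap[of _ "{..<n}"] by (intro sum.cong) (auto simp: algebra_simps)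

lemma ip_self_0: "ip n f f = 0 \<Longrightarrow> f \<in> supp n \<Longrightarrow> f = (\<lambda>_. 0)"
  unfolding ip_def by (subst (asm) sum_nonneg_eq_0_iff) (auto simp: supp_def fun_eq_iff, metis lessThan_iff not_le)

lemma subsp_supp: "subsp (supp n)" by (auto simp: subsp_def supp_def)

lemma subsp_perp: "subsp (perp n S)"
  unfolding subsp_def perp_def by (auto simp: ip_add supp_def) (simp add: ip_def)

lemma perp_supp: "perp n S \<subseteq> supp n" by (auto simp: perp_def)

lemma orth_decomp:
  assumes S: "subsp S" "S \<subseteq> supp n" and f: "f \<in> supp n"
  shows "\<exists>g\<in>S. (\<lambda>i. f i - g i) \<in> perp n S"
proof -
  obtain d vs where vs: "indep d vs" "S = range (\<lambda>c. comb d c vs)" using basis_exists[OF S] by blast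
  obtain c where c: "\<forall>k<d. (\<Sum>i<n. 1 * (f i - comb d c vs i) * vs k i) = 0"
    using weighted_projection[of "{..<n}" "\<lambda>_. 1" d f vs] by auto
  have "ip n (\<lambda>i. f i - comb d c vs i) (comb d c' vs) = 0" for c'
    unfolding ip_comb using c by (auto simp: ip_def)
  moreover have "comb d c vs \<in> S" using vs by auto
  moreover have "(\<lambda>i. f i - comb d c vs i) \<in> supp n" using subspD(4)[OF subsp_supp f] calculation(2) S(2) by auto
  ultimately show ?thesis unfolding perp_def vs(2) by (intro bexI[of _ "comb d c vs"]) auto
qed

lemma perp_perp:
  assumes S: "subsp S" "S \<subseteq> supp n"
  shows "perp n (perp n S) = S"
proof
  show "S \<subseteq> perp n (perp n S)" using S(2) by (auto simp: perp_def ip_commute[of n])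
  show "perp n (perp n S) \<subseteq> S"
  proof
    fix f assume f: "f \<in> perp n (perp n S)"
    then have fs: "f \<in> supp n" by (auto simp: perp_def)
    obtain g where g: "g \<in> S" "(\<lambda>i. f i - g i) \<in> perp n S" using orth_decomp[OF S fs] by blast
    have "ip n (\<lambda>i. f i - g i) (\<lambda>i. f i - g i) = ip n f (\<lambda>i. f i - g i) - ip n g (\<lambda>i. f i - g i)" by (simp add: ip_add)
    also have "ip n f (\<lambda>i. f i - g i) = 0" using f g(2) unfolding perp_def by auto
    also have "ip n g (\<lambda>i. f i - g i) = 0" using g unfolding perp_def by (subst ip_commute) auto
    finally have "(\<lambda>i. f i - g i) = (\<lambda>_. 0)" using ip_self_0 g(2) unfolding perp_def by auto
    then have "f = g" by (auto simp: fun_eq_iff)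
    then show "f \<in> S" using g(1) by simp
  qed
qed

lemma has_dim_perp:
  assumes "S = range (\<lambda>c. comb d c vs)"
  shows "has_dim (perp n S) (n - d)"
proof -
  have "has_dim {f \<in> supp n. \<forall>k\<in>{..<d}. ip n (vs k) f = 0} (n - d)"
    using has_dim_constraints_set[OF _ _ has_dim_supp, of "{..<d}" "\<lambda>k f. ip n (vs k) f" n] linfun_ip unfolding ip_def by simp
  then show ?thesis
    by (rule has_dim_subset) (auto simp: perp_def assms ip_comb ip_commute[of n "vs _"])
qed

subsection \<open>Steps near the central path\<close>

abbreviation nrm :: "nat \<Rightarrow> (nat \<Rightarrow> real) \<Rightarrow> real" where "nrm n f \<equiv> L2_set f {..<n}"

locale orth_pair =
  fixes n :: nat and W W' :: "(nat \<Rightarrow> real) set"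
  assumes W: "subsp W" and W_supp: "W \<subseteq> supp n" and W'_eq: "W' = perp n W"
begin

lemma W': "subsp W'" and W'_supp: "W' \<subseteq> supp n" and W_eq: "W = perp n W'"
  using W W_supp by (auto simp: W'_eq subsp_perp perp_perp perp_supp)

lemma dual_pair: "orth_pair n W' W"
  using W' W'_supp W_eq by unfold_locales

lemma orthogonal: "f \<in> W \<Longrightarrow> g \<in> W' \<Longrightarrow> ip n f g = 0"
  by (auto simp: W'_eq perp_def ip_commute)

text \<open>The system says that \<open>dx\<close> is \<open>x / s\<close> times the residual
  \<open>r / x - ds\<close>. Taking \<open>ds\<close> as the projection of \<open>r / x\<close> onto
  \<open>W'\<close> with weights \<open>x / s\<close> makes this weighted residual orthogonal to
  \<open>W'\<close>, hence an element of \<open>W\<close>.\<close>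

lemma newton_exists:
  assumes x: "\<And>i. i < n \<Longrightarrow> 0 < x i" and s: "\<And>i. i < n \<Longrightarrow> 0 < s i"
  shows "\<exists>dx\<in>W. \<exists>ds\<in>W'. \<forall>i<n. s i * dx i + x i * ds i = r i"
proof -
  obtain d vs where vs: "indep d vs" "W' = range (\<lambda>c. comb d c vs)" using basis_exists[OF W' W'_supp] by blast
  obtain c where c: "\<forall>k<d. (\<Sum>i<n. x i / s i * (r i / x i - comb d c vs i) * vs k i) = 0"
    using weighted_projection[of "{..<n}" "\<lambda>i. x i / s i" d "\<lambda>i. r i / x i" vs] x s by (fastforce intro: divide_nonneg_pos less_imp_le)
  define ds where "ds = comb d c vs"
  define dx where "dx = (\<lambda>i. if i < n then x i / s i * (r i / x i - ds i) else 0)"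
  have "ip n dx (comb d c' vs) = 0" for c'
    unfolding ip_comb using c by (auto simp: ip_def dx_def ds_def)
  then have "dx \<in> W" unfolding W_eq perp_def vs(2) by (auto simp: dx_def supp_def)
  moreover have "ds \<in> W'" by (auto simp: vs(2) ds_def)
  moreover have "s i * dx i + x i * ds i = r i" if "i < n" for i
    using x[OF that] s[OF that] that by (simp add: dx_def field_simps)
  ultimately show ?thesis by blast
qed

end

text \<open>Pythagoras: after scaling, \<open>dx\<close> and \<open>ds\<close> are the orthogonal
  components of \<open>r / sqrt (x s)\<close>.\<close>

lemma newton_sum:
  assumes x: "\<And>i. i < n \<Longrightarrow> 0 < x i" and s: "\<And>i. i < n \<Longrightarrow> 0 < s i"
    and o: "ip n dx ds = 0" and r: "\<And>i. i < n \<Longrightarrow> s i * dx i + x i * ds i = r i"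
  shows "(\<Sum>i<n. s i / x i * (dx i)\<^sup>2) + (\<Sum>i<n. x i / s i * (ds i)\<^sup>2) = (\<Sum>i<n. (r i)\<^sup>2 / (x i * s i))"
proof -
  have "(r i)\<^sup>2 / (x i * s i) = s i / x i * (dx i)\<^sup>2 + x i / s i * (ds i)\<^sup>2 + 2 * (dx i * ds i)" if "i < n" for i
    using x[OF that] s[OF that] unfolding r[OF that, symmetric] by (simp add: field_simps power2_eq_square)
  then have "(\<Sum>i<n. (r i)\<^sup>2 / (x i * s i)) = (\<Sum>i<n. s i / x i * (dx i)\<^sup>2 + x i / s i * (ds i)\<^sup>2 + 2 * (dx i * ds i))" by simp
  then show ?thesis using o unfolding ip_def by (simp add: sum.distrib sum_distrib_left[symmetric])
qed

text \<open>Each squared product is the product of the two weighted squares of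
  \<open>newton_sum\<close>. Bounding one of them by its sum and then comparing geometric and
  arithmetic mean gives half of the total.\<close>

lemma newton_product_bound:
  assumes x: "\<And>i. i < n \<Longrightarrow> 0 < x i" and s: "\<And>i. i < n \<Longrightarrow> 0 < s i"
    and o: "ip n dx ds = 0" and r: "\<And>i. i < n \<Longrightarrow> s i * dx i + x i * ds i = r i"
  shows "nrm n (\<lambda>i. dx i * ds i) \<le> (\<Sum>i<n. (r i)\<^sup>2 / (x i * s i)) / 2"
proof -
  define p q where "p i = s i / x i * (dx i)\<^sup>2" and "q i = x i / s i * (ds i)\<^sup>2" for i
  have p: "0 \<le> p i" and q: "0 \<le> q i" if "i < n" for i using x[OF that] s[OF that] by (auto simp: p_def q_def)
  have "(\<Sum>i<n. (dx i * ds i)\<^sup>2) = (\<Sum>i<n. p i * q i)"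
  proof (rule sum.cong)
    fix i assume "i \<in> {..<n}"
    with x[of i] s[of i] show "(dx i * ds i)\<^sup>2 = p i * q i" by (simp add: p_def q_def field_simps power2_eq_square)
  qed simp
  also have "\<dots> \<le> (\<Sum>i<n. (\<Sum>j<n. p j) * q i)"
    using p q by (intro sum_mono mult_right_mono) (auto intro: member_le_sum)
  also have "\<dots> = (\<Sum>j<n. p j) * (\<Sum>i<n. q i)" by (simp add: sum_distrib_left)
  also have "\<dots> \<le> (((\<Sum>j<n. p j) + (\<Sum>i<n. q i)) / 2)\<^sup>2"
    using zero_le_power2[of "sum p {..<n} - sum q {..<n}"] by (simp add: power2_eq_square algebra_simps)
  also have "(\<Sum>j<n. p j) + (\<Sum>i<n. q i) = (\<Sum>i<n. (r i)\<^sup>2 / (x i * s i))"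
    using newton_sum[OF assms] unfolding p_def q_def .
  finally have "nrm n (\<lambda>i. dx i * ds i) \<le> sqrt (((\<Sum>i<n. (r i)\<^sup>2 / (x i * s i)) / 2)\<^sup>2)"
    unfolding L2_set_def by (rule real_sqrt_le_mono)
  also have "0 \<le> (\<Sum>i<n. (r i)\<^sup>2 / (x i * s i))" using x s by (auto intro!: sum_nonneg simp: less_imp_le)
  then have "sqrt (((\<Sum>i<n. (r i)\<^sup>2 / (x i * s i)) / 2)\<^sup>2) = (\<Sum>i<n. (r i)\<^sup>2 / (x i * s i)) / 2" by simp
  finally show ?thesis .
qed

section \<open>Staying positive and central along a step\<close>

text \<open>A factor can only become nonpositive by passing through zero, at
  \<open>- x / dx\<close>, where the product would vanish.\<close>

lemma pos_along_segment:
  fixes x s :: real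
  assumes "0 < x" "0 < s" "0 \<le> a" and p: "\<And>t. 0 \<le> t \<Longrightarrow> t \<le> a \<Longrightarrow> 0 < (x + t * dx) * (s + t * ds)"
  shows "0 < x + a * dx" "0 < s + a * ds"
proof -
  have *: "0 < x + a * dx" if "0 < x" "\<And>t. 0 \<le> t \<Longrightarrow> t \<le> a \<Longrightarrow> 0 < (x + t * dx) * (s + t * ds)" for x dx s ds :: real
  proof (rule ccontr)
    assume n: "\<not> 0 < x + a * dx"
    have d: "dx < 0" using n that(1) assms(3) by (smt (verit) mult_nonneg_nonneg)
    have "- x / dx \<le> a" "0 \<le> - x / dx" using n d that(1) by (auto simp: field_simps)
    from that(2)[OF this(2,1)] d show False by simp
  qed
  show "0 < x + a * dx" by (rule *[OF assms(1) p])
  show "0 < s + a * ds" by (rule *[of s ds x dx, OF assms(2)]) (metis p mult.commute)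
qed

lemma nrm_coord: "i < n \<Longrightarrow> \<bar>f i\<bar> \<le> nrm n f"
  using member_le_L2_set[of "{..<n}" i "\<lambda>i. \<bar>f i\<bar>"] by (simp add: L2_set_def)

lemma nrm_triangle: "nrm n (\<lambda>i. f i + g i) \<le> nrm n f + nrm n g"
  by (rule L2_set_triangle_ineq)

lemma nrm_scale: "nrm n (\<lambda>i. a * f i) = \<bar>a\<bar> * nrm n f"
  unfolding L2_set_def power_mult_distrib sum_distrib_left[symmetric] by (simp add: real_sqrt_mult)

lemma abs_sum_le_nrm: "\<bar>\<Sum>i<n. f i\<bar> \<le> sqrt n * nrm n f"
proof -
  have "\<bar>\<Sum>i<n. f i\<bar> \<le> (\<Sum>i<n. \<bar>f i\<bar> * \<bar>1\<bar>)" using sum_abs[of f "{..<n}"] by simp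
  also have "\<dots> \<le> nrm n f * nrm n (\<lambda>_. 1)" by (rule L2_set_mult_ineq)
  finally show ?thesis by (simp add: L2_set_constant mult.commute)
qed

text \<open>The positivity argument shared by the three kinds of steps. Nearness to a positive
  number is asked along the whole segment, since at the end point alone two negative factors could
  not be excluded.\<close>

lemma segment_positive:
  assumes x: "\<And>i. i < n \<Longrightarrow> 0 < x i" and s: "\<And>i. i < n \<Longrightarrow> 0 < s i"
    and \<beta>: "\<beta> < 1" and a: "0 \<le> a"
    and m: "\<And>t. 0 \<le> t \<Longrightarrow> t \<le> a \<Longrightarrow> 0 < m t \<and> nrm n (\<lambda>i. (x i + t * dx i) * (s i + t * ds i) - m t) \<le> \<beta> * m t"
    and i: "i < n"
  shows "0 < x i + a * dx i" "0 < s i + a * ds i"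
proof -
  have "0 < (x i + t * dx i) * (s i + t * ds i)" if "0 \<le> t" "t \<le> a" for t
  proof -
    have "\<bar>(x i + t * dx i) * (s i + t * ds i) - m t\<bar> \<le> \<beta> * m t"
      using nrm_coord[OF i, of "\<lambda>i. (x i + t * dx i) * (s i + t * ds i) - m t"] m[OF that] by linarith
    moreover have "\<beta> * m t < m t" using m[OF that] \<beta> by simp
    ultimately show ?thesis by linarith
  qed
  then show "0 < x i + a * dx i" "0 < s i + a * ds i"
    using pos_along_segment[OF x[OF i] s[OF i] a] by blast+
qed

text \<open>Along the step the deviation from \<open>\<mu>\<close> is \<open>1 - t\<close> times the
  initial one plus \<open>t^2 dx ds\<close>, so at \<open>t = 1\<close> only the quadratic term is
  left. As the products are at least \<open>5/6 \<mu>\<close>, it is at most half of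
  \<open>6/5 \<beta>^2 \<mu>\<close>, and \<open>\<beta> \<le> 1/6\<close> turns this into
  \<open>\<beta>/10 \<mu>\<close>.\<close>

lemma corrector_step:
  assumes x: "\<And>i. i < n \<Longrightarrow> 0 < x i" and s: "\<And>i. i < n \<Longrightarrow> 0 < s i"
    and \<beta>: "0 < \<beta>" "\<beta> \<le> 1/6" and \<mu>: "0 < \<mu>" and near: "nrm n (\<lambda>i. x i * s i - \<mu>) \<le> \<beta> * \<mu>"
    and o: "ip n dx ds = 0" and r: "\<And>i. i < n \<Longrightarrow> s i * dx i + x i * ds i = \<mu> - x i * s i"
  shows "nrm n (\<lambda>i. (x i + dx i) * (s i + ds i) - \<mu>) \<le> \<beta> / 10 * \<mu>"
    and "\<And>i. i < n \<Longrightarrow> 0 < x i + dx i" "\<And>i. i < n \<Longrightarrow> 0 < s i + ds i"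
proof -
  have lb: "5/6 * \<mu> \<le> x i * s i" if "i < n" for i
  proof -
    have "\<bar>x i * s i - \<mu>\<bar> \<le> \<beta> * \<mu>" using nrm_coord[OF that, of "\<lambda>i. x i * s i - \<mu>"] near by linarith
    moreover have "\<beta> * \<mu> \<le> 1/6 * \<mu>" using \<beta> \<mu> by (intro mult_right_mono) auto
    ultimately show ?thesis by linarith
  qed
  have "(\<Sum>i<n. (\<mu> - x i * s i)\<^sup>2 / (x i * s i)) \<le> (\<Sum>i<n. (x i * s i - \<mu>)\<^sup>2 / (5/6 * \<mu>))"
    using lb x s \<mu> unfolding power2_commute[of \<mu>] by (intro sum_mono divide_left_mono mult_pos_pos) auto
  also have "\<dots> = (nrm n (\<lambda>i. x i * s i - \<mu>))\<^sup>2 / (5/6 * \<mu>)"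
    unfolding sum_divide_distrib[symmetric] L2_set_def by (simp add: sum_nonneg)
  also have "\<dots> \<le> (\<beta> * \<mu>)\<^sup>2 / (5/6 * \<mu>)" using near \<mu> by (intro divide_right_mono power_mono) auto
  also have "\<dots> = \<beta> * (6/5 * \<beta> * \<mu>)" using \<mu> by (simp add: power2_eq_square)
  also have "\<dots> \<le> \<beta> * (6/5 * (1/6) * \<mu>)" using \<beta> \<mu> by (intro mult_left_mono mult_right_mono) auto
  finally have P: "nrm n (\<lambda>i. dx i * ds i) \<le> \<beta> / 10 * \<mu>"
    using newton_product_bound[OF x s o r] by linarith
  have path: "nrm n (\<lambda>i. (x i + t * dx i) * (s i + t * ds i) - \<mu>) \<le> (1 - t) * (\<beta> * \<mu>) + t\<^sup>2 * (\<beta> / 10 * \<mu>)" if "0 \<le> t" "t \<le> 1" for t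
  proof -
    have "nrm n (\<lambda>i. (x i + t * dx i) * (s i + t * ds i) - \<mu>) = nrm n (\<lambda>i. (1 - t) * (x i * s i - \<mu>) + t\<^sup>2 * (dx i * ds i))"
    proof (rule L2_set_cong)
      fix i assume "i \<in> {..<n}"
      then have "(x i + t * dx i) * (s i + t * ds i) = x i * s i + t * (\<mu> - x i * s i) + t\<^sup>2 * (dx i * ds i)"
        unfolding r[of i, symmetric, OF \<open>i \<in> _\<close>[unfolded lessThan_iff]] by (simp add: algebra_simps power2_eq_square)
      then show "(x i + t * dx i) * (s i + t * ds i) - \<mu> = (1 - t) * (x i * s i - \<mu>) + t\<^sup>2 * (dx i * ds i)" by (simp add: algebra_simps)
    qed simp
    also have "\<dots> \<le> \<bar>1 - t\<bar> * nrm n (\<lambda>i. x i * s i - \<mu>) + \<bar>t\<^sup>2\<bar> * nrm n (\<lambda>i. dx i * ds i)"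
      unfolding nrm_scale[symmetric] by (rule nrm_triangle)
    also have "\<dots> \<le> (1 - t) * (\<beta> * \<mu>) + t\<^sup>2 * (\<beta> / 10 * \<mu>)" using that near P by (intro add_mono mult_mono) auto
    finally show ?thesis .
  qed
  show "nrm n (\<lambda>i. (x i + dx i) * (s i + ds i) - \<mu>) \<le> \<beta> / 10 * \<mu>" using path[of 1] by simp
  have bd: "0 < \<mu> \<and> nrm n (\<lambda>i. (x i + t * dx i) * (s i + t * ds i) - \<mu>) \<le> 1/2 * \<mu>" if "0 \<le> t" "t \<le> 1" for t
  proof -
    have "t\<^sup>2 \<le> t" using that by (simp add: power2_eq_square mult_left_le)
    have "\<beta> * \<mu> \<le> 1/6 * \<mu>" using \<beta> \<mu> by (intro mult_right_mono) auto
    moreover have "(1 - t) * (\<beta> * \<mu>) \<le> \<beta> * \<mu>" using that \<beta> \<mu> by (simp add: mult_left_le_one_le)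
    moreover have "t\<^sup>2 * (\<beta> / 10 * \<mu>) \<le> \<beta> / 10 * \<mu>" using that \<beta> \<mu> \<open>t\<^sup>2 \<le> t\<close> by (simp add: mult_left_le_one_le)
    ultimately show ?thesis using path[OF that] \<mu> by linarith
  qed
  show "\<And>i. i < n \<Longrightarrow> 0 < x i + dx i" "\<And>i. i < n \<Longrightarrow> 0 < s i + ds i"
    using segment_positive[OF x s _ _ bd, of 1] by simp_all
qed

text \<open>The target value shrinks to \<open>(1 - t) \<mu>\<close>, and the error is
  \<open>1 - t\<close> times the initial deviation plus \<open>t^2 dx ds\<close>. The first part
  uses a tenth of the allowance \<open>\<beta> (1 - t) \<mu>\<close>, the second at most half of
  it.\<close>

lemma affine_step:
  assumes x: "\<And>i. i < n \<Longrightarrow> 0 < x i" and s: "\<And>i. i < n \<Longrightarrow> 0 < s i" and n: "0 < n"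
    and \<beta>: "0 < \<beta>" "\<beta> \<le> 1/6" and \<mu>: "0 < \<mu>" and mean: "ip n x s = n * \<mu>"
    and near: "nrm n (\<lambda>i. x i * s i - \<mu>) \<le> \<beta> / 10 * \<mu>"
    and o: "ip n dx ds = 0" and r: "\<And>i. i < n \<Longrightarrow> s i * dx i + x i * ds i = - (x i * s i)"
    and a: "0 \<le> a" "a < 1" "a \<le> max (\<beta> / (2 * sqrt n)) (1 - 2 * nrm n (\<lambda>i. dx i * ds i) / (\<beta> * \<mu>))"
  shows "nrm n (\<lambda>i. (x i + a * dx i) * (s i + a * ds i) - (1 - a) * \<mu>) \<le> \<beta> * ((1 - a) * \<mu>)"
    and "\<And>i. i < n \<Longrightarrow> 0 < x i + a * dx i" "\<And>i. i < n \<Longrightarrow> 0 < s i + a * ds i"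
proof -
  define D where "D = nrm n (\<lambda>i. dx i * ds i)"
  have D0: "0 \<le> D" by (simp add: D_def)
  have "(\<Sum>i<n. (- (x i * s i))\<^sup>2 / (x i * s i)) = ip n x s"
    unfolding ip_def by (intro sum.cong) (auto simp: power2_eq_square)
  then have D: "D \<le> n * \<mu> / 2" using newton_product_bound[OF x s o r] mean unfolding D_def by simp
  have path: "0 < (1 - t) * \<mu> \<and> nrm n (\<lambda>i. (x i + t * dx i) * (s i + t * ds i) - (1 - t) * \<mu>) \<le> \<beta> * ((1 - t) * \<mu>)"
    if t: "0 \<le> t" "t \<le> a" for t
  proof -
    have "nrm n (\<lambda>i. (x i + t * dx i) * (s i + t * ds i) - (1 - t) * \<mu>) = nrm n (\<lambda>i. (1 - t) * (x i * s i - \<mu>) + t\<^sup>2 * (dx i * ds i))"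
    proof (rule L2_set_cong)
      fix i assume "i \<in> {..<n}"
      then have "(x i + t * dx i) * (s i + t * ds i) = x i * s i + t * (- (x i * s i)) + t\<^sup>2 * (dx i * ds i)"
        unfolding r[of i, symmetric, OF \<open>i \<in> _\<close>[unfolded lessThan_iff]] by (simp add: algebra_simps power2_eq_square)
      then show "(x i + t * dx i) * (s i + t * ds i) - (1 - t) * \<mu> = (1 - t) * (x i * s i - \<mu>) + t\<^sup>2 * (dx i * ds i)" by (simp add: algebra_simps)
    qed simp
    also have "\<dots> \<le> \<bar>1 - t\<bar> * nrm n (\<lambda>i. x i * s i - \<mu>) + \<bar>t\<^sup>2\<bar> * D"
      unfolding nrm_scale[symmetric] D_def by (rule nrm_triangle)
    also have "\<dots> \<le> (1 - t) * (\<beta> / 10 * \<mu>) + t\<^sup>2 * D" using t a near D0 by (intro add_mono mult_mono) auto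
    also have "t\<^sup>2 * D \<le> 1/2 * (\<beta> * ((1 - t) * \<mu>))"
    proof -
      \<comment> \<open>The two arguments of the maximum in the step length. A short step is safe
        for every direction, because the product norm is at most \<open>n \<mu> / 2\<close>; a
        longer one is safe because its length was adapted to the actual product norm.\<close>
      consider "t \<le> \<beta> / (2 * sqrt n)" | "t \<le> 1 - 2 * D / (\<beta> * \<mu>)" using a(3) t unfolding D_def by linarith
      then show ?thesis
      proof cases
        case 1
        have "t\<^sup>2 \<le> (\<beta> / (2 * sqrt n))\<^sup>2" using 1 t by (intro power_mono) auto
        then have "t\<^sup>2 * D \<le> (\<beta> / (2 * sqrt n))\<^sup>2 * (n * \<mu> / 2)" using D D0 by (intro mult_mono) auto
        also have "\<dots> = \<beta> * (\<beta> / 8) * \<mu>" using n by (simp add: power2_eq_square field_simps)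
        also have "\<dots> \<le> \<beta> * (1 / 8) * \<mu>" using \<beta> \<mu> by (intro mult_right_mono mult_left_mono) auto
        finally have A: "t\<^sup>2 * D \<le> 1/8 * (\<beta> * \<mu>)" by simp
        have "\<beta> / (2 * sqrt n) \<le> \<beta> / 2" using n \<beta> by (intro divide_left_mono) auto
        then have "1/2 \<le> 1 - t" using 1 \<beta> by linarith
        then have "1/2 * (\<beta> * \<mu>) \<le> (1 - t) * (\<beta> * \<mu>)" using \<beta> \<mu> by (intro mult_right_mono) auto
        moreover have "0 < \<beta> * \<mu>" using \<beta> \<mu> by simp
        ultimately show ?thesis using A by (simp add: algebra_simps)
      next
        case 2
        then have "D \<le> (1 - t) * \<beta> * \<mu> / 2" using \<beta> \<mu> by (simp add: field_simps)
        moreover have "t\<^sup>2 * D \<le> D" using t a D0 by (simp add: mult_left_le_one_le power_le_one)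
        ultimately show ?thesis by (simp add: algebra_simps)
      qed
    qed
    finally have "nrm n (\<lambda>i. (x i + t * dx i) * (s i + t * ds i) - (1 - t) * \<mu>) \<le> (1 - t) * (\<beta> / 10 * \<mu>) + 1/2 * (\<beta> * ((1 - t) * \<mu>))" by simp
    moreover have "(1 - t) * (\<beta> / 10 * \<mu>) = 1/10 * (\<beta> * ((1 - t) * \<mu>))" by simp
    ultimately have "nrm n (\<lambda>i. (x i + t * dx i) * (s i + t * ds i) - (1 - t) * \<mu>) \<le> 6/10 * (\<beta> * ((1 - t) * \<mu>))" by linarith
    moreover have "0 < \<beta> * ((1 - t) * \<mu>)" using \<beta> \<mu> t a by simp
    ultimately show ?thesis using \<mu> t a by simp
  qed
  show "nrm n (\<lambda>i. (x i + a * dx i) * (s i + a * ds i) - (1 - a) * \<mu>) \<le> \<beta> * ((1 - a) * \<mu>)" using path[of a] a by simp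
  show "\<And>i. i < n \<Longrightarrow> 0 < x i + a * dx i" "\<And>i. i < n \<Longrightarrow> 0 < s i + a * ds i"
    using segment_positive[OF x s _ a(1) path] \<beta> by simp_all
qed

text \<open>The products along the step interpolate between the current ones and those of the full
  step, called \<open>p\<close>, with the correction \<open>- t (1 - t) dx ds\<close>. The former
  are of order \<open>\<epsilon> \<mu>\<close> and the correction carries a factor
  \<open>1 - t\<close>, so all errors are small against \<open>\<beta> (1 - t) \<mu>\<close> as long
  as \<open>8 \<epsilon> \<le> \<beta> (1 - t)\<close>.\<close>

lemma layered_step:
  assumes x: "\<And>i. i < n \<Longrightarrow> 0 < x i" and s: "\<And>i. i < n \<Longrightarrow> 0 < s i" and n: "0 < n"
    and \<beta>: "0 < \<beta>" "\<beta> \<le> 1/6" and \<mu>: "0 < \<mu>" and mean: "ip n x s = n * \<mu>"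
    and near: "nrm n (\<lambda>i. x i * s i - \<mu>) \<le> \<beta> / 10 * \<mu>"
    and o: "ip n dx ds = 0"
    and \<epsilon>: "nrm n (\<lambda>i. (x i + dx i) * (s i + ds i)) \<le> \<epsilon> * \<mu>"
    and D: "nrm n (\<lambda>i. dx i * ds i) \<le> \<beta> / 9 * \<mu>"
    and a: "0 \<le> a" "a < 1" "a \<le> 1 - 8 * \<epsilon> / \<beta>"
    and m: "m = ip n (\<lambda>i. x i + a * dx i) (\<lambda>i. s i + a * ds i) / n"
  shows "\<bar>m - (1 - a) * \<mu>\<bar> \<le> \<epsilon> * \<mu>" "0 < m"
    and "nrm n (\<lambda>i. (x i + a * dx i) * (s i + a * ds i) - m) \<le> \<beta> * m"
    and "\<And>i. i < n \<Longrightarrow> 0 < x i + a * dx i" "\<And>i. i < n \<Longrightarrow> 0 < s i + a * ds i"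
proof -
  define p where "p i = (x i + dx i) * (s i + ds i)" for i
  \<comment> \<open>The mean of the products at time \<open>t\<close>; orthogonality of
    \<open>dx\<close> and \<open>ds\<close> removes the quadratic term from it.\<close>
  define M where "M t = (1 - t) * \<mu> + t * ((\<Sum>i<n. p i) / n)" for t
  have \<epsilon>0: "0 \<le> \<epsilon> * \<mu>" using order_trans[OF _ \<epsilon>] by simp
  have mp: "\<bar>(\<Sum>i<n. p i) / n\<bar> \<le> \<epsilon> * \<mu>" "sqrt n * \<bar>(\<Sum>i<n. p i) / n\<bar> \<le> \<epsilon> * \<mu>"
  proof -
    have "\<bar>\<Sum>i<n. p i\<bar> \<le> sqrt n * (\<epsilon> * \<mu>)"
      using order_trans[OF abs_sum_le_nrm mult_left_mono[OF \<epsilon>]] by (simp add: p_def)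
    then have "sqrt n * \<bar>\<Sum>i<n. p i\<bar> \<le> sqrt n * (sqrt n * (\<epsilon> * \<mu>))" by (rule mult_left_mono) simp
    then have "sqrt n * \<bar>\<Sum>i<n. p i\<bar> \<le> real n * (\<epsilon> * \<mu>)" by (simp add: mult.assoc[symmetric])
    then show "sqrt n * \<bar>(\<Sum>i<n. p i) / n\<bar> \<le> \<epsilon> * \<mu>" using n by (simp add: field_simps)
    moreover have "1 * \<bar>(\<Sum>i<n. p i) / n\<bar> \<le> sqrt n * \<bar>(\<Sum>i<n. p i) / n\<bar>" using n by (intro mult_right_mono) auto
    ultimately show "\<bar>(\<Sum>i<n. p i) / n\<bar> \<le> \<epsilon> * \<mu>" by linarith
  qed
  have prod: "(x i + t * dx i) * (s i + t * ds i) = (1 - t) * (x i * s i) + t * p i - t * (1 - t) * (dx i * ds i)" for i t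
    by (simp add: p_def algebra_simps)
  have "ip n (\<lambda>i. x i + a * dx i) (\<lambda>i. s i + a * ds i) = (1 - a) * ip n x s + a * (\<Sum>i<n. p i) - a * (1 - a) * ip n dx ds"
    unfolding ip_def prod by (simp only: sum.distrib sum_subtractf sum_distrib_left)
  then have mM: "m = M a" using n unfolding m M_def mean o by (simp add: field_simps)
  have Mb: "\<bar>M t - (1 - t) * \<mu>\<bar> \<le> \<epsilon> * \<mu>" if t: "0 \<le> t" "t \<le> a" for t
  proof -
    have "\<bar>M t - (1 - t) * \<mu>\<bar> = t * \<bar>(\<Sum>i<n. p i) / n\<bar>" using t unfolding M_def by (simp add: abs_mult)
    also have "\<dots> \<le> 1 * (\<epsilon> * \<mu>)" using t a mp(1) by (intro mult_mono) auto
    finally show ?thesis by simp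
  qed
  show 1: "\<bar>m - (1 - a) * \<mu>\<bar> \<le> \<epsilon> * \<mu>" using Mb[of a] a mM by simp
  have path: "0 < M t \<and> nrm n (\<lambda>i. (x i + t * dx i) * (s i + t * ds i) - M t) \<le> \<beta> * M t"
    if t: "0 \<le> t" "t \<le> a" for t
  proof -
    have g: "8 * (\<epsilon> * \<mu>) \<le> \<beta> * ((1 - t) * \<mu>)"
    proof -
      have "8 * \<epsilon> / \<beta> \<le> 1 - t" using a t by linarith
      then have "8 * \<epsilon> \<le> (1 - t) * \<beta>" using \<beta> by (simp add: pos_divide_le_eq)
      then have "8 * \<epsilon> * \<mu> \<le> (1 - t) * \<beta> * \<mu>" using \<mu> by (intro mult_right_mono) auto
      then show ?thesis by (simp add: algebra_simps)
    qed
    define E where "E = (1 - t) * \<mu>"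
    have E: "0 < E" using t a \<mu> by (simp add: E_def)
    have "nrm n (\<lambda>i. (x i + t * dx i) * (s i + t * ds i) - M t)
        = nrm n (\<lambda>i. (1 - t) * (x i * s i - \<mu>) + (t * (p i + - ((\<Sum>i<n. p i) / n)) + (- t * (1 - t)) * (dx i * ds i)))"
      unfolding prod M_def by (simp add: algebra_simps)
    also have "\<dots> \<le> \<bar>1 - t\<bar> * nrm n (\<lambda>i. x i * s i - \<mu>) + (\<bar>t\<bar> * (nrm n p + nrm n (\<lambda>_. - ((\<Sum>i<n. p i) / n))) + \<bar>- t * (1 - t)\<bar> * nrm n (\<lambda>i. dx i * ds i))"
    proof -
      have "\<bar>t\<bar> * nrm n (\<lambda>i. p i + - ((\<Sum>i<n. p i) / n)) \<le> \<bar>t\<bar> * (nrm n p + nrm n (\<lambda>_. - ((\<Sum>i<n. p i) / n)))"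
        by (intro mult_left_mono nrm_triangle) auto
      then show ?thesis
        using nrm_triangle[where n=n and f="\<lambda>i. (1 - t) * (x i * s i - \<mu>)" and g="\<lambda>i. (t * (p i + - ((\<Sum>i<n. p i) / n)) + (- t * (1 - t)) * (dx i * ds i))"]
          nrm_triangle[where n=n and f="\<lambda>i. t * (p i + - ((\<Sum>i<n. p i) / n))" and g="\<lambda>i. (- t * (1 - t)) * (dx i * ds i)"]
        unfolding nrm_scale by linarith
    qed
    also have "\<dots> \<le> (1 - t) * (\<beta> / 10 * \<mu>) + (1 * (\<epsilon> * \<mu> + \<epsilon> * \<mu>) + (1 - t) * (\<beta> / 9 * \<mu>))"
    proof (intro add_mono mult_mono)
      show "nrm n p \<le> \<epsilon> * \<mu>" using \<epsilon> unfolding p_def .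
      show "nrm n (\<lambda>_. - ((\<Sum>i<n. p i) / n)) \<le> \<epsilon> * \<mu>" using mp(2) by (simp only: L2_set_constant card_lessThan abs_minus_cancel)
      show "\<bar>- t * (1 - t)\<bar> \<le> 1 - t" using t a by (simp add: abs_mult mult_left_le_one_le)
    qed (use t a near D \<epsilon>0 in auto)
    also have "\<dots> = 19/90 * (\<beta> * E) + 2 * (\<epsilon> * \<mu>)" unfolding E_def by (simp add: algebra_simps)
    finally have N: "nrm n (\<lambda>i. (x i + t * dx i) * (s i + t * ds i) - M t) \<le> 19/90 * (\<beta> * E) + 2 * (\<epsilon> * \<mu>)" .
    have bE: "\<beta> * E \<le> 1/6 * E" "0 < \<beta> * E" using \<beta> E by (auto intro: mult_right_mono)
    have M1: "E - \<epsilon> * \<mu> \<le> M t" using Mb[OF t] unfolding E_def by linarith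
    have "M t \<ge> 9/10 * E" using M1 g bE unfolding E_def[symmetric] by linarith
    then have "\<beta> * M t \<ge> \<beta> * (9/10 * E)" using \<beta> by (intro mult_left_mono) auto
    then have "\<beta> * M t \<ge> 9/10 * (\<beta> * E)" by (simp add: algebra_simps)
    then show ?thesis using N g bE E \<open>M t \<ge> 9/10 * E\<close> unfolding E_def[symmetric] by linarith
  qed
  show "0 < m" "nrm n (\<lambda>i. (x i + a * dx i) * (s i + a * ds i) - m) \<le> \<beta> * m" using path[of a] a mM by simp_all
  show "\<And>i. i < n \<Longrightarrow> 0 < x i + a * dx i" "\<And>i. i < n \<Longrightarrow> 0 < s i + a * ds i"
    using segment_positive[OF x s _ a(1) path] \<beta> by simp_all
qed

subsection \<open>The central path\<close>

definition strict_feas :: "nat \<Rightarrow> (nat \<Rightarrow> real) set \<Rightarrow> (nat \<Rightarrow> real) \<Rightarrow> (nat \<Rightarrow> real) set" where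
  "strict_feas n W x0 = {x \<in> supp n. (\<forall>i<n. 0 < x i) \<and> (\<lambda>i. x i - x0 i) \<in> W}"

locale lp_pair = orth_pair +
  fixes x0 s0 :: "nat \<Rightarrow> real"
  assumes x0: "x0 \<in> supp n" "\<And>i. i < n \<Longrightarrow> 0 < x0 i" and s0: "s0 \<in> supp n" "\<And>i. i < n \<Longrightarrow> 0 < s0 i"
begin

abbreviation "PP \<equiv> strict_feas n W x0"
abbreviation "DD \<equiv> strict_feas n W' s0"

definition on_path :: "real \<Rightarrow> (nat \<Rightarrow> real) \<Rightarrow> (nat \<Rightarrow> real) \<Rightarrow> bool" where
  "on_path \<mu> x s \<longleftrightarrow> x \<in> PP \<and> s \<in> DD \<and> (\<forall>i<n. x i * s i = \<mu>)"

lemma feas_diff_orth: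
  assumes "x \<in> PP" "y \<in> PP" "s \<in> DD" "t \<in> DD"
  shows "(\<lambda>i. x i - y i) \<in> W" "(\<lambda>i. s i - t i) \<in> W'" "ip n (\<lambda>i. x i - y i) (\<lambda>i. s i - t i) = 0"
proof -
  show 1: "(\<lambda>i. x i - y i) \<in> W"
    using subspD(4)[OF W, of "\<lambda>i. x i - x0 i" "\<lambda>i. y i - x0 i"] assms by (simp add: strict_feas_def)
  show 2: "(\<lambda>i. s i - t i) \<in> W'"
    using subspD(4)[OF W', of "\<lambda>i. s i - s0 i" "\<lambda>i. t i - s0 i"] assms by (simp add: strict_feas_def)
  show "ip n (\<lambda>i. x i - y i) (\<lambda>i. s i - t i) = 0" by (rule orthogonal[OF 1 2])
qed

lemma feas_pos: "x \<in> PP \<Longrightarrow> i < n \<Longrightarrow> 0 < x i" "s \<in> DD \<Longrightarrow> i < n \<Longrightarrow> 0 < s i"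
  by (auto simp: strict_feas_def)

text \<open>Differences of feasible points are orthogonal, so the mixed products are determined by
  the two complementarity gaps. Both coordinatewise estimates below start from this
  identity.\<close>

lemma cross_sum:
  assumes "x \<in> PP" "y \<in> PP" "s \<in> DD" "t \<in> DD"
  shows "(\<Sum>i<n. x i * t i + y i * s i) = ip n x s + ip n y t"
  using feas_diff_orth(3)[OF assms] by (simp add: ip_def algebra_simps sum.distrib sum_subtractf)

text \<open>With equal products, \<open>x - y\<close> and \<open>s - t\<close> have opposite signs
  in every coordinate, while their inner product is zero.\<close>

lemma on_path_unique:
  assumes "on_path \<mu> x s" "on_path \<mu> y t"
  shows "x = y" "s = t"
proof -
  have f: "x \<in> PP" "y \<in> PP" "s \<in> DD" "t \<in> DD" and e: "\<And>i. i < n \<Longrightarrow> x i * s i = \<mu>" "\<And>i. i < n \<Longrightarrow> y i * t i = \<mu>"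
    using assms by (auto simp: on_path_def)
  have id: "(x i - y i)\<^sup>2 * (s i / y i) = - ((x i - y i) * (s i - t i))" if "i < n" for i
  proof -
    have "(x i - y i) * s i = - (y i * (s i - t i))" using e[OF that] by (simp add: algebra_simps)
    then have "(x i - y i)\<^sup>2 * (s i / y i) = (x i - y i) * (- (y i * (s i - t i))) / y i" unfolding power2_eq_square by (metis mult.assoc times_divide_eq_right)
    then show ?thesis using feas_pos(1)[OF f(2) that] by simp
  qed
  have "(\<Sum>i<n. (x i - y i)\<^sup>2 * (s i / y i)) = 0"
    using feas_diff_orth(3)[OF f] id unfolding ip_def by (simp add: sum_negf)
  then have "\<forall>i\<in>{..<n}. (x i - y i)\<^sup>2 * (s i / y i) = 0"
    using feas_pos(1)[OF f(2)] feas_pos(2)[OF f(3)] by (subst (asm) sum_nonneg_eq_0_iff) (auto simp: less_imp_le)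
  then have eq: "x i = y i" if "i < n" for i using that feas_pos(1)[OF f(2)] feas_pos(2)[OF f(3)] by force
  then have "s i = t i" if "i < n" for i using that e[OF that] feas_pos(1)[OF f(2) that] by (metis mult_left_cancel less_irrefl)
  then show "x = y" "s = t" using eq f by (auto simp: strict_feas_def supp_def fun_eq_iff) (metis not_le)+
qed

text \<open>Near-monotonicity of the central path: one positive summand of \<open>cross_sum\<close>
  is at most the whole sum, hence at most \<open>2 n \<mu>\<close>, and \<open>\<mu>\<close> is
  \<open>x i * s i\<close>.\<close>

lemma path_le:
  assumes "on_path \<mu> x s" "on_path \<nu> y t" "0 < \<nu>" "\<nu> \<le> \<mu>" "i < n"
  shows "y i \<le> 2 * real n * x i" "t i \<le> 2 * real n * s i"
proof -
  have f: "x \<in> PP" "y \<in> PP" "s \<in> DD" "t \<in> DD" and e: "\<And>i. i < n \<Longrightarrow> x i * s i = \<mu>" "\<And>i. i < n \<Longrightarrow> y i * t i = \<nu>"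
    using assms by (auto simp: on_path_def)
  have n0: "0 < x j * t j" "0 < y j * s j" if "j < n" for j
    using feas_pos(1)[OF f(1) that] feas_pos(1)[OF f(2) that] feas_pos(2)[OF f(3) that] feas_pos(2)[OF f(4) that] by auto
  have "x i * t i + y i * s i \<le> (\<Sum>i<n. x i * t i + y i * s i)"
    using assms(5) add_pos_pos[OF n0(1) n0(2)] by (intro member_le_sum) (auto intro: less_imp_le)
  also have "\<dots> = ip n x s + ip n y t" by (rule cross_sum[OF f])
  also have "\<dots> = real n * \<mu> + real n * \<nu>" unfolding ip_def using e by simp
  also have "\<dots> \<le> 2 * real n * \<mu>" using mult_left_mono[OF assms(4), of "real n"] by linarith
  finally have *: "x i * t i + y i * s i \<le> 2 * real n * \<mu>" .
  have "y i * s i \<le> (2 * real n * x i) * s i" using * n0(1)[OF assms(5)] e(1)[OF assms(5)] by (simp add: mult.assoc)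
  then show "y i \<le> 2 * real n * x i" using feas_pos(2)[OF f(3) assms(5)] by simp
  have "x i * t i \<le> x i * (2 * real n * s i)" using * n0(2)[OF assms(5)] unfolding e(1)[OF assms(5), symmetric] by (simp add: algebra_simps)
  then show "t i \<le> 2 * real n * s i" using feas_pos(1)[OF f(1) assms(5)] by simp
qed

text \<open>The quotients of iterate and path point are written as squares \<open>a^2\<close> and
  \<open>b^2\<close>. Their total is \<open>2 n\<close>, which exceeds the total of
  \<open>2 a b\<close> only by second-order terms in the centrality error \<open>u\<close>. So
  \<open>a\<close> and \<open>b\<close> nearly coincide, and as \<open>a b\<close> is nearly 1, so
  are both of them.\<close>

lemma near_path:
  assumes x: "x \<in> PP" "s \<in> DD" and mean: "ip n x s = real n * \<mu>" and \<mu>: "0 < \<mu>"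
    and near: "nrm n (\<lambda>i. x i * s i - \<mu>) \<le> 1/60 * \<mu>"
    and p: "on_path \<mu> y t" and i: "i < n"
  shows "x i \<le> 5/4 * y i" "y i \<le> 5/4 * x i" "s i \<le> 5/4 * t i" "t i \<le> 5/4 * s i"
proof -
  have f: "x \<in> PP" "y \<in> PP" "s \<in> DD" "t \<in> DD" and e: "\<And>i. i < n \<Longrightarrow> y i * t i = \<mu>"
    using x p by (auto simp: on_path_def)
  define a b where "a j = sqrt (x j / y j)" and "b j = sqrt (s j / t j)" for j
  have pos: "0 < x j" "0 < y j" "0 < s j" "0 < t j" if "j < n" for j
    using feas_pos(1)[OF f(1) that] feas_pos(1)[OF f(2) that] feas_pos(2)[OF f(3) that] feas_pos(2)[OF f(4) that] by auto
  have ab0: "0 < a j" "0 < b j" if "j < n" for j using pos[OF that] by (auto simp: a_def b_def)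
  have sq: "(a j)\<^sup>2 = x j / y j" "(b j)\<^sup>2 = s j / t j" if "j < n" for j using pos[OF that] by (auto simp: a_def b_def)
  define u where "u j = x j * s j / \<mu> - 1" for j
  have u: "(a j)\<^sup>2 * (b j)\<^sup>2 = 1 + u j" if "j < n" for j
    unfolding sq[OF that] u_def e[OF that, symmetric] using pos[OF that] by simp
  have unear: "nrm n u \<le> 1/60"
  proof -
    have "nrm n u = nrm n (\<lambda>i. (1/\<mu>) * (x i * s i - \<mu>))" using \<mu> by (intro L2_set_cong) (auto simp: u_def field_simps)
    also have "\<dots> \<le> (1/\<mu>) * (1/60 * \<mu>)" unfolding nrm_scale using near \<mu> by (intro mult_mono) auto
    finally show ?thesis using \<mu> by simp
  qed
  have ub: "\<bar>u j\<bar> \<le> 1/60" if "j < n" for j using nrm_coord[OF that, of u] unear by linarith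
  have su: "(\<Sum>j<n. u j) = 0" using mean \<mu> unfolding u_def ip_def by (simp add: sum_subtractf sum_divide_distrib[symmetric])
  have "(\<Sum>j<n. (x j * t j + y j * s j) / \<mu>) = 2 * real n"
    using cross_sum[OF f] mean e \<mu> unfolding sum_divide_distrib[symmetric] by (simp add: ip_def)
  also have "(\<Sum>j<n. (x j * t j + y j * s j) / \<mu>) = (\<Sum>j<n. (a j)\<^sup>2 + (b j)\<^sup>2)"
  proof (rule sum.cong)
    fix j assume "j \<in> {..<n}" then have j: "j < n" by simp
    show "(x j * t j + y j * s j) / \<mu> = (a j)\<^sup>2 + (b j)\<^sup>2" unfolding sq[OF j] e[OF j, symmetric] using pos[OF j] by (simp add: field_simps)
  qed simp
  finally have S: "(\<Sum>j<n. (a j)\<^sup>2 + (b j)\<^sup>2) = 2 * real n" .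
  have d: "(a j - b j)\<^sup>2 \<le> (a j)\<^sup>2 + (b j)\<^sup>2 - 2 - u j + 2 * (u j)\<^sup>2" if "j < n" for j
  proof -
    \<comment> \<open>A lower bound for \<open>sqrt (1 + u)\<close> that is exact to first order;
      the linear terms disappear in the sum because the deviations \<open>u\<close> add up to
      zero.\<close>
    have "1 + u j / 2 - (u j)\<^sup>2 \<le> a j * b j"
    proof (rule power2_le_imp_le)
      have "(1 + u j / 2 - (u j)\<^sup>2)\<^sup>2 = 1 + u j - (u j)\<^sup>2 * (7/4 + u j - (u j)\<^sup>2)"
        by (simp add: power2_eq_square algebra_simps)
      moreover have "(u j)\<^sup>2 * (7/4 + u j - (u j)\<^sup>2) \<ge> 0"
      proof -
        have "(u j)\<^sup>2 \<le> 1" using ub[OF that] by (simp add: abs_square_le_1)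
        then show ?thesis using ub[OF that] by (intro mult_nonneg_nonneg) auto
      qed
      ultimately show "(1 + u j / 2 - (u j)\<^sup>2)\<^sup>2 \<le> (a j * b j)\<^sup>2" using u[OF that] by (simp add: power_mult_distrib)
      show "0 \<le> a j * b j" using ab0[OF that] by simp
    qed
    then show ?thesis by (simp add: power2_eq_square algebra_simps)
  qed
  have "(a i - b i)\<^sup>2 \<le> (\<Sum>j<n. (a j - b j)\<^sup>2)" using i by (intro member_le_sum) auto
  also have "\<dots> \<le> (\<Sum>j<n. (a j)\<^sup>2 + (b j)\<^sup>2 - 2 - u j + 2 * (u j)\<^sup>2)" using d by (intro sum_mono) auto
  also have "\<dots> = 2 * (nrm n u)\<^sup>2" using S su unfolding L2_set_def
    by (simp add: sum.distrib sum_subtractf sum_distrib_left[symmetric] sum_nonneg)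
  also have "\<dots> \<le> 2 * (1/60)\<^sup>2" using unear by (intro mult_left_mono power_mono) auto
  also have "\<dots> \<le> (1/40)\<^sup>2" by (simp add: power2_eq_square)
  finally have D: "\<bar>a i - b i\<bar> \<le> 1/40" by (subst (asm) abs_le_square_iff[symmetric]) simp
  have P1: "(a i * b i)\<^sup>2 \<ge> 59/60" "(a i * b i)\<^sup>2 \<le> 61/60" using u[OF i] ub[OF i] by (auto simp: power_mult_distrib)
  have bd: "9/10 \<le> v\<^sup>2 \<and> v\<^sup>2 \<le> 11/10" if v: "0 < v" "0 < w" "\<bar>v - w\<bar> \<le> 1/40" "(v * w)\<^sup>2 \<ge> 59/60" "(v * w)\<^sup>2 \<le> 61/60" for v w :: real
  proof -
    have "99/100 \<le> v * w" by (rule power2_le_imp_le) (use v in \<open>auto simp: power2_eq_square\<close>)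
    moreover have "v * w \<le> 101/100" by (rule power2_le_imp_le) (use v in \<open>auto simp: power2_eq_square\<close>)
    moreover have "v * w \<le> v * (v + 1/40)" "v * (v - 1/40) \<le> v * w" using v by (intro mult_left_mono; linarith)+
    ultimately have 1: "99/100 - v/40 \<le> v\<^sup>2" "v\<^sup>2 - v/40 \<le> 101/100" by (auto simp: power2_eq_square algebra_simps)
    have "v \<le> 11/10"
    proof (rule ccontr)
      assume "\<not> v \<le> 11/10"
      then have "v * (v - 1/40) \<ge> 11/10 * (11/10 - 1/40)" by (intro mult_mono) auto
      then show False using 1(2) by (simp add: power2_eq_square algebra_simps)
    qed
    then show ?thesis using 1 v by auto
  qed
  have A: "9/10 \<le> (a i)\<^sup>2 \<and> (a i)\<^sup>2 \<le> 11/10" using bd[of "a i" "b i"] ab0[OF i] D P1 by auto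
  have B: "9/10 \<le> (b i)\<^sup>2 \<and> (b i)\<^sup>2 \<le> 11/10" using bd[of "b i" "a i"] ab0[OF i] D P1 by (auto simp: mult.commute abs_minus_commute)
  from A B show "x i \<le> 5/4 * y i" "y i \<le> 5/4 * x i" "s i \<le> 5/4 * t i" "t i \<le> 5/4 * s i"
    unfolding sq[OF i] using pos[OF i] by (auto simp: field_simps)
qed

end

section \<open>Existence of the central path by minimizing the logarithmic barrier\<close>

text \<open>The tangent inequality \<open>ln u \<le> u - 1\<close> bounds one summand of the barrier
  from below. If the summand is at most \<open>c\<close>, the logarithm keeps \<open>t\<close> away
  from zero, and the same inequality with slope \<open>s / 2\<close> leaves half of the linear term
  to bound \<open>t\<close> from above.\<close>

lemma barrier_term_lower:
  fixes s t \<mu> :: real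
  assumes "0 < s" "0 < t" "0 < \<mu>"
  shows "\<mu> + \<mu> * ln (s / \<mu>) \<le> s * t - \<mu> * ln t"
    and "s * t - \<mu> * ln t \<le> c \<Longrightarrow> exp (- c / \<mu>) \<le> t"
    and "s * t - \<mu> * ln t \<le> c \<Longrightarrow> t \<le> 2 * (c - \<mu> - \<mu> * ln (s / (2 * \<mu>))) / s"
proof -
  have *: "\<mu> * ln t \<le> r * t - \<mu> - \<mu> * ln (r / \<mu>)" if "0 < r" for r
  proof -
    have "ln (r / \<mu> * t) \<le> r / \<mu> * t - 1" using that assms by (intro ln_le_minus_one) simp
    then have "\<mu> * ln (r / \<mu> * t) \<le> \<mu> * (r / \<mu> * t - 1)" using assms by (intro mult_left_mono) auto
    moreover have "ln (r / \<mu> * t) = ln (r / \<mu>) + ln t" using that assms by (intro ln_mult_pos) auto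
    moreover have "\<mu> * (r / \<mu> * t - 1) = r * t - \<mu>" using assms by (simp add: algebra_simps)
    ultimately show ?thesis by (simp add: algebra_simps)
  qed
  show "\<mu> + \<mu> * ln (s / \<mu>) \<le> s * t - \<mu> * ln t" using *[OF assms(1)] by linarith
  show "exp (- c / \<mu>) \<le> t" if "s * t - \<mu> * ln t \<le> c"
  proof -
    have "0 < s * t" using assms by simp
    then have "- c \<le> \<mu> * ln t" using that by linarith
    then have "- c / \<mu> \<le> ln t" using assms by (simp add: field_simps)
    then show ?thesis using assms by (metis exp_le_cancel_iff exp_ln)
  qed
  show "t \<le> 2 * (c - \<mu> - \<mu> * ln (s / (2 * \<mu>))) / s" if "s * t - \<mu> * ln t \<le> c"
  proof -
    have "s / 2 / \<mu> = s / (2 * \<mu>)" by simp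
    then have "s * t / 2 \<le> c - \<mu> - \<mu> * ln (s / (2 * \<mu>))" using *[of "s/2"] that assms by simp
    then show ?thesis using assms by (simp add: field_simps)
  qed
qed

lemma compact_box: "compact {f :: nat \<Rightarrow> real. \<forall>i. l i \<le> f i \<and> f i \<le> u i}"
proof -
  have "compactin (product_topology (\<lambda>_. euclidean) UNIV) (PiE UNIV (\<lambda>i. {l i..u i}))"
    unfolding compactin_PiE by simp
  then have "compact (PiE UNIV (\<lambda>i. {l i..u i}))" unfolding euclidean_product_topology by simp
  also have "PiE UNIV (\<lambda>i. {l i..u i}) = {f. \<forall>i. l i \<le> f i \<and> f i \<le> u i}" by (auto simp: PiE_def)
  finally show ?thesis .
qed

context lp_pair begin

text \<open>On the sublevel set of \<open>x0\<close> every summand is bounded above once the lower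
  bounds of the others are subtracted, so the set lies in a box away from the boundary. Intersecting
  the box with the closed conditions that describe \<open>W\<close> as the complement of
  \<open>W'\<close> gives a compact set of feasible points.\<close>

lemma barrier_minimizer:
  assumes \<mu>: "0 < \<mu>"
  shows "\<exists>x\<in>PP. \<forall>y\<in>PP. (\<Sum>i<n. s0 i * x i - \<mu> * ln (x i)) \<le> (\<Sum>i<n. s0 i * y i - \<mu> * ln (y i))"
proof -
  define F where "F x = (\<Sum>i<n. s0 i * x i - \<mu> * ln (x i))" for x
  define g where "g i = \<mu> + \<mu> * ln (s0 i / \<mu>)" for i
  define c where "c i = F x0 - (\<Sum>j\<in>{..<n} - {i}. g j)" for i
  define l u where "l i = (if i < n then exp (- c i / \<mu>) else 0)" and
    "u i = (if i < n then 2 * (c i - \<mu> - \<mu> * ln (s0 i / (2 * \<mu>))) / s0 i else 0)" for i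
  define K where "K = {f. \<forall>i. l i \<le> f i \<and> f i \<le> u i} \<inter> (\<Inter>h\<in>W'. {f. ip n (\<lambda>i. f i - x0 i) h = 0})"
  have x0P: "x0 \<in> PP" using x0 subspD(1)[OF W] by (simp add: strict_feas_def)
  have inK: "x \<in> K" if x: "x \<in> PP" "F x \<le> F x0" for x
  proof -
    have "l i \<le> x i \<and> x i \<le> u i" for i
    proof (cases "i < n")
      case True
      have "F x = (s0 i * x i - \<mu> * ln (x i)) + (\<Sum>j\<in>{..<n} - {i}. s0 j * x j - \<mu> * ln (x j))"
        unfolding F_def using True by (intro sum.remove) auto
      moreover have "(\<Sum>j\<in>{..<n} - {i}. g j) \<le> (\<Sum>j\<in>{..<n} - {i}. s0 j * x j - \<mu> * ln (x j))"
        unfolding g_def using x(1) s0 \<mu> by (intro sum_mono barrier_term_lower(1)) (auto simp: strict_feas_def)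
      ultimately have "s0 i * x i - \<mu> * ln (x i) \<le> c i" using x(2) unfolding c_def by linarith
      from barrier_term_lower(2,3)[OF s0(2)[OF True] feas_pos(1)[OF x(1) True] \<mu> this]
      show ?thesis using True by (simp add: l_def u_def)
    next
      case False then show ?thesis using x(1) by (simp add: l_def u_def strict_feas_def supp_def)
    qed
    moreover have "ip n (\<lambda>i. x i - x0 i) h = 0" if "h \<in> W'" for h
      using orthogonal[OF _ that] x(1) by (simp add: strict_feas_def)
    ultimately show ?thesis by (simp add: K_def)
  qed
  have KP: "x \<in> PP" if "x \<in> K" for x
  proof -
    have b: "l i \<le> x i \<and> x i \<le> u i" for i using that by (simp add: K_def)
    have s: "x \<in> supp n" unfolding supp_def
    proof (intro CollectI allI impI)
      fix i assume "n \<le> i" then show "x i = 0" using b[of i] by (simp add: l_def u_def)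
    qed
    have "0 < x i" if "i < n" for i using b[of i] that by (simp add: l_def) (meson exp_gt_zero less_le_trans)
    moreover have "(\<lambda>i. x i - x0 i) \<in> W"
      using that s x0(1) unfolding W_eq perp_def K_def by (auto intro: subspD(4)[OF subsp_supp])
    ultimately show ?thesis using s by (simp add: strict_feas_def)
  qed
  have coord: "continuous_on A (\<lambda>f. f i)" for A :: "(nat \<Rightarrow> real) set" and i
    by (rule continuous_on_subset[OF continuous_on_product_coordinates]) simp
  have "closed {f. ip n (\<lambda>i. f i - x0 i) h = 0}" for h
    unfolding ip_def by (intro closed_Collect_eq continuous_intros) auto
  then have "compact K" unfolding K_def by (intro compact_Int_closed compact_box closed_INT) auto
  moreover have "continuous_on K F" unfolding F_def
  proof (intro continuous_intros coord ballI)
    fix i x assume "i \<in> {..<n}" "x \<in> K" then show "x i \<noteq> 0" using feas_pos(1)[OF KP] by force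
  qed
  moreover have "K \<noteq> {}" using inK[OF x0P] by auto
  ultimately obtain x where x: "x \<in> K" "\<And>y. y \<in> K \<Longrightarrow> F x \<le> F y" using continuous_attains_inf[of K F] by blast
  have "F x \<le> F y" if "y \<in> PP" for y
  proof (cases "F y \<le> F x0")
    case True then show ?thesis using x(2) inK that by blast
  next
    case False then show ?thesis using x(2)[OF inK[OF x0P]] by simp
  qed
  then show ?thesis using KP[OF x(1)] unfolding F_def by blast
qed

text \<open>First-order optimality: at the minimizer the derivative along every \<open>w\<close> in
  \<open>W\<close> vanishes, which says that \<open>\<mu> / x - s0\<close> is orthogonal to
  \<open>W\<close>.\<close>

lemma on_path_exists:
  assumes \<mu>: "0 < \<mu>"
  shows "\<exists>x s. on_path \<mu> x s"
proof -
  define F where "F x = (\<Sum>i<n. s0 i * x i - \<mu> * ln (x i))" for x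
  obtain x where x: "x \<in> PP" "\<And>y. y \<in> PP \<Longrightarrow> F x \<le> F y" using barrier_minimizer[OF \<mu>] unfolding F_def by blast
  have xp: "0 < x i" if "i < n" for i using feas_pos(1)[OF x(1) that] .
  define s where "s = (\<lambda>i. if i < n then \<mu> / x i else 0)"
  have grad: "ip n (\<lambda>i. s i - s0 i) w = 0" if w: "w \<in> W" for w
  proof -
    \<comment> \<open>Keeps \<open>x + t * w\<close> positive for all \<open>t\<close> of absolute
      value below \<open>\<delta>\<close>; the summand 1 in the denominators avoids division by
      zero.\<close>
    define \<delta> where "\<delta> = Min (insert 1 ((\<lambda>i. x i / (1 + \<bar>w i\<bar>)) ` {..<n}))"
    have d0: "0 < \<delta>" unfolding \<delta>_def using xp by (subst Min_gr_iff) auto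
    have inP: "(\<lambda>i. x i + t * w i) \<in> PP" if "\<bar>t\<bar> < \<delta>" for t
    proof -
      have "0 < x i + t * w i" if "i < n" for i
      proof -
        have "\<delta> \<le> x i / (1 + \<bar>w i\<bar>)" unfolding \<delta>_def using that by (intro Min_le) auto
        then have "\<bar>t\<bar> < x i / (1 + \<bar>w i\<bar>)" using \<open>\<bar>t\<bar> < \<delta>\<close> by simp
        then have "\<bar>t\<bar> * (1 + \<bar>w i\<bar>) < x i" by (simp add: field_simps)
        moreover have "\<bar>t * w i\<bar> \<le> \<bar>t\<bar> * (1 + \<bar>w i\<bar>)" by (simp add: abs_mult mult_left_mono)
        ultimately show ?thesis by linarith
      qed
      moreover have "(\<lambda>i. (x i - x0 i) + t * w i) \<in> W"
        using x(1) w subspD(2)[OF W _ subspD(3)[OF W w]] by (simp add: strict_feas_def)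
      moreover have "(\<lambda>i. x i + t * w i) \<in> supp n" using x(1) w W_supp by (auto simp: strict_feas_def supp_def)
      ultimately show ?thesis by (simp add: strict_feas_def algebra_simps)
    qed
    define h where "h t = F (\<lambda>i. x i + t * w i)" for t
    have D: "DERIV h 0 :> (\<Sum>i<n. s0 i * w i - \<mu> * (w i / x i))"
      unfolding h_def F_def using xp by (auto intro!: derivative_eq_intros sum.cong simp: field_simps)
    have "\<forall>t. \<bar>0 - t\<bar> < \<delta> \<longrightarrow> h 0 \<le> h t" using x(2)[OF inP] unfolding h_def by simp
    from DERIV_local_min[OF D d0 this] have "(\<Sum>i<n. s0 i * w i - \<mu> * (w i / x i)) = 0" .
    moreover have "ip n (\<lambda>i. s i - s0 i) w = - (\<Sum>i<n. s0 i * w i - \<mu> * (w i / x i))"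
      unfolding ip_def s_def sum_negf[symmetric] by (intro sum.cong) (auto simp: algebra_simps)
    ultimately show ?thesis by simp
  qed
  have ss: "s \<in> supp n" by (simp add: supp_def s_def)
  have "(\<lambda>i. s i - s0 i) \<in> W'" unfolding W'_eq perp_def using grad ss s0(1) by (auto intro: subspD(4)[OF subsp_supp])
  then have "s \<in> DD" using ss xp \<mu> by (simp add: strict_feas_def s_def)
  moreover have "\<forall>i<n. x i * s i = \<mu>" using xp by (auto simp: s_def) (metis less_irrefl)
  ultimately show ?thesis using x(1) unfolding on_path_def by blast
qed

end

subsection \<open>Cheap cones\<close>

text \<open>Closed under scaling but in general not under addition, so dimensions are counted by the
  subspaces it contains.\<close>

definition cone :: "(nat \<Rightarrow> real) set \<Rightarrow> nat set \<Rightarrow> nat set \<Rightarrow> (nat \<Rightarrow> real) \<Rightarrow> real \<Rightarrow> (nat \<Rightarrow> real) set" where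
  "cone S B N y t = {f \<in> S. L2_set (\<lambda>i. f i / y i) B \<le> t * L2_set (\<lambda>i. f i / y i) N}"

definition scl :: "(nat \<Rightarrow> real) \<Rightarrow> (nat \<Rightarrow> real) set \<Rightarrow> (nat \<Rightarrow> real) set" where
  "scl y S = (\<lambda>f i. f i / y i) ` S"

lemma cone_mono: "t \<le> t' \<Longrightarrow> cone S B N y t \<subseteq> cone S B N y t'"
  unfolding cone_def by (auto intro: order_trans[OF _ mult_right_mono])

lemma L2_set_sq: "(L2_set f A)\<^sup>2 = (\<Sum>i\<in>A. (f i)\<^sup>2)"
  by (simp add: L2_set_def sum_nonneg)

lemma L2_set_le_scale:
  assumes "\<And>i. i \<in> I \<Longrightarrow> \<bar>f i\<bar> \<le> r * \<bar>g i\<bar>" "0 \<le> r"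
  shows "L2_set f I \<le> r * L2_set g I"
proof -
  have "L2_set f I \<le> L2_set (\<lambda>i. r * \<bar>g i\<bar>) I"
    unfolding L2_set_def using assms by (intro real_sqrt_le_mono sum_mono) (simp add: abs_le_square_iff[symmetric])
  also have "\<dots> = r * L2_set g I"
    using assms(2) by (subst L2_set_right_distrib[symmetric]) (simp_all add: L2_set_def)
  finally show ?thesis .
qed

lemma L2_set_subset: "finite J \<Longrightarrow> I \<subseteq> J \<Longrightarrow> L2_set f I \<le> L2_set f J"
  unfolding L2_set_def by (intro real_sqrt_le_mono sum_mono2) auto

lemma L2_set_restrict_eq: "finite J \<Longrightarrow> I \<subseteq> J \<Longrightarrow> (\<And>i. i \<in> J - I \<Longrightarrow> f i = 0) \<Longrightarrow> L2_set f I = L2_set f J"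
  unfolding L2_set_def by (simp, intro sum.mono_neutral_left) auto

lemma nrm_split:
  assumes "B \<union> N = {..<n}" "B \<inter> N = {}"
  shows "(nrm n f)\<^sup>2 = (L2_set f B)\<^sup>2 + (L2_set f N)\<^sup>2" "L2_set f B \<le> nrm n f" "L2_set f N \<le> nrm n f" "nrm n f \<le> L2_set f B + L2_set f N"
proof -
  have fin: "finite B" "finite N" using finite_subset[of _ "{..<n}"] assms(1) by auto
  show 1: "(nrm n f)\<^sup>2 = (L2_set f B)\<^sup>2 + (L2_set f N)\<^sup>2"
    unfolding L2_set_sq assms(1)[symmetric] using fin assms(2) by (simp add: sum.union_disjoint)
  show "L2_set f B \<le> nrm n f" "L2_set f N \<le> nrm n f" using assms(1) by (auto intro!: L2_set_subset)
  show "nrm n f \<le> L2_set f B + L2_set f N"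
    by (rule power2_le_imp_le) (simp_all add: 1 power2_sum)
qed

lemma partition_finite: "B \<union> N = {..<n::nat} \<Longrightarrow> finite B \<and> finite N"
  using finite_subset[of _ "{..<n}"] by auto

text \<open>Only one direction of comparison is asked for on each block: \<open>y\<close> against
  \<open>z\<close> on \<open>B\<close>, the reverse on \<open>N\<close>. These are the two
  inequalities that polarization supplies along a segment.\<close>

lemma cone_rescale:
  assumes f: "f \<in> cone S B N y t" and t: "0 \<le> t" "0 \<le> a" "0 \<le> b"
    and B: "\<And>i. i \<in> B \<Longrightarrow> 0 < y i \<and> 0 < z i \<and> y i \<le> a * z i"
    and N: "\<And>i. i \<in> N \<Longrightarrow> 0 < y i \<and> 0 < z i \<and> z i \<le> b * y i"
  shows "f \<in> cone S B N z (a * b * t)"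
proof -
  have "L2_set (\<lambda>i. f i / z i) B \<le> a * L2_set (\<lambda>i. f i / y i) B"
  proof (rule L2_set_le_scale[OF _ t(2)])
    fix i assume "i \<in> B"
    from B[OF this] have "\<bar>f i\<bar> * y i \<le> \<bar>f i\<bar> * (a * z i)" by (intro mult_left_mono) auto
    then show "\<bar>f i / z i\<bar> \<le> a * \<bar>f i / y i\<bar>" using B[OF \<open>i \<in> B\<close>] by (simp add: field_simps)
  qed
  also have "\<dots> \<le> a * (t * L2_set (\<lambda>i. f i / y i) N)" using f t by (intro mult_left_mono) (auto simp: cone_def)
  also have "\<dots> \<le> a * (t * (b * L2_set (\<lambda>i. f i / z i) N))"
  proof (intro mult_left_mono L2_set_le_scale t)
    fix i assume "i \<in> N"
    from N[OF this] have "\<bar>f i\<bar> * z i \<le> \<bar>f i\<bar> * (b * y i)" by (intro mult_left_mono) auto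
    then show "\<bar>f i / y i\<bar> \<le> b * \<bar>f i / z i\<bar>" using N[OF \<open>i \<in> N\<close>] by (simp add: field_simps)
  qed
  finally show ?thesis using f by (simp add: cone_def algebra_simps)
qed

lemma cone_zero:
  assumes "f \<in> cone S B N y t" "S \<subseteq> supp n" "B \<union> N = {..<n}" "\<And>i. i \<in> N \<Longrightarrow> f i = 0" "\<And>i. i < n \<Longrightarrow> y i \<noteq> 0"
  shows "f = (\<lambda>_. 0)"
proof
  fix i
  have fin: "finite B" using partition_finite[OF assms(3)] by simp
  have "L2_set (\<lambda>i. f i / y i) N = 0" using assms(4) by (intro L2_set_0') auto
  then have "L2_set (\<lambda>i. f i / y i) B = 0" using assms(1) by (simp add: cone_def antisym)
  then have "\<forall>i\<in>B. f i / y i = 0" using fin by (simp add: L2_set_eq_0_iff)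
  then have "f i = 0" if "i < n" using that assms(3-5) by fastforce
  then show "f i = 0" using assms(1,2) by (cases "i < n") (auto simp: cone_def supp_def)
qed

text \<open>A cheap vector vanishing on \<open>N\<close> vanishes on \<open>B\<close> too, so cheap
  vectors are determined by their coordinates in \<open>N\<close>.\<close>

lemma cone_dim_le:
  assumes "has_dim (cone S B N y t) d" "S \<subseteq> supp n" "B \<union> N = {..<n}" "\<And>i. i < n \<Longrightarrow> y i \<noteq> 0"
  shows "d \<le> card N"
  using cone_zero[OF _ assms(2,3) _ assms(4)] partition_finite[OF assms(3)]
  by (intro has_dim_le_card[OF assms(1)]) auto

lemma has_dim_diag:
  assumes T: "has_dim T d" "T \<subseteq> supp n" and z: "\<And>i. i < n \<Longrightarrow> z i \<noteq> 0"
  shows "has_dim ((\<lambda>f i. f i * z i) ` T) d"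
proof -
  obtain vs where vs: "indep d vs" "\<And>c. comb d c vs \<in> T" using T(1) by (auto simp: has_dim_def)
  define us where "us k = (\<lambda>i. vs k i * z i)" for k
  have c: "comb d c us = (\<lambda>i. comb d c vs i * z i)" for c
    by (simp add: comb_def us_def sum_distrib_right mult.assoc)
  have "indep d us" unfolding indep_def
  proof (intro allI impI)
    fix c k assume a: "comb d c us = (\<lambda>_. 0)" "k < d"
    have "comb d c vs i = 0" for i
      using fun_cong[OF a(1), of i] z[of i] vs(2)[of c] T(2) unfolding c by (cases "i < n") (auto simp: supp_def subset_iff)
    then show "c k = 0" using indepD[OF vs(1) _ a(2)] by blast
  qed
  then show ?thesis unfolding has_dim_def using c vs(2) by (auto intro!: exI[of _ us])
qed

lemma subsp_scl: "subsp S \<Longrightarrow> subsp (scl y S)"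
proof -
  assume S: "subsp S"
  have "(\<lambda>i. 0 / y i) \<in> scl y S" unfolding scl_def using subspD(1)[OF S] by (rule imageI)
  moreover have "(\<lambda>i. f i / y i + g i / y i) \<in> scl y S" if "f \<in> S" "g \<in> S" for f g
    using imageI[OF subspD(2)[OF S that], of "\<lambda>f i. f i / y i"] unfolding scl_def by (simp add: add_divide_distrib)
  moreover have "(\<lambda>i. a * (f i / y i)) \<in> scl y S" if "f \<in> S" for f a
    using imageI[OF subspD(3)[OF S that], of "\<lambda>f i. f i / y i"] unfolding scl_def by simp
  ultimately show "subsp (scl y S)" unfolding subsp_def by (auto simp: scl_def)
qed

lemma scl_supp: "S \<subseteq> supp n \<Longrightarrow> scl y S \<subseteq> supp n"
  by (auto simp: scl_def supp_def)

lemma cone_scl: "cone (scl y S) B N (\<lambda>_. 1) t = scl y (cone S B N y t)"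
  by (auto simp: cone_def scl_def)

lemma has_dim_cone_scl:
  assumes "S \<subseteq> supp n" "\<And>i. i < n \<Longrightarrow> y i \<noteq> 0"
  shows "has_dim (cone (scl y S) B N (\<lambda>_. 1) t) d \<longleftrightarrow> has_dim (cone S B N y t) d"
proof
  have sub: "cone S B N y t \<subseteq> supp n" using assms(1) by (auto simp: cone_def)
  assume "has_dim (cone S B N y t) d"
  from has_dim_diag[OF this sub, of "\<lambda>i. 1 / y i"] assms(2)
  show "has_dim (cone (scl y S) B N (\<lambda>_. 1) t) d" unfolding cone_scl by (simp add: scl_def)
next
  assume "has_dim (cone (scl y S) B N (\<lambda>_. 1) t) d"
  moreover have "cone (scl y S) B N (\<lambda>_. 1) t \<subseteq> supp n" using scl_supp[OF assms(1)] by (auto simp: cone_def)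
  ultimately have "has_dim ((\<lambda>f i. f i * y i) ` cone (scl y S) B N (\<lambda>_. 1) t) d"
    using assms(2) by (intro has_dim_diag) auto
  moreover have "(\<lambda>f i. f i * y i) ` cone (scl y S) B N (\<lambda>_. 1) t \<subseteq> cone S B N y t"
  proof -
    have "(\<lambda>i. f i / y i * y i) = f" if "f \<in> cone S B N y t" for f
    proof
      fix i show "f i / y i * y i = f i" using that assms by (cases "i < n") (auto simp: cone_def supp_def)
    qed
    then show ?thesis unfolding cone_scl unfolding scl_def by (auto simp del: times_divide_eq_left)
  qed
  ultimately show "has_dim (cone S B N y t) d" by (rule has_dim_subset)
qed

text \<open>Dividing by \<open>x\<close> on one side and by \<open>s\<close> on the other multiplies
  inner products between \<open>W\<close> and \<open>W'\<close> by the constant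
  \<open>1 / \<mu>\<close>.\<close>

lemma orth_pair_scl:
  assumes "orth_pair n W W'" and xs: "\<And>i. i < n \<Longrightarrow> x i \<noteq> 0 \<and> x i * s i = \<mu>" and \<mu>: "\<mu> \<noteq> 0"
  shows "orth_pair n (scl x W) (scl s W')"
proof -
  interpret orth_pair n W W' by (rule assms(1))
  have s0: "s i \<noteq> 0" if "i < n" for i using xs[OF that] \<mu> by auto
  have "scl s W' = perp n (scl x W)"
  proof (intro equalityI subsetI)
    fix g assume "g \<in> scl s W'"
    then obtain h where h: "h \<in> W'" "g = (\<lambda>i. h i / s i)" by (auto simp: scl_def)
    have "ip n g (\<lambda>i. f i / x i) = 0" if "f \<in> W" for f
    proof -
      have "ip n g (\<lambda>i. f i / x i) = (\<Sum>i<n. 1 / \<mu> * (f i * h i))"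
        unfolding ip_def h(2) using xs by (intro sum.cong) (auto simp: mult.commute)
      also have "\<dots> = 1 / \<mu> * ip n f h" by (simp add: ip_def sum_distrib_left sum_divide_distrib)
      finally show ?thesis using orthogonal[OF that h(1)] by simp
    qed
    then show "g \<in> perp n (scl x W)" using h W'_supp unfolding perp_def scl_def by (auto simp: supp_def subset_iff)
  next
    fix g assume g: "g \<in> perp n (scl x W)"
    define h where "h = (\<lambda>i. g i * s i)"
    have gs: "g \<in> supp n" using g by (auto simp: perp_def)
    have "ip n h f = 0" if "f \<in> W" for f
    proof -
      have "ip n h f = (\<Sum>i<n. \<mu> * (g i * (f i / x i)))"
        unfolding ip_def h_def using xs by (intro sum.cong) (auto simp: field_simps)
      also have "\<dots> = \<mu> * ip n g (\<lambda>i. f i / x i)" by (simp add: ip_def sum_distrib_left)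
      finally show ?thesis using g that unfolding perp_def scl_def by auto
    qed
    then have "h \<in> W'" unfolding W'_eq perp_def using gs by (auto simp: supp_def h_def)
    moreover have "g = (\<lambda>i. h i / s i)"
    proof
      fix i show "g i = h i / s i" using s0[of i] gs by (cases "i < n") (auto simp: h_def supp_def)
    qed
    ultimately show "g \<in> scl s W'" by (auto simp: scl_def)
  qed
  then show ?thesis using W W_supp by unfold_locales (auto intro: subsp_scl scl_supp[THEN subsetD])
qed

text \<open>Restricting to vectors that vanish on the indices leaving \<open>N\<close> costs at most
  their number in dimension. For the remaining vectors the whole weight on the old \<open>N\<close>
  sits on indices that stay in the new one, and nothing moves into the new \<open>B\<close>.\<close>

lemma cone_switch:
  assumes d: "has_dim (cone S B N y t) d" and t: "0 \<le> t"
    and p: "B \<union> N = {..<n}" "B \<inter> N = {}" "B' \<union> N' = {..<n}" "B' \<inter> N' = {}"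
  shows "has_dim (cone S B' N' y t) (d - card (N - N'))"
proof -
  have fin: "finite B" "finite N" "finite N'" using partition_finite[OF p(1)] partition_finite[OF p(3)] by auto
  have "has_dim {f \<in> cone S B N y t. \<forall>r\<in>N - N'. f r = 0} (d - card (N - N'))"
    using d fin by (intro has_dim_constraints_set) (auto simp: linfun_coord)
  moreover have "{f \<in> cone S B N y t. \<forall>r\<in>N - N'. f r = 0} \<subseteq> cone S B' N' y t"
  proof safe
    fix f assume f: "f \<in> cone S B N y t" "\<forall>r\<in>N - N'. f r = 0"
    let ?g = "\<lambda>i. f i / y i"
    have "L2_set ?g B' = L2_set ?g (B' - (N - N'))"
      using p f(2) partition_finite[OF p(3)] by (intro L2_set_restrict_eq[symmetric]) auto
    also have "\<dots> \<le> L2_set ?g B" using p fin by (intro L2_set_subset) auto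
    also have "\<dots> \<le> t * L2_set ?g N" using f(1) by (simp add: cone_def)
    also have "L2_set ?g N = L2_set ?g (N \<inter> N')" using fin f(2) by (intro L2_set_restrict_eq[symmetric]) auto
    also have "t * \<dots> \<le> t * L2_set ?g N'" using fin t by (intro mult_left_mono L2_set_subset) auto
    finally show "f \<in> cone S B' N' y t" using f(1) by (simp add: cone_def)
  qed
  ultimately show ?thesis by (rule has_dim_subset)
qed

lemma has_dim_sum:
  assumes "has_dim S1 a" "has_dim S2 b" and z: "\<And>f. f \<in> S1 \<Longrightarrow> (\<lambda>i. - f i) \<in> S2 \<Longrightarrow> f = (\<lambda>_. 0)"
    and T: "\<And>f g. f \<in> S1 \<Longrightarrow> g \<in> S2 \<Longrightarrow> (\<lambda>i. f i + g i) \<in> T"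
  shows "has_dim T (a + b)"
proof -
  obtain vs us where vs: "indep a vs" "\<And>c. comb a c vs \<in> S1" and us: "indep b us" "\<And>c. comb b c us \<in> S2"
    using assms(1,2) by (auto simp: has_dim_def)
  define ws where "ws k = (if k < a then vs k else us (k - a))" for k
  have c: "comb (a + b) c ws = (\<lambda>i. comb a c vs i + comb b (\<lambda>k. c (a + k)) us i)" for c
    unfolding ws_def by (rule comb_append)
  have "indep (a + b) ws" unfolding indep_def
  proof (intro allI impI)
    fix c k assume e: "comb (a + b) c ws = (\<lambda>_. 0)" "k < a + b"
    have "- comb a c vs i = comb b (\<lambda>k. c (a + k)) us i" for i
      using fun_cong[OF e(1)[unfolded c], of i] by simp
    then have m: "(\<lambda>i. - comb a c vs i) = comb b (\<lambda>k. c (a + k)) us" by auto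
    then have 1: "comb a c vs = (\<lambda>_. 0)" using z[OF vs(2)] us(2) by simp
    then have 2: "comb b (\<lambda>k. c (a + k)) us = (\<lambda>_. 0)" using m by simp
    show "c k = 0"
    proof (cases "k < a")
      case True then show ?thesis using indepD[OF vs(1) 1] by simp
    next
      case False then show ?thesis using indepD[OF us(1) 2, of "k - a"] e(2) by simp
    qed
  qed
  then show ?thesis unfolding has_dim_def c[symmetric] using T[OF vs(2) us(2)] by (intro exI[of _ ws]) (auto simp: c)
qed

lemma has_dim_coordinate_subspace:
  assumes "B \<union> N = {..<n}" "B \<inter> N = {}"
  shows "has_dim {f \<in> supp n. \<forall>i\<in>N. f i = 0} (card B)"
proof -
  have "card B + card N = n" using card_Un_disjoint[of B N] partition_finite[OF assms(1)] assms by simp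
  then have "card B = n - card N" by simp
  then show ?thesis
    using has_dim_constraints_set[OF _ _ has_dim_supp, of N "\<lambda>r f. f r" n] partition_finite[OF assms(1)]
    by (simp add: linfun_coord)
qed

context orth_pair begin

lemma dims_exist: "\<exists>p\<le>n. has_dim W' p \<and> has_dim W (n - p)"
proof -
  obtain d vs where vs: "indep d vs" "W' = range (\<lambda>c. comb d c vs)" using basis_exists[OF W' W'_supp] by blast
  have "has_dim W' d" unfolding has_dim_def using vs by blast
  moreover from this have "d \<le> n" using has_dim_le W'_supp by blast
  moreover have "has_dim W (n - d)" unfolding W_eq by (rule has_dim_perp[OF vs(2)])
  ultimately show ?thesis by blast
qed

text \<open>The part of \<open>W'\<close> whose \<open>N\<close>-coordinates match those of a cheap subspace of \<open>W\<close> is itself cheap,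
  because a vector of \<open>W'\<close> is orthogonal to the vector of \<open>W\<close> it is matched with.\<close>

lemma cheap_dual:
  assumes p: "B \<union> N = {..<n}" "B \<inter> N = {}" and t: "0 \<le> t"
    and d: "has_dim (cone W B N (\<lambda>_. 1) t) d" and p': "has_dim W' p'"
  shows "has_dim (cone W' N B (\<lambda>_. 1) t) (p' + d - card N)"
proof -
  note fin = partition_finite[OF p(1)]
  have cards: "card B + card N = n" using card_Un_disjoint[of B N] fin p by simp
  obtain vs where vs: "indep d vs" "\<And>c. comb d c vs \<in> cone W B N (\<lambda>_. 1) t" using d by (auto simp: has_dim_def)
  have vs0: "comb d c vs = (\<lambda>_. 0)" if "\<And>i. i \<in> N \<Longrightarrow> comb d c vs i = 0" for c
    using cone_zero[OF vs(2) W_supp p(1) that] by simp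
  define us where "us k = (\<lambda>i. if i \<in> N then vs k i else 0)" for k
  have us: "comb d c us = (\<lambda>i. if i \<in> N then comb d c vs i else 0)" for c
    by (auto simp: comb_def us_def)
  \<comment> \<open>Vectors whose \<open>N\<close>-coordinates match those of the cheap subspace,
    with free \<open>B\<close>-coordinates. Its dimension is at least \<open>d + card B\<close>, so
    membership costs at most \<open>card N - d\<close> linear constraints on
    \<open>W'\<close>.\<close>
  define T where "T = {f \<in> supp n. \<exists>c. \<forall>i\<in>N. f i = comb d c vs i}"
  have Tsub: "subsp T" unfolding subsp_def
  proof (intro conjI ballI allI)
    show "(\<lambda>_. 0) \<in> T" unfolding T_def by (auto simp: supp_def comb_def intro: exI[of _ "\<lambda>_. 0"])
    show "(\<lambda>i. f i + g i) \<in> T" if "f \<in> T" "g \<in> T" for f g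
    proof -
      obtain c c' where "\<forall>i\<in>N. f i = comb d c vs i" "\<forall>i\<in>N. g i = comb d c' vs i" using \<open>f \<in> T\<close> \<open>g \<in> T\<close> by (auto simp: T_def)
      then have "\<forall>i\<in>N. f i + g i = comb d (\<lambda>k. c k + c' k) vs i" by (simp add: comb_add)
      moreover have "(\<lambda>i. f i + g i) \<in> supp n" using that by (simp add: T_def supp_def)
      ultimately show ?thesis unfolding T_def by blast
    qed
    show "(\<lambda>i. a * f i) \<in> T" if "f \<in> T" for f a
    proof -
      obtain c where "\<forall>i\<in>N. f i = comb d c vs i" using \<open>f \<in> T\<close> by (auto simp: T_def)
      then have "\<forall>i\<in>N. a * f i = comb d (\<lambda>k. a * c k) vs i" by (simp add: comb_scale)
      moreover have "(\<lambda>i. a * f i) \<in> supp n" using that by (simp add: T_def supp_def)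
      ultimately show ?thesis unfolding T_def by blast
    qed
  qed
  have Tsupp: "T \<subseteq> supp n" by (auto simp: T_def)
  have "has_dim (range (\<lambda>c. comb d c us)) d" unfolding has_dim_def
  proof (intro exI conjI)
    show "indep d us" unfolding indep_def
    proof (intro allI impI)
      fix c k assume a: "comb d c us = (\<lambda>_. 0)" "k < d"
      have "comb d c vs i = 0" if "i \<in> N" for i using fun_cong[OF a(1), of i] that by (simp add: us)
      then show "c k = 0" using vs0 indepD[OF vs(1) _ a(2)] by blast
    qed
  qed auto
  then have dT: "has_dim T (d + card B)"
  proof (rule has_dim_sum[OF _ has_dim_coordinate_subspace[OF p]])
    show "f = (\<lambda>_. 0)" if f: "f \<in> range (\<lambda>c. comb d c us)" "(\<lambda>i. - f i) \<in> {f \<in> supp n. \<forall>i\<in>N. f i = 0}" for f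
    proof
      fix i obtain c where "f = comb d c us" using f(1) by blast
      then show "f i = 0" using f(2) by (cases "i \<in> N") (auto simp: us)
    qed
    show "(\<lambda>i. f i + g i) \<in> T" if f: "f \<in> range (\<lambda>c. comb d c us)" and "g \<in> {f \<in> supp n. \<forall>i\<in>N. f i = 0}" for f g
    proof -
      obtain c where c: "f = comb d c us" using f by blast
      have N: "i < n" if "i \<in> N" for i using that p(1) by auto
      have "f i + g i = 0" if "n \<le> i" for i
      proof -
        have "g i = 0" "i \<notin> N" using that N[of i] \<open>g \<in> _\<close> by (auto simp: supp_def)
        then show ?thesis by (simp add: c us)
      qed
      moreover have "f i + g i = comb d c vs i" if "i \<in> N" for i
      proof -
        have "g i = 0" using that \<open>g \<in> _\<close> by simp
        then show ?thesis using that by (simp add: c us)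
      qed
      ultimately show ?thesis unfolding T_def supp_def by (intro CollectI conjI exI[of _ c]) auto
    qed
  qed
  obtain e gs where gs: "indep e gs" "perp n T = range (\<lambda>c. comb e c gs)"
    using basis_exists[OF subsp_perp perp_supp[of n T]] by blast
  have "has_dim (perp n T) e" unfolding has_dim_def gs(2) using gs(1) by blast
  have e: "e + (d + card B) \<le> n"
  proof (rule ccontr)
    assume "\<not> ?thesis"
    then obtain f where f: "f \<in> perp n T \<inter> T" "f \<noteq> (\<lambda>_. 0)"
      using has_dim_inter[OF \<open>has_dim (perp n T) e\<close> dT perp_supp Tsupp] by auto
    then have "ip n f f = 0" by (auto simp: perp_def)
    then show False using ip_self_0 f Tsupp by auto
  qed
  have "has_dim {u \<in> W'. \<forall>k\<in>{..<e}. ip n (gs k) u = 0} (p' - card {..<e})"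
    using linfun_ip unfolding ip_def by (intro has_dim_constraints_set p') auto
  then have "has_dim {u \<in> W'. \<forall>k\<in>{..<e}. ip n (gs k) u = 0} (p' + d - card N)"
    using e cards by (elim has_dim_mono) auto
  moreover have "{u \<in> W'. \<forall>k\<in>{..<e}. ip n (gs k) u = 0} \<subseteq> cone W' N B (\<lambda>_. 1) t"
  proof safe
    fix u assume u: "u \<in> W'" "\<forall>k\<in>{..<e}. ip n (gs k) u = 0"
    have "ip n u g = 0" if g: "g \<in> perp n T" for g
    proof -
      obtain c where c: "g = comb e c gs" using g unfolding gs(2) by blast
      have "ip n u (gs k) = 0" if "k < e" for k using u(2) that ip_commute[of n u "gs k"] by simp
      then show ?thesis unfolding c ip_comb by simp
    qed
    then have "u \<in> perp n (perp n T)" unfolding perp_def[of n "perp n T"] using u(1) W'_supp by blast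
    then have "u \<in> T" unfolding perp_perp[OF Tsub Tsupp] .
    then obtain c where c: "\<And>i. i \<in> N \<Longrightarrow> u i = comb d c vs i" by (auto simp: T_def)
    define v where "v = comb d c vs"
    have vc: "v \<in> W" "L2_set v B \<le> t * L2_set v N" using vs(2)[of c] by (auto simp: cone_def v_def)
    have uv: "L2_set u N = L2_set v N" using c by (intro L2_set_cong) (auto simp: v_def)
    have "0 = (\<Sum>i\<in>B. v i * u i) + (\<Sum>i\<in>N. v i * u i)"
      using orthogonal[OF vc(1) u(1)] unfolding ip_def p(1)[symmetric] sum.union_disjoint[OF fin[THEN conjunct1] fin[THEN conjunct2] p(2)] by simp
    moreover have "(\<Sum>i\<in>N. v i * u i) = (L2_set u N)\<^sup>2"
      unfolding L2_set_sq using c by (simp add: v_def power2_eq_square)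
    moreover have "- (\<Sum>i\<in>B. v i * u i) \<le> L2_set v B * L2_set u B"
    proof -
      have "- (\<Sum>i\<in>B. v i * u i) \<le> (\<Sum>i\<in>B. \<bar>v i\<bar> * \<bar>u i\<bar>)"
        unfolding sum_negf[symmetric] by (intro sum_mono) (simp add: abs_mult[symmetric])
      also have "\<dots> \<le> L2_set v B * L2_set u B" by (rule L2_set_mult_ineq)
      finally show ?thesis .
    qed
    ultimately have "(L2_set u N)\<^sup>2 \<le> L2_set v B * L2_set u B" by linarith
    also have "\<dots> \<le> (t * L2_set u N) * L2_set u B" using vc(2) uv by (intro mult_right_mono) auto
    finally have "L2_set u N * L2_set u N \<le> L2_set u N * (t * L2_set u B)" by (simp add: power2_eq_square algebra_simps)
    moreover have "0 < L2_set u N" if "L2_set u N \<noteq> 0" using that L2_set_nonneg[of u N] by linarith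
    ultimately have "L2_set u N \<le> t * L2_set u B"
      using t by (cases "L2_set u N = 0") (auto dest: mult_left_le_imp_le)
    then show "u \<in> cone W' N B (\<lambda>_. 1) t" using u(1) by (simp add: cone_def)
  qed
  ultimately show ?thesis by (rule has_dim_subset)
qed

text \<open>If the residual of the best approximation of \<open>w\<close> on \<open>N\<close> were large, adding it to the cheap
  subspace would produce a cheap subspace of larger dimension.\<close>

lemma cheap_residual:
  assumes p: "B \<union> N = {..<n}" "B \<inter> N = {}"
    and V: "has_dim V d" "V \<subseteq> cone W B N (\<lambda>_. 1) 1"
    and mx: "\<not> has_dim (cone W B N (\<lambda>_. 1) H) (Suc d)" and H: "2 \<le> H"
    and w: "w \<in> W" "L2_set w B \<le> D" "L2_set w N \<le> D"
  shows "\<exists>v\<in>V. L2_set (\<lambda>i. w i - v i) N \<le> 4 * D / H"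
proof -
  note fin = partition_finite[OF p(1)]
  obtain vs where vs: "indep d vs" "\<And>c. comb d c vs \<in> V" using V(1) by (auto simp: has_dim_def)
  have vW: "comb d c vs \<in> W" "L2_set (comb d c vs) B \<le> L2_set (comb d c vs) N" for c
    using vs(2)[of c] V(2) by (auto simp: cone_def)
  obtain c where c: "\<forall>k<d. (\<Sum>i\<in>N. 1 * (w i - comb d c vs i) * vs k i) = 0"
    using weighted_projection[of N "\<lambda>_. 1" d w vs] fin by auto
  define v where "v = comb d c vs"
  define z where "z = (\<lambda>i. w i - v i)"
  have zN: "(\<Sum>i\<in>N. z i * comb d c' vs i) = 0" for c'
  proof -
    have "(\<Sum>i\<in>N. z i * comb d c' vs i) = (\<Sum>k<d. c' k * (\<Sum>i\<in>N. z i * vs k i))"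
      unfolding comb_def sum_distrib_left sum.swap[of _ N] by (intro sum.cong) (auto simp: algebra_simps)
    then show ?thesis using c by (simp add: z_def v_def)
  qed
  have pyth: "(L2_set (\<lambda>i. comb d c' vs i + a * z i) N)\<^sup>2 = (L2_set (comb d c' vs) N)\<^sup>2 + (\<bar>a\<bar> * L2_set z N)\<^sup>2" for c' a
  proof -
    have "(L2_set (\<lambda>i. comb d c' vs i + a * z i) N)\<^sup>2 = (\<Sum>i\<in>N. (comb d c' vs i)\<^sup>2 + a\<^sup>2 * (z i)\<^sup>2 + 2 * a * (z i * comb d c' vs i))"
      unfolding L2_set_sq by (intro sum.cong) (auto simp: power2_eq_square algebra_simps)
    also have "\<dots> = (\<Sum>i\<in>N. (comb d c' vs i)\<^sup>2) + a\<^sup>2 * (\<Sum>i\<in>N. (z i)\<^sup>2)"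
      using zN[of c'] by (simp add: sum.distrib sum_distrib_left[symmetric])
    finally show ?thesis unfolding power_mult_distrib L2_set_sq by simp
  qed
  have zW: "z \<in> W" unfolding z_def v_def by (rule subspD(4)[OF W w(1) vW(1)])
  have D0: "0 \<le> D" using w(3) L2_set_nonneg[of w N] by linarith
  have "L2_set z N \<le> 4 * D / H"
  proof (cases "L2_set z N = 0")
    case True then show ?thesis using D0 H by simp
  next
    case False
    have "z \<noteq> comb d c' vs" for c'
    proof
      assume "z = comb d c' vs"
      then have "(\<Sum>i\<in>N. z i * z i) = 0" using zN[of c'] by simp
      then show False using False by (simp add: L2_set_def power2_eq_square)
    qed
    from indep_extend[OF vs(1) this] have "indep (Suc d) (vs(d := z))" .
    \<comment> \<open>No subspace of dimension \<open>d + 1\<close> is cheap at level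
      \<open>H\<close>, so some combination of the basis and the residual is expensive. Its basis
      part is cheap, so the cost comes from \<open>z\<close>, which forces \<open>z\<close> to be
      small on \<open>N\<close> compared with its size on \<open>B\<close>.\<close>
    then obtain c' where c': "comb (Suc d) c' (vs(d := z)) \<notin> cone W B N (\<lambda>_. 1) H" using mx unfolding has_dim_def by blast
    define a where "a = c' d"
    define v' where "v' = comb d c' vs"
    have e: "comb (Suc d) c' (vs(d := z)) = (\<lambda>i. v' i + a * z i)" unfolding comb_Suc a_def v'_def by (simp cong: comb_cong)
    have "(\<lambda>i. v' i + a * z i) \<in> W" unfolding v'_def by (rule subspD(2)[OF W vW(1) subspD(3)[OF W zW]])
    then have gt: "H * L2_set (\<lambda>i. v' i + a * z i) N < L2_set (\<lambda>i. v' i + a * z i) B" using c' unfolding e by (simp add: cone_def)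
    define M where "M = L2_set (\<lambda>i. v' i + a * z i) N"
    have py: "M\<^sup>2 = (L2_set v' N)\<^sup>2 + (\<bar>a\<bar> * L2_set z N)\<^sup>2" unfolding M_def v'_def by (rule pyth)
    have M0: "0 \<le> M" by (simp add: M_def)
    have M1: "L2_set v' N \<le> M" by (rule power2_le_imp_le[OF _ M0]) (use py zero_le_power2[of "\<bar>a\<bar> * L2_set z N"] in linarith)
    have M2: "\<bar>a\<bar> * L2_set z N \<le> M" by (rule power2_le_imp_le[OF _ M0]) (use py zero_le_power2[of "L2_set v' N"] in linarith)
    have "L2_set (\<lambda>i. v' i + a * z i) B \<le> L2_set v' B + L2_set (\<lambda>i. a * z i) B" by (rule L2_set_triangle_ineq)
    also have "L2_set (\<lambda>i. a * z i) B = \<bar>a\<bar> * L2_set z B"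
      unfolding L2_set_def power_mult_distrib sum_distrib_left[symmetric] by (simp add: real_sqrt_mult)
    also have "L2_set v' B \<le> M" using vW(2)[of c'] M1 unfolding v'_def by linarith
    finally have "H * M < M + \<bar>a\<bar> * L2_set z B" using gt unfolding M_def by linarith
    then have 1: "(H - 1) * M < \<bar>a\<bar> * L2_set z B" by (simp add: algebra_simps)
    have "(H - 1) * (\<bar>a\<bar> * L2_set z N) \<le> (H - 1) * M" using M2 H by (intro mult_left_mono) auto
    then have 2: "\<bar>a\<bar> * ((H - 1) * L2_set z N) < \<bar>a\<bar> * L2_set z B" using 1 by (simp add: algebra_simps)
    then have 3: "(H - 1) * L2_set z N < L2_set z B" by (simp add: mult_less_cancel_left)
    have "L2_set z B \<le> L2_set w B + L2_set (\<lambda>i. - v i) B" unfolding z_def using L2_set_triangle_ineq[of w "\<lambda>i. - v i" B] by simp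
    also have "L2_set (\<lambda>i. - v i) B = L2_set v B" by (simp add: L2_set_def)
    also have "L2_set v B \<le> L2_set v N" unfolding v_def by (rule vW)
    also have "L2_set v N \<le> L2_set w N"
    proof -
      have "w = (\<lambda>i. v i + 1 * z i)" by (simp add: z_def)
      then have "(L2_set w N)\<^sup>2 = (L2_set v N)\<^sup>2 + (\<bar>1\<bar> * L2_set z N)\<^sup>2" using pyth[of c 1] unfolding v_def by simp
      then have "(L2_set v N)\<^sup>2 \<le> (L2_set w N)\<^sup>2" using zero_le_power2[of "\<bar>1\<bar> * L2_set z N"] by linarith
      then show ?thesis by (rule power2_le_imp_le) simp
    qed
    finally have 4: "L2_set z B \<le> 2 * D" using w by linarith
    have "H / 2 * L2_set z N \<le> (H - 1) * L2_set z N" using H by (intro mult_right_mono) auto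
    then have "H / 2 * L2_set z N \<le> 2 * D" using 3 4 by linarith
    then show ?thesis using H by (simp add: field_simps)
  qed
  moreover have "v \<in> V" using vs(2) by (simp add: v_def)
  ultimately show ?thesis unfolding z_def by blast
qed

text \<open>The two errors are orthogonal to each other, so neither exceeds the error of the
  sum.\<close>

lemma decomposition_close:
  assumes "a \<in> W" "b \<in> W'" "v \<in> W" "u \<in> W'" and e: "nrm n (\<lambda>i. (a i + b i) - (v i + u i)) \<le> e"
  shows "nrm n (\<lambda>i. a i - v i) \<le> e" "nrm n (\<lambda>i. b i - u i) \<le> e"
proof -
  define f g where "f = (\<lambda>i. a i - v i)" and "g = (\<lambda>i. b i - u i)"
  have o: "ip n f g = 0" unfolding f_def g_def by (rule orthogonal[OF subspD(4)[OF W assms(1,3)] subspD(4)[OF W' assms(2,4)]])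
  have "(nrm n (\<lambda>i. (a i + b i) - (v i + u i)))\<^sup>2 = (\<Sum>i<n. (f i)\<^sup>2 + (g i)\<^sup>2 + 2 * (f i * g i))"
    unfolding L2_set_sq by (intro sum.cong) (auto simp: f_def g_def power2_eq_square algebra_simps)
  also have "\<dots> = (nrm n f)\<^sup>2 + (nrm n g)\<^sup>2"
    using o unfolding L2_set_sq ip_def by (simp add: sum.distrib sum_distrib_left[symmetric])
  finally have eq: "(nrm n (\<lambda>i. (a i + b i) - (v i + u i)))\<^sup>2 = (nrm n f)\<^sup>2 + (nrm n g)\<^sup>2" .
  have "nrm n f \<le> nrm n (\<lambda>i. (a i + b i) - (v i + u i))"
    by (rule power2_le_imp_le) (use eq zero_le_power2[of "nrm n g"] in linarith, simp)
  moreover have "nrm n g \<le> nrm n (\<lambda>i. (a i + b i) - (v i + u i))"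
    by (rule power2_le_imp_le) (use eq zero_le_power2[of "nrm n f"] in linarith, simp)
  ultimately show "nrm n (\<lambda>i. a i - v i) \<le> e" "nrm n (\<lambda>i. b i - u i) \<le> e" using e unfolding f_def g_def by auto
qed

end

subsection \<open>Layered steps at a nearly central iterate\<close>

lemma (in lp_pair) dual_lp: "lp_pair n W' W s0 x0"
  using dual_pair x0 s0 unfolding lp_pair_def lp_pair_axioms_def by blast

text \<open>An iterate after the corrector step; \<open>1/60\<close> is the centrality
  \<open>\<beta> / 10\<close> at the largest admissible \<open>\<beta>\<close>.\<close>

locale lp_iterate = lp_pair +
  fixes x s :: "nat \<Rightarrow> real" and \<mu> :: real
  assumes x: "x \<in> PP" and s: "s \<in> DD" and mean: "ip n x s = real n * \<mu>" and \<mu>: "0 < \<mu>" and n: "0 < n"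
    and near: "nrm n (\<lambda>i. x i * s i - \<mu>) \<le> 1/60 * \<mu>"
begin

text \<open>The scaled point of the layered step: \<open>x = xh om\<close>,
  \<open>s = sh om\<close>, with \<open>om\<close> close to 1. Unlike \<open>x\<close> and
  \<open>s\<close>, the pair \<open>xh\<close>, \<open>sh\<close> has exactly constant products, so
  dividing by it preserves the orthogonality of \<open>W\<close> and \<open>W'\<close>.\<close>

definition "xh i = sqrt (\<mu> * (x i / s i))"
definition "sh i = sqrt (\<mu> * (s i / x i))"
definition "om i = sqrt (x i * s i / \<mu>)"

lemma xpos: "i < n \<Longrightarrow> 0 < x i" and spos: "i < n \<Longrightarrow> 0 < s i"
  using feas_pos x s by auto

lemma hpos: "i < n \<Longrightarrow> 0 < xh i" "i < n \<Longrightarrow> 0 < sh i"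
  using xpos spos \<mu> by (auto simp: xh_def sh_def)

lemma xs_h: "i < n \<Longrightarrow> xh i * sh i = \<mu>"
  using xpos[of i] spos[of i] \<mu> unfolding xh_def sh_def real_sqrt_mult[symmetric] by (simp add: power2_eq_square[symmetric])

lemma x_om: "i < n \<Longrightarrow> x i = xh i * om i" and s_om: "i < n \<Longrightarrow> s i = sh i * om i"
  using xpos[of i] spos[of i] \<mu> unfolding xh_def sh_def om_def real_sqrt_mult[symmetric]
  by (simp_all add: field_simps power2_eq_square[symmetric])

lemma om_bounds: assumes "i < n" shows "99/100 \<le> om i" "om i \<le> 101/100"
proof -
  have "\<bar>x i * s i - \<mu>\<bar> \<le> 1/60 * \<mu>" using nrm_coord[OF assms, of "\<lambda>i. x i * s i - \<mu>"] near by linarith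
  then have "59/60 * \<mu> \<le> x i * s i" "x i * s i \<le> 61/60 * \<mu>" by linarith+
  then have 1: "59/60 \<le> x i * s i / \<mu>" "x i * s i / \<mu> \<le> 61/60" using \<mu> by (simp_all add: pos_le_divide_eq pos_divide_le_eq)
  have "sqrt ((99/100)\<^sup>2) \<le> om i" unfolding om_def using 1 by (intro real_sqrt_le_mono) (simp add: power2_eq_square)
  then show "99/100 \<le> om i" by simp
  have "om i \<le> sqrt ((101/100)\<^sup>2)" unfolding om_def using 1 by (intro real_sqrt_le_mono) (simp add: power2_eq_square)
  then show "om i \<le> 101/100" by simp
qed

text \<open>Exchanging primal and dual turns an iterate into an iterate, so estimates proved for
  \<open>W\<close> can be instantiated for \<open>W'\<close>.\<close>

lemma dual_iterate: "lp_iterate n W' W s0 x0 s x \<mu>"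
  using dual_lp s x mean \<mu> n near
  unfolding lp_iterate_def lp_iterate_axioms_def by (simp add: ip_commute mult.commute)

lemma dual_scaling: "lp_iterate.xh s x \<mu> = sh" "lp_iterate.sh s x \<mu> = xh" "lp_iterate.om s x \<mu> = om"
proof -
  interpret d: lp_iterate n W' W s0 x0 s x \<mu> by (rule dual_iterate)
  show "d.xh = sh" "d.sh = xh" "d.om = om"
    by (simp_all add: fun_eq_iff d.xh_def d.sh_def d.om_def xh_def sh_def om_def mult.commute)
qed

lemma scaled_pair: "orth_pair n (scl xh W) (scl sh W')"
  using xs_h \<mu> by (intro orth_pair_scl[where \<mu>=\<mu>]) (auto simp: orth_pair_axioms dest: hpos(1))

lemma nrm_om: "L2_set om I \<le> 101/100 * sqrt (real n)" if "I \<subseteq> {..<n}"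
proof -
  have "L2_set om I \<le> nrm n om" using that by (intro L2_set_subset) auto
  also have "\<dots> \<le> nrm n (\<lambda>_. 101/100)"   proof (intro L2_set_mono)
    fix i assume "i \<in> {..<n}"
    then show "om i \<le> 101/100" "0 \<le> om i" using om_bounds[of i] by auto
  qed
  finally show ?thesis by (simp add: L2_set_constant)
qed

lemma sqrt_n: "1 \<le> sqrt (real n)" using n by simp

text \<open>The displacement from \<open>x\<close> to a later path point \<open>Y\<close> lies in
  \<open>W\<close> and nearly cancels \<open>x\<close> on \<open>N\<close>, where \<open>Y\<close>
  is small. It need not be cheap itself, but \<open>cheap_residual\<close> replaces it by an element
  of \<open>V\<close> with almost the same \<open>N\<close>-coordinates.\<close>

lemma residual:
  assumes p: "B \<union> N = {..<n}" "B \<inter> N = {}"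
    and V: "has_dim V d" "V \<subseteq> cone W B N xh 1" and mx: "\<not> has_dim (cone W B N xh H) (Suc d)" and H: "2 \<le> H"
    and path: "on_path \<mu> X S" "on_path \<nu> Y T" and \<nu>: "0 < \<nu>" "\<nu> \<le> \<mu>"
    and small: "\<And>i. i \<in> N \<Longrightarrow> Y i \<le> \<Gamma> * (\<nu> / \<mu>) * X i" and \<Gamma>: "0 \<le> \<Gamma>"
  shows "\<exists>v\<in>V. L2_set (\<lambda>i. (x i + v i) / xh i) N \<le> 2 * \<Gamma> * sqrt n * (\<nu> / \<mu>) + 24 * n * sqrt n / H"
proof -
  interpret sp: orth_pair n "scl xh W" "scl sh W'" by (rule scaled_pair)
  have YP: "Y \<in> PP" and Xp: "\<And>i. i < n \<Longrightarrow> 0 < X i" and Yp: "\<And>i. i < n \<Longrightarrow> 0 < Y i"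
    using path feas_pos(1) by (auto simp: on_path_def)
  have Sn: "N \<subseteq> {..<n}" "B \<subseteq> {..<n}" using p by auto
  have h0: "xh i \<noteq> 0" if "i < n" for i using hpos(1)[OF that] by simp
  define w where "w = (\<lambda>i. (Y i - x i) / xh i)"
  have "w \<in> scl xh W" unfolding w_def scl_def using feas_diff_orth(1)[OF YP x s s] by auto
  have XX: "X i / xh i \<le> 2" if "i < n" for i
  proof -
    have "X i \<le> 5/4 * x i" using near_path(2)[OF x s mean \<mu> near path(1) that] .
    also have "\<dots> = 5/4 * om i * xh i" using x_om[OF that] by simp
    also have "\<dots> \<le> 2 * xh i" using om_bounds[OF that] hpos(1)[OF that] by (intro mult_right_mono) auto
    finally show ?thesis using hpos(1)[OF that] by (simp add: field_simps)
  qed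
  have YN: "L2_set (\<lambda>i. Y i / xh i) N \<le> 2 * \<Gamma> * sqrt n * (\<nu> / \<mu>)"
  proof -
    have "Y i / xh i \<le> 2 * \<Gamma> * (\<nu> / \<mu>)" if "i \<in> N" for i
    proof -
      have i: "i < n" using that Sn by auto
      have "Y i / xh i \<le> \<Gamma> * (\<nu> / \<mu>) * (X i / xh i)" using small[OF that] hpos(1)[OF i] by (simp add: field_simps)
      also have "\<dots> \<le> \<Gamma> * (\<nu> / \<mu>) * 2" using XX[OF i] \<Gamma> \<nu> \<mu> by (intro mult_left_mono) auto
      finally show ?thesis by (simp add: mult.commute mult.left_commute)
    qed
    then have "L2_set (\<lambda>i. Y i / xh i) N \<le> L2_set (\<lambda>_. 2 * \<Gamma> * (\<nu> / \<mu>)) N"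
      using Sn Yp hpos(1) by (intro L2_set_mono) (auto intro!: divide_nonneg_pos less_imp_le)
    also have "\<dots> \<le> nrm n (\<lambda>_. 2 * \<Gamma> * (\<nu> / \<mu>))" using Sn by (intro L2_set_subset) auto
    also have "\<dots> = 2 * \<Gamma> * sqrt n * (\<nu> / \<mu>)" using \<Gamma> \<nu> \<mu> by (simp add: L2_set_constant)
    finally show ?thesis .
  qed
  \<comment> \<open>In scaled coordinates \<open>Y\<close> is at most \<open>4 n\<close> per entry
    and \<open>om\<close> contributes at most \<open>2 n sqrt n\<close> to the norm; the resulting
    factor 6 becomes the 24 of the claim through \<open>cheap_residual\<close>.\<close>
  have w_bd: "nrm n w \<le> 6 * n * sqrt n"
  proof -
    have "Y i / xh i \<le> 4 * n" if "i < n" for i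
    proof -
      have "Y i / xh i \<le> 2 * real n * (X i / xh i)" using path_le(1)[OF path \<nu> that] hpos(1)[OF that] by (simp add: field_simps)
      also have "\<dots> \<le> 2 * real n * 2" using XX[OF that] by (intro mult_left_mono) auto
      finally show ?thesis by simp
    qed
    then have "nrm n (\<lambda>i. Y i / xh i) \<le> nrm n (\<lambda>_. 4 * real n)"
      using Yp hpos(1) by (intro L2_set_mono) (auto intro!: divide_nonneg_pos less_imp_le)
    then have 1: "nrm n (\<lambda>i. Y i / xh i) \<le> 4 * n * sqrt n" by (simp add: L2_set_constant mult.commute)
    have "nrm n w = nrm n (\<lambda>i. Y i / xh i + (- om i))"
      using h0 x_om by (intro L2_set_cong) (auto simp: w_def diff_divide_distrib)
    also have "\<dots> \<le> nrm n (\<lambda>i. Y i / xh i) + nrm n (\<lambda>i. - om i)" by (rule nrm_triangle)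
    also have "nrm n (\<lambda>i. - om i) = nrm n om" by (simp add: L2_set_def)
    also have "nrm n om \<le> 101/100 * sqrt n" by (intro nrm_om) simp
    also have "101/100 * sqrt n \<le> 2 * (n * sqrt n)" using n by (simp add: mult_right_mono)
    finally show ?thesis using 1 by linarith
  qed
  have mx': "\<not> has_dim (cone (scl xh W) B N (\<lambda>_. 1) H) (Suc d)" using mx has_dim_cone_scl[OF W_supp, of xh] h0 by blast
  have V': "has_dim (scl xh V) d" "scl xh V \<subseteq> cone (scl xh W) B N (\<lambda>_. 1) 1"
  proof -
    have "V \<subseteq> supp n" using V(2) W_supp by (auto simp: cone_def)
    from has_dim_diag[OF V(1) this, of "\<lambda>i. 1 / xh i"] h0 show "has_dim (scl xh V) d" by (simp add: scl_def)
    show "scl xh V \<subseteq> cone (scl xh W) B N (\<lambda>_. 1) 1" unfolding cone_scl using V(2) by (auto simp: scl_def)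
  qed
  obtain v where v: "v \<in> V" "L2_set (\<lambda>i. w i - v i / xh i) N \<le> 4 * (6 * n * sqrt n) / H"
    using sp.cheap_residual[OF p V' mx' H \<open>w \<in> _\<close>, of "6 * n * sqrt n"] nrm_split(2,3)[OF p, of w] w_bd
    by (auto simp: scl_def)
  have "L2_set (\<lambda>i. (x i + v i) / xh i) N = L2_set (\<lambda>i. Y i / xh i + (- (w i - v i / xh i))) N"
    by (intro L2_set_cong) (auto simp: w_def add_divide_distrib diff_divide_distrib)
  also have "\<dots> \<le> L2_set (\<lambda>i. Y i / xh i) N + L2_set (\<lambda>i. - (w i - v i / xh i)) N" by (rule L2_set_triangle_ineq)
  also have "L2_set (\<lambda>i. - (w i - v i / xh i)) N = L2_set (\<lambda>i. w i - v i / xh i) N" unfolding L2_set_def power2_minus ..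
  also have "\<dots> \<le> 24 * n * sqrt n / H" using v(2) by simp
  finally show ?thesis using v(1) YN by (intro bexI[of _ v]) linarith+
qed

text \<open>A vector that nearly cancels \<open>x\<close> on \<open>N\<close> has scaled norm of
  order \<open>sqrt n\<close> there, which turns relative cheapness into an absolute bound on
  \<open>B\<close>.\<close>

lemma cone_small:
  assumes p: "B \<union> N = {..<n}" and v: "v \<in> cone W B N xh \<tau>" and \<tau>: "0 \<le> \<tau>"
    and r: "L2_set (\<lambda>i. (x i + v i) / xh i) N \<le> 1/2"
  shows "L2_set (\<lambda>i. v i / xh i) B \<le> 2 * sqrt n * \<tau>"
proof -
  have "L2_set (\<lambda>i. v i / xh i) N = L2_set (\<lambda>i. (x i + v i) / xh i + (- om i)) N"
  proof (intro L2_set_cong)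
    fix i assume "i \<in> N"
    then have "i < n" using p by auto
    then show "v i / xh i = (x i + v i) / xh i + (- om i)" using x_om[of i] hpos(1)[of i] by (simp add: add_divide_distrib)
  qed simp
  also have "\<dots> \<le> L2_set (\<lambda>i. (x i + v i) / xh i) N + L2_set (\<lambda>i. - om i) N" by (rule L2_set_triangle_ineq)
  also have "L2_set (\<lambda>i. - om i) N = L2_set om N" by (simp add: L2_set_def)
  also have "L2_set om N \<le> 101/100 * sqrt n" using p by (intro nrm_om) auto
  finally have "L2_set (\<lambda>i. v i / xh i) N \<le> 2 * sqrt n" using r sqrt_n by linarith
  then have "\<tau> * L2_set (\<lambda>i. v i / xh i) N \<le> \<tau> * (2 * sqrt n)" using \<tau> by (intro mult_left_mono)
  then show ?thesis using v by (simp add: cone_def algebra_simps)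
qed

text \<open>In scaled coordinates the affine direction splits \<open>- om\<close> into its
  components in the two complementary subspaces. The pair \<open>v\<close>, \<open>u\<close> is
  almost such a splitting: \<open>v\<close> is close to \<open>- om\<close> on \<open>N\<close> and
  small on \<open>B\<close>, and \<open>u\<close> the other way round. Stability of the orthogonal
  splitting transfers this to the affine direction, so its larger part reveals the block of each
  index.\<close>

lemma partition_identified:
  assumes p: "B \<union> N = {..<n}" "B \<inter> N = {}"
    and a: "dx \<in> W" "ds \<in> W'" "\<And>i. i < n \<Longrightarrow> s i * dx i + x i * ds i = - (x i * s i)"
    and v: "v \<in> W" "L2_set (\<lambda>i. (x i + v i) / xh i) N \<le> 1/32" "L2_set (\<lambda>i. v i / xh i) B \<le> 1/32"
    and u: "u \<in> W'" "L2_set (\<lambda>i. (s i + u i) / sh i) B \<le> 1/32" "L2_set (\<lambda>i. u i / sh i) N \<le> 1/32"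
    and i: "i < n"
  shows "\<bar>dx i / x i\<bar> < \<bar>ds i / s i\<bar> \<longleftrightarrow> i \<in> B"
proof -
  interpret sp: orth_pair n "scl xh W" "scl sh W'" by (rule scaled_pair)
  define a' b' v' u' where "a' = (\<lambda>i. dx i / xh i)" and "b' = (\<lambda>i. ds i / sh i)" and "v' = (\<lambda>i. v i / xh i)" and "u' = (\<lambda>i. u i / sh i)"
  have mem: "a' \<in> scl xh W" "b' \<in> scl sh W'" "v' \<in> scl xh W" "u' \<in> scl sh W'"
    using a v u by (auto simp: scl_def a'_def b'_def v'_def u'_def)
  have ab: "a' j + b' j = - om j" if "j < n" for j
  proof -
    have "a' j + b' j = (sh j * dx j + xh j * ds j) / (xh j * sh j)"
      unfolding a'_def b'_def using hpos[OF that] by (simp add: field_simps)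
    also have "xh j * sh j = \<mu>" by (rule xs_h[OF that])
    also have "(sh j * dx j + xh j * ds j) / \<mu> = ((s j * dx j + x j * ds j) / om j) / \<mu>"
      using om_bounds(1)[OF that] by (simp add: x_om[OF that] s_om[OF that] add_divide_distrib)
    also have "\<dots> = - ((x j * s j) / om j) / \<mu>" using a(3)[OF that] by simp
    also have "(x j * s j) / om j = \<mu> * om j" using om_bounds(1)[OF that] xs_h[OF that] by (simp add: x_om[OF that] s_om[OF that]) 
    finally show ?thesis using \<mu> by simp
  qed
  have B: "L2_set (\<lambda>i. (a' i + b' i) - (v' i + u' i)) B \<le> 1/16"
  proof -
    have "L2_set (\<lambda>i. (a' i + b' i) - (v' i + u' i)) B = L2_set (\<lambda>i. (- ((s i + u i) / sh i)) + (- (v i / xh i))) B"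
    proof (intro L2_set_cong)
      fix j assume "j \<in> B" then have j: "j < n" using p by auto
      show "(a' j + b' j) - (v' j + u' j) = (- ((s j + u j) / sh j)) + (- (v j / xh j))"
        unfolding ab[OF j] s_om[OF j] v'_def u'_def using hpos[OF j] by (simp add: field_simps)
    qed simp
    also have "\<dots> \<le> L2_set (\<lambda>i. - ((s i + u i) / sh i)) B + L2_set (\<lambda>i. - (v i / xh i)) B" by (rule L2_set_triangle_ineq)
    also have "\<dots> = L2_set (\<lambda>i. (s i + u i) / sh i) B + L2_set (\<lambda>i. v i / xh i) B" by (simp add: L2_set_def)
    finally show ?thesis using v u by linarith
  qed
  have N: "L2_set (\<lambda>i. (a' i + b' i) - (v' i + u' i)) N \<le> 1/16"
  proof -
    have "L2_set (\<lambda>i. (a' i + b' i) - (v' i + u' i)) N = L2_set (\<lambda>i. (- ((x i + v i) / xh i)) + (- (u i / sh i))) N"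
    proof (intro L2_set_cong)
      fix j assume "j \<in> N" then have j: "j < n" using p by auto
      show "(a' j + b' j) - (v' j + u' j) = (- ((x j + v j) / xh j)) + (- (u j / sh j))"
        unfolding ab[OF j] x_om[OF j] v'_def u'_def using hpos[OF j] by (simp add: field_simps)
    qed simp
    also have "\<dots> \<le> L2_set (\<lambda>i. - ((x i + v i) / xh i)) N + L2_set (\<lambda>i. - (u i / sh i)) N" by (rule L2_set_triangle_ineq)
    also have "\<dots> = L2_set (\<lambda>i. (x i + v i) / xh i) N + L2_set (\<lambda>i. u i / sh i) N" by (simp add: L2_set_def)
    finally show ?thesis using v u by linarith
  qed
  have "nrm n (\<lambda>i. (a' i + b' i) - (v' i + u' i)) \<le> 1/8" using nrm_split(4)[OF p, of "\<lambda>i. (a' i + b' i) - (v' i + u' i)"] B N by linarith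
  from sp.decomposition_close[OF mem this]
  have close: "\<bar>a' i - v' i\<bar> \<le> 1/8" "\<bar>b' i - u' i\<bar> \<le> 1/8"
    using nrm_coord[OF i, of "\<lambda>i. a' i - v' i"] nrm_coord[OF i, of "\<lambda>i. b' i - u' i"] by linarith+
  have coord: "\<bar>f j\<bar> \<le> L2_set f I" if "finite I" "j \<in> I" for f :: "nat \<Rightarrow> real" and I j
    using member_le_L2_set[OF that, of "\<lambda>i. \<bar>f i\<bar>"] by (simp add: L2_set_def)
  have fin: "finite B" "finite N" using partition_finite[OF p(1)] by auto
  have dxx: "dx i / x i = a' i / om i" "ds i / s i = b' i / om i"
    using x_om[OF i] s_om[OF i] by (simp_all add: a'_def b'_def)
  have iff: "\<bar>dx i / x i\<bar> < \<bar>ds i / s i\<bar> \<longleftrightarrow> \<bar>a' i\<bar> < \<bar>b' i\<bar>"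
    unfolding dxx using om_bounds(1)[OF i] by (simp add: abs_divide divide_less_cancel)
  show ?thesis
  proof (cases "i \<in> B")
    case True
    have "\<bar>v' i\<bar> \<le> 1/32" using coord[OF fin(1) True, of v'] v(3) unfolding v'_def by linarith
    then show ?thesis using True close ab[OF i] om_bounds[OF i] iff by linarith
  next
    case False
    then have "i \<in> N" using p i by auto
    have "\<bar>u' i\<bar> \<le> 1/32" using coord[OF fin(2) \<open>i \<in> N\<close>, of u'] u(3) unfolding u'_def by linarith
    then show ?thesis using False close ab[OF i] om_bounds[OF i] iff by linarith
  qed
qed

text \<open>On each block one factor is small in norm and the other is at most 2 in scaled
  coordinates; this gives \<open>2 \<mu>\<close> times the small norm per block.\<close>

lemma layered_products:
  assumes p: "B \<union> N = {..<n}" "B \<inter> N = {}" and \<tau>: "\<tau> \<le> 1/2" and \<eta>: "\<eta> \<le> 1/2"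
    and v: "L2_set (\<lambda>i. (x i + v i) / xh i) N \<le> \<eta>" "L2_set (\<lambda>i. v i / xh i) B \<le> \<tau>"
    and u: "L2_set (\<lambda>i. (s i + u i) / sh i) B \<le> \<eta>" "L2_set (\<lambda>i. u i / sh i) N \<le> \<tau>"
  shows "nrm n (\<lambda>i. (x i + v i) * (s i + u i)) \<le> 4 * \<eta> * \<mu>" "nrm n (\<lambda>i. v i * u i) \<le> 4 * \<tau> * \<mu>"
proof -
  have fin: "finite B" "finite N" and sub: "B \<subseteq> {..<n}" "N \<subseteq> {..<n}" using partition_finite[OF p(1)] p by auto
  have coord: "\<bar>f j\<bar> \<le> L2_set f I" if "finite I" "j \<in> I" for f :: "nat \<Rightarrow> real" and I j
    using member_le_L2_set[OF that, of "\<lambda>i. \<bar>f i\<bar>"] by (simp add: L2_set_def)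
  have prod: "L2_set (\<lambda>i. f i * g i) I \<le> 2 * \<mu> * L2_set (\<lambda>i. f i / xh i) I"
    if I: "I \<subseteq> {..<n}" and g: "\<And>i. i \<in> I \<Longrightarrow> \<bar>g i / sh i\<bar> \<le> 2" for f g :: "nat \<Rightarrow> real" and I
  proof (rule L2_set_le_scale)
    fix i assume "i \<in> I" then have i: "i < n" using I by auto
    have "\<bar>f i * g i\<bar> = (xh i * sh i) * \<bar>f i / xh i\<bar> * \<bar>g i / sh i\<bar>"
      using hpos[OF i] by (simp add: abs_mult)
    also have "xh i * sh i = \<mu>" by (rule xs_h[OF i])
    also have "\<mu> * \<bar>f i / xh i\<bar> * \<bar>g i / sh i\<bar> \<le> \<mu> * \<bar>f i / xh i\<bar> * 2" using g[OF \<open>i \<in> I\<close>] \<mu> by (intro mult_left_mono) auto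
    finally show "\<bar>f i * g i\<bar> \<le> 2 * \<mu> * \<bar>f i / xh i\<bar>" by (simp add: mult.commute mult.left_commute)
  qed (use \<mu> in simp)
  have prod': "L2_set (\<lambda>i. f i * g i) I \<le> 2 * \<mu> * L2_set (\<lambda>i. g i / sh i) I"
    if I: "I \<subseteq> {..<n}" and g: "\<And>i. i \<in> I \<Longrightarrow> \<bar>f i / xh i\<bar> \<le> 2" for f g :: "nat \<Rightarrow> real" and I
  proof (rule L2_set_le_scale)
    fix i assume "i \<in> I" then have i: "i < n" using I by auto
    have "\<bar>f i * g i\<bar> = (xh i * sh i) * \<bar>g i / sh i\<bar> * \<bar>f i / xh i\<bar>"
      using hpos[OF i] by (simp add: abs_mult)
    also have "xh i * sh i = \<mu>" by (rule xs_h[OF i])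
    also have "\<mu> * \<bar>g i / sh i\<bar> * \<bar>f i / xh i\<bar> \<le> \<mu> * \<bar>g i / sh i\<bar> * 2" using g[OF \<open>i \<in> I\<close>] \<mu> by (intro mult_left_mono) auto
    finally show "\<bar>f i * g i\<bar> \<le> 2 * \<mu> * \<bar>g i / sh i\<bar>" by (simp add: mult.commute mult.left_commute)
  qed (use \<mu> in simp)
  have vB: "\<bar>v i / xh i\<bar> \<le> 1/2" if "i \<in> B" for i using coord[OF fin(1) that, of "\<lambda>i. v i / xh i"] v(2) \<tau> by linarith
  have uN: "\<bar>u i / sh i\<bar> \<le> 1/2" if "i \<in> N" for i using coord[OF fin(2) that, of "\<lambda>i. u i / sh i"] u(2) \<tau> by linarith
  have vN: "\<bar>(x i + v i) / xh i\<bar> \<le> 1/2" if "i \<in> N" for i using coord[OF fin(2) that, of "\<lambda>i. (x i + v i) / xh i"] v(1) \<eta> by linarith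
  have uB: "\<bar>(s i + u i) / sh i\<bar> \<le> 1/2" if "i \<in> B" for i using coord[OF fin(1) that, of "\<lambda>i. (s i + u i) / sh i"] u(1) \<eta> by linarith
  have xo: "(x i + v i) / xh i = om i + v i / xh i" "(s i + u i) / sh i = om i + u i / sh i" if "i < n" for i
    using hpos[OF that] by (simp_all add: add_divide_distrib x_om[OF that] s_om[OF that])
  have b1: "\<bar>(x i + v i) / xh i\<bar> \<le> 2" "\<bar>u i / sh i\<bar> \<le> 2" if "i \<in> B" for i
  proof -
    have i: "i < n" using that sub by auto
    show "\<bar>(x i + v i) / xh i\<bar> \<le> 2" "\<bar>u i / sh i\<bar> \<le> 2"
      using vB[OF that] uB[OF that] om_bounds[OF i] unfolding xo[OF i] by linarith+
  qed
  have b2: "\<bar>(s i + u i) / sh i\<bar> \<le> 2" "\<bar>v i / xh i\<bar> \<le> 2" if "i \<in> N" for i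
  proof -
    have i: "i < n" using that sub by auto
    show "\<bar>(s i + u i) / sh i\<bar> \<le> 2" "\<bar>v i / xh i\<bar> \<le> 2"
      using vN[OF that] uN[OF that] om_bounds[OF i] unfolding xo[OF i] by linarith+
  qed
  have "L2_set (\<lambda>i. (x i + v i) * (s i + u i)) N \<le> 2 * \<mu> * \<eta>"
    using prod[OF sub(2) b2(1), of "\<lambda>i. x i + v i"] mult_left_mono[OF v(1), of "2 * \<mu>"] \<mu> by linarith
  moreover have "L2_set (\<lambda>i. (x i + v i) * (s i + u i)) B \<le> 2 * \<mu> * \<eta>"
    using prod'[OF sub(1) b1(1), of "\<lambda>i. s i + u i"] mult_left_mono[OF u(1), of "2 * \<mu>"] \<mu> by linarith
  ultimately show "nrm n (\<lambda>i. (x i + v i) * (s i + u i)) \<le> 4 * \<eta> * \<mu>"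
    using nrm_split(4)[OF p, of "\<lambda>i. (x i + v i) * (s i + u i)"] by (simp add: algebra_simps)
  have "L2_set (\<lambda>i. v i * u i) N \<le> 2 * \<mu> * \<tau>"
    using prod'[OF sub(2) b2(2), of u] mult_left_mono[OF u(2), of "2 * \<mu>"] \<mu> by linarith
  moreover have "L2_set (\<lambda>i. v i * u i) B \<le> 2 * \<mu> * \<tau>"
    using prod[OF sub(1) b1(2), of v] mult_left_mono[OF v(2), of "2 * \<mu>"] \<mu> by linarith
  ultimately show "nrm n (\<lambda>i. v i * u i) \<le> 4 * \<tau> * \<mu>"
    using nrm_split(4)[OF p, of "\<lambda>i. v i * u i"] by (simp add: algebra_simps)
qed

end

subsection \<open>Approximate singular value decompositions of lifting maps\<close>

lemma has_dim_image:
  assumes T: "has_dim T d" and add: "\<And>f g. \<phi> (\<lambda>i. f i + g i) = (\<lambda>i. \<phi> f i + \<phi> g i)"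
    and scale: "\<And>a f. \<phi> (\<lambda>i. a * f i) = (\<lambda>i. a * \<phi> f i)"
    and inj: "\<And>f. f \<in> T \<Longrightarrow> \<phi> f = (\<lambda>_. 0) \<Longrightarrow> f = (\<lambda>_. 0)"
  shows "has_dim (\<phi> ` T) d"
proof -
  obtain vs where vs: "indep d vs" "\<And>c. comb d c vs \<in> T" using T by (auto simp: has_dim_def)
  have zero: "\<phi> (\<lambda>_. 0) = (\<lambda>_. 0)" using scale[of 0 "\<lambda>_. 0"] by simp
  have c: "comb e c (\<lambda>k. \<phi> (vs k)) = \<phi> (comb e c vs)" for c e
    by (induction e) (simp_all add: zero comb_Suc add scale)
  have "indep d (\<lambda>k. \<phi> (vs k))" unfolding indep_def
  proof (intro allI impI)
    fix c k assume "comb d c (\<lambda>k. \<phi> (vs k)) = (\<lambda>_. 0)" "k < d"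
    then show "c k = 0" using indepD[OF vs(1) inj[OF vs(2)]] unfolding c by blast
  qed
  then show ?thesis unfolding has_dim_def using vs(2) by (intro exI[of _ "\<lambda>k. \<phi> (vs k)"]) (simp add: c)
qed

text \<open>Explains the counting in \<open>small_span\<close>: for a monotone sequence, taking as
  many last columns as there are entries at most 1 selects exactly the columns of those
  entries.\<close>

lemma sorted_threshold:
  fixes P :: "nat \<Rightarrow> bool"
  assumes "\<And>i j. i \<le> j \<Longrightarrow> j < q \<Longrightarrow> P i \<Longrightarrow> P j"
  shows "{i. i < q \<and> P i} = {q - card {i. i < q \<and> P i}..<q}"
proof -
  define m where "m = (LEAST m. m = q \<or> (m < q \<and> P m))"
  have m: "m = q \<or> (m < q \<and> P m)" unfolding m_def by (rule LeastI[of _ q]) simp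
  have "m \<le> i" if "i < q" "P i" for i unfolding m_def using that by (intro Least_le) auto
  then have eq: "{i. i < q \<and> P i} = {m..<q}" using m assms by fastforce
  have "m \<le> q" using m by auto
  then show ?thesis unfolding eq by simp
qed

text \<open>\<open>L\<close> plays the role of the lifting map and \<open>r\<close> of the restriction to the coordinates in \<open>N\<close>,
  enumerated by \<open>{..<q}\<close>.\<close>

locale lift_map =
  fixes n q :: nat and S :: "(nat \<Rightarrow> real) set" and B N :: "nat set"
    and L r :: "(nat \<Rightarrow> real) \<Rightarrow> nat \<Rightarrow> real"
  assumes part: "B \<union> N = {..<n}" "B \<inter> N = {}" and S_supp: "S \<subseteq> supp n"
    and L_add: "\<And>f g. L (\<lambda>i. f i + g i) = (\<lambda>i. L f i + L g i)"
    and L_scale: "\<And>a f. L (\<lambda>i. a * f i) = (\<lambda>i. a * L f i)"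
    and r_add: "\<And>f g. r (\<lambda>i. f i + g i) = (\<lambda>i. r f i + r g i)"
    and r_scale: "\<And>a f. r (\<lambda>i. a * f i) = (\<lambda>i. a * r f i)"
    and r_supp: "\<And>f. r f \<in> supp q"
    and r_norm: "\<And>f. nrm q (r f) = L2_set f N"
    and L_S: "\<And>u. u \<in> supp q \<Longrightarrow> L u \<in> S"
    and lift: "\<And>v. v \<in> S \<Longrightarrow> r (L (r v)) = r v"
    and lift_min: "\<And>v. v \<in> S \<Longrightarrow> L2_set (L (r v)) B \<le> L2_set v B"
    and sym: "\<And>u v. u \<in> supp q \<Longrightarrow> v \<in> supp q \<Longrightarrow> ip q (r (L u)) v = ip q u (r (L v))"
    and kernel: "\<And>u. u \<in> supp q \<Longrightarrow> r (L u) = (\<lambda>_. 0) \<Longrightarrow> L u = (\<lambda>_. 0)"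
begin

lemma r_minus: "r (\<lambda>i. f i - g i) = (\<lambda>i. r f i - r g i)" and L_minus: "L (\<lambda>i. f i - g i) = (\<lambda>i. L f i - L g i)"
  using r_add[of f "\<lambda>i. (-1) * g i"] r_scale[of "-1" g] L_add[of f "\<lambda>i. (-1) * g i"] L_scale[of "-1" g] by simp_all

lemma r_zero: "r (\<lambda>_. 0) = (\<lambda>_. 0)" and L_zero: "L (\<lambda>_. 0) = (\<lambda>_. 0)"
  using r_scale[of 0 "\<lambda>_. 0"] L_scale[of 0 "\<lambda>_. 0"] by simp_all

definition "ker = {u \<in> supp q. r (L u) = (\<lambda>_. 0)}"

lemma subsp_ker: "subsp ker"
  unfolding subsp_def ker_def by (auto simp: supp_def L_zero r_zero L_add r_add L_scale r_scale)

lemma residual_ker: "u \<in> supp q \<Longrightarrow> (\<lambda>i. u i - r (L u) i) \<in> ker"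
  unfolding ker_def using subspD(4)[OF subsp_supp _ r_supp] lift[OF L_S] by (simp add: L_minus r_minus)

lemma ker_orth: "k \<in> ker \<Longrightarrow> u \<in> supp q \<Longrightarrow> ip q (r (L u)) k = 0"
  using sym[of u k] by (simp add: ker_def ip_def)

text \<open>\<open>r\<close> after \<open>L\<close> is a self-adjoint projection, so it is the
  identity on the orthogonal complement of its kernel.\<close>

lemma orth_ker_fixed:
  assumes u: "u \<in> supp q" and o: "\<And>k. k \<in> ker \<Longrightarrow> ip q k u = 0"
  shows "r (L u) = u"
proof -
  define k where "k = (\<lambda>i. u i - r (L u) i)"
  have k: "k \<in> ker" unfolding k_def by (rule residual_ker[OF u])
  have "ip q k k = ip q k u - ip q k (r (L u))" by (subst (2) k_def) (simp add: ip_add)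
  also have "\<dots> = 0" using o[OF k] ker_orth[OF k u] by (simp add: ip_commute)
  finally have "k = (\<lambda>_. 0)" using ip_self_0 k by (simp add: ker_def)
  then show ?thesis unfolding k_def by (auto simp: fun_eq_iff)
qed

text \<open>Two dimension counts meet. A subspace stretched by more than \<open>\<tau>\<close> meets
  the restrictions of cheap vectors only in zero, which bounds the number of singular values above
  \<open>\<tau>\<close>. Conversely, the selected columns without the kernel lift to a subspace that
  is cheap at level 1, hence of dimension at most \<open>d\<close>. So exactly the columns of
  singular values at most \<open>\<tau>\<close> are selected, and their lifts cost at most
  \<open>\<rho> \<tau>\<close>.\<close>

lemma approximate_svd_lift:
  fixes C :: "nat \<Rightarrow> nat \<Rightarrow> real" and \<sigma> t :: "nat \<Rightarrow> real"
  defines "sp \<equiv> \<lambda>i. {u. \<exists>c. u = (\<lambda>k. \<Sum>j\<in>{i..<q}. c j * C j k)}"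
  defines "p \<equiv> card {i. i < q \<and> t i \<le> 1}"
  assumes C: "\<And>j. j < q \<Longrightarrow> C j \<in> supp q" "\<And>j. j < q \<Longrightarrow> ip q (C j) (C j) \<noteq> 0"
      "\<And>i j. i < q \<Longrightarrow> j < q \<Longrightarrow> i \<noteq> j \<Longrightarrow> ip q (C i) (C j) = 0"
    and t: "\<And>i j. i \<le> j \<Longrightarrow> j < q \<Longrightarrow> t j \<le> t i" "\<And>i. i < q \<Longrightarrow> 0 \<le> t i"
    and bound: "\<And>i u. i < q \<Longrightarrow> u \<in> sp i \<Longrightarrow> L2_set (L u) B \<le> t i * nrm q u"
    and \<sigma>: "\<And>i j. i \<le> j \<Longrightarrow> j < q \<Longrightarrow> \<sigma> j \<le> \<sigma> i" "\<And>i. i < q \<Longrightarrow> 0 \<le> \<sigma> i" "\<And>i. i < q \<Longrightarrow> t i \<le> \<rho> * \<sigma> i"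
    and sv: "\<And>\<theta>. 0 \<le> \<theta> \<Longrightarrow> has_dim {u \<in> supp q. u = (\<lambda>_. 0) \<or> \<theta> * nrm q u < L2_set (L u) B} (card {i. i < q \<and> \<theta> < \<sigma> i})"
    and d: "has_dim (cone S B N (\<lambda>_. 1) \<tau>) d" "\<not> has_dim (cone S B N (\<lambda>_. 1) 1) (Suc d)"
    and \<tau>: "0 \<le> \<tau>" "\<rho> * \<tau> \<le> 1" and \<rho>: "1 \<le> \<rho>"
  shows "has_dim (L ` sp (q - p)) d" "L ` sp (q - p) \<subseteq> cone S B N (\<lambda>_. 1) (\<rho> * \<tau>)"
proof -
  have sp_supp: "sp i \<subseteq> supp q" for i unfolding sp_def using C(1) by (auto simp: supp_def)
  have sp_sub: "subsp (sp i)" for i unfolding subsp_def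
  proof (intro conjI ballI allI)
    show "(\<lambda>_. 0) \<in> sp i" unfolding sp_def by (auto intro!: exI[of _ "\<lambda>_. 0"])
    show "(\<lambda>k. f k + g k) \<in> sp i" if fg: "f \<in> sp i" "g \<in> sp i" for f g
    proof -
      obtain c e where "f = (\<lambda>k. \<Sum>j\<in>{i..<q}. c j * C j k)" "g = (\<lambda>k. \<Sum>j\<in>{i..<q}. e j * C j k)" using fg by (auto simp: sp_def)
      then have "(\<lambda>k. f k + g k) = (\<lambda>k. \<Sum>j\<in>{i..<q}. (c j + e j) * C j k)" by (simp add: sum.distrib algebra_simps)
      then show ?thesis unfolding sp_def by (intro CollectI exI)
    qed
    show "(\<lambda>k. a * f k) \<in> sp i" if f: "f \<in> sp i" for f a
    proof -
      obtain c where "f = (\<lambda>k. \<Sum>j\<in>{i..<q}. c j * C j k)" using f by (auto simp: sp_def)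
      then have "(\<lambda>k. a * f k) = (\<lambda>k. \<Sum>j\<in>{i..<q}. (a * c j) * C j k)" by (simp add: sum_distrib_left algebra_simps)
      then show ?thesis unfolding sp_def by (intro CollectI exI)
    qed
  qed
  have sp_dim: "\<exists>vs. indep (q - i) vs \<and> (\<forall>c. comb (q - i) c vs \<in> sp i) \<and> sp i = range (\<lambda>c. comb (q - i) c vs)" if i: "i \<le> q" for i
  proof (intro exI conjI allI)
    define vs where "vs = (\<lambda>k. C (i + k))"
    have cb: "comb (q - i) c vs = (\<lambda>k. \<Sum>j\<in>{i..<q}. c (j - i) * C j k)" for c
    proof
      fix k
      have "(\<Sum>j\<in>{i..<q}. c (j - i) * C j k) = (\<Sum>j\<in>{0 + i..<(q - i) + i}. c (j - i) * C j k)" using i by simp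
      also have "\<dots> = (\<Sum>j\<in>{0..<q - i}. c j * C (i + j) k)" unfolding sum.shift_bounds_nat_ivl by (simp add: add.commute)
      finally show "comb (q - i) c vs k = (\<Sum>j\<in>{i..<q}. c (j - i) * C j k)" by (simp add: comb_def vs_def lessThan_atLeast0)
    qed
    show "indep (q - i) vs" unfolding indep_def
    proof (intro allI impI)
      fix c k assume a: "comb (q - i) c vs = (\<lambda>_. 0)" "k < q - i"
      have "0 = ip q (vs k) (comb (q - i) c vs)" unfolding a(1) by (simp add: ip_def)
      also have "\<dots> = (\<Sum>j<q - i. c j * ip q (vs k) (vs j))" by (rule ip_comb)
      also have "\<dots> = (\<Sum>j<q - i. if j = k then c k * ip q (vs k) (vs k) else 0)"
        using a(2) C(3) by (intro sum.cong) (auto simp: vs_def)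
      also have "\<dots> = c k * ip q (vs k) (vs k)" using a(2) by simp
      finally show "c k = 0" using C(2)[of "i + k"] a(2) by (simp add: vs_def)
    qed
    show eq: "sp i = range (\<lambda>c. comb (q - i) c vs)"
    proof (intro equalityI subsetI)
      fix u assume "u \<in> sp i"
      then obtain c where c: "u = (\<lambda>k. \<Sum>j\<in>{i..<q}. c j * C j k)" by (auto simp: sp_def)
      have "u = comb (q - i) (\<lambda>j. c (i + j)) vs" unfolding cb c by auto
      then show "u \<in> range (\<lambda>c. comb (q - i) c vs)" by blast
    next
      fix u assume "u \<in> range (\<lambda>c. comb (q - i) c vs)"
      then obtain c where "u = comb (q - i) c vs" by blast
      then show "u \<in> sp i" unfolding sp_def cb by (intro CollectI exI)
    qed
    show "comb (q - i) c vs \<in> sp i" for c unfolding eq by blast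
  qed
  obtain rk ks where ks: "indep rk ks" "ker = range (\<lambda>c. comb rk c ks)"
    using basis_exists[OF subsp_ker, of q] by (auto simp: ker_def)
  have dker: "has_dim ker rk" unfolding has_dim_def ks(2) using ks(1) by blast
  have ksk: "ks j \<in> ker" if "j < rk" for j unfolding ks(2) comb_unit[OF that, of ks, symmetric] by (rule rangeI)
  define h where "h \<theta> = card {i. i < q \<and> \<theta> < \<sigma> i}" for \<theta>
  have h_le: "h \<theta> \<le> q" for \<theta> using card_mono[of "{..<q}" "{i. i < q \<and> \<theta> < \<sigma> i}"] by (auto simp: h_def)
  have h: "\<sigma> i \<le> \<theta>" if i: "h \<theta> \<le> i" "i < q" for i \<theta>
  proof (rule ccontr)
    assume "\<not> ?thesis"
    then have "{..i} \<subseteq> {i. i < q \<and> \<theta> < \<sigma> i}" using \<sigma>(1) i by force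
    from card_mono[OF _ this] have "Suc i \<le> h \<theta>" by (simp add: h_def)
    then show False using i by simp
  qed
  define E where "E \<theta> = {u \<in> supp q. u = (\<lambda>_. 0) \<or> \<theta> * nrm q u < L2_set (L u) B}" for \<theta>
  have E: "has_dim (E \<theta>) (h \<theta>)" "E \<theta> \<subseteq> supp q" if "0 \<le> \<theta>" for \<theta> using sv[OF that] by (auto simp: E_def h_def)
  \<comment> \<open>Restrictions of cheap vectors to \<open>N\<close>, enlarged by the kernel of the
    lift, which adds dimensions on which the lift vanishes.\<close>
  define T where "T = {u \<in> supp q. \<exists>v\<in>cone S B N (\<lambda>_. 1) \<tau>. \<exists>k\<in>ker. u = (\<lambda>i. r v i + k i)}"
  have cone_r0: "v = (\<lambda>_. 0)" if "v \<in> cone S B N (\<lambda>_. 1) t'" "r v = (\<lambda>_. 0)" for v t'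
  proof -
    have "L2_set v N = 0" using r_norm[of v] that(2) by (simp add: L2_set_0')
    then have "\<And>i. i \<in> N \<Longrightarrow> v i = 0" using partition_finite[OF part(1)] by (simp add: L2_set_eq_0_iff)
    from cone_zero[OF that(1) S_supp part(1) this] show ?thesis by simp
  qed
  have "has_dim (r ` cone S B N (\<lambda>_. 1) \<tau>) d" by (rule has_dim_image[OF d(1) r_add r_scale cone_r0])
  then have dT: "has_dim T (d + rk)"
  proof (rule has_dim_sum[OF _ dker])
    fix f assume f: "f \<in> r ` cone S B N (\<lambda>_. 1) \<tau>" "(\<lambda>i. - f i) \<in> ker"
    then obtain v where v: "v \<in> S" "f = r v" by (auto simp: cone_def)
    have "(\<lambda>i. (-1) * (- f i)) \<in> ker" by (rule subspD(3)[OF subsp_ker f(2)])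
    then have "r (L f) = (\<lambda>_. 0)" by (simp add: ker_def)
    then show "f = (\<lambda>_. 0)" using lift[OF v(1)] unfolding v(2) by simp
  next
    fix f g assume "f \<in> r ` cone S B N (\<lambda>_. 1) \<tau>" "g \<in> ker"
    then show "(\<lambda>i. f i + g i) \<in> T" unfolding T_def using subspD(2)[OF subsp_supp r_supp, of g] by (auto simp: ker_def)
  qed
  have T_small: "L2_set (L u) B \<le> \<tau> * nrm q u" if uT: "u \<in> T" for u
  proof -
    obtain v k where vk: "v \<in> cone S B N (\<lambda>_. 1) \<tau>" "k \<in> ker" "u = (\<lambda>i. r v i + k i)" using uT unfolding T_def by blast
    have v: "v \<in> S" using vk(1) by (simp add: cone_def)
    have "L k = (\<lambda>_. 0)" using kernel vk(2) by (simp add: ker_def)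
    then have "L2_set (L u) B = L2_set (L (r v)) B" unfolding vk(3) L_add by simp
    also have "\<dots> \<le> L2_set v B" by (rule lift_min[OF v])
    also have "\<dots> \<le> \<tau> * nrm q (r v)" using vk(1) r_norm by (simp add: cone_def)
    also have "nrm q (r v) \<le> nrm q u"
    proof (rule power2_le_imp_le)
      have "ip q (r v) k = 0" using ker_orth[OF vk(2) r_supp[of v]] lift[OF v] by simp
      then have "(nrm q u)\<^sup>2 = (nrm q (r v))\<^sup>2 + (nrm q k)\<^sup>2"
        unfolding L2_set_sq vk(3) ip_def power2_sum by (simp add: sum.distrib sum_distrib_left[symmetric] mult.assoc)
      then show "(nrm q (r v))\<^sup>2 \<le> (nrm q u)\<^sup>2" using zero_le_power2[of "nrm q k"] by linarith
    qed simp
    finally show ?thesis using \<tau> by (simp add: mult_left_mono)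
  qed
  have c1: "h \<tau> + (d + rk) \<le> q"
  proof (rule ccontr)
    assume "\<not> ?thesis"
    then obtain u where "u \<in> E \<tau> \<inter> T" "u \<noteq> (\<lambda>_. 0)"
      using has_dim_inter[OF E(1)[OF \<tau>(1)] dT E(2)[OF \<tau>(1)]] by (auto simp: T_def)
    then show False using T_small[of u] by (auto simp: E_def)
  qed
  define i0 where "i0 = q - p"
  have p_le: "p \<le> q" using card_mono[of "{..<q}" "{i. i < q \<and> t i \<le> 1}"] by (auto simp: p_def)
  have tset: "{i. i < q \<and> t i \<le> 1} = {i0..<q}"
    unfolding i0_def p_def by (rule sorted_threshold) (use t(1) in \<open>blast intro: order_trans\<close>)
  have t_h: "t i \<le> \<rho> * \<theta>" if "h \<theta> \<le> i" "i < q" for i \<theta>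
    using order_trans[OF \<sigma>(3)[OF that(2)] mult_left_mono[OF h[OF that], of \<rho>]] \<rho> by simp
  \<comment> \<open>From index \<open>h \<theta>\<close> on,
    \<open>t i \<le> \<rho> * \<theta> \<le> 1\<close>, so these columns are among the selected
    ones.\<close>
  have i0h: "i0 \<le> h \<theta>" if "\<rho> * \<theta> \<le> 1" for \<theta>
  proof (cases "h \<theta> < q")
    case True
    then have "h \<theta> \<in> {i. i < q \<and> t i \<le> 1}" using t_h[of \<theta> "h \<theta>"] that by simp
    then show ?thesis unfolding tset by simp
  next
    case False then show ?thesis by (simp add: i0_def)
  qed
  \<comment> \<open>Selected vectors orthogonal to the kernel. There \<open>r\<close> after
    \<open>L\<close> is the identity, so \<open>L\<close> is injective and its cost on
    \<open>B\<close> can be compared with the norm of the lift on \<open>N\<close>.\<close>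
  define U where "U = {u \<in> sp i0. \<forall>k\<in>{..<rk}. ip q (ks k) u = 0}"
  have i0q: "i0 \<le> q" by (simp add: i0_def)
  have "has_dim (sp i0) (q - i0)" unfolding has_dim_def using sp_dim[OF i0q] by blast
  then have "has_dim U (q - i0 - card {..<rk})" unfolding U_def
    by (intro has_dim_constraints_set) (auto simp: ip_def intro: linfun_ip)
  then have dU: "has_dim U (p - rk)" using p_le by (simp add: i0_def)
  have Ufix: "r (L u) = u" if "u \<in> U" for u
  proof (rule orth_ker_fixed)
    show "u \<in> supp q" using that sp_supp by (auto simp: U_def)
    fix k assume "k \<in> ker"
    then obtain c where "k = comb rk c ks" unfolding ks(2) by blast
    then have "ip q u k = 0" using that by (simp add: ip_comb U_def ip_commute[of q u "ks _"])
    then show "ip q k u = 0" by (simp add: ip_commute)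
  qed
  have "has_dim (L ` U) (p - rk)"
  proof (rule has_dim_image[OF dU L_add L_scale])
    fix f assume "f \<in> U" "L f = (\<lambda>_. 0)"
    then show "f = (\<lambda>_. 0)" using Ufix[of f] by (simp add: r_zero)
  qed
  moreover have "L ` U \<subseteq> cone S B N (\<lambda>_. 1) 1"
  proof (rule image_subsetI)
    fix u assume u: "u \<in> U"
    have us: "u \<in> sp i0" "u \<in> supp q" using u sp_supp by (auto simp: U_def)
    have "L2_set (L u) B \<le> nrm q u"
    proof (cases "i0 < q")
      case True
      then have "i0 \<in> {i0..<q}" by simp
      then have "t i0 \<le> 1" unfolding tset[symmetric] by simp
      then have "t i0 * nrm q u \<le> nrm q u" by (simp add: mult_left_le_one_le t(2)[OF True])
      then show ?thesis using bound[OF True us(1)] by linarith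
    next
      case False
      then have "u = (\<lambda>_. 0)" using us(1) by (auto simp: sp_def)
      then show ?thesis by (simp add: L_zero L2_set_0')
    qed
    also have "nrm q u = L2_set (L u) N" using r_norm[of "L u"] Ufix[OF u] by simp
    finally show "L u \<in> cone S B N (\<lambda>_. 1) 1" using L_S[OF us(2)] by (simp add: cone_def)
  qed
  ultimately have "has_dim (cone S B N (\<lambda>_. 1) 1) (p - rk)" by (rule has_dim_subset)
  then have "p - rk \<le> d" using d(2) has_dim_mono[of _ "p - rk" "Suc d"] by (meson not_less_eq_eq)
  \<comment> \<open>The inequalities \<open>h \<tau> + d + rk \<le> q\<close>,
    \<open>p - rk \<le> d\<close> and \<open>q - p \<le> h \<tau>\<close> squeeze to
    equalities.\<close>
  then have pd: "p = d + rk" "i0 = h \<tau>" using c1 i0h[OF \<tau>(2)] p_le h_le[of \<tau>] by (auto simp: i0_def)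
  have "L ` U \<subseteq> L ` sp (q - p)" by (auto simp: U_def i0_def)
  with \<open>has_dim (L ` U) (p - rk)\<close> show "has_dim (L ` sp (q - p)) d" using pd(1) by (auto intro: has_dim_subset)
  \<comment> \<open>The kernel already lies in the span of the columns from \<open>h 0\<close> on,
    where \<open>t\<close> is zero. That span has the largest dimension that vectors of zero cost
    can have beside the \<open>h 0\<close> positive singular values, so a kernel vector outside it
    would force \<open>Z\<close> and \<open>E 0\<close> to overlap.\<close>
  have ker_sp: "ker \<subseteq> sp i0"
  proof -
    define Z where "Z = {f \<in> supp q. \<forall>i\<in>B. L f i = 0}"
    have Zs: "subsp Z" "Z \<subseteq> supp q" unfolding subsp_def Z_def by (auto simp: supp_def L_zero L_add L_scale)
    have Z0: "L2_set (L f) B = 0" if "f \<in> Z" for f using that by (simp add: Z_def L2_set_0')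
    have h0: "h 0 \<le> q" by (rule h_le)
    have spZ: "sp (h 0) \<subseteq> Z"
    proof
      fix u assume u: "u \<in> sp (h 0)"
      have "L2_set (L u) B = 0"
      proof (cases "h 0 < q")
        case True
        then have "t (h 0) = 0" using t_h[of 0 "h 0"] t(2)[of "h 0"] by simp
        then show ?thesis using bound[OF True u] by (simp add: antisym)
      next
        case False
        then have "u = (\<lambda>_. 0)" using u by (auto simp: sp_def)
        then show ?thesis by (simp add: L_zero L2_set_0')
      qed
      then show "u \<in> Z" using u sp_supp partition_finite[OF part(1)] by (auto simp: Z_def L2_set_eq_0_iff)
    qed
    obtain vs where vs: "indep (q - h 0) vs" "\<And>c. comb (q - h 0) c vs \<in> sp (h 0)" "sp (h 0) = range (\<lambda>c. comb (q - h 0) c vs)"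
      using sp_dim[OF h0] by blast
    have "ker \<subseteq> sp (h 0)"
    proof (rule ccontr)
      assume "\<not> ?thesis"
      then obtain k where k: "k \<in> ker" "k \<notin> sp (h 0)" by auto
      have kZ: "k \<in> Z" using k(1) kernel[of k] by (simp add: ker_def Z_def)
      have "has_dim Z (Suc (q - h 0))"
        by (rule has_dim_add_vector[OF Zs(1) vs(1) _ kZ]) (use vs spZ k(2) in blast)+
      moreover have "q < h 0 + Suc (q - h 0)" using h0 by simp
      ultimately obtain u where u: "u \<in> E 0 \<inter> Z" "u \<noteq> (\<lambda>_. 0)"
        using has_dim_inter[OF E(1)[of 0] _ E(2)[of 0] Zs(2)] by blast
      then show False using Z0[of u] by (auto simp: E_def)
    qed
    moreover have "sp (h 0) \<subseteq> sp i0"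
    proof
      fix u assume "u \<in> sp (h 0)"
      then obtain c where c: "u = (\<lambda>k. \<Sum>j\<in>{h 0..<q}. c j * C j k)" by (auto simp: sp_def)
      have "u k = (\<Sum>j\<in>{i0..<q}. (if h 0 \<le> j then c j else 0) * C j k)" for k
        unfolding c using i0h[of 0] by (intro sum.mono_neutral_cong_left) auto
      then show "u \<in> sp i0" unfolding sp_def by (intro CollectI exI[of _ "\<lambda>j. if h 0 \<le> j then c j else 0"] ext)
    qed
    ultimately show ?thesis by blast
  qed
  show "L ` sp (q - p) \<subseteq> cone S B N (\<lambda>_. 1) (\<rho> * \<tau>)"
  proof (rule image_subsetI)
    fix u assume "u \<in> sp (q - p)"
    then have u: "u \<in> sp i0" "u \<in> supp q" using sp_supp by (auto simp: i0_def)
    \<comment> \<open>The cost of the lift of \<open>u\<close> must be compared with its norm on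
      \<open>N\<close>, which is the norm of \<open>w\<close> and possibly smaller than that of
      \<open>u\<close>. Since the kernel lies in the span, \<open>w\<close> is a selected vector
      too, with the same lift.\<close>
    define w where "w = r (L u)"
    have k: "(\<lambda>i. u i - w i) \<in> ker" unfolding w_def by (rule residual_ker[OF u(2)])
    have "w = (\<lambda>i. u i - (u i - w i))" by simp
    then have w: "w \<in> sp i0" using subspD(4)[OF sp_sub u(1), of "\<lambda>i. u i - w i"] k ker_sp by auto
    have "L (\<lambda>i. u i - w i) = (\<lambda>_. 0)" using k kernel by (simp add: ker_def)
    then have Lw: "L u = L w" unfolding L_minus by (auto simp: fun_eq_iff)
    have "L2_set (L w) B \<le> \<rho> * \<tau> * nrm q w"
    proof (cases "i0 < q")
      case True
      have "t i0 \<le> \<rho> * \<tau>" using t_h[of \<tau> i0] True pd(2) by simp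
      then show ?thesis using bound[OF True w] by (meson L2_set_nonneg mult_right_mono order_trans)
    next
      case False
      then have "w = (\<lambda>_. 0)" using w by (auto simp: sp_def)
      then show ?thesis by (simp add: L_zero L2_set_0')
    qed
    also have "nrm q w = L2_set (L u) N" unfolding w_def by (rule r_norm)
    finally show "L u \<in> cone S B N (\<lambda>_. 1) (\<rho> * \<tau>)" using L_S[OF u(2)] by (simp add: cone_def Lw)
  qed
qed

end

subsection \<open>Vectors as functions, projections and pseudoinverses\<close>

text \<open>Padding with zeros places vectors of dimension \<open>n\<close> in
  \<open>supp n\<close>, where the results on dimension and orthogonality apply.\<close>

definition fn :: "real vec \<Rightarrow> nat \<Rightarrow> real" where
  "fn v = (\<lambda>i. if i < dim_vec v then v $ i else 0)"


lemma fn_supp: "v \<in> carrier_vec n \<Longrightarrow> fn v \<in> supp n" by (auto simp: fn_def supp_def)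

lemma fn_inj: "v \<in> carrier_vec n \<Longrightarrow> w \<in> carrier_vec n \<Longrightarrow> fn v = fn w \<Longrightarrow> v = w"
  by (intro eq_vecI) (auto simp: fn_def fun_eq_iff split: if_splits)

lemma fn_vec [simp]: "fn (vec n f) = (\<lambda>i. if i < n then f i else 0)" by (auto simp: fn_def)

lemma vec_fn: "f \<in> supp n \<Longrightarrow> fn (vec n f) = f" by (auto simp: supp_def fun_eq_iff)

lemma fn_add: "v \<in> carrier_vec n \<Longrightarrow> w \<in> carrier_vec n \<Longrightarrow> fn (v + w) = (\<lambda>i. fn v i + fn w i)"
  by (auto simp: fn_def)

lemma fn_minus: "v \<in> carrier_vec n \<Longrightarrow> w \<in> carrier_vec n \<Longrightarrow> fn (v - w) = (\<lambda>i. fn v i - fn w i)"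
  by (auto simp: fn_def)

lemma fn_smult: "fn (a \<cdot>\<^sub>v v) = (\<lambda>i. a * fn v i)"
  by (auto simp: fn_def)

lemma scalar_prod_ip: "v \<in> carrier_vec n \<Longrightarrow> w \<in> carrier_vec n \<Longrightarrow> v \<bullet> w = ip n (fn v) (fn w)"
  unfolding scalar_prod_def ip_def by (auto intro!: sum.cong simp: fn_def)

lemma vnorm_nrm: "v \<in> carrier_vec n \<Longrightarrow> vnorm v = nrm n (fn v)"
  unfolding vnorm_def scalar_prod_ip[of v n v] by (simp add: scalar_prod_ip ip_def L2_set_def power2_eq_square)

lemma fn_mult_mat_vec:
  "M \<in> carrier_mat m n \<Longrightarrow> v \<in> carrier_vec n \<Longrightarrow> fn (M *\<^sub>v v) = (\<lambda>i. if i < m then \<Sum>j<n. M $$ (i, j) * fn v j else 0)"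
  by (auto simp: fn_def scalar_prod_def lessThan_atLeast0 intro!: sum.cong)

lemma fn_col: "C \<in> carrier_mat m n \<Longrightarrow> j < n \<Longrightarrow> fn (col C j) = (\<lambda>i. if i < m then C $$ (i, j) else 0)"
  by (auto simp: fn_def)

definition mcol :: "real mat \<Rightarrow> nat \<Rightarrow> nat \<Rightarrow> real" where
  "mcol C j = fn (col C j)"

lemma fn_mult_comb:
  assumes "M \<in> carrier_mat m n" "v \<in> carrier_vec n"
  shows "fn (M *\<^sub>v v) = comb n (fn v) (mcol M)"
proof
  fix i
  show "fn (M *\<^sub>v v) i = comb n (fn v) (mcol M) i"
  proof (cases "i < m")
    case True
    then show ?thesis unfolding fn_mult_mat_vec[OF assms] comb_def using fn_col[OF assms(1)]
      by (auto simp: mcol_def intro!: sum.cong)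
  next
    case False
    then show ?thesis unfolding fn_mult_mat_vec[OF assms] comb_def using fn_col[OF assms(1)]
      by (auto simp: mcol_def)
  qed
qed

text \<open>The span is taken of a set of columns, whereas the sum runs over indices. Nonzero
  pairwise orthogonal columns are distinct, so the two agree.\<close>

lemma vec_span_cols:
  assumes C: "C \<in> carrier_mat q q" "orthogonal_mat C"
  shows "u \<in> vec_span q (col C ` {i..<q}) \<longleftrightarrow> u \<in> carrier_vec q \<and> (\<exists>c. fn u = (\<lambda>k. \<Sum>j\<in>{i..<q}. c j * mcol C j k))"
proof -
  interpret vec_space "TYPE(real)" q .
  define A where "A = col C ` {i..<q}"
  have A: "finite A" "A \<subseteq> carrier_vec q" using C(1) by (auto simp: A_def)
  have inj: "inj_on (col C) {i..<q}"
  proof (rule inj_onI)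
    fix j k assume jk: "j \<in> {i..<q}" "k \<in> {i..<q}" "col C j = col C k"
    then show "j = k" using orthogonal_matD[OF C(2), of j k] orthogonal_matD[OF C(2), of j j] C(1) by auto
  qed
  have vs: "vec_span q A = {lincomb a A | a. True}"
    unfolding vec_span_def using finite_span[OF A(1)] A(2) by auto
  have lc: "lincomb a A \<in> carrier_vec q" for a using lincomb_closed[OF A(2)] by auto
  have fl: "fn (lincomb a A) = (\<lambda>k. \<Sum>j\<in>{i..<q}. a (col C j) * mcol C j k)" for a
  proof
    fix k
    show "fn (lincomb a A) k = (\<Sum>j\<in>{i..<q}. a (col C j) * mcol C j k)"
    proof (cases "k < q")
      case True
      then have "fn (lincomb a A) k = (\<Sum>x\<in>A. a x * x $ k)" using lincomb_index[OF True A(2)] lc[of a] by (simp add: fn_def)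
      also have "\<dots> = (\<Sum>j\<in>{i..<q}. a (col C j) * col C j $ k)" unfolding A_def by (simp add: sum.reindex[OF inj])
      also have "\<dots> = (\<Sum>j\<in>{i..<q}. a (col C j) * mcol C j k)" using True C(1) by (intro sum.cong) (auto simp: mcol_def fn_def)
      finally show ?thesis .
    next
      case False then show ?thesis using lc[of a] C(1) by (simp add: fn_def mcol_def)
    qed
  qed
  show ?thesis
  proof
    assume "u \<in> vec_span q (col C ` {i..<q})"
    then obtain a where "u = lincomb a A" unfolding A_def[symmetric] vs by auto
    then show "u \<in> carrier_vec q \<and> (\<exists>c. fn u = (\<lambda>k. \<Sum>j\<in>{i..<q}. c j * mcol C j k))" using lc fl by auto
  next
    assume "u \<in> carrier_vec q \<and> (\<exists>c. fn u = (\<lambda>k. \<Sum>j\<in>{i..<q}. c j * mcol C j k))"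
    then obtain c where u: "u \<in> carrier_vec q" "fn u = (\<lambda>k. \<Sum>j\<in>{i..<q}. c j * mcol C j k)" by blast
    define a where "a = (\<lambda>x. c (the_inv_into {i..<q} (col C) x))"
    have "fn (lincomb a A) = fn u" unfolding fl u(2) a_def using the_inv_into_f_f[OF inj] by (auto intro!: sum.cong)
    then have "u = lincomb a A" using fn_inj[OF u(1) lc[of a]] by simp
    then show "u \<in> vec_span q (col C ` {i..<q})" unfolding A_def[symmetric] vs by auto
  qed
qed

section \<open>Orthogonal projection matrices and reproducing kernels\<close>

definition is_proj :: "nat \<Rightarrow> real vec set \<Rightarrow> real mat \<Rightarrow> bool" where
  "is_proj n S P \<longleftrightarrow> P \<in> carrier_mat n n \<and> (\<forall>v\<in>carrier_vec n. P *\<^sub>v v \<in> S \<and> (\<forall>w\<in>S. (v - P *\<^sub>v v) \<bullet> w = 0))"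

text \<open>The columns of the matrix are the orthogonal projections of the unit vectors.\<close>

lemma is_proj_exists:
  assumes S: "S \<subseteq> carrier_vec n" and op: "subsp (fn ` S)"
  shows "\<exists>P. is_proj n S P"
proof -
  have sup: "fn ` S \<subseteq> supp n" using S fn_supp by blast
  define e where "e j = (\<lambda>i::nat. if i = j then 1 else (0::real))" for j :: nat
  have "\<exists>g\<in>fn ` S. (\<lambda>i. e j i - g i) \<in> perp n (fn ` S)" if "j < n" for j
    using that by (intro orth_decomp op sup) (auto simp: supp_def e_def)
  then obtain g where g: "\<And>j. j < n \<Longrightarrow> g j \<in> fn ` S" "\<And>j. j < n \<Longrightarrow> (\<lambda>i. e j i - g j i) \<in> perp n (fn ` S)" by metis
  define P where "P = mat n n (\<lambda>(i, j). g j i)"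
  have gs: "g j \<in> supp n" if "j < n" for j using g(1)[OF that] sup by auto
  have P: "P \<in> carrier_mat n n" by (simp add: P_def)
  have Pv: "fn (P *\<^sub>v v) = comb n (fn v) g" if "v \<in> carrier_vec n" for v
  proof -
    have "mcol P j = g j" if "j < n" for j
      unfolding mcol_def fn_col[OF P that] using that gs[OF that] by (auto simp: P_def supp_def)
    then show ?thesis unfolding fn_mult_comb[OF P that] by (intro comb_cong) auto
  qed
  show ?thesis unfolding is_proj_def
  proof (intro exI[of _ P] conjI P ballI)
    fix v :: "real vec" assume v: "v \<in> carrier_vec n"
    have "comb n (fn v) g \<in> fn ` S" by (rule subsp_comb[OF op g(1)])
    then obtain w where w: "w \<in> S" "fn (P *\<^sub>v v) = fn w" unfolding Pv[OF v, symmetric] by auto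
    then have "P *\<^sub>v v = w" using fn_inj[of "P *\<^sub>v v" n w] P v S by auto
    then show Pin: "P *\<^sub>v v \<in> S" using w by simp
    fix w assume wS: "w \<in> S"
    have "fn v = comb n (fn v) e"
      using v by (auto simp: comb_def e_def fun_eq_iff fn_def if_distrib cong: if_cong)
    moreover have "comb n (fn v) (\<lambda>j i. e j i - g j i) = (\<lambda>i. comb n (fn v) e i - comb n (fn v) g i)"
      by (simp add: comb_def algebra_simps sum_subtractf)
    ultimately have "(\<lambda>i. fn v i - fn (P *\<^sub>v v) i) = comb n (fn v) (\<lambda>j i. e j i - g j i)" unfolding Pv[OF v] by simp
    also have "\<dots> \<in> perp n (fn ` S)" by (rule subsp_comb[OF subsp_perp g(2)])
    finally have "ip n (\<lambda>i. fn v i - fn (P *\<^sub>v v) i) (fn w) = 0" using wS by (simp add: perp_def)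
    moreover have "fn (v - P *\<^sub>v v) = (\<lambda>i. fn v i - fn (P *\<^sub>v v) i)" using v P by (intro fn_minus) auto
    ultimately show "(v - P *\<^sub>v v) \<bullet> w = 0"
      using scalar_prod_ip[of "v - P *\<^sub>v v" n w] v P wS S by auto
  qed
qed

lemma mult_unit_vec_col: "(P :: real mat) \<in> carrier_mat m n \<Longrightarrow> j < n \<Longrightarrow> P *\<^sub>v unit_vec n j = col P j"
  by (intro eq_vecI) auto

lemma is_proj_unique:
  assumes S: "S \<subseteq> carrier_vec n" and op: "subsp (fn ` S)" and P: "is_proj n S P" and Q: "is_proj n S Q"
  shows "P = Q"
proof -
  have car: "P \<in> carrier_mat n n" "Q \<in> carrier_mat n n" using P Q by (auto simp: is_proj_def)
  have "P *\<^sub>v v = Q *\<^sub>v v" if v: "v \<in> carrier_vec n" for v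
  proof -
    define p r where "p = fn (P *\<^sub>v v)" and "r = fn (Q *\<^sub>v v)"
    have pr: "p \<in> fn ` S" "r \<in> fn ` S" using P Q v by (auto simp: is_proj_def p_def r_def)
    have d: "(\<lambda>i. p i - r i) \<in> fn ` S" by (rule subspD(4)[OF op pr])
    have orth: "ip n (\<lambda>i. fn v i - fn (R *\<^sub>v v) i) g = 0" if R: "is_proj n S R" and g: "g \<in> fn ` S" for R g
    proof -
      obtain w where w: "w \<in> S" "g = fn w" using g by auto
      have c: "R \<in> carrier_mat n n" using R by (simp add: is_proj_def)
      have "fn (v - R *\<^sub>v v) = (\<lambda>i. fn v i - fn (R *\<^sub>v v) i)" using v c by (intro fn_minus) auto
      moreover have "(v - R *\<^sub>v v) \<bullet> w = 0" using R v w(1) by (simp add: is_proj_def)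
      ultimately show ?thesis using scalar_prod_ip[of "v - R *\<^sub>v v" n w] v c w S by auto
    qed
    have "ip n (\<lambda>i. fn v i - p i) (\<lambda>i. p i - r i) = 0" "ip n (\<lambda>i. fn v i - r i) (\<lambda>i. p i - r i) = 0"
      unfolding p_def[symmetric] r_def[symmetric] using orth[OF P d] orth[OF Q d] by (simp_all add: p_def r_def)
    then have "ip n (\<lambda>i. p i - r i) (\<lambda>i. p i - r i) = 0" by (simp add: ip_add)
    moreover have "(\<lambda>i. p i - r i) \<in> supp n" using d S fn_supp by auto
    ultimately have "(\<lambda>i. p i - r i) = (\<lambda>_. 0)" by (rule ip_self_0)
    then have "p = r" by (auto simp: fun_eq_iff)
    then show ?thesis unfolding p_def r_def using fn_inj[of "P *\<^sub>v v" n "Q *\<^sub>v v"] car v by auto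
  qed
  then have "col P j = col Q j" if "j < n" for j
    using mult_unit_vec_col[OF car(1) that] mult_unit_vec_col[OF car(2) that] that by (metis unit_vec_carrier)
  then show ?thesis using car by (intro mat_col_eqI) auto
qed

lemma orth_proj_is_proj:
  assumes "S \<subseteq> carrier_vec n" "subsp (fn ` S)"
  shows "is_proj n S (orth_proj n S)"
proof -
  obtain P where P: "is_proj n S P" using is_proj_exists[OF assms] by blast
  have "orth_proj n S = (THE P. is_proj n S P)" unfolding orth_proj_def is_proj_def ..
  also have "\<dots> = P" by (rule the_equality, rule P, rule is_proj_unique[OF assms _ P])
  finally show ?thesis using P by simp
qed

text \<open>The columns of a projection matrix form the reproducing kernel of its subspace: pairing
  with column \<open>l\<close> evaluates coordinate \<open>l\<close>. In this form the projection
  enters the analysis of the lifting map.\<close>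

definition reproducing :: "nat \<Rightarrow> (nat \<Rightarrow> real) set \<Rightarrow> (nat \<Rightarrow> nat \<Rightarrow> real) \<Rightarrow> bool" where
  "reproducing n S c \<longleftrightarrow> (\<forall>l<n. c l \<in> S \<and> (\<forall>z\<in>S. ip n (c l) z = z l))"

lemma is_proj_reproducing:
  assumes S: "S \<subseteq> carrier_vec n" and P: "is_proj n S P"
  shows "reproducing n (fn ` S) (mcol P)"
  unfolding reproducing_def
proof (intro allI impI conjI ballI)
  fix l assume l: "l < n"
  have c: "P \<in> carrier_mat n n" using P by (simp add: is_proj_def)
  have e: "P *\<^sub>v unit_vec n l = col P l" by (rule mult_unit_vec_col[OF c l])
  then show "mcol P l \<in> fn ` S" using P unfolding is_proj_def mcol_def by (metis imageI unit_vec_carrier)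
  fix z assume "z \<in> fn ` S"
  then obtain w where w: "w \<in> S" "z = fn w" by auto
  have wc: "w \<in> carrier_vec n" using w S by auto
  have "(unit_vec n l - col P l) \<bullet> w = 0" using P w(1) unfolding is_proj_def e[symmetric] by simp
  then have "unit_vec n l \<bullet> w = col P l \<bullet> w" using c l wc by (simp add: minus_scalar_prod_distrib[of _ n])
  then have "w $ l = col P l \<bullet> w" using wc l by simp
  then show "ip n (mcol P l) z = z l" unfolding mcol_def w(2) using scalar_prod_ip[of "col P l" n w] c l wc by (simp add: fn_def)
qed

text \<open>The identity matrix evaluates coordinates on the whole space; subtracting the kernel of
  \<open>W\<close> leaves that of the complement, on which the subtracted part pairs to
  zero.\<close>

lemma reproducing_complement:
  assumes c: "reproducing n W c" and op: "orth_pair n W W'"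
  shows "reproducing n W' (\<lambda>l i. if i < n then (if i = l then 1 else 0) - c l i else 0)"
  unfolding reproducing_def
proof (intro allI impI conjI ballI)
  interpret orth_pair n W W' by (rule op)
  fix l assume l: "l < n"
  let ?d = "\<lambda>i. if i < n then (if i = l then 1 else 0) - c l i else 0"
  have cl: "c l \<in> W" "\<And>z. z \<in> W \<Longrightarrow> ip n (c l) z = z l" using c l by (auto simp: reproducing_def)
  have d: "ip n ?d z = z l - ip n (c l) z" for z
  proof -
    have "ip n ?d z = (\<Sum>i<n. (if i = l then z l else 0) - c l i * z i)" unfolding ip_def by (intro sum.cong) (auto simp: algebra_simps)
    then show ?thesis using l by (simp add: sum_subtractf ip_def)
  qed
  then show "?d \<in> W'" unfolding W'_eq perp_def using cl by (auto simp: supp_def)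
  fix z assume "z \<in> W'"
  then show "ip n ?d z = z l" unfolding d using orthogonal[OF cl(1)] by simp
qed

section \<open>Pseudoinverses from singular value decompositions\<close>

lemma mat_mult_entry:
  fixes A B :: "real mat"
  assumes "A \<in> carrier_mat m n" "B \<in> carrier_mat n k" "i < m" "j < k"
  shows "(A * B) $$ (i, j) = (\<Sum>l<n. A $$ (i, l) * B $$ (l, j))"
  using assms by (auto simp: scalar_prod_def lessThan_atLeast0 intro!: sum.cong)

text \<open>From a decomposition \<open>U D V^T\<close> the candidate is \<open>V E U^T\<close>; the
  orthogonal factors cancel in all four equations and leave those for the diagonal matrices.\<close>

lemma pinv_exists:
  fixes M :: "real mat"
  assumes sv: "singular_values M \<sigma>"
  shows "\<exists>X. X \<in> carrier_mat (dim_col M) (dim_row M) \<and> M * X * M = M \<and> X * M * X = X \<and>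
     transpose_mat (M * X) = M * X \<and> transpose_mat (X * M) = X * M"
proof -
  define m n where "m = dim_row M" and "n = dim_col M"
  \<comment> \<open>Since \<open>inverse 0 = 0\<close>, the matrix \<open>E\<close> is the
    pseudoinverse of \<open>D\<close> also where singular values vanish.\<close>
  define D E where "D = mat m n (\<lambda>(i, j). if i = j then \<sigma> $ i else 0)"
    and "E = mat n m (\<lambda>(i, j). if i = j then inverse (\<sigma> $ i) else 0)"
  have "\<exists>U\<in>carrier_mat m m. \<exists>V\<in>carrier_mat n n. transpose_mat U * U = 1\<^sub>m m \<and> transpose_mat V * V = 1\<^sub>m n \<and> M = U * D * transpose_mat V"
    using sv unfolding singular_values_def m_def[symmetric] n_def[symmetric] D_def[symmetric] by (elim conjE)
  then obtain U V where U: "U \<in> carrier_mat m m" "transpose_mat U * U = 1\<^sub>m m"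
    and V: "V \<in> carrier_mat n n" "transpose_mat V * V = 1\<^sub>m n" and M': "M = U * D * transpose_mat V" by (elim bexE conjE)
  define X where "X = V * E * transpose_mat U"
  have DE: "D \<in> carrier_mat m n" "E \<in> carrier_mat n m" by (auto simp: D_def E_def)
  have UT: "transpose_mat U \<in> carrier_mat m m" "transpose_mat V \<in> carrier_mat n n" using U V by auto

  have de: "(D * E) $$ (i, j) = (if i = j \<and> i < n \<and> \<sigma> $ i \<noteq> 0 then 1 else 0)" if "i < m" "j < m" for i j
  proof -
    have "(D * E) $$ (i, j) = (\<Sum>k<n. D $$ (i, k) * E $$ (k, j))"
      using DE that by (intro mat_mult_entry) auto
    also have "\<dots> = (\<Sum>k<n. if k = i then (if i = j then \<sigma> $ i * inverse (\<sigma> $ i) else 0) else 0)"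
      using that by (intro sum.cong) (auto simp: D_def E_def)
    finally show ?thesis by auto
  qed
  have ed: "(E * D) $$ (i, j) = (if i = j \<and> i < m \<and> \<sigma> $ i \<noteq> 0 then 1 else 0)" if "i < n" "j < n" for i j
  proof -
    have "(E * D) $$ (i, j) = (\<Sum>k<m. E $$ (i, k) * D $$ (k, j))"
      using DE that by (intro mat_mult_entry) auto
    also have "\<dots> = (\<Sum>k<m. if k = i then (if i = j then inverse (\<sigma> $ i) * \<sigma> $ i else 0) else 0)"
      using that by (intro sum.cong) (auto simp: D_def E_def)
    finally show ?thesis by auto
  qed
  have DED: "D * E * D = D"
  proof (rule eq_matI)
    fix i j assume ij: "i < dim_row D" "j < dim_col D"
    then have ij': "i < m" "j < n" by (auto simp: D_def)
    have "(D * E * D) $$ (i, j) = (\<Sum>k<m. (D * E) $$ (i, k) * D $$ (k, j))"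
      using DE ij' by (intro mat_mult_entry[of _ m m _ n]) auto
    also have "\<dots> = (\<Sum>k<m. if k = i then (if i < n \<and> \<sigma> $ i \<noteq> 0 then D $$ (i, j) else 0) else 0)"
      using de ij' by (intro sum.cong) auto
    also have "\<dots> = D $$ (i, j)" using ij' by (auto simp: D_def)
    finally show "(D * E * D) $$ (i, j) = D $$ (i, j)" .
  qed (use DE in auto)
  have EDE: "E * D * E = E"
  proof (rule eq_matI)
    fix i j assume ij: "i < dim_row E" "j < dim_col E"
    then have ij': "i < n" "j < m" by (auto simp: E_def)
    have "(E * D * E) $$ (i, j) = (\<Sum>k<n. (E * D) $$ (i, k) * E $$ (k, j))"
      using DE ij' by (intro mat_mult_entry[of _ n n _ m]) auto
    also have "\<dots> = (\<Sum>k<n. if k = i then (if i < m \<and> \<sigma> $ i \<noteq> 0 then E $$ (i, j) else 0) else 0)"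
      using ed ij' by (intro sum.cong) auto
    also have "\<dots> = E $$ (i, j)" using ij' by (auto simp: E_def)
    finally show "(E * D * E) $$ (i, j) = E $$ (i, j)" .
  qed (use DE in auto)
  have sDE: "transpose_mat (D * E) = D * E" by (rule eq_matI) (use DE de in auto)
  have sED: "transpose_mat (E * D) = E * D" by (rule eq_matI) (use DE ed in auto)
  have c [simp]: "D \<in> carrier_mat m n" "E \<in> carrier_mat n m" "U \<in> carrier_mat m m" "V \<in> carrier_mat n n"
    "transpose_mat U \<in> carrier_mat m m" "transpose_mat V \<in> carrier_mat n n" using DE U V by auto
  have p [simp]: "D * transpose_mat V \<in> carrier_mat m n" "E * transpose_mat U \<in> carrier_mat n m" "D * E \<in> carrier_mat m m" "E * D \<in> carrier_mat n n"
    by (rule mult_carrier_mat[OF c(1,6)] mult_carrier_mat[OF c(2,5)] mult_carrier_mat[OF c(1,2)] mult_carrier_mat[OF c(2,1)])+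
  have p' [simp]: "E * (D * transpose_mat V) \<in> carrier_mat n n" "D * (E * transpose_mat U) \<in> carrier_mat m m"
    by (rule mult_carrier_mat[OF c(2) p(1)] mult_carrier_mat[OF c(1) p(2)])+
  have cV: "transpose_mat V * (V * Z) = Z" if "Z \<in> carrier_mat n k" for Z k
    using assoc_mult_mat[OF c(6,4) that] V(2) that by simp
  have cU: "transpose_mat U * (U * Z) = Z" if "Z \<in> carrier_mat m k" for Z k
    using assoc_mult_mat[OF c(5,3) that] U(2) that by simp
  have dd: "D * (E * (D * Z)) = D * Z" if Z: "Z \<in> carrier_mat n k" for Z k
  proof -
    have "D * Z = D * E * D * Z" unfolding DED ..
    also have "\<dots> = D * E * (D * Z)" by (rule assoc_mult_mat[OF p(3) c(1) Z])
    also have "\<dots> = D * (E * (D * Z))" by (rule assoc_mult_mat[OF c(1,2) mult_carrier_mat[OF c(1) Z]])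
    finally show ?thesis ..
  qed
  have ee: "E * (D * (E * Z)) = E * Z" if Z: "Z \<in> carrier_mat m k" for Z k
  proof -
    have "E * Z = E * D * E * Z" unfolding EDE ..
    also have "\<dots> = E * D * (E * Z)" by (rule assoc_mult_mat[OF p(4) c(2) Z])
    also have "\<dots> = E * (D * (E * Z))" by (rule assoc_mult_mat[OF c(2,1) mult_carrier_mat[OF c(2) Z]])
    finally show ?thesis ..
  qed
  have Mr: "M = U * (D * transpose_mat V)" unfolding M' by (rule assoc_mult_mat[OF c(3,1,6)])
  have Xr: "X = V * (E * transpose_mat U)" unfolding X_def by (rule assoc_mult_mat[OF c(4,2,5)])
  have MX: "M * X = U * (D * (E * transpose_mat U))"
  proof -
    have "M * X = U * ((D * transpose_mat V) * (V * (E * transpose_mat U)))"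
      unfolding Mr Xr by (rule assoc_mult_mat[OF c(3) p(1) mult_carrier_mat[OF c(4) p(2)]])
    also have "(D * transpose_mat V) * (V * (E * transpose_mat U)) = D * (transpose_mat V * (V * (E * transpose_mat U)))"
      by (rule assoc_mult_mat[OF c(1,6) mult_carrier_mat[OF c(4) p(2)]])
    finally show ?thesis unfolding cV[OF p(2)] .
  qed
  have XM: "X * M = V * (E * (D * transpose_mat V))"
  proof -
    have "X * M = V * ((E * transpose_mat U) * (U * (D * transpose_mat V)))"
      unfolding Mr Xr by (rule assoc_mult_mat[OF c(4) p(2) mult_carrier_mat[OF c(3) p(1)]])
    also have "(E * transpose_mat U) * (U * (D * transpose_mat V)) = E * (transpose_mat U * (U * (D * transpose_mat V)))"
      by (rule assoc_mult_mat[OF c(2,5) mult_carrier_mat[OF c(3) p(1)]])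
    finally show ?thesis unfolding cU[OF p(1)] .
  qed
  have Mc: "M \<in> carrier_mat m n" "X \<in> carrier_mat n m" unfolding Mr Xr by (rule mult_carrier_mat[OF c(3) p(1)] mult_carrier_mat[OF c(4) p(2)])+
  have MXM: "M * X * M = M"
  proof -
    have "M * X * M = M * (X * M)" by (rule assoc_mult_mat[OF Mc(1,2,1)])
    also have "\<dots> = U * ((D * transpose_mat V) * (V * (E * (D * transpose_mat V))))"
      unfolding XM unfolding Mr by (rule assoc_mult_mat[OF c(3) p(1) mult_carrier_mat[OF c(4) p'(1)]])
    also have "(D * transpose_mat V) * (V * (E * (D * transpose_mat V))) = D * (transpose_mat V * (V * (E * (D * transpose_mat V))))"
      by (rule assoc_mult_mat[OF c(1,6) mult_carrier_mat[OF c(4) p'(1)]])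
    finally show ?thesis unfolding cV[OF p'(1)] dd[OF c(6)] Mr .
  qed
  have XMX: "X * M * X = X"
  proof -
    have "X * M * X = X * (M * X)" by (rule assoc_mult_mat[OF Mc(2,1,2)])
    also have "\<dots> = V * ((E * transpose_mat U) * (U * (D * (E * transpose_mat U))))"
      unfolding MX unfolding Xr by (rule assoc_mult_mat[OF c(4) p(2) mult_carrier_mat[OF c(3) p'(2)]])
    also have "(E * transpose_mat U) * (U * (D * (E * transpose_mat U))) = E * (transpose_mat U * (U * (D * (E * transpose_mat U))))"
      by (rule assoc_mult_mat[OF c(2,5) mult_carrier_mat[OF c(3) p'(2)]])
    finally show ?thesis unfolding cU[OF p'(2)] ee[OF c(5)] Xr .
  qed
  have tr: "transpose_mat (Q * (A * transpose_mat Q)) = Q * (A * transpose_mat Q)"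
    if Q: "Q \<in> carrier_mat k k" and A: "A \<in> carrier_mat k k" "transpose_mat A = A" for Q A :: "real mat" and k
  proof -
    have QT: "transpose_mat Q \<in> carrier_mat k k" using Q by simp
    have "transpose_mat (Q * (A * transpose_mat Q)) = transpose_mat (A * transpose_mat Q) * transpose_mat Q"
      by (rule transpose_mult[OF Q mult_carrier_mat[OF A(1) QT]])
    also have "transpose_mat (A * transpose_mat Q) = Q * A" using transpose_mult[OF A(1) QT] A(2) by simp
    also have "Q * A * transpose_mat Q = Q * (A * transpose_mat Q)" by (rule assoc_mult_mat[OF Q A(1) QT])
    finally show ?thesis .
  qed
  have sMX: "transpose_mat (M * X) = M * X"
    using tr[OF c(3) p(3) sDE] unfolding MX assoc_mult_mat[OF c(1,2,5)] .
  have sXM: "transpose_mat (X * M) = X * M"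
    using tr[OF c(4) p(4) sED] unfolding XM assoc_mult_mat[OF c(2,1,6)] .
  show ?thesis unfolding m_def[symmetric] n_def[symmetric] using Mc(2) MXM XMX sMX sXM by (intro exI[of _ X] conjI)
qed

text \<open>The symmetry conditions give \<open>M X = M Y\<close> and \<open>X M = Y M\<close>, and
  then \<open>X = X M X = Y M X = Y M Y = Y\<close>.\<close>

lemma pinv_unique:
  fixes M X Y :: "real mat"
  assumes X: "X \<in> carrier_mat n m" "M * X * M = M" "X * M * X = X" "transpose_mat (M * X) = M * X" "transpose_mat (X * M) = X * M"
    and Y: "Y \<in> carrier_mat n m" "M * Y * M = M" "Y * M * Y = Y" "transpose_mat (M * Y) = M * Y" "transpose_mat (Y * M) = Y * M"
    and M: "M \<in> carrier_mat m n"
  shows "X = Y"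
proof -
  have MT: "transpose_mat M \<in> carrier_mat n m" "transpose_mat X \<in> carrier_mat m n" "transpose_mat Y \<in> carrier_mat m n" using M X Y by auto
  have 1: "M * X = M * Y"
  proof -
    have "M * X = (M * Y * M) * X" using Y by simp
    also have "\<dots> = (M * Y) * (M * X)" using M X Y by (intro assoc_mult_mat[of _ m m _ n _ m]) auto
    also have "\<dots> = transpose_mat ((M * X) * (M * Y))"
      using M X Y by (simp add: transpose_mult[of "M * X" m m "M * Y" m])
    also have "(M * X) * (M * Y) = (M * X * M) * Y" using M X Y by (intro assoc_mult_mat[of _ m m _ n _ m, symmetric]) auto
    also have "\<dots> = M * Y" using X by simp
    finally show ?thesis using Y by simp
  qed
  have 2: "X * M = Y * M"
  proof -
    have "X * M = X * (M * Y * M)" using Y by simp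
    also have "X * (M * Y * M) = X * (M * (Y * M))" using M X Y by (simp add: assoc_mult_mat[of M m n Y m M n])
    also have "\<dots> = (X * M) * (Y * M)" using M X Y by (intro assoc_mult_mat[of _ n m _ n _ n, symmetric]) auto
    also have "\<dots> = transpose_mat ((Y * M) * (X * M))"
      using M X Y by (simp add: transpose_mult[of "Y * M" n n "X * M" n])
    also have "(Y * M) * (X * M) = Y * (M * (X * M))" using M X Y by (intro assoc_mult_mat[of _ n m _ n _ n]) auto
    also have "M * (X * M) = M * X * M" using M X Y by (intro assoc_mult_mat[of _ m n _ m _ n, symmetric]) auto
    also have "M * X * M = M" using X by simp
    finally show ?thesis using Y by simp
  qed
  have "X = X * M * X" using X by simp
  also have "\<dots> = Y * M * X" unfolding 2 ..
  also have "\<dots> = Y * (M * X)" using M X Y by (intro assoc_mult_mat[of _ n m _ n _ m]) auto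
  also have "\<dots> = Y * M * Y" unfolding 1 using M Y by (intro assoc_mult_mat[of _ n m _ n _ m, symmetric]) auto
  finally show ?thesis using Y by simp
qed

lemma pinv_props:
  fixes M :: "real mat"
  assumes sv: "singular_values M \<sigma>"
  shows "pinv M \<in> carrier_mat (dim_col M) (dim_row M)" "M * pinv M * M = M" "transpose_mat (M * pinv M) = M * pinv M"
proof -
  obtain X where X: "X \<in> carrier_mat (dim_col M) (dim_row M) \<and> M * X * M = M \<and> X * M * X = X \<and>
     transpose_mat (M * X) = M * X \<and> transpose_mat (X * M) = X * M" using pinv_exists[OF sv] by blast
  have "pinv M = X" unfolding pinv_def
  proof (rule the_equality, rule X)
    fix Y assume "Y \<in> carrier_mat (dim_col M) (dim_row M) \<and> M * Y * M = M \<and> Y * M * Y = Y \<and>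
      transpose_mat (M * Y) = M * Y \<and> transpose_mat (Y * M) = Y * M"
    then show "Y = X" using X by (intro pinv_unique[of Y "dim_col M" "dim_row M" M X]) auto
  qed
  then show "pinv M \<in> carrier_mat (dim_col M) (dim_row M)" "M * pinv M * M = M" "transpose_mat (M * pinv M) = M * pinv M"
    using X by auto
qed

section \<open>The lifting map of a projection matrix\<close>

lemma vec_fn_id: "w \<in> carrier_vec q \<Longrightarrow> vec q (fn w) = w"
  by (rule eq_vecI) (auto simp: fn_def)

text \<open>\<open>submatrix\<close> enumerates its rows and columns through \<open>pick\<close>, so
  sums over a submatrix become sums over the index set by this reindexing.\<close>

lemma pick_bij:
  assumes "finite N"
  shows "bij_betw (pick N) {..<card N} N"
proof -
  have "N \<subseteq> pick N ` {..<card N}"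
  proof
    fix i assume i: "i \<in> N"
    have "{a \<in> N. a < i} \<subset> N" using i by auto
    then have "card {a \<in> N. a < i} < card N" using assms by (rule psubset_card_mono[rotated])
    then show "i \<in> pick N ` {..<card N}" by (intro image_eqI[of _ _ "card {a \<in> N. a < i}"]) (simp_all add: pick_card_in_set[OF i])
  qed
  moreover have "pick N ` {..<card N} \<subseteq> N" using pick_in_set_le by auto
  ultimately have eq: "pick N ` {..<card N} = N" by auto
  then have "inj_on (pick N) {..<card N}" by (intro eq_card_imp_inj_on) auto
  then show ?thesis using eq by (simp add: bij_betw_def)
qed

lemma L2_set_pick:
  assumes "finite N"
  shows "nrm (card N) (\<lambda>k. f (pick N k)) = L2_set f N"
  unfolding L2_set_def using sum.reindex_bij_betw[OF pick_bij[OF assms], of "\<lambda>i. (f i)\<^sup>2"] by simp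

text \<open>With the columns of \<open>P\<close> as kernels, \<open>P_NN\<close> is the Gram matrix
  of those with index in \<open>N\<close>, and the lift of \<open>u\<close> combines them with
  coefficients \<open>P_NN^+ u\<close>. By the reproducing property a combination of these kernels
  is orthogonal to everything in \<open>S\<close> that vanishes on \<open>N\<close>; therefore the
  lift of a restriction is the element of least norm with that restriction.\<close>

lemma lift_map_of_projection:
  assumes P: "P \<in> carrier_mat n n" and rep: "reproducing n S (mcol P)" and S: "subsp S" "S \<subseteq> supp n"
    and part: "B \<union> N = {..<n}" "B \<inter> N = {}" and sv: "singular_values (submatrix P N N) \<sigma>"
  defines "q \<equiv> card N"
  shows "lift_mat P N \<in> carrier_mat n q"
    and "lift_map n q S B N (\<lambda>u. fn (lift_mat P N *\<^sub>v vec q u)) (\<lambda>f k. if k < q then f (pick N k) else 0)"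
proof -
  define a where "a = pick N"
  define M where "M = submatrix P N N"
  define X where "X = pinv M"
  define c where "c = mcol P"
  have fin: "finite N" "finite B" and Nn: "N \<subseteq> {..<n}" using partition_finite[OF part(1)] part by auto
  have a: "bij_betw a {..<q} N" unfolding a_def q_def by (rule pick_bij[OF fin(1)])
  have an: "a k < n" "a k \<in> N" if "k < q" for k using bij_betwE[OF a] that Nn by auto
  have cardN: "card {i. i < n \<and> i \<in> N} = q" unfolding q_def using Nn by (intro arg_cong[of _ _ card]) auto
  have c: "c l \<in> S" "z \<in> S \<Longrightarrow> ip n (c l) z = z l" if "l < n" for l z using rep that by (auto simp: reproducing_def c_def)
  have cP: "c l i = P $$ (i, l)" if "i < n" "l < n" for i l using that P by (simp add: c_def mcol_def fn_def)
  have csym: "c l i = c i l" if "i < n" "l < n" for i l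
    using c(2)[OF that(1) c(1)[OF that(2)]] c(2)[OF that(2) c(1)[OF that(1)]] by (simp add: ip_commute)
  have M: "M \<in> carrier_mat q q" "\<And>i j. i < q \<Longrightarrow> j < q \<Longrightarrow> M $$ (i, j) = c (a j) (a i)"
  proof -
    have dP: "dim_row P = n" "dim_col P = n" using P by auto
    show "M \<in> carrier_mat q q" unfolding M_def submatrix_def dP cardN by simp
    fix i j assume ij: "i < q" "j < q"
    then have "M $$ (i, j) = P $$ (a i, a j)" unfolding M_def submatrix_def dP cardN a_def by simp
    then show "M $$ (i, j) = c (a j) (a i)" using cP[OF an(1)[OF ij(1)] an(1)[OF ij(2)]] by simp
  qed
  have MT: "transpose_mat M = M" by (rule eq_matI) (use M csym an in auto)
  have dimM: "dim_col M = q" "dim_row M = q" using M(1) by auto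
  have X: "X \<in> carrier_mat q q" "M * X * M = M" "transpose_mat (M * X) = M * X"
    using pinv_props[OF sv] dimM unfolding M_def[symmetric] X_def by auto
  define SP where "SP = submatrix P UNIV N"
  have SP: "SP \<in> carrier_mat n q" "\<And>i j. i < n \<Longrightarrow> j < q \<Longrightarrow> SP $$ (i, j) = c (a j) i"
  proof -
    have dP: "dim_row P = n" "dim_col P = n" using P by auto
    have U: "card {i. i < n \<and> i \<in> UNIV} = n" by simp
    show "SP \<in> carrier_mat n q" unfolding SP_def submatrix_def dP cardN U by simp
    fix i j assume ij: "i < n" "j < q"
    then have "SP $$ (i, j) = P $$ (i, a j)" unfolding SP_def submatrix_def dP cardN U a_def by (simp add: pick_UNIV)
    then show "SP $$ (i, j) = c (a j) i" using cP[OF ij(1) an(1)[OF ij(2)]] by simp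
  qed
  have L_eq: "lift_mat P N = SP * X" by (simp add: lift_mat_def SP_def X_def M_def)
  show Lc: "lift_mat P N \<in> carrier_mat n q" unfolding L_eq using SP X by auto
  define y where "y u = fn (X *\<^sub>v vec q u)" for u
  define Lf where "Lf u = fn (lift_mat P N *\<^sub>v vec q u)" for u
  define r where "r f = (\<lambda>k. if k < q then f (a k) else 0)" for f :: "nat \<Rightarrow> real"
  \<comment> \<open>The orthogonal projection onto the range of the Gram matrix; it is what
    restriction after lifting amounts to.\<close>
  define Q where "Q = M * X"
  have Q: "Q \<in> carrier_mat q q" using M X by (auto simp: Q_def)
  have Lf: "Lf u = comb q (y u) (\<lambda>j. c (a j))" for u
  proof -
    have "Lf u = fn (SP *\<^sub>v (X *\<^sub>v vec q u))" unfolding Lf_def L_eq using SP X by simp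
    also have "\<dots> = comb q (y u) (mcol SP)" unfolding y_def using SP X by (intro fn_mult_comb) auto
    also have "\<dots> = comb q (y u) (\<lambda>j. c (a j))"
    proof (rule comb_cong)
      fix j assume j: "j < q"
      have "c (a j) \<in> supp n" using c(1)[OF an(1)[OF j]] S by auto
      then show "mcol SP j = c (a j)" unfolding mcol_def fn_col[OF SP(1) j] using SP(2) j by (auto simp: supp_def fun_eq_iff)
    qed simp
    finally show ?thesis .
  qed
  have comb_r: "r (comb q w (\<lambda>j. c (a j))) = fn (M *\<^sub>v vec q w)" for w
    unfolding fn_mult_mat_vec[OF M(1) vec_carrier] r_def comb_def
    by (auto simp: M(2) mult.commute intro!: sum.cong)
  have vec_y: "vec q (y u) = X *\<^sub>v vec q u" for u
    by (rule eq_vecI) (use X in \<open>auto simp: y_def fn_def\<close>)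
  have rL: "r (Lf u) = fn (Q *\<^sub>v vec q u)" for u
    unfolding Lf comb_r vec_y Q_def using M X by simp
  have ip_comb_c: "ip n (comb q w (\<lambda>j. c (a j))) z = ip q w (r z)" if "z \<in> S" for w z
  proof -
    have "ip n z (comb q w (\<lambda>j. c (a j))) = (\<Sum>j<q. w j * z (a j))"
      unfolding ip_comb using c(2)[OF an(1) that] by (intro sum.cong) (auto simp: ip_commute[of n z])
    then show ?thesis by (subst ip_commute) (simp add: ip_def r_def)
  qed
  have comb_S: "comb q w (\<lambda>j. c (a j)) \<in> S" for w using c(1) an by (intro subsp_comb S) auto
  have r_supp: "r f \<in> supp q" for f by (simp add: r_def supp_def)
  have sym: "ip q (fn (Q *\<^sub>v vec q u)) v = ip q u (fn (Q *\<^sub>v vec q v))" if u: "u \<in> supp q" "v \<in> supp q" for u v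
  proof -
    have "ip q (fn (Q *\<^sub>v vec q u)) v = (transpose_mat Q *\<^sub>v vec q u) \<bullet> vec q v"
      using scalar_prod_ip[of "Q *\<^sub>v vec q u" q "vec q v"] Q X(3) vec_fn[OF u(2)] by (simp add: Q_def)
    also have "\<dots> = vec q u \<bullet> (Q *\<^sub>v vec q v)" by (rule transpose_vec_mult_scalar[OF Q]) auto
    also have "\<dots> = ip q u (fn (Q *\<^sub>v vec q v))"
      using scalar_prod_ip[of "vec q u" q "Q *\<^sub>v vec q v"] Q vec_fn[OF u(1)] by simp
    finally show ?thesis .
  qed
  have MQ: "M * Q = M"
  proof -
    have "M * Q = transpose_mat M * transpose_mat Q" using MT X(3) by (simp add: Q_def)
    also have "\<dots> = transpose_mat (Q * M)" using transpose_mult[OF Q M(1)] by simp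
    also have "\<dots> = M" using X(2) MT by (simp add: Q_def)
    finally show ?thesis .
  qed
  have QQ: "Q * Q = Q"   proof -
    have "Q * Q = (Q * M) * X" unfolding Q_def by (rule assoc_mult_mat[OF Q[unfolded Q_def] M(1) X(1), symmetric])
    then show ?thesis using X(2) by (simp add: Q_def)
  qed
  have kernel: "Lf u = (\<lambda>_. 0)" if z: "r (Lf u) = (\<lambda>_. 0)" for u
  proof -
    have LS: "Lf u \<in> S" unfolding Lf by (rule comb_S)
    have "ip n (Lf u) (Lf u) = ip q (y u) (r (Lf u))" using ip_comb_c[OF LS, of "y u"] unfolding Lf[symmetric] .
    then show ?thesis using ip_self_0[of n "Lf u"] LS S(2) z by (auto simp: ip_def)
  qed
  have lift: "r (Lf (r v)) = r v" if v: "v \<in> S" for v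
  proof -
    define w where "w = vec q (r v)"
    \<comment> \<open>The part of the restriction of \<open>v\<close> that \<open>Q\<close> misses.
      It lies in the kernel of the Gram matrix, so the combination of kernels with coefficients
      \<open>k\<close> has norm zero; pairing that combination with \<open>v\<close> shows that
      \<open>k\<close> is orthogonal to \<open>r v\<close>, and hence to itself.\<close>
    define k where "k = w - Q *\<^sub>v w"
    have wk: "w \<in> carrier_vec q" "k \<in> carrier_vec q" using Q by (auto simp: w_def k_def)
    have "M *\<^sub>v k = M *\<^sub>v w - (M * Q) *\<^sub>v w"
      unfolding k_def using M Q wk by (simp add: mult_minus_distrib_mat_vec[of M q q])
    then have Mk: "M *\<^sub>v k = 0\<^sub>v q" using MQ M wk by simp
    have "Q *\<^sub>v k = Q *\<^sub>v w - (Q * Q) *\<^sub>v w"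
      unfolding k_def using M Q wk by (simp add: mult_minus_distrib_mat_vec[of Q q q])
    then have Qk: "Q *\<^sub>v k = 0\<^sub>v q" using QQ Q wk by simp
    have vk: "vec q (fn k) = k" by (rule eq_vecI) (use wk in \<open>auto simp: fn_def\<close>)
    define \<kappa> where "\<kappa> = comb q (fn k) (\<lambda>j. c (a j))"
    have \<kappa>S: "\<kappa> \<in> S" unfolding \<kappa>_def by (rule comb_S)
    have "r \<kappa> = (\<lambda>_. 0)" unfolding \<kappa>_def comb_r vk Mk by (auto simp: fn_def)
    then have "ip n \<kappa> \<kappa> = 0" using ip_comb_c[OF \<kappa>S, of "fn k"] unfolding \<kappa>_def[symmetric] by (simp add: ip_def)
    then have "\<kappa> = (\<lambda>_. 0)" using ip_self_0 \<kappa>S S(2) by auto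
    then have 1: "ip q (fn k) (r v) = 0" using ip_comb_c[OF v, of "fn k"] unfolding \<kappa>_def[symmetric] by (simp add: ip_def)
    have "ip q (fn (Q *\<^sub>v vec q (fn k))) (r v) = ip q (fn k) (fn (Q *\<^sub>v w))"
      unfolding w_def by (intro sym r_supp fn_supp wk)
    then have 2: "ip q (fn k) (fn (Q *\<^sub>v w)) = 0" unfolding vk Qk by (simp add: ip_def fn_def)
    have fk: "fn k = (\<lambda>i. r v i - fn (Q *\<^sub>v w) i)"
    proof -
      have "fn w = r v" unfolding w_def by (rule vec_fn[OF r_supp])
      then show ?thesis unfolding k_def using fn_minus[OF wk(1) mult_mat_vec_carrier[OF Q wk(1)]] by simp
    qed
    have "ip q (fn k) (fn k) = ip q (fn k) (r v) - ip q (fn k) (fn (Q *\<^sub>v w))" by (subst (2) fk) (simp add: ip_add)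
    then have "fn k = (\<lambda>_. 0)" using 1 2 ip_self_0[of q "fn k"] fn_supp[OF wk(2)] by simp
    then show ?thesis unfolding rL w_def[symmetric] using fk by (auto simp: fun_eq_iff)
  qed
  have r_norm: "nrm q (r f) = L2_set f N" for f
    unfolding L2_set_pick[OF fin(1), symmetric] q_def[symmetric] r_def a_def by (intro L2_set_cong) auto
  have lin: "Lf (\<lambda>i. f i + g i) = (\<lambda>i. Lf f i + Lf g i)" "Lf (\<lambda>i. b * f i) = (\<lambda>i. b * Lf f i)" for f g b
    unfolding Lf_def fn_mult_mat_vec[OF Lc vec_carrier] by (auto simp: algebra_simps sum.distrib sum_distrib_left)
  have "lift_map n q S B N Lf r"
  proof (unfold_locales, goal_cases)
    case (3) show ?case by (rule S(2))
  next
    case (10 u) show ?case unfolding Lf by (rule comb_S)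
  next
    case (12 v)
    \<comment> \<open>This difference vanishes on \<open>N\<close> and is orthogonal to the lift, so
      the lift has the smaller norm. As lift and \<open>v\<close> agree on \<open>N\<close>, the
      comparison passes to \<open>B\<close>.\<close>
    define z where "z = (\<lambda>i. v i - Lf (r v) i)"
    have LS: "Lf (r v) \<in> S" unfolding Lf by (rule comb_S)
    have zS: "z \<in> S" unfolding z_def by (rule subspD(4)[OF S(1) 12 LS])
    have "r z = (\<lambda>i. r v i - r (Lf (r v)) i)" by (simp add: z_def r_def fun_eq_iff)
    then have "r z = (\<lambda>_. 0)" unfolding lift[OF 12] by simp
    then have o: "ip n (Lf (r v)) z = 0" using ip_comb_c[OF zS, of "y (r v)"] unfolding Lf[symmetric] by (simp add: ip_def)
    have "(nrm n v)\<^sup>2 = (\<Sum>i<n. (Lf (r v) i + z i)\<^sup>2)" unfolding L2_set_sq z_def by simp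
    also have "\<dots> = (nrm n (Lf (r v)))\<^sup>2 + (nrm n z)\<^sup>2 + 2 * ip n (Lf (r v)) z"
      unfolding L2_set_sq ip_def power2_sum by (simp add: sum.distrib sum_distrib_left mult.assoc)
    finally have "(nrm n (Lf (r v)))\<^sup>2 \<le> (nrm n v)\<^sup>2" using o zero_le_power2[of "nrm n z"] by linarith
    moreover have "L2_set (Lf (r v)) N = L2_set v N" using r_norm[of "Lf (r v)"] r_norm[of v] lift[OF 12] by simp
    ultimately have "(L2_set (Lf (r v)) B)\<^sup>2 \<le> (L2_set v B)\<^sup>2"
      unfolding nrm_split(1)[OF part] by simp
    then show ?case by (rule power2_le_imp_le) simp
  next
    case (13 u v) then show ?case unfolding rL by (rule sym)
  next
    case (14 u) then show ?case using kernel by blast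
  qed (use part r_norm r_supp lift lin in \<open>auto simp: r_def fun_eq_iff\<close>)
  then show "lift_map n q S B N (\<lambda>u. fn (lift_mat P N *\<^sub>v vec q u)) (\<lambda>f k. if k < q then f (pick N k) else 0)"
    unfolding Lf_def r_def a_def .
qed

section \<open>Right singular vectors and outputs of the solver\<close>

lemma orthonormal_cancel:
  fixes U :: "real mat"
  assumes U: "U \<in> carrier_mat m k" "transpose_mat U * U = 1\<^sub>m k" and w: "w \<in> carrier_vec k"
  shows "transpose_mat U *\<^sub>v (U *\<^sub>v w) = w"
proof -
  have "transpose_mat U *\<^sub>v (U *\<^sub>v w) = (transpose_mat U * U) *\<^sub>v w"
    by (rule assoc_mult_mat_vec[symmetric, of _ k m _ k]) (use U w in auto)
  then show ?thesis unfolding U(2) using w by simp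
qed

lemma orthonormal_norm:
  assumes U: "U \<in> carrier_mat m k" "transpose_mat U * U = 1\<^sub>m k" and w: "w \<in> carrier_vec k"
  shows "nrm m (fn (U *\<^sub>v w)) = nrm k (fn w)"
proof -
  have "(U *\<^sub>v w) \<bullet> (U *\<^sub>v w) = (transpose_mat U *\<^sub>v (U *\<^sub>v w)) \<bullet> w"
    using U w by (intro transpose_vec_mult_scalar[symmetric]) auto
  also have "transpose_mat U *\<^sub>v (U *\<^sub>v w) = w" by (rule orthonormal_cancel[OF U w])
  finally have "vnorm (U *\<^sub>v w) = vnorm w" by (simp add: vnorm_def)
  then show ?thesis using vnorm_nrm[of "U *\<^sub>v w" m] vnorm_nrm[OF w] U w by simp
qed

text \<open>The witness is the span of the right singular vectors with singular value above
  \<open>\<theta>\<close>; every nonzero vector in it is stretched by more than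
  \<open>\<theta>\<close>.\<close>

lemma singular_family:
  assumes sv: "singular_values E \<sigma>" and E: "E \<in> carrier_mat p q" and \<theta>: "0 \<le> \<theta>"
  shows "has_dim {u \<in> supp q. u = (\<lambda>_. 0) \<or> \<theta> * nrm q u < nrm p (fn (E *\<^sub>v vec q u))} (card {i. i < q \<and> \<theta> < \<sigma> $ i})"
proof -
  have dims: "dim_row E = p" "dim_col E = q" using E by auto
  define D where "D = mat p q (\<lambda>(i, j). if i = j then \<sigma> $ i else 0)"
  have sv': "\<exists>U\<in>carrier_mat p p. \<exists>V\<in>carrier_mat q q. transpose_mat U * U = 1\<^sub>m p \<and> transpose_mat V * V = 1\<^sub>m q \<and> E = U * D * transpose_mat V"
      "\<forall>i j. i \<le> j \<and> j < q \<longrightarrow> \<sigma> $ j \<le> \<sigma> $ i" "\<forall>i<q. p \<le> i \<longrightarrow> \<sigma> $ i = 0"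
    using sv unfolding singular_values_def dims D_def[symmetric] by - ((elim conjE, assumption)+)
  then have sorted: "\<And>i j. i \<le> j \<Longrightarrow> j < q \<Longrightarrow> \<sigma> $ j \<le> \<sigma> $ i" and pad: "\<And>i. i < q \<Longrightarrow> p \<le> i \<Longrightarrow> \<sigma> $ i = 0" by simp_all
  obtain U V where U: "U \<in> carrier_mat p p" "transpose_mat U * U = 1\<^sub>m p"
    and V: "V \<in> carrier_mat q q" "transpose_mat V * V = 1\<^sub>m q" and EU: "E = U * D * transpose_mat V"
    using sv'(1) by (elim bexE conjE)
  have D: "D \<in> carrier_mat p q" by (simp add: D_def)
  define h where "h = card {i. i < q \<and> \<theta> < \<sigma> $ i}"
  have hs: "\<theta> < \<sigma> $ i \<and> i < q" if i: "i < h" for i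
  proof (rule ccontr)
    assume n: "\<not> ?thesis"
    have "{i. i < q \<and> \<theta> < \<sigma> $ i} \<subseteq> {..<i}"
    proof
      fix j assume "j \<in> {i. i < q \<and> \<theta> < \<sigma> $ i}"
      then show "j \<in> {..<i}" using n sorted[of i j] by (cases "i \<le> j") auto
    qed
    from card_mono[OF _ this] i show False by (simp add: h_def)
  qed
  \<comment> \<open>Entries beyond the number of rows are zero padding, so an index whose singular
    value exceeds \<open>\<theta> \<ge> 0\<close> belongs to an actual row.\<close>
  have hp: "i < p" if "i < h" for i using hs[OF that] pad[of i] \<theta> by (cases "p \<le> i") auto
  have hq: "h \<le> q" using card_mono[of "{..<q}" "{i. i < q \<and> \<theta> < \<sigma> $ i}"] by (auto simp: h_def)
  define y where "y c = vec q (\<lambda>i. if i < h then c i else 0)" for c :: "nat \<Rightarrow> real"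
  have y: "y c \<in> carrier_vec q" for c by (simp add: y_def)
  have cb: "comb h c (mcol V) = fn (V *\<^sub>v y c)" for c
  proof -
    have "fn (V *\<^sub>v y c) = comb q (fn (y c)) (mcol V)" by (rule fn_mult_comb[OF V(1) y])
    also have "\<dots> = comb h c (mcol V)"
      unfolding comb_def y_def fn_vec using hq by (intro ext sum.mono_neutral_cong_right) auto
    finally show ?thesis ..
  qed
  have ny: "(nrm q (fn (y c)))\<^sup>2 = (\<Sum>i<h. (c i)\<^sup>2)" for c
    unfolding L2_set_sq y_def fn_vec using hq by (intro sum.mono_neutral_cong_right) auto
  have nV: "nrm q (fn (V *\<^sub>v y c)) = nrm q (fn (y c))" for c by (rule orthonormal_norm[OF V y])
  have nE: "(nrm p (fn (E *\<^sub>v (V *\<^sub>v y c))))\<^sup>2 = (\<Sum>i<h. (\<sigma> $ i * c i)\<^sup>2)" for c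
  proof -
    have "E *\<^sub>v (V *\<^sub>v y c) = U *\<^sub>v (D *\<^sub>v (transpose_mat V *\<^sub>v (V *\<^sub>v y c)))"
    proof -
      have c: "transpose_mat V \<in> carrier_mat q q" "V *\<^sub>v y c \<in> carrier_vec q" using V(1) y by simp_all
      show ?thesis unfolding EU using assoc_mult_mat_vec[OF mult_carrier_mat[OF U(1) D] c]
        assoc_mult_mat_vec[OF U(1) D mult_mat_vec_carrier[OF c]] by (rule trans)
    qed
    also have "transpose_mat V *\<^sub>v (V *\<^sub>v y c) = y c" by (rule orthonormal_cancel[OF V y])
    finally have "nrm p (fn (E *\<^sub>v (V *\<^sub>v y c))) = nrm p (fn (D *\<^sub>v y c))"
      using orthonormal_norm[OF U, of "D *\<^sub>v y c"] D y by simp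
    moreover have "(nrm p (fn (D *\<^sub>v y c)))\<^sup>2 = (\<Sum>i<h. (\<sigma> $ i * c i)\<^sup>2)"
    proof -
      have "fn (D *\<^sub>v y c) i = (if i < h then \<sigma> $ i * c i else 0)" if "i < p" for i
      proof -
        have "fn (D *\<^sub>v y c) i = (\<Sum>j<q. D $$ (i, j) * fn (y c) j)"
          unfolding fn_mult_mat_vec[OF D y] using that by simp
        also have "\<dots> = (\<Sum>j<q. if j = i then (if i < h then \<sigma> $ i * c i else 0) else 0)"
          using that by (intro sum.cong) (auto simp: D_def y_def)
        finally have "fn (D *\<^sub>v y c) i = (\<Sum>j<q. if j = i then (if i < h then \<sigma> $ i * c i else 0) else 0)" .
        then show ?thesis using hs by auto
      qed
      moreover have "h \<le> p" using hp[of p] by (cases "h \<le> p") auto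
      ultimately show ?thesis unfolding L2_set_sq by (intro sum.mono_neutral_cong_right) auto
    qed
    ultimately show ?thesis by simp
  qed
  have ind: "indep h (mcol V)" unfolding indep_def
  proof (intro allI impI)
    fix c k assume a: "comb h c (mcol V) = (\<lambda>_. 0)" "k < h"
    have "(\<Sum>i<h. (c i)\<^sup>2) = 0" using a(1) unfolding ny[symmetric] nV[symmetric] cb[symmetric] by (simp add: L2_set_0')
    then show "c k = 0" using a(2) by (subst (asm) sum_nonneg_eq_0_iff) auto
  qed
  have "comb h c (mcol V) \<in> {u \<in> supp q. u = (\<lambda>_. 0) \<or> \<theta> * nrm q u < nrm p (fn (E *\<^sub>v vec q u))}" for c
  proof -
    have Vy: "V *\<^sub>v y c \<in> carrier_vec q" using V y by simp
    have v: "vec q (fn (V *\<^sub>v y c)) = V *\<^sub>v y c" by (rule vec_fn_id[OF Vy])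
    show ?thesis
    proof (cases "\<forall>k<h. c k = 0")
      case True
      then show ?thesis using comb_zero[of h c "mcol V"] by (simp add: supp_def)
    next
      case False
      then obtain k where k: "k < h" "c k \<noteq> 0" by auto
      have "(\<theta> * nrm q (fn (V *\<^sub>v y c)))\<^sup>2 = (\<Sum>i<h. (\<theta> * c i)\<^sup>2)"
        unfolding power_mult_distrib nV ny by (simp add: sum_distrib_left)
      also have "\<dots> < (\<Sum>i<h. (\<sigma> $ i * c i)\<^sup>2)"
      proof (rule sum_strict_mono_ex1)
        have "\<theta>\<^sup>2 \<le> (\<sigma> $ i)\<^sup>2" if "i < h" for i using hs[OF that] \<theta> by (intro power_mono) auto
        then show "\<forall>i\<in>{..<h}. (\<theta> * c i)\<^sup>2 \<le> (\<sigma> $ i * c i)\<^sup>2" by (auto simp: power_mult_distrib intro: mult_right_mono)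
        have "\<theta>\<^sup>2 < (\<sigma> $ k)\<^sup>2" using hs[OF k(1)] \<theta> by (intro power_strict_mono) auto
        then show "\<exists>i\<in>{..<h}. (\<theta> * c i)\<^sup>2 < (\<sigma> $ i * c i)\<^sup>2" using k by (auto simp: power_mult_distrib intro!: bexI[of _ k])
      qed simp
      also have "\<dots> = (nrm p (fn (E *\<^sub>v (V *\<^sub>v y c))))\<^sup>2" by (simp add: nE)
      finally have "\<theta> * nrm q (fn (V *\<^sub>v y c)) < nrm p (fn (E *\<^sub>v (V *\<^sub>v y c)))" by (rule power_less_imp_less_base) simp
      then show ?thesis unfolding cb using fn_supp[OF Vy] by (simp add: v)
    qed
  qed
  then show ?thesis unfolding has_dim_def h_def[symmetric] using ind by blast
qed

text \<open>Applies \<open>approximate_svd_lift\<close> to a solver output for the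
  \<open>B\<close>-rows of the lifting matrix. The conclusions without a dimension hypothesis hold
  for every partition; they make the layered directions exist also when the spectrum has no
  gap.\<close>

lemma rho_svd_lift:
  assumes P: "P \<in> carrier_mat n n" and rep: "reproducing n S (mcol P)" and S: "subsp S" "S \<subseteq> supp n"
    and part: "B \<union> N = {..<n}" "B \<inter> N = {}" and sv: "singular_values (submatrix P N N) \<sigma>"
    and svd: "rho_svd \<rho> (submatrix (lift_mat P N) B UNIV) C t" and \<rho>: "1 \<le> \<rho>"
  defines "V \<equiv> fn ` ((\<lambda>w. lift_mat P N *\<^sub>v w) ` small_span C t)"
  shows "V \<subseteq> S" "\<exists>d vs. V = range (\<lambda>c. comb d c vs)"
    and "has_dim (cone S B N (\<lambda>_. 1) \<tau>) d \<Longrightarrow> \<not> has_dim (cone S B N (\<lambda>_. 1) 1) (Suc d) \<Longrightarrow> 0 \<le> \<tau> \<Longrightarrow> \<rho> * \<tau> \<le> 1 \<Longrightarrow>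
      has_dim V d \<and> V \<subseteq> cone S B N (\<lambda>_. 1) (\<rho> * \<tau>)"
    and "(\<lambda>w. lift_mat P N *\<^sub>v w) ` small_span C t \<subseteq> carrier_vec n"
proof -
  define q where "q = card N"
  define L where "L = lift_mat P N"
  define E where "E = submatrix L B UNIV"
  define Lf where "Lf u = fn (L *\<^sub>v vec q u)" for u
  define r where "r f = (\<lambda>k. if k < q then f (pick N k) else 0)" for f :: "nat \<Rightarrow> real"
  have L: "L \<in> carrier_mat n q" and lm: "lift_map n q S B N Lf r"
    using lift_map_of_projection[OF P rep S part sv] unfolding L_def q_def Lf_def r_def by auto
  interpret lift_map n q S B N Lf r by (rule lm)
  have fin: "finite N" "finite B" and Bn: "B \<subseteq> {..<n}" using partition_finite[OF part(1)] part by auto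
  have cardB: "card {i. i < n \<and> i \<in> B} = card B" using Bn by (intro arg_cong[of _ _ card]) auto
  have E: "E \<in> carrier_mat (card B) q" "\<And>i j. i < card B \<Longrightarrow> j < q \<Longrightarrow> E $$ (i, j) = L $$ (pick B i, j)"
  proof -
    have dL: "dim_row L = n" "dim_col L = q" using L by auto
    have U: "card {i. i < q \<and> i \<in> UNIV} = q" by simp
    show "E \<in> carrier_mat (card B) q" unfolding E_def submatrix_def dL cardB U by simp
    show "E $$ (i, j) = L $$ (pick B i, j)" if "i < card B" "j < q" for i j
      using that unfolding E_def submatrix_def dL cardB U by (simp add: pick_UNIV)
  qed
  have nE: "nrm (card B) (fn (E *\<^sub>v vec q u)) = L2_set (Lf u) B" for u
  proof -
    have "nrm (card B) (fn (E *\<^sub>v vec q u)) = nrm (card B) (\<lambda>k. Lf u (pick B k))"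
    proof (rule L2_set_cong)
      fix k assume "k \<in> {..<card B}"
      then have k: "k < card B" "pick B k < n" using bij_betwE[OF pick_bij[OF fin(2)]] Bn by auto
      then show "fn (E *\<^sub>v vec q u) k = Lf u (pick B k)"
        unfolding Lf_def fn_mult_mat_vec[OF E(1) vec_carrier] fn_mult_mat_vec[OF L vec_carrier] by (simp add: E(2))
    qed simp
    then show ?thesis by (simp add: L2_set_pick[OF fin(2)])
  qed
  have dE: "dim_col E = q" using E by simp
  obtain \<sigma>' where C: "C \<in> carrier_mat q q" "orthogonal_mat C" and t: "t \<in> carrier_vec q" "\<And>i. i < q \<Longrightarrow> 0 \<le> t $ i"
      "\<And>i j. i \<le> j \<Longrightarrow> j < q \<Longrightarrow> t $ j \<le> t $ i"
    and bd: "\<And>i u. i < q \<Longrightarrow> u \<in> vec_span q (col C ` {i..<q}) \<Longrightarrow> vnorm (E *\<^sub>v u) \<le> t $ i * vnorm u"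
    and \<sigma>': "singular_values E \<sigma>'" "\<And>i. i < q \<Longrightarrow> inverse \<rho> * t $ i \<le> \<sigma>' $ i"
  proof -
    have svd': "C \<in> carrier_mat q q" "orthogonal_mat C" "t \<in> carrier_vec q" "\<forall>i<q. 0 \<le> t $ i" "\<forall>i j. i \<le> j \<and> j < q \<longrightarrow> t $ j \<le> t $ i"
      "\<forall>i<q. \<forall>u\<in>vec_span q (col C ` {i..<q}). vnorm (E *\<^sub>v u) \<le> t $ i * vnorm u"
      "\<exists>\<sigma>. singular_values E \<sigma> \<and> (\<forall>i<q. inverse \<rho> * t $ i \<le> \<sigma> $ i \<and> \<sigma> $ i \<le> t $ i)"
      using svd unfolding rho_svd_def Let_def L_def[symmetric] E_def[symmetric] dE by - ((elim conjE, assumption)+)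
    from svd'(7) obtain \<sigma>' where "singular_values E \<sigma>'" "\<forall>i<q. inverse \<rho> * t $ i \<le> \<sigma>' $ i \<and> \<sigma>' $ i \<le> t $ i" by (elim exE conjE)
    with svd' show thesis by (intro that[of \<sigma>']) simp_all
  qed
  define sp where "sp i = {u. \<exists>c. u = (\<lambda>k. \<Sum>j\<in>{i..<q}. c j * mcol C j k)}" for i
  have mC: "mcol C j \<in> supp q" if "j < q" for j unfolding mcol_def using C(1) that by (intro fn_supp) auto
  have spq: "u \<in> supp q" if "u \<in> sp i" for u i using that mC by (auto simp: sp_def supp_def)
  have span: "u \<in> vec_span q (col C ` {i..<q}) \<longleftrightarrow> u \<in> carrier_vec q \<and> fn u \<in> sp i" for u i
    unfolding vec_span_cols[OF C] sp_def by simp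
  define p where "p = card {i. i < q \<and> t $ i \<le> 1}"
  have ss: "small_span C t = vec_span q (col C ` {q - p..<q})"
    unfolding small_span_def Let_def p_def using C(1) t(1) by simp
  have vfn: "vec q (fn w) = w" if "w \<in> carrier_vec q" for w
    by (rule eq_vecI) (use that in \<open>auto simp: fn_def\<close>)
  have Veq: "V = Lf ` sp (q - p)"
  proof (intro equalityI subsetI)
    fix f assume "f \<in> V"
    then obtain w where w: "w \<in> small_span C t" "f = fn (L *\<^sub>v w)" by (auto simp: V_def L_def)
    then have "w \<in> carrier_vec q" "fn w \<in> sp (q - p)" unfolding ss span by auto
    then show "f \<in> Lf ` sp (q - p)" unfolding w(2) Lf_def using vfn by (intro image_eqI[of _ _ "fn w"]) auto
  next
    fix f assume "f \<in> Lf ` sp (q - p)"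
    then obtain u where u: "u \<in> sp (q - p)" "f = Lf u" by auto
    then have "vec q u \<in> small_span C t" unfolding ss span using vec_fn[OF spq[OF u(1)]] by simp
    then show "f \<in> V" unfolding V_def u(2) Lf_def L_def by blast
  qed
  show "V \<subseteq> S" unfolding Veq using L_S spq by blast
  show "(\<lambda>w. lift_mat P N *\<^sub>v w) ` small_span C t \<subseteq> carrier_vec n"
    using L unfolding L_def[symmetric] ss by (auto simp: span)
  have Lf0: "Lf (\<lambda>_. 0) = (\<lambda>_. 0)" by (rule L_zero)
  have Lc: "Lf (comb e c vs) = comb e c (\<lambda>k. Lf (vs k))" for e c vs
    by (induction e) (simp_all add: Lf0 comb_Suc L_add L_scale)
  show "\<exists>d vs. V = range (\<lambda>c. comb d c vs)"
  proof (intro exI)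
    define i0 where "i0 = q - p"
    have i0: "i0 \<le> q" by (simp add: i0_def)
    define vs where "vs = (\<lambda>k. mcol C (i0 + k))"
    have sh: "(\<Sum>j\<in>{i0..<q}. c j * mcol C j k) = comb (q - i0) (\<lambda>j. c (i0 + j)) vs k" for c k
    proof -
      have "(\<Sum>j\<in>{i0..<q}. c j * mcol C j k) = (\<Sum>j\<in>{0 + i0..<(q - i0) + i0}. c j * mcol C j k)" using i0 by simp
      also have "\<dots> = (\<Sum>j\<in>{0..<q - i0}. c (i0 + j) * mcol C (i0 + j) k)" unfolding sum.shift_bounds_nat_ivl by (simp add: add.commute)
      finally show ?thesis by (simp add: comb_def vs_def lessThan_atLeast0)
    qed
    have "sp i0 = range (\<lambda>c. comb (q - i0) c vs)"
    proof (intro equalityI subsetI)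
      fix u assume "u \<in> sp i0"
      then obtain c where "u = (\<lambda>k. \<Sum>j\<in>{i0..<q}. c j * mcol C j k)" by (auto simp: sp_def)
      then show "u \<in> range (\<lambda>c. comb (q - i0) c vs)" unfolding sh by blast
    next
      fix u assume "u \<in> range (\<lambda>c. comb (q - i0) c vs)"
      then obtain c where c: "u = comb (q - i0) c vs" by blast
      have "u = (\<lambda>k. \<Sum>j\<in>{i0..<q}. c (j - i0) * mcol C j k)" unfolding sh c by simp
      then show "u \<in> sp i0" unfolding sp_def by (intro CollectI exI[of _ "\<lambda>j. c (j - i0)"])
    qed
    then show "V = range (\<lambda>c. comb (q - i0) c (\<lambda>k. Lf (vs k)))"
      unfolding Veq i0_def[symmetric] by (simp add: image_image Lc)
  qed
  assume d: "has_dim (cone S B N (\<lambda>_. 1) \<tau>) d" "\<not> has_dim (cone S B N (\<lambda>_. 1) 1) (Suc d)" "0 \<le> \<tau>" "\<rho> * \<tau> \<le> 1"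
  have ortho: "ip q (mcol C i) (mcol C j) = 0 \<longleftrightarrow> i \<noteq> j" if "i < q" "j < q" for i j
    using orthogonal_matD[OF C(2), of i j] that C(1) scalar_prod_ip[of "col C i" q "col C j"] by (simp add: mcol_def)
  have sorted: "\<And>i j. i \<le> j \<Longrightarrow> j < q \<Longrightarrow> \<sigma>' $ j \<le> \<sigma>' $ i" "\<And>i. i < q \<Longrightarrow> 0 \<le> \<sigma>' $ i"
    using \<sigma>'(1) unfolding singular_values_def dE by auto
  have A: "L2_set (Lf u) B \<le> t $ i * nrm q u" if "i < q" "u \<in> {u. \<exists>c. u = (\<lambda>k. \<Sum>j\<in>{i..<q}. c j * mcol C j k)}" for i u
  proof -
    have u: "u \<in> sp i" using that(2) by (simp add: sp_def)
    have "vec q u \<in> vec_span q (col C ` {i..<q})" unfolding span using vec_fn[OF spq[OF u]] u by simp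
    from bd[OF that(1) this] show ?thesis
      using vnorm_nrm[of "E *\<^sub>v vec q u" "card B"] vnorm_nrm[of "vec q u" q] E(1) vec_fn[OF spq[OF u]] nE[of u] by simp
  qed
  have T: "t $ i \<le> \<rho> * \<sigma>' $ i" if "i < q" for i using \<sigma>'(2)[OF that] \<rho> by (simp add: field_simps)
  have F: "has_dim {u \<in> supp q. u = (\<lambda>_. 0) \<or> \<theta> * nrm q u < L2_set (Lf u) B} (card {i. i < q \<and> \<theta> < \<sigma>' $ i})" if "0 \<le> \<theta>" for \<theta>
    using singular_family[OF \<sigma>'(1) E(1) that] unfolding nE .
  have "has_dim (Lf ` sp (q - p)) d" "Lf ` sp (q - p) \<subseteq> cone S B N (\<lambda>_. 1) (\<rho> * \<tau>)"
    unfolding sp_def p_def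
    using approximate_svd_lift[of "mcol C" "\<lambda>i. t $ i" "\<lambda>i. \<sigma>' $ i" \<rho> \<tau> d, OF mC _ _ t(3) t(2) A sorted T F d \<rho>] ortho by auto
  then show "has_dim V d \<and> V \<subseteq> cone S B N (\<lambda>_. 1) (\<rho> * \<tau>)" unfolding Veq by simp
qed

subsection \<open>Linear programs\<close>

lemma fn_cmult: "v \<in> carrier_vec n \<Longrightarrow> w \<in> carrier_vec n \<Longrightarrow> fn (v \<odot> w) = (\<lambda>i. fn v i * fn w i)"
  by (auto simp: fn_def component_mult_def)

lemma fn_cinv: "fn (cinv v) = (\<lambda>i. inverse (fn v i))"
  by (auto simp: fn_def cinv_def)

lemma cmult_carrier: "v \<in> carrier_vec n \<Longrightarrow> w \<in> carrier_vec n \<Longrightarrow> v \<odot> w \<in> carrier_vec n"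
  by (auto simp: component_mult_def)

lemma cinv_carrier: "v \<in> carrier_vec n \<Longrightarrow> cinv v \<in> carrier_vec n"
  by (auto simp: cinv_def)

lemma fn_ones: "fn (ones n) = (\<lambda>i. if i < n then 1 else 0)"
  by (simp add: ones_def)

lemma kerW_fn:
  assumes A: "A \<in> carrier_mat m n"
  shows "fn ` kerW A = {f \<in> supp n. \<forall>r<m. (\<Sum>j<n. A $$ (r, j) * f j) = 0}"
proof (intro equalityI subsetI)
  fix f assume "f \<in> fn ` kerW A"
  then obtain v where v: "v \<in> carrier_vec n" "A *\<^sub>v v = 0\<^sub>v m" "f = fn v" using A by (auto simp: mat_kernel_def)
  have "(\<Sum>j<n. A $$ (r, j) * fn v j) = 0" if "r < m" for r
  proof -
    have "fn (A *\<^sub>v v) r = 0" unfolding v(2) by (simp add: fn_def)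
    then show ?thesis unfolding fn_mult_mat_vec[OF A v(1)] using that by simp
  qed
  then show "f \<in> {f \<in> supp n. \<forall>r<m. (\<Sum>j<n. A $$ (r, j) * f j) = 0}" using fn_supp[OF v(1)] unfolding v(3) by simp
next
  fix f assume f: "f \<in> {f \<in> supp n. \<forall>r<m. (\<Sum>j<n. A $$ (r, j) * f j) = 0}"
  then have fv: "fn (vec n f) = f" by (intro vec_fn) auto
  have "fn (A *\<^sub>v vec n f) = fn (0\<^sub>v m)"
    unfolding fn_mult_mat_vec[OF A vec_carrier] fv using f by (auto simp: fn_def)
  then have "A *\<^sub>v vec n f = 0\<^sub>v m" using A by (intro fn_inj[of _ m]) auto
  then have "vec n f \<in> kerW A" using A by (auto simp: mat_kernel_def)
  then show "f \<in> fn ` kerW A" using fv by (intro image_eqI[of _ _ "vec n f"]) auto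
qed

lemma kerW_perp_fn:
  assumes A: "A \<in> carrier_mat m n"
  shows "fn ` kerW_perp A = range (\<lambda>c. comb m c (mcol (transpose_mat A)))"
proof -
  have T: "transpose_mat A \<in> carrier_mat n m" using A by simp
  have "fn ` kerW_perp A = {fn (transpose_mat A *\<^sub>v y) | y. y \<in> carrier_vec m}" using A by (auto simp: mat_image_def)
  also have "\<dots> = {comb m (fn y) (mcol (transpose_mat A)) | y. y \<in> carrier_vec m}" using fn_mult_comb[OF T] by (intro Collect_cong) metis
  also have "\<dots> = range (\<lambda>c. comb m c (mcol (transpose_mat A)))"
  proof (intro equalityI subsetI)
    fix f assume "f \<in> range (\<lambda>c. comb m c (mcol (transpose_mat A)))"
    then obtain c where c: "f = comb m c (mcol (transpose_mat A))" by blast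
    have "f = comb m (fn (vec m c)) (mcol (transpose_mat A))" unfolding c by (rule comb_cong) auto
    then show "f \<in> {comb m (fn y) (mcol (transpose_mat A)) | y. y \<in> carrier_vec m}" by (intro CollectI exI[of _ "vec m c"]) auto
  qed auto
  finally show ?thesis .
qed

lemma range_comb_subsp: "subsp (range (\<lambda>c. comb d c vs))"
  unfolding subsp_def
proof (intro conjI ballI allI)
  show "(\<lambda>_. 0) \<in> range (\<lambda>c. comb d c vs)" by (rule image_eqI[of _ _ "\<lambda>_. 0"]) (auto simp: comb_def)
  fix f assume "f \<in> range (\<lambda>c. comb d c vs)"
  then obtain c where c: "f = comb d c vs" by blast
  show "(\<lambda>i. a * f i) \<in> range (\<lambda>c. comb d c vs)" for a unfolding c comb_scale[symmetric] by blast
  fix g assume "g \<in> range (\<lambda>c. comb d c vs)"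
  then obtain c' where c': "g = comb d c' vs" by blast
  show "(\<lambda>i. f i + g i) \<in> range (\<lambda>c. comb d c vs)" unfolding c c' comb_add[symmetric] by blast
qed

text \<open>The image of the transpose is spanned by the rows of \<open>A\<close>, so its orthogonal
  complement is the kernel; a double complement gives the orientation used by
  \<open>orth_pair\<close>.\<close>

lemma orth_pair_kernel:
  assumes A: "A \<in> carrier_mat m n"
  shows "orth_pair n (fn ` kerW A) (fn ` kerW_perp A)"
proof -
  let ?W = "fn ` kerW A" and ?W' = "fn ` kerW_perp A"
  have T: "transpose_mat A \<in> carrier_mat n m" using A by simp
  have ip: "ip n f (mcol (transpose_mat A) r) = (\<Sum>j<n. A $$ (r, j) * f j)" if "r < m" for f r
    unfolding ip_def mcol_def fn_col[OF T that] using A that by (intro sum.cong) auto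
  have W': "subsp ?W'" unfolding kerW_perp_fn[OF A] by (rule range_comb_subsp)
  have W's: "?W' \<subseteq> supp n" using A by (auto simp: mat_image_def intro!: fn_supp)
  have "?W = perp n ?W'"
    unfolding kerW_fn[OF A] kerW_perp_fn[OF A] perp_def
  proof (intro equalityI subsetI)
    fix f assume "f \<in> {f \<in> supp n. \<forall>r<m. (\<Sum>j<n. A $$ (r, j) * f j) = 0}"
    then show "f \<in> {f \<in> supp n. \<forall>g\<in>range (\<lambda>c. comb m c (mcol (transpose_mat A))). ip n f g = 0}"
      by (auto simp: ip_comb ip)
  next
    fix f assume f: "f \<in> {f \<in> supp n. \<forall>g\<in>range (\<lambda>c. comb m c (mcol (transpose_mat A))). ip n f g = 0}"
    have "(\<Sum>j<n. A $$ (r, j) * f j) = 0" if "r < m" for r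
    proof -
      have "mcol (transpose_mat A) r \<in> range (\<lambda>c. comb m c (mcol (transpose_mat A)))"
        unfolding comb_unit[OF that, of "mcol (transpose_mat A)", symmetric] by (rule rangeI)
      then show ?thesis using f ip[OF that, of f] by auto
    qed
    then show "f \<in> {f \<in> supp n. \<forall>r<m. (\<Sum>j<n. A $$ (r, j) * f j) = 0}" using f by auto
  qed
  then show ?thesis using W' W's perp_perp[OF W' W's] subsp_perp perp_supp by unfold_locales auto
qed

text \<open>One strictly feasible point on each side is fixed, so that feasibility becomes
  membership of differences in \<open>W\<close> and \<open>W'\<close>, with no reference to
  \<open>b\<close>, \<open>c\<close> or the multipliers.\<close>

locale lp_data =
  fixes n m :: nat and A :: "real mat" and b c xv sv :: "real vec"
  assumes n_pos: "0 < n" and A: "A \<in> carrier_mat m n" and xv: "xv \<in> primal_pos A b" and sv: "sv \<in> dual_pos A c"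
begin

abbreviation "W \<equiv> fn ` kerW A"
abbreviation "W' \<equiv> fn ` kerW_perp A"

lemma dimA: "dim_col A = n" "dim_row A = m" using A by auto

lemma xv_car: "xv \<in> carrier_vec n" and sv_car: "sv \<in> carrier_vec n"
  using xv sv by (auto simp: primal_pos_def primal_def dual_pos_def dual_def dimA)

sublocale orth_pair n W W' by (rule orth_pair_kernel[OF A])

sublocale lp_pair n W W' "fn xv" "fn sv"
proof
  show "fn xv \<in> supp n" "fn sv \<in> supp n" using fn_supp xv_car sv_car by auto
  show "0 < fn xv i" "0 < fn sv i" if "i < n" for i
    using xv sv that xv_car sv_car by (auto simp: primal_pos_def dual_pos_def dimA fn_def)
qed

lemma W_mem: "v \<in> carrier_vec n \<Longrightarrow> fn v \<in> W \<longleftrightarrow> v \<in> kerW A"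
  using fn_inj[of v n] A by (auto simp: mat_kernel_def)

lemma W'_mem: "v \<in> carrier_vec n \<Longrightarrow> fn v \<in> W' \<longleftrightarrow> v \<in> kerW_perp A"
proof
  assume v: "v \<in> carrier_vec n" "fn v \<in> W'"
  then obtain w where "w \<in> kerW_perp A" "fn v = fn w" by auto
  moreover have "w \<in> carrier_vec n" using \<open>w \<in> kerW_perp A\<close> A by (auto simp: mat_image_def)
  ultimately show "v \<in> kerW_perp A" using fn_inj[OF v(1)] by auto
qed auto

lemma W_car: "v \<in> kerW A \<Longrightarrow> v \<in> carrier_vec n" and W'_car: "v \<in> kerW_perp A \<Longrightarrow> v \<in> carrier_vec n"
  using A by (auto simp: mat_kernel_def mat_image_def)

lemma primal_pos_iff: "x \<in> primal_pos A b \<longleftrightarrow> x \<in> carrier_vec n \<and> fn x \<in> PP"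
proof (cases "x \<in> carrier_vec n")
  case x: True
  have d: "fn (x - xv) = (\<lambda>i. fn x i - fn xv i)" by (rule fn_minus[OF x xv_car])
  have xd: "x - xv \<in> carrier_vec n" using x xv_car by simp
  have b: "A *\<^sub>v xv = b" using xv by (simp add: primal_pos_def primal_def)
  have bc: "b \<in> carrier_vec m" unfolding b[symmetric] using A xv_car by simp
  have "A *\<^sub>v (x - xv) = A *\<^sub>v x - b" using mult_minus_distrib_mat_vec[OF A x xv_car] b by simp
  then have "A *\<^sub>v x = b \<longleftrightarrow> x - xv \<in> kerW A"
  proof -
    assume e: "A *\<^sub>v (x - xv) = A *\<^sub>v x - b"
    have Ax: "A *\<^sub>v x \<in> carrier_vec m" using A x by simp
    have "A *\<^sub>v x - b = 0\<^sub>v m \<longleftrightarrow> A *\<^sub>v x = b"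
    proof
      assume z: "A *\<^sub>v x - b = 0\<^sub>v m"
      show "A *\<^sub>v x = b"
      proof (rule eq_vecI)
        fix i assume i: "i < dim_vec b"
        then have "(A *\<^sub>v x - b) $ i = 0" using bc z by simp
        then show "(A *\<^sub>v x) $ i = b $ i" using i bc Ax by simp
      qed (use carrier_vecD[OF Ax] carrier_vecD[OF bc] in simp)
    qed (use bc in simp)
    then show ?thesis using xd e A by (auto simp: mat_kernel_def)
  qed
  then have "A *\<^sub>v x = b \<longleftrightarrow> (\<lambda>i. fn x i - fn xv i) \<in> W" unfolding W_mem[OF xd, symmetric] d .
  moreover have "(\<forall>i<n. 0 < x $ i) \<longleftrightarrow> (\<forall>i<n. 0 < fn x i)" using x by (auto simp: fn_def)
  ultimately show ?thesis using x fn_supp[OF x]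
    by (auto simp: primal_pos_def primal_def strict_feas_def dimA less_imp_le)
qed (auto simp: primal_pos_def primal_def dimA)

lemma dual_pos_iff: "s \<in> dual_pos A c \<longleftrightarrow> s \<in> carrier_vec n \<and> fn s \<in> DD"
proof (cases "s \<in> carrier_vec n")
  case s: True
  have T: "transpose_mat A \<in> carrier_mat n m" using A by simp
  have d: "fn (s - sv) = (\<lambda>i. fn s i - fn sv i)" by (rule fn_minus[OF s sv_car])
  have sd: "s - sv \<in> carrier_vec n" using s sv_car by simp
  obtain y0 where y0: "y0 \<in> carrier_vec m" "transpose_mat A *\<^sub>v y0 + sv = c"
    using sv by (auto simp: dual_pos_def dual_def dimA)
  have "(\<exists>y\<in>carrier_vec m. transpose_mat A *\<^sub>v y + s = c) \<longleftrightarrow> s - sv \<in> kerW_perp A"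
  proof
    assume "\<exists>y\<in>carrier_vec m. transpose_mat A *\<^sub>v y + s = c"
    then obtain y where y: "y \<in> carrier_vec m" "transpose_mat A *\<^sub>v y + s = transpose_mat A *\<^sub>v y0 + sv" using y0 by auto
    have "s - sv = transpose_mat A *\<^sub>v (y0 - y)"
    proof (rule eq_vecI)
      fix i assume "i < dim_vec (transpose_mat A *\<^sub>v (y0 - y))"
      then have i: "i < n" using T by simp
      have "(transpose_mat A *\<^sub>v y + s) $ i = (transpose_mat A *\<^sub>v y0 + sv) $ i" using y by simp
      then show "(s - sv) $ i = (transpose_mat A *\<^sub>v (y0 - y)) $ i"
        using i s sv_car T by (simp add: mult_minus_distrib_mat_vec[OF T y0(1) y(1)])
    qed (use carrier_vecD[OF sd] A in simp)
    then show "s - sv \<in> kerW_perp A" using y0 y A by (auto simp: mat_image_def)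
  next
    assume "s - sv \<in> kerW_perp A"
    then obtain y where y: "y \<in> carrier_vec m" "s - sv = transpose_mat A *\<^sub>v y" using A by (auto simp: mat_image_def)
    have "transpose_mat A *\<^sub>v (y0 - y) + s = c"
    proof (rule eq_vecI)
      fix i assume "i < dim_vec c"
      moreover have "dim_vec c = n" unfolding y0(2)[symmetric] using sv_car by simp
      ultimately have i: "i < n" by simp
      have "(s - sv) $ i = (transpose_mat A *\<^sub>v y) $ i" using y by simp
      moreover have "c $ i = (transpose_mat A *\<^sub>v y0 + sv) $ i" using y0 by simp
      ultimately show "(transpose_mat A *\<^sub>v (y0 - y) + s) $ i = c $ i"
        using i s sv_car T by (simp add: mult_minus_distrib_mat_vec[OF T y0(1) y(1)])
    qed (use s sv_car y0(2)[symmetric] in auto)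
    then show "\<exists>y\<in>carrier_vec m. transpose_mat A *\<^sub>v y + s = c"
      by (rule bexI[of _ "y0 - y"]) (use y0(1) y(1) in simp)
  qed
  then have "(\<exists>y\<in>carrier_vec m. transpose_mat A *\<^sub>v y + s = c) \<longleftrightarrow> (\<lambda>i. fn s i - fn sv i) \<in> W'"
    unfolding W'_mem[OF sd, symmetric] d .
  moreover have "(\<forall>i<n. 0 < s $ i) \<longleftrightarrow> (\<forall>i<n. 0 < fn s i)" using s by (auto simp: fn_def)
  ultimately show ?thesis using s fn_supp[OF s]
    by (auto simp: dual_pos_def dual_def strict_feas_def dimA less_imp_le)
qed (auto simp: dual_pos_def dual_def dimA)

lemma mubar_fn: "x \<in> carrier_vec n \<Longrightarrow> s \<in> carrier_vec n \<Longrightarrow> mubar (x, s) = ip n (fn x) (fn s) / n"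
  unfolding mubar_def by (simp add: scalar_prod_ip)

lemma mubar_pos: "x \<in> primal_pos A b \<Longrightarrow> s \<in> dual_pos A c \<Longrightarrow> 0 < mubar (x, s)"
proof -
  assume a: "x \<in> primal_pos A b" "s \<in> dual_pos A c"
  then have f: "fn x \<in> PP" "fn s \<in> DD" "x \<in> carrier_vec n" "s \<in> carrier_vec n" by (auto simp: primal_pos_iff dual_pos_iff)
  have "0 < ip n (fn x) (fn s)" unfolding ip_def
  proof (rule sum_pos)
    fix i assume "i \<in> {..<n}"
    then show "0 < fn x i * fn s i" using feas_pos(1)[OF f(1)] feas_pos(2)[OF f(2)] by simp
  qed (use n_pos in auto)
  then show ?thesis unfolding mubar_fn[OF f(3,4)] using n_pos by simp
qed

lemma nbhd_iff:
  "(x, s) \<in> nbhd A b c \<beta> \<longleftrightarrow> x \<in> primal_pos A b \<and> s \<in> dual_pos A c \<and>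
     nrm n (\<lambda>i. fn x i * fn s i - mubar (x, s)) \<le> \<beta> * mubar (x, s)"
proof (cases "x \<in> primal_pos A b \<and> s \<in> dual_pos A c")
  case True
  define \<mu> where "\<mu> = mubar (x, s)"
  have \<mu>: "0 < \<mu>" using mubar_pos True by (simp add: \<mu>_def)
  have car: "x \<in> carrier_vec n" "s \<in> carrier_vec n" using True by (auto simp: primal_pos_iff dual_pos_iff)
  have xs: "x \<odot> s \<in> carrier_vec n" by (rule cmult_carrier[OF car])
  have "vnorm (inverse \<mu> \<cdot>\<^sub>v (x \<odot> s) - ones n) = nrm n (\<lambda>i. inverse \<mu> * (fn x i * fn s i - \<mu>))"
  proof -
    have "vnorm (inverse \<mu> \<cdot>\<^sub>v (x \<odot> s) - ones n) = nrm n (fn (inverse \<mu> \<cdot>\<^sub>v (x \<odot> s) - ones n))"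
      using xs by (intro vnorm_nrm) (auto simp: ones_def)
    also have "fn (inverse \<mu> \<cdot>\<^sub>v (x \<odot> s) - ones n) = (\<lambda>i. inverse \<mu> * (fn x i * fn s i) - fn (ones n) i)"
      using xs by (subst fn_minus[of _ n]) (auto simp: fn_smult fn_cmult[OF car] ones_def)
    also have "nrm n \<dots> = nrm n (\<lambda>i. inverse \<mu> * (fn x i * fn s i - \<mu>))"
      using \<mu> by (intro L2_set_cong) (auto simp: fn_ones algebra_simps)
    finally show ?thesis .
  qed
  also have "\<dots> = inverse \<mu> * nrm n (\<lambda>i. fn x i * fn s i - \<mu>)" unfolding nrm_scale using \<mu> by simp
  finally have "vnorm (inverse \<mu> \<cdot>\<^sub>v (x \<odot> s) - ones n) \<le> \<beta> \<longleftrightarrow> nrm n (\<lambda>i. fn x i * fn s i - \<mu>) \<le> \<beta> * \<mu>"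
  proof -
    assume e: "vnorm (inverse \<mu> \<cdot>\<^sub>v (x \<odot> s) - ones n) = inverse \<mu> * nrm n (\<lambda>i. fn x i * fn s i - \<mu>)"
    show ?thesis unfolding e using \<mu> by (simp add: pos_divide_le_eq divide_inverse[symmetric] mult.commute[of "inverse \<mu>"])
  qed
  then show ?thesis using True by (simp add: nbhd_def dimA \<mu>_def)
qed (auto simp: nbhd_def)

text \<open>Existence and uniqueness for functions give the definite description in
  \<open>cp_pos\<close> its meaning.\<close>

lemma cp_on_path:
  assumes \<mu>: "0 < \<mu>"
  shows "on_path \<mu> (fn (fst (cp A b c \<mu>))) (fn (snd (cp A b c \<mu>)))" "cp A b c \<mu> \<in> carrier_vec n \<times> carrier_vec n"
proof -
  let ?P = "\<lambda>z. fst z \<in> primal_pos A b \<and> snd z \<in> dual_pos A c \<and> fst z \<odot> snd z = \<mu> \<cdot>\<^sub>v ones (dim_col A)"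
  have iff: "?P (x, s) \<longleftrightarrow> x \<in> carrier_vec n \<and> s \<in> carrier_vec n \<and> on_path \<mu> (fn x) (fn s)" for x s
  proof (cases "x \<in> carrier_vec n \<and> s \<in> carrier_vec n")
    case True
    then have car: "x \<in> carrier_vec n" "s \<in> carrier_vec n" by auto
    have "x \<odot> s = \<mu> \<cdot>\<^sub>v ones n \<longleftrightarrow> fn (x \<odot> s) = fn (\<mu> \<cdot>\<^sub>v ones n)"
      using fn_inj[OF cmult_carrier[OF car], of "\<mu> \<cdot>\<^sub>v ones n"] by (auto simp: ones_def)
    also have "\<dots> \<longleftrightarrow> (\<forall>i<n. fn x i * fn s i = \<mu>)"
      unfolding fn_cmult[OF car] fn_smult fn_ones using car by (auto simp: fun_eq_iff fn_def)
    finally show ?thesis using car by (simp add: on_path_def primal_pos_iff dual_pos_iff dimA)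
  qed (auto simp: primal_pos_iff dual_pos_iff)
  obtain X S where XS: "on_path \<mu> X S" using on_path_exists[OF \<mu>] by blast
  have sup: "X \<in> supp n" "S \<in> supp n" using XS by (auto simp: on_path_def strict_feas_def)
  have ex: "?P (vec n X, vec n S)" unfolding iff using XS vec_fn[OF sup(1)] vec_fn[OF sup(2)] by simp
  have "cp A b c \<mu> = (THE z. ?P z)" using \<mu> by (simp add: cp_def cp_pos_def)
  also have "\<dots> = (vec n X, vec n S)"
  proof (rule the_equality, rule ex)
    fix z assume z: "?P z"
    obtain x s where xs: "z = (x, s)" by (cases z)
    have p: "x \<in> carrier_vec n" "s \<in> carrier_vec n" "on_path \<mu> (fn x) (fn s)" using z iff unfolding xs by auto
    show "z = (vec n X, vec n S)" unfolding xs
      using on_path_unique[OF p(3) XS] fn_inj[OF p(1), of "vec n X"] fn_inj[OF p(2), of "vec n S"] vec_fn[OF sup(1)] vec_fn[OF sup(2)] by simp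
  qed
  finally have e: "cp A b c \<mu> = (vec n X, vec n S)" .
  show "on_path \<mu> (fn (fst (cp A b c \<mu>))) (fn (snd (cp A b c \<mu>)))" "cp A b c \<mu> \<in> carrier_vec n \<times> carrier_vec n"
    unfolding e using XS vec_fn[OF sup(1)] vec_fn[OF sup(2)] by simp_all
qed

end

lemma lp_instance_data: "lp_instance n m A b c \<Longrightarrow> \<exists>xv sv. lp_data n m A b c xv sv"
  unfolding lp_instance_def lp_data_def by blast

subsection \<open>Lift subspaces and one iteration of the algorithm\<close>

lemma scl_mult_cancel:
  assumes "K \<subseteq> supp n" "\<And>i. i < n \<Longrightarrow> y i \<noteq> 0" "f \<in> scl y K"
  shows "(\<lambda>i. f i * y i) \<in> K"
proof -
  obtain g where g: "g \<in> K" "f = (\<lambda>i. g i / y i)" using assms(3) by (auto simp: scl_def)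
  have "f i * y i = g i" for i using g assms(1,2) by (cases "i < n") (auto simp: supp_def)
  then show ?thesis using g(1) by simp
qed

lemma cscale_fn:
  assumes "V \<subseteq> carrier_vec n" "x \<in> carrier_vec n"
  shows "fn ` cscale x V = (\<lambda>f i. f i * fn x i) ` fn ` V" "cscale x V \<subseteq> carrier_vec n"
proof -
  have "fn (x \<odot> v) = (\<lambda>i. fn v i * fn x i)" if "v \<in> V" for v
    using fn_cmult[OF assms(2), of v] that assms(1) by (auto simp: mult.commute)
  then show "fn ` cscale x V = (\<lambda>f i. f i * fn x i) ` fn ` V" by (auto simp: cscale_def image_image)
  show "cscale x V \<subseteq> carrier_vec n" using assms cmult_carrier by (auto simp: cscale_def)
qed

lemma range_comb_mult:
  assumes "F = range (\<lambda>c. comb d c vs)"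
  shows "(\<lambda>f i. f i * y i) ` F = range (\<lambda>c. comb d c (\<lambda>k i. vs k i * y i))"
proof -
  have "comb d c (\<lambda>k i. vs k i * y i) = (\<lambda>i. comb d c vs i * y i)" for c
    by (simp add: comb_def sum_distrib_right mult.assoc)
  then show ?thesis unfolding assms by (auto simp: image_image)
qed

text \<open>Undoes the coordinatewise scaling: the lifting map works in \<open>scl y W\<close> with
  unit weights, the cheap cones are taken in \<open>W\<close> with weights \<open>y\<close>.\<close>

lemma scaled_lift_props:
  assumes y: "\<And>i. i < n \<Longrightarrow> y i \<noteq> 0" and W: "W \<subseteq> supp n"
    and V0: "V0 \<subseteq> scl y W" "\<exists>d vs. V0 = range (\<lambda>c. comb d c vs)"
    and dim: "\<And>\<tau> d. has_dim (cone (scl y W) B N (\<lambda>_. 1) \<tau>) d \<Longrightarrow> \<not> has_dim (cone (scl y W) B N (\<lambda>_. 1) 1) (Suc d)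
      \<Longrightarrow> 0 \<le> \<tau> \<Longrightarrow> \<rho> * \<tau> \<le> 1 \<Longrightarrow> has_dim V0 d \<and> V0 \<subseteq> cone (scl y W) B N (\<lambda>_. 1) (\<rho> * \<tau>)"
    and V: "V = (\<lambda>f i. f i * y i) ` V0"
  shows "V \<subseteq> W" "\<exists>d vs. V = range (\<lambda>c. comb d c vs)"
    and "has_dim (cone W B N y \<tau>) d \<Longrightarrow> \<not> has_dim (cone W B N y 1) (Suc d) \<Longrightarrow> 0 \<le> \<tau> \<Longrightarrow> \<rho> * \<tau> \<le> 1
      \<Longrightarrow> has_dim V d \<and> V \<subseteq> cone W B N y (\<rho> * \<tau>)"
proof -
  show "V \<subseteq> W"
    unfolding V
  proof (rule image_subsetI)
    fix f assume "f \<in> V0"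
    then have f: "f \<in> scl y W" using V0(1) by blast
    show "(\<lambda>i. f i * y i) \<in> W" by (rule scl_mult_cancel[OF W y f])
  qed
  show "\<exists>d vs. V = range (\<lambda>c. comb d c vs)" using V0(2) range_comb_mult unfolding V by blast
  assume d: "has_dim (cone W B N y \<tau>) d" "\<not> has_dim (cone W B N y 1) (Suc d)" "0 \<le> \<tau>" "\<rho> * \<tau> \<le> 1"
  have 1: "has_dim V0 d \<and> V0 \<subseteq> cone (scl y W) B N (\<lambda>_. 1) (\<rho> * \<tau>)"
    using dim[of \<tau> d] d has_dim_cone_scl[OF W, of y] y by simp
  have "V0 \<subseteq> supp n" using V0(1) scl_supp[OF W] by blast
  then have "has_dim V d" unfolding V using has_dim_diag[of V0 d n y] 1 y by simp
  moreover have "V \<subseteq> cone W B N y (\<rho> * \<tau>)"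
    unfolding V
  proof (rule image_subsetI)
    fix f assume "f \<in> V0"
    then have f: "f \<in> scl y (cone W B N y (\<rho> * \<tau>))" using 1 cone_scl by blast
    have "cone W B N y (\<rho> * \<tau>) \<subseteq> supp n" using W by (auto simp: cone_def)
    then show "(\<lambda>i. f i * y i) \<in> cone W B N y (\<rho> * \<tau>)" using scl_mult_cancel[OF _ y f] by simp
  qed
  ultimately show "has_dim V d \<and> V \<subseteq> cone W B N y (\<rho> * \<tau>)" by blast
qed

locale slls = lp_data +
  fixes svd :: "real mat \<Rightarrow> (real mat \<times> real vec) set" and \<beta> \<rho> :: real
  assumes \<beta>: "0 < \<beta>" "\<beta> \<le> 1/6" and \<rho>: "1 \<le> \<rho>" and solver: "rho_svd_solver \<rho> svd"
begin

lemma svd_output: "(C, t) \<in> svd M \<Longrightarrow> rho_svd \<rho> M C t"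
  using solver by (auto simp: rho_svd_solver_def)

lemma svd_nonempty: "\<exists>C t. (C, t) \<in> svd M"
  using solver unfolding rho_svd_solver_def by (metis ex_in_conv surj_pair)

text \<open>Read off from the solver: whatever it returns on a matrix comes with singular values
  that it approximates. This also supplies the pseudoinverses of the lifting matrices.\<close>

lemma singular_values_exist: "\<exists>\<sigma>. singular_values M \<sigma>"
proof -
  obtain C t where "(C, t) \<in> svd M" using svd_nonempty by blast
  from svd_output[OF this] have "\<exists>\<sigma>. singular_values M \<sigma> \<and> (\<forall>i<dim_col M. inverse \<rho> * t $ i \<le> \<sigma> $ i \<and> \<sigma> $ i \<le> t $ i)"
    unfolding rho_svd_def Let_def by (elim conjE)
  then show ?thesis by blast
qed

lemma primal_car: "x \<in> primal_pos A b \<Longrightarrow> x \<in> carrier_vec n" and dual_car: "s \<in> dual_pos A c \<Longrightarrow> s \<in> carrier_vec n"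
  by (auto simp: primal_pos_iff dual_pos_iff)

lemma fn_pos: "x \<in> primal_pos A b \<Longrightarrow> i < n \<Longrightarrow> 0 < fn x i" "s \<in> dual_pos A c \<Longrightarrow> i < n \<Longrightarrow> 0 < fn s i"
  using feas_pos by (auto simp: primal_pos_iff dual_pos_iff)

text \<open>In the degenerate cases one cone is the whole space and the other one is zero, because
  norms over the empty index set vanish; so the prescribed subspaces satisfy the same claims as the
  lifted ones.\<close>

lemma lift_subspaces_props:
  assumes x: "x \<in> primal_pos A b" and B: "B \<union> N = {..<n}" "B \<inter> N = {}"
    and VU: "lift_subspaces svd A x B N V U"
  shows "V \<subseteq> kerW A" "U \<subseteq> kerW_perp A"
    and "\<exists>d vs. fn ` V = range (\<lambda>c. comb d c vs)" "\<exists>d vs. fn ` U = range (\<lambda>c. comb d c vs)"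
    and "has_dim (cone W B N (fn x) \<tau>) d \<Longrightarrow> \<not> has_dim (cone W B N (fn x) 1) (Suc d) \<Longrightarrow> 0 \<le> \<tau> \<Longrightarrow> \<rho> * \<tau> \<le> 1
      \<Longrightarrow> has_dim (fn ` V) d \<and> fn ` V \<subseteq> cone W B N (fn x) (\<rho> * \<tau>)"
    and "has_dim (cone W' N B (\<lambda>i. 1 / fn x i) \<tau>) d \<Longrightarrow> \<not> has_dim (cone W' N B (\<lambda>i. 1 / fn x i) 1) (Suc d) \<Longrightarrow> 0 \<le> \<tau> \<Longrightarrow> \<rho> * \<tau> \<le> 1
      \<Longrightarrow> has_dim (fn ` U) d \<and> fn ` U \<subseteq> cone W' N B (\<lambda>i. 1 / fn x i) (\<rho> * \<tau>)"
proof -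
  have xc: "x \<in> carrier_vec n" by (rule primal_car[OF x])
  have y: "fn x i \<noteq> 0" if "i < n" for i using fn_pos(1)[OF x that] by simp
  have y': "1 / fn x i \<noteq> 0" if "i < n" for i using y[OF that] by simp
  have zero: "fn ` {0\<^sub>v n} = {\<lambda>_. 0}" by (auto simp: fn_def)
  have zero_comb: "{\<lambda>_. 0} = range (\<lambda>c. comb 0 c (\<lambda>_ _. 0))" by auto
  have full: "\<exists>d vs. S = range (\<lambda>c. comb d c vs)" if "subsp S" "S \<subseteq> supp n" for S
    using basis_exists[OF that] by blast
  have W0: "(\<lambda>_. 0) \<in> W" "(\<lambda>_. 0) \<in> W'" using subspD(1)[OF W] subspD(1)[OF W'] .
  have fz: "fn (0\<^sub>v n) = (\<lambda>_. 0)" by (auto simp: fn_def)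
  have zv: "0\<^sub>v n \<in> kerW A" "0\<^sub>v n \<in> kerW_perp A"
    using W0 W_mem[of "0\<^sub>v n"] W'_mem[of "0\<^sub>v n"] fz by simp_all
  have cone_empty: "cone S {} M z t = S" if "0 \<le> t" for S M z t using that by (simp add: cone_def)
  have cone_empty_zero: "cone S M {} z t \<subseteq> {\<lambda>_. 0}" if "M = {..<n}" "S \<subseteq> supp n" "\<And>i. i < n \<Longrightarrow> z i \<noteq> 0" for S M z t
    using cone_zero[of _ S M "{}" z t n] that by auto
  have dim_zero: "d = 0" if "has_dim S d" "S \<subseteq> {\<lambda>_. 0}" for S d
    using has_dim_nonzero[of S "d - 1"] that by (cases d) auto
  have zero_dim: "has_dim {\<lambda>_. 0} 0" by (auto simp: has_dim_def indep_def)
  have zero_cone: "{\<lambda>_. 0} \<subseteq> cone S M M' z t" if "(\<lambda>_. 0) \<in> S" "0 \<le> t" for S M M' z t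
    using that by (auto simp: cone_def L2_set_0')
  have rt: "0 \<le> \<rho> * \<tau>" if "0 \<le> \<tau>" for \<tau> using that \<rho> by simp
  consider (B) "B = {}" | (N) "B \<noteq> {}" "N = {}" | (BN) "B \<noteq> {}" "N \<noteq> {}" by blast
  then have main: "V \<subseteq> kerW A \<and> U \<subseteq> kerW_perp A \<and> (\<exists>d vs. fn ` V = range (\<lambda>c. comb d c vs)) \<and> (\<exists>d vs. fn ` U = range (\<lambda>c. comb d c vs)) \<and>
    (\<forall>\<tau> d. has_dim (cone W B N (fn x) \<tau>) d \<longrightarrow> \<not> has_dim (cone W B N (fn x) 1) (Suc d) \<longrightarrow> 0 \<le> \<tau> \<longrightarrow> \<rho> * \<tau> \<le> 1
      \<longrightarrow> has_dim (fn ` V) d \<and> fn ` V \<subseteq> cone W B N (fn x) (\<rho> * \<tau>)) \<and>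
    (\<forall>\<tau> d. has_dim (cone W' N B (\<lambda>i. 1 / fn x i) \<tau>) d \<longrightarrow> \<not> has_dim (cone W' N B (\<lambda>i. 1 / fn x i) 1) (Suc d) \<longrightarrow> 0 \<le> \<tau> \<longrightarrow> \<rho> * \<tau> \<le> 1
      \<longrightarrow> has_dim (fn ` U) d \<and> fn ` U \<subseteq> cone W' N B (\<lambda>i. 1 / fn x i) (\<rho> * \<tau>))"
  proof cases
    case B
    then have VU': "V = kerW A" "U = {0\<^sub>v n}" using VU by (auto simp: lift_subspaces_def dimA)
    have N: "N = {..<n}" using assms(2) B by simp
    show ?thesis unfolding VU' zero
    proof (intro conjI allI impI)
      show "\<exists>d vs. W = range (\<lambda>c. comb d c vs)" by (rule full[OF W W_supp])
      show "\<exists>d vs. {\<lambda>_. 0} = range (\<lambda>c. comb d c vs)" using zero_comb by blast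
      show "{0\<^sub>v n} \<subseteq> kerW_perp A" using zv by simp
      fix \<tau> :: real and d
      assume t: "0 \<le> \<tau>"
      show "has_dim W d" if "has_dim (cone W B N (fn x) \<tau>) d" using that unfolding B cone_empty[OF t] .
      show "W \<subseteq> cone W B N (fn x) (\<rho> * \<tau>)" unfolding B cone_empty[OF rt[OF t]] by simp
      show "has_dim {\<lambda>_. 0} d" if "has_dim (cone W' N B (\<lambda>i. 1 / fn x i) \<tau>) d"
      proof -
        have "d = 0" using dim_zero[OF that] cone_empty_zero[where z="\<lambda>i. 1 / fn x i" and t=\<tau>, OF N W'_supp y'] unfolding B by simp
        then show ?thesis using zero_dim by simp
      qed
      show "{\<lambda>_. 0} \<subseteq> cone W' N B (\<lambda>i. 1 / fn x i) (\<rho> * \<tau>)" by (rule zero_cone[OF W0(2) rt[OF t]])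
    qed simp
  next
    case N
    then have VU': "V = {0\<^sub>v n}" "U = kerW_perp A" using VU by (auto simp: lift_subspaces_def dimA)
    have B: "B = {..<n}" using assms(2) N by simp
    show ?thesis unfolding VU' zero
    proof (intro conjI allI impI)
      show "\<exists>d vs. W' = range (\<lambda>c. comb d c vs)" by (rule full[OF W' W'_supp])
      show "\<exists>d vs. {\<lambda>_. 0} = range (\<lambda>c. comb d c vs)" using zero_comb by blast
      show "{0\<^sub>v n} \<subseteq> kerW A" using zv by simp
      fix \<tau> :: real and d
      assume t: "0 \<le> \<tau>"
      show "has_dim W' d" if "has_dim (cone W' N B (\<lambda>i. 1 / fn x i) \<tau>) d" using that unfolding N cone_empty[OF t] .
      show "W' \<subseteq> cone W' N B (\<lambda>i. 1 / fn x i) (\<rho> * \<tau>)" unfolding N cone_empty[OF rt[OF t]] by simp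
      show "has_dim {\<lambda>_. 0} d" if "has_dim (cone W B N (fn x) \<tau>) d"
      proof -
        have "d = 0" using dim_zero[OF that] cone_empty_zero[where z="fn x" and t=\<tau>, OF B W_supp y] unfolding N by simp
        then show ?thesis using zero_dim by simp
      qed
      show "{\<lambda>_. 0} \<subseteq> cone W B N (fn x) (\<rho> * \<tau>)" by (rule zero_cone[OF W0(1) rt[OF t]])
    qed simp
  next
    case BN
    define S where "S = cscale (cinv x) (kerW A)"
    define P where "P = orth_proj n S"
    have Wc: "kerW A \<subseteq> carrier_vec n" using W_car by blast
    have Sf: "fn ` S = scl (fn x) W" "S \<subseteq> carrier_vec n"
      unfolding S_def using cscale_fn[OF Wc cinv_carrier[OF xc]] by (auto simp: fn_cinv scl_def divide_inverse)
    have sub: "subsp (fn ` S)" unfolding Sf by (rule subsp_scl[OF W])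
    have P: "is_proj n S P" unfolding P_def by (rule orth_proj_is_proj[OF Sf(2) sub])
    have Pc: "P \<in> carrier_mat n n" using P by (simp add: is_proj_def)
    \<comment> \<open>The dual side is scaled by the reciprocal of \<open>x\<close> rather than by
      \<open>s\<close>, as in the algorithm, so the products of the two scalings are exactly
      1.\<close>
    have op: "orth_pair n (scl (fn x) W) (scl (\<lambda>i. 1 / fn x i) W')"
      using y by (intro orth_pair_scl[OF orth_pair_axioms, where \<mu>=1]) auto
    interpret sp: orth_pair n "scl (fn x) W" "scl (\<lambda>i. 1 / fn x i) W'" by (rule op)
    have rep: "reproducing n (scl (fn x) W) (mcol P)" using is_proj_reproducing[OF Sf(2) P] unfolding Sf .
    have P'c: "1\<^sub>m n - P \<in> carrier_mat n n" by (rule minus_carrier_mat[OF Pc])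
    have "mcol (1\<^sub>m n - P) l = (\<lambda>i. if i < n then (if i = l then 1 else 0) - mcol P l i else 0)" if "l < n" for l
      unfolding mcol_def fn_col[OF P'c that] fn_col[OF Pc that] using Pc that by (auto simp: fun_eq_iff)
    then have rep': "reproducing n (scl (\<lambda>i. 1 / fn x i) W') (mcol (1\<^sub>m n - P))"
      using reproducing_complement[OF rep op] by (simp add: reproducing_def)
    define L L' where "L = lift_mat P N" and "L' = lift_mat (1\<^sub>m n - P) B"
    obtain C t C' t' where Ct: "(C, t) \<in> svd (submatrix L B UNIV)" "(C', t') \<in> svd (submatrix L' N UNIV)"
      and V: "V = cscale x ((\<lambda>w. L *\<^sub>v w) ` small_span C t)" and U: "U = cscale (cinv x) ((\<lambda>w. L' *\<^sub>v w) ` small_span C' t')"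
      using VU BN unfolding lift_subspaces_def Let_def dimA S_def[symmetric] P_def[symmetric] L_def[symmetric] L'_def[symmetric] by auto
    obtain \<sigma> \<sigma>' where sv: "singular_values (submatrix P N N) \<sigma>" "singular_values (submatrix (1\<^sub>m n - P) B B) \<sigma>'"
      using singular_values_exist by metis
    note R = rho_svd_lift[OF Pc rep sp.W sp.W_supp assms(2,3) sv(1) svd_output[OF Ct(1)[unfolded L_def]] \<rho>, folded L_def]
    have p': "N \<union> B = {..<n}" "N \<inter> B = {}" using assms(2,3) by auto
    note R' = rho_svd_lift[OF P'c rep' sp.W' sp.W'_supp p' sv(2) svd_output[OF Ct(2)[unfolded L'_def]] \<rho>, folded L'_def]
    have fV: "fn ` V = (\<lambda>f i. f i * fn x i) ` fn ` ((\<lambda>w. L *\<^sub>v w) ` small_span C t)" "V \<subseteq> carrier_vec n"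
      unfolding V by (rule cscale_fn[OF R(4) xc])+
    have fU: "fn ` U = (\<lambda>f i. f i * (1 / fn x i)) ` fn ` ((\<lambda>w. L' *\<^sub>v w) ` small_span C' t')" "U \<subseteq> carrier_vec n"
      unfolding U using cscale_fn[OF R'(4) cinv_carrier[OF xc]] by (simp_all add: fn_cinv divide_inverse)
    note G = scaled_lift_props[where y="fn x", OF y W_supp R(1,2) R(3) fV(1)]
    note G' = scaled_lift_props[where y="\<lambda>i. 1 / fn x i", OF y' W'_supp R'(1,2) R'(3) fU(1)]
    have "V \<subseteq> kerW A" using G(1) W_mem fV(2) by blast
    moreover have "U \<subseteq> kerW_perp A" using G'(1) W'_mem fU(2) by blast
    ultimately show ?thesis using G(2,3) G'(2,3) by simp
  qed
  show "V \<subseteq> kerW A" "U \<subseteq> kerW_perp A"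
    and "\<exists>d vs. fn ` V = range (\<lambda>c. comb d c vs)" "\<exists>d vs. fn ` U = range (\<lambda>c. comb d c vs)"
    and "has_dim (cone W B N (fn x) \<tau>) d \<Longrightarrow> \<not> has_dim (cone W B N (fn x) 1) (Suc d) \<Longrightarrow> 0 \<le> \<tau> \<Longrightarrow> \<rho> * \<tau> \<le> 1
      \<Longrightarrow> has_dim (fn ` V) d \<and> fn ` V \<subseteq> cone W B N (fn x) (\<rho> * \<tau>)"
    and "has_dim (cone W' N B (\<lambda>i. 1 / fn x i) \<tau>) d \<Longrightarrow> \<not> has_dim (cone W' N B (\<lambda>i. 1 / fn x i) 1) (Suc d) \<Longrightarrow> 0 \<le> \<tau> \<Longrightarrow> \<rho> * \<tau> \<le> 1
      \<Longrightarrow> has_dim (fn ` U) d \<and> fn ` U \<subseteq> cone W' N B (\<lambda>i. 1 / fn x i) (\<rho> * \<tau>)"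
    by (fact main[THEN conjunct1] main[THEN conjunct2, THEN conjunct1] main[THEN conjunct2, THEN conjunct2, THEN conjunct1]
      main[THEN conjunct2, THEN conjunct2, THEN conjunct2, THEN conjunct1]
      main[THEN conjunct2, THEN conjunct2, THEN conjunct2, THEN conjunct2, THEN conjunct1, rule_format, of \<tau> d]
      main[THEN conjunct2, THEN conjunct2, THEN conjunct2, THEN conjunct2, THEN conjunct2, rule_format, of \<tau> d])+
qed

end

section \<open>Minimizers of the layered problems and comparison of nearby scalings\<close>

text \<open>By the normal equations the squared objective at any other point is its value at
  \<open>\<delta>\<close> plus a sum of squares.\<close>

lemma L2_set_argmin:
  assumes V: "fn ` V = range (\<lambda>c. comb d c vs)" and N: "finite N"
  shows "\<exists>\<delta>\<in>V. \<forall>\<delta>'\<in>V. L2_set (\<lambda>i. (f i + fn \<delta> i) / g i) N \<le> L2_set (\<lambda>i. (f i + fn \<delta>' i) / g i) N"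
proof -
  define w where "w i = (1 / g i)\<^sup>2" for i
  obtain c where c: "\<forall>k<d. (\<Sum>i\<in>N. w i * (- f i - comb d c vs i) * vs k i) = 0"
    using weighted_projection[of N w d "\<lambda>i. - f i" vs] N by (auto simp: w_def)
  have orth: "(\<Sum>i\<in>N. w i * (f i + comb d c vs i) * comb d e vs i) = 0" for e
  proof -
    have "(\<Sum>i\<in>N. w i * (f i + comb d c vs i) * comb d e vs i) = (\<Sum>k<d. - e k * (\<Sum>i\<in>N. w i * (- f i - comb d c vs i) * vs k i))"
      unfolding comb_def[of d e] sum_distrib_left sum.swap[of _ N] by (intro sum.cong) (auto simp: algebra_simps)
    then show ?thesis using c by simp
  qed
  have "comb d c vs \<in> fn ` V" unfolding V by blast
  then obtain \<delta> where \<delta>: "\<delta> \<in> V" "fn \<delta> = comb d c vs" by auto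
  have "L2_set (\<lambda>i. (f i + fn \<delta> i) / g i) N \<le> L2_set (\<lambda>i. (f i + fn \<delta>' i) / g i) N" if "\<delta>' \<in> V" for \<delta>'
  proof -
    have "fn \<delta>' \<in> fn ` V" using that by blast
    then obtain c' where c': "fn \<delta>' = comb d c' vs" unfolding V by blast
    define e where "e = (\<lambda>k. c' k + (-1) * c k)"
    have e: "comb d c' vs = (\<lambda>i. comb d c vs i + comb d e vs i)"
      unfolding e_def comb_add comb_scale by simp
    have "(\<Sum>i\<in>N. ((f i + fn \<delta>' i) / g i)\<^sup>2) = (\<Sum>i\<in>N. ((f i + fn \<delta> i) / g i)\<^sup>2 + (comb d e vs i / g i)\<^sup>2 + 2 * (w i * (f i + comb d c vs i) * comb d e vs i))"
      unfolding c' e \<delta>(2) w_def by (intro sum.cong) (auto simp: power2_eq_square add_divide_distrib algebra_simps)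
    also have "\<dots> = (\<Sum>i\<in>N. ((f i + fn \<delta> i) / g i)\<^sup>2) + (\<Sum>i\<in>N. (comb d e vs i / g i)\<^sup>2)"
      using orth[of e] by (simp add: sum.distrib sum_distrib_left[symmetric])
    finally show ?thesis unfolding L2_set_def by (intro real_sqrt_le_mono) (simp add: sum_nonneg)
  qed
  then show ?thesis using \<delta>(1) by blast
qed

lemma (in lp_pair) on_path_dual: "on_path \<mu> X S \<Longrightarrow> lp_pair.on_path n W' W s0 x0 \<mu> S X"
proof -
  assume a: "on_path \<mu> X S"
  interpret d: lp_pair n W' W s0 x0 by (rule dual_lp)
  show ?thesis using a unfolding on_path_def d.on_path_def by (auto simp: mult.commute)
qed

text \<open>A constant factor cancels on both sides of the cone condition; it arises because
  \<open>sh\<close> is \<open>\<mu> / xh\<close>.\<close>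

lemma cone_scale_const: "0 < k \<Longrightarrow> cone S B N (\<lambda>i. y i * k) t = cone S B N y t"
proof -
  assume k: "0 < k"
  have "L2_set (\<lambda>i. f i / (y i * k)) I = 1 / k * L2_set (\<lambda>i. f i / y i) I" for f I
    using k by (subst L2_set_right_distrib) (auto intro!: L2_set_cong)
  then have "L2_set (\<lambda>i. f i / (y i * k)) B \<le> t * L2_set (\<lambda>i. f i / (y i * k)) N \<longleftrightarrow> 1 / k * L2_set (\<lambda>i. f i / y i) B \<le> 1 / k * (t * L2_set (\<lambda>i. f i / y i) N)" for f
    by (simp only: mult.left_commute)
  then have "L2_set (\<lambda>i. f i / (y i * k)) B \<le> t * L2_set (\<lambda>i. f i / (y i * k)) N \<longleftrightarrow> L2_set (\<lambda>i. f i / y i) B \<le> t * L2_set (\<lambda>i. f i / y i) N" for f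
    using k by (simp only: mult_le_cancel_left_pos[of "1 / k"] zero_less_divide_1_iff)
  then show ?thesis by (simp only: cone_def)
qed

text \<open>Passing from the path point to the iterate, or from there to the scaled iterate, changes
  coordinates by at most 5/4 and hence the level by at most \<open>25/16\<close>, rounded up to
  2.\<close>

lemma cone_nearby:
  assumes p: "B \<union> N = {..<n}" and t: "0 \<le> t"
    and yz: "\<And>i. i < n \<Longrightarrow> 0 < y i \<and> 0 < z i \<and> y i \<le> 5/4 * z i \<and> z i \<le> 5/4 * y i"
  shows "cone S B N y t \<subseteq> cone S B N z (2 * t)"
proof
  fix f assume "f \<in> cone S B N y t"
  then have "f \<in> cone S B N z (5/4 * (5/4) * t)"
    using p yz by (intro cone_rescale[OF _ t]) auto
  then show "f \<in> cone S B N z (2 * t)" using cone_mono[of "5/4 * (5/4) * t" "2 * t" S B N z] t by auto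
qed

lemma fn_move: "v \<in> carrier_vec n \<Longrightarrow> w \<in> carrier_vec n \<Longrightarrow> fn (v + a \<cdot>\<^sub>v w) = (\<lambda>i. fn v i + a * fn w i)"
  by (auto simp: fn_def)

section \<open>Corrector, affine and layered steps of the algorithm\<close>

context slls begin

lemma newton_dir_fn:
  assumes "x \<in> carrier_vec n" "s \<in> carrier_vec n" "r \<in> carrier_vec n"
  shows "newton_dir A x s r dx ds \<longleftrightarrow> dx \<in> kerW A \<and> ds \<in> kerW_perp A \<and> (\<forall>i<n. fn s i * fn dx i + fn x i * fn ds i = fn r i)"
proof (cases "dx \<in> kerW A \<and> ds \<in> kerW_perp A")
  case True
  then have car: "dx \<in> carrier_vec n" "ds \<in> carrier_vec n" using W_car W'_car by auto
  have c2: "s \<odot> dx \<in> carrier_vec n" "x \<odot> ds \<in> carrier_vec n" using assms car cmult_carrier by auto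
  have "s \<odot> dx + x \<odot> ds = r \<longleftrightarrow> fn (s \<odot> dx + x \<odot> ds) = fn r"
    using fn_inj[of "s \<odot> dx + x \<odot> ds" n r] c2 assms by auto
  also have "\<dots> \<longleftrightarrow> (\<forall>i<n. fn s i * fn dx i + fn x i * fn ds i = fn r i)"
    unfolding fn_add[OF c2] fn_cmult[OF assms(2) car(1)] fn_cmult[OF assms(1) car(2)]
    using assms by (auto simp: fun_eq_iff fn_def)
  finally show ?thesis using True by (simp add: newton_dir_def)
qed (auto simp: newton_dir_def)

lemma newton_dir_exists:
  assumes x: "x \<in> primal_pos A b" and s: "s \<in> dual_pos A c" and r: "r \<in> carrier_vec n"
  shows "\<exists>dx ds. newton_dir A x s r dx ds"
proof -
  obtain f g where fg: "f \<in> W" "g \<in> W'" "\<forall>i<n. fn s i * f i + fn x i * g i = fn r i"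
    using newton_exists[of "fn x" "fn s" "fn r"] fn_pos(1)[OF x] fn_pos(2)[OF s] by blast
  then show ?thesis unfolding newton_dir_fn[OF primal_car[OF x] dual_car[OF s] r] by blast
qed

lemma primal_move:
  assumes x: "x \<in> primal_pos A b" and dx: "dx \<in> kerW A" and p: "\<And>i. i < n \<Longrightarrow> 0 < fn x i + a * fn dx i"
  shows "x + a \<cdot>\<^sub>v dx \<in> primal_pos A b"
proof -
  have car: "x \<in> carrier_vec n" "dx \<in> carrier_vec n" using primal_car[OF x] W_car[OF dx] .
  have "(\<lambda>i. (fn x i - fn xv i) + a * fn dx i) \<in> W"
    using x dx by (intro subspD(2)[OF W] subspD(3)[OF W]) (auto simp: primal_pos_iff strict_feas_def)
  then have "(\<lambda>i. fn (x + a \<cdot>\<^sub>v dx) i - fn xv i) \<in> W" unfolding fn_move[OF car] by (simp add: algebra_simps)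
  moreover have "x + a \<cdot>\<^sub>v dx \<in> carrier_vec n" using car by simp
  ultimately show ?thesis using p fn_supp[of "x + a \<cdot>\<^sub>v dx" n] unfolding primal_pos_iff strict_feas_def by (simp add: fn_move[OF car])
qed

lemma dual_move:
  assumes s: "s \<in> dual_pos A c" and ds: "ds \<in> kerW_perp A" and p: "\<And>i. i < n \<Longrightarrow> 0 < fn s i + a * fn ds i"
  shows "s + a \<cdot>\<^sub>v ds \<in> dual_pos A c"
proof -
  have car: "s \<in> carrier_vec n" "ds \<in> carrier_vec n" using dual_car[OF s] W'_car[OF ds] .
  have "(\<lambda>i. (fn s i - fn sv i) + a * fn ds i) \<in> W'"
    using s ds by (intro subspD(2)[OF W'] subspD(3)[OF W']) (auto simp: dual_pos_iff strict_feas_def)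
  then have "(\<lambda>i. fn (s + a \<cdot>\<^sub>v ds) i - fn sv i) \<in> W'" unfolding fn_move[OF car] by (simp add: algebra_simps)
  moreover have "s + a \<cdot>\<^sub>v ds \<in> carrier_vec n" using car by simp
  ultimately show ?thesis using p fn_supp[of "s + a \<cdot>\<^sub>v ds" n] unfolding dual_pos_iff strict_feas_def by (simp add: fn_move[OF car])
qed

text \<open>The situation after a corrector step, with deviation ten times smaller than the
  neighbourhood demands; the room is spent by the affine or layered step.\<close>

definition central :: "real vec \<Rightarrow> real vec \<Rightarrow> real \<Rightarrow> bool" where
  "central x s \<mu> \<longleftrightarrow> x \<in> primal_pos A b \<and> s \<in> dual_pos A c \<and> mubar (x, s) = \<mu> \<and>
    nrm n (\<lambda>i. fn x i * fn s i - \<mu>) \<le> \<beta> / 10 * \<mu>"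

lemma centralD:
  assumes "central x s \<mu>"
  shows "x \<in> primal_pos A b" "s \<in> dual_pos A c" "x \<in> carrier_vec n" "s \<in> carrier_vec n" "0 < \<mu>"
    "ip n (fn x) (fn s) = real n * \<mu>" "nrm n (\<lambda>i. fn x i * fn s i - \<mu>) \<le> \<beta> / 10 * \<mu>" "mubar (x, s) = \<mu>"
    "\<And>i. i < n \<Longrightarrow> 0 < fn x i" "\<And>i. i < n \<Longrightarrow> 0 < fn s i"
proof -
  show x: "x \<in> primal_pos A b" and s: "s \<in> dual_pos A c" and m: "mubar (x, s) = \<mu>"
    and "nrm n (\<lambda>i. fn x i * fn s i - \<mu>) \<le> \<beta> / 10 * \<mu>" using assms by (auto simp: central_def)
  show xs: "x \<in> carrier_vec n" "s \<in> carrier_vec n" using primal_car[OF x] dual_car[OF s] .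
  show "0 < \<mu>" using mubar_pos[OF x s] m by simp
  show "ip n (fn x) (fn s) = real n * \<mu>" using mubar_fn[OF xs] m n_pos by simp
  show "\<And>i. i < n \<Longrightarrow> 0 < fn x i" "\<And>i. i < n \<Longrightarrow> 0 < fn s i" using fn_pos x s by auto
qed

lemma central_iterate:
  assumes "central x s \<mu>"
  shows "lp_iterate n W W' (fn xv) (fn sv) (fn x) (fn s) \<mu>"
proof -
  note c = centralD[OF assms]
  have "\<beta> / 10 * \<mu> \<le> 1/60 * \<mu>" using \<beta> c(5) by (intro mult_right_mono) auto
  then have near: "nrm n (\<lambda>i. fn x i * fn s i - \<mu>) \<le> 1/60 * \<mu>" using c(7) by linarith
  have "fn x \<in> PP" "fn s \<in> DD" using c(1,2) by (auto simp: primal_pos_iff dual_pos_iff)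
  then show ?thesis using c(5,6) near n_pos lp_pair_axioms unfolding lp_iterate_def lp_iterate_axioms_def by blast
qed

lemma corrector:
  assumes z: "(x, s) \<in> nbhd A b c \<beta>" and d: "newton_dir A x s (mubar (x, s) \<cdot>\<^sub>v ones n - x \<odot> s) dx ds"
  shows "central (x + dx) (s + ds) (mubar (x, s))"
proof -
  define \<mu> where "\<mu> = mubar (x, s)"
  have zz: "x \<in> primal_pos A b" "s \<in> dual_pos A c" "nrm n (\<lambda>i. fn x i * fn s i - \<mu>) \<le> \<beta> * \<mu>"
    using z unfolding nbhd_iff \<mu>_def by auto
  have car: "x \<in> carrier_vec n" "s \<in> carrier_vec n" using primal_car dual_car zz by auto
  have \<mu>: "0 < \<mu>" using mubar_pos zz by (simp add: \<mu>_def)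
  have rc: "\<mu> \<cdot>\<^sub>v ones n - x \<odot> s \<in> carrier_vec n" using cmult_carrier[OF car] by (simp add: ones_def)
  have fr: "fn (\<mu> \<cdot>\<^sub>v ones n - x \<odot> s) i = \<mu> - fn x i * fn s i" if "i < n" for i
    using fn_minus[of "\<mu> \<cdot>\<^sub>v ones n" n "x \<odot> s"] cmult_carrier[OF car] that by (simp add: ones_def fn_smult fn_cmult[OF car])
  have dd: "dx \<in> kerW A" "ds \<in> kerW_perp A" and eq: "\<And>i. i < n \<Longrightarrow> fn s i * fn dx i + fn x i * fn ds i = \<mu> - fn x i * fn s i"
    using d[folded \<mu>_def] fr unfolding newton_dir_fn[OF car rc] by auto
  have dcar: "dx \<in> carrier_vec n" "ds \<in> carrier_vec n" using W_car W'_car dd by auto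
  have o: "ip n (fn dx) (fn ds) = 0" using orthogonal dd by blast
  note C = corrector_step[OF fn_pos(1)[OF zz(1)] fn_pos(2)[OF zz(2)] \<beta> \<mu> zz(3) o eq]
  have P: "x + dx \<in> primal_pos A b" "s + ds \<in> dual_pos A c"
    using primal_move[OF zz(1) dd(1), of 1] dual_move[OF zz(2) dd(2), of 1] C(2,3) by auto
  have f: "fn (x + dx) = (\<lambda>i. fn x i + fn dx i)" "fn (s + ds) = (\<lambda>i. fn s i + fn ds i)"
    using fn_add car dcar by auto
  have "ip n (fn (x + dx)) (fn (s + ds)) = (\<Sum>i<n. fn x i * fn s i + (fn s i * fn dx i + fn x i * fn ds i) + fn dx i * fn ds i)"
    unfolding f ip_def by (intro sum.cong) (auto simp: algebra_simps)
  also have "\<dots> = (\<Sum>i<n. \<mu> + fn dx i * fn ds i)" using eq by (intro sum.cong) auto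
  also have "\<dots> = n * \<mu>" using o by (simp add: sum.distrib ip_def)
  finally have "mubar (x + dx, s + ds) = \<mu>" using mubar_fn[of "x + dx" "s + ds"] car dcar n_pos by simp
  then show ?thesis unfolding central_def \<mu>_def[symmetric] using P C(1) by (simp add: f)
qed

text \<open>The neighbourhood is claimed for \<open>a < 1\<close> only: at length 1 the mean is zero
  and the point is no longer strictly feasible on both sides.\<close>

lemma affine:
  assumes C: "central x s \<mu>" and d: "newton_dir A x s (- (x \<odot> s)) dx ds"
  shows "dx \<in> kerW A" "ds \<in> kerW_perp A" "\<And>i. i < n \<Longrightarrow> fn s i * fn dx i + fn x i * fn ds i = - (fn x i * fn s i)"
    and "mubar (x + a \<cdot>\<^sub>v dx, s + a \<cdot>\<^sub>v ds) = (1 - a) * \<mu>"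
    and "0 \<le> a \<Longrightarrow> a < 1 \<Longrightarrow> a \<le> max (\<beta> / (2 * sqrt n)) (1 - 2 * vnorm (dx \<odot> ds) / (\<beta> * \<mu>)) \<Longrightarrow>
      (x + a \<cdot>\<^sub>v dx, s + a \<cdot>\<^sub>v ds) \<in> nbhd A b c \<beta>"
proof -
  note c = centralD[OF C]
  have rc: "- (x \<odot> s) \<in> carrier_vec n" using cmult_carrier[OF c(3,4)] by simp
  have fr: "fn (- (x \<odot> s)) i = - (fn x i * fn s i)" if "i < n" for i
    using that c(3,4) by (simp add: fn_def component_mult_def)
  show dd: "dx \<in> kerW A" "ds \<in> kerW_perp A" and eq: "\<And>i. i < n \<Longrightarrow> fn s i * fn dx i + fn x i * fn ds i = - (fn x i * fn s i)"
    using d fr unfolding newton_dir_fn[OF c(3,4) rc] by auto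
  have dcar: "dx \<in> carrier_vec n" "ds \<in> carrier_vec n" using W_car W'_car dd by auto
  have o: "ip n (fn dx) (fn ds) = 0" using orthogonal dd by blast
  have f: "fn (x + a \<cdot>\<^sub>v dx) = (\<lambda>i. fn x i + a * fn dx i)" "fn (s + a \<cdot>\<^sub>v ds) = (\<lambda>i. fn s i + a * fn ds i)" for a
    using fn_move c(3,4) dcar by auto
  show m: "mubar (x + a \<cdot>\<^sub>v dx, s + a \<cdot>\<^sub>v ds) = (1 - a) * \<mu>" for a
  proof -
    have "ip n (fn (x + a \<cdot>\<^sub>v dx)) (fn (s + a \<cdot>\<^sub>v ds)) = (\<Sum>i<n. fn x i * fn s i + a * (fn s i * fn dx i + fn x i * fn ds i) + a\<^sup>2 * (fn dx i * fn ds i))"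
      unfolding f ip_def by (intro sum.cong) (auto simp: algebra_simps power2_eq_square)
    also have "\<dots> = (\<Sum>i<n. (1 - a) * (fn x i * fn s i) + a\<^sup>2 * (fn dx i * fn ds i))" using eq by (intro sum.cong) (auto simp: algebra_simps)
    also have "\<dots> = (1 - a) * ip n (fn x) (fn s) + a\<^sup>2 * ip n (fn dx) (fn ds)" by (simp add: sum.distrib ip_def sum_distrib_left)
    finally show ?thesis using mubar_fn[of "x + a \<cdot>\<^sub>v dx" "s + a \<cdot>\<^sub>v ds"] c(3,4,6) dcar n_pos o by simp
  qed
  assume a: "0 \<le> a" "a < 1" "a \<le> max (\<beta> / (2 * sqrt n)) (1 - 2 * vnorm (dx \<odot> ds) / (\<beta> * \<mu>))"
  have vn: "vnorm (dx \<odot> ds) = nrm n (\<lambda>i. fn dx i * fn ds i)"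
    using vnorm_nrm[OF cmult_carrier[OF dcar]] fn_cmult[OF dcar] by simp
  note S = affine_step[OF c(9,10) n_pos \<beta> c(5,6,7) o eq a(1,2) a(3)[unfolded vn]]
  show "(x + a \<cdot>\<^sub>v dx, s + a \<cdot>\<^sub>v ds) \<in> nbhd A b c \<beta>"
    unfolding nbhd_iff m using S(1) primal_move[OF c(1) dd(1) S(2)] dual_move[OF c(2) dd(2) S(3)] by (simp add: f)
qed

lemma layered:
  assumes C: "central x s \<mu>" and dd: "dx \<in> kerW A" "ds \<in> kerW_perp A"
    and D: "vnorm (dx \<odot> ds) \<le> \<beta> / 9 * \<mu>"
  defines "\<epsilon> \<equiv> vnorm ((x + dx) \<odot> (s + ds)) / \<mu>"
  shows "0 \<le> a \<Longrightarrow> a < 1 \<Longrightarrow> a \<le> 1 - 8 * \<epsilon> / \<beta> \<Longrightarrow>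
      (x + a \<cdot>\<^sub>v dx, s + a \<cdot>\<^sub>v ds) \<in> nbhd A b c \<beta> \<and> mubar (x + a \<cdot>\<^sub>v dx, s + a \<cdot>\<^sub>v ds) \<le> (1 - a) * \<mu> + \<epsilon> * \<mu>"
    and "\<epsilon> = 0 \<Longrightarrow> mubar (x + 1 \<cdot>\<^sub>v dx, s + 1 \<cdot>\<^sub>v ds) = 0"
proof -
  note c = centralD[OF C]
  have dcar: "dx \<in> carrier_vec n" "ds \<in> carrier_vec n" using W_car W'_car dd by auto
  have o: "ip n (fn dx) (fn ds) = 0" using orthogonal dd by blast
  have f: "fn (x + a \<cdot>\<^sub>v dx) = (\<lambda>i. fn x i + a * fn dx i)" "fn (s + a \<cdot>\<^sub>v ds) = (\<lambda>i. fn s i + a * fn ds i)" for a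
    using fn_move c(3,4) dcar by auto
  have f1: "fn (x + dx) = (\<lambda>i. fn x i + fn dx i)" "fn (s + ds) = (\<lambda>i. fn s i + fn ds i)"
    using fn_add c(3,4) dcar by auto
  have acar: "x + a \<cdot>\<^sub>v dx \<in> carrier_vec n" "s + a \<cdot>\<^sub>v ds \<in> carrier_vec n" for a using c(3,4) dcar by auto
  have vn: "vnorm (dx \<odot> ds) = nrm n (\<lambda>i. fn dx i * fn ds i)"
    using vnorm_nrm[OF cmult_carrier[OF dcar]] fn_cmult[OF dcar] by simp
  have ca: "x + dx \<in> carrier_vec n" "s + ds \<in> carrier_vec n" using c(3,4) dcar by auto
  have ve: "nrm n (\<lambda>i. (fn x i + fn dx i) * (fn s i + fn ds i)) = \<epsilon> * \<mu>"
    unfolding \<epsilon>_def using vnorm_nrm[OF cmult_carrier[OF ca]] fn_cmult[OF ca] c(5) by (simp add: f1)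
  show "mubar (x + 1 \<cdot>\<^sub>v dx, s + 1 \<cdot>\<^sub>v ds) = 0" if "\<epsilon> = 0"
  proof -
    have "nrm n (\<lambda>i. (fn x i + fn dx i) * (fn s i + fn ds i)) = 0" using ve that by simp
    then have "ip n (fn (x + 1 \<cdot>\<^sub>v dx)) (fn (s + 1 \<cdot>\<^sub>v ds)) = 0"
      unfolding f ip_def by (intro sum.neutral) (simp add: L2_set_eq_0_iff)
    then show ?thesis using mubar_fn[OF acar(1)[of 1] acar(2)[of 1]] by simp
  qed
  assume a: "0 \<le> a" "a < 1" "a \<le> 1 - 8 * \<epsilon> / \<beta>"
  define m where "m = ip n (\<lambda>i. fn x i + a * fn dx i) (\<lambda>i. fn s i + a * fn ds i) / n"
  have m: "mubar (x + a \<cdot>\<^sub>v dx, s + a \<cdot>\<^sub>v ds) = m" using mubar_fn[OF acar] by (simp add: f m_def)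
  note S = layered_step[OF c(9,10) n_pos \<beta> c(5,6,7) o eq_refl[OF ve] D[unfolded vn] a m_def]
  have "m \<le> (1 - a) * \<mu> + \<epsilon> * \<mu>" using S(1) by linarith
  then show "(x + a \<cdot>\<^sub>v dx, s + a \<cdot>\<^sub>v ds) \<in> nbhd A b c \<beta> \<and> mubar (x + a \<cdot>\<^sub>v dx, s + a \<cdot>\<^sub>v ds) \<le> (1 - a) * \<mu> + \<epsilon> * \<mu>"
    unfolding nbhd_iff m using S(3) primal_move[OF c(1) dd(1) S(4)] dual_move[OF c(2) dd(2) S(5)] by (simp add: f)
qed

text \<open>A step of length 1 may leave the neighbourhood, but when all shorter steps stay inside,
  its end point is their limit.\<close>

lemma closure_limit:
  assumes car: "x \<in> carrier_vec n" "s \<in> carrier_vec n" "dx \<in> carrier_vec n" "ds \<in> carrier_vec n"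
    and seg: "\<And>t. 0 \<le> t \<Longrightarrow> t < 1 \<Longrightarrow> (x + t \<cdot>\<^sub>v dx, s + t \<cdot>\<^sub>v ds) \<in> nbhd A b c \<beta>"
  shows "(x + 1 \<cdot>\<^sub>v dx, s + 1 \<cdot>\<^sub>v ds) \<in> nbhd_closure A b c \<beta>"
  unfolding nbhd_closure_def closure2_def dimA
proof (intro CollectI case_prodI conjI allI impI)
  fix e :: real assume e: "0 < e"
  define K where "K = 1 + nrm n (fn dx) + nrm n (fn ds)"
  have K: "1 \<le> K" "nrm n (fn dx) < K" "nrm n (fn ds) < K" by (simp_all add: K_def add_nonneg_nonneg add_pos_nonneg)
  define r where "r = min 1 (e / K)"
  have r: "0 < r" "r \<le> 1" "r \<le> e / K" using e K by (auto simp: r_def)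
  have d: "vnorm ((v + (1 - r) \<cdot>\<^sub>v dv) - (v + 1 \<cdot>\<^sub>v dv)) < e" if "v \<in> carrier_vec n" "dv \<in> carrier_vec n" "nrm n (fn dv) < K" for v dv
  proof -
    have "fn ((v + (1 - r) \<cdot>\<^sub>v dv) - (v + 1 \<cdot>\<^sub>v dv)) = (\<lambda>i. - r * fn dv i)"
      using that by (auto simp: fn_def algebra_simps)
    then have "vnorm ((v + (1 - r) \<cdot>\<^sub>v dv) - (v + 1 \<cdot>\<^sub>v dv)) = nrm n (\<lambda>i. - r * fn dv i)"
      using vnorm_nrm[of "(v + (1 - r) \<cdot>\<^sub>v dv) - (v + 1 \<cdot>\<^sub>v dv)" n] that by simp
    also have "\<dots> = r * nrm n (fn dv)" unfolding nrm_scale using r by simp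
    also have "\<dots> < r * K" using that r by simp
    also have "\<dots> \<le> e" using r K by (simp add: pos_le_divide_eq)
    finally show ?thesis .
  qed
  show "\<exists>(x', s')\<in>nbhd A b c \<beta>. vnorm (x' - (x + 1 \<cdot>\<^sub>v dx)) < e \<and> vnorm (s' - (s + 1 \<cdot>\<^sub>v ds)) < e"
    using seg[of "1 - r"] r d[OF car(1,3) K(2)] d[OF car(2,4) K(3)] by (intro bexI[of _ "(x + (1 - r) \<cdot>\<^sub>v dx, s + (1 - r) \<cdot>\<^sub>v ds)"]) auto
qed (use car in auto)

end

section \<open>Cheap dimensions seen from an iterate\<close>

context lp_iterate begin

text \<open>Carries cheapness and maximality from the path point to the iterate and to the dual
  side. \<open>cheap_dual\<close> is used twice: forwards it makes \<open>d'\<close> dual dimensions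
  cheap, and backwards a further dual dimension would produce one more than \<open>d\<close> in
  \<open>W\<close>. Each change of scaling costs a factor 2 in the level.\<close>

lemma cheap_levels:
  assumes p: "B \<union> N = {..<n}" "B \<inter> N = {}" and path: "on_path \<mu> X S"
    and d: "has_dim (cone W B N X \<tau>) d" and \<tau>: "0 \<le> \<tau>"
    and mx: "\<not> has_dim (cone W B N X H) (Suc d)" and H: "0 \<le> H"
  obtains d' where "has_dim (cone W B N x (2 * \<tau>)) d" "\<not> has_dim (cone W B N x (H / 2)) (Suc d)"
    "has_dim (cone W' N B (\<lambda>i. 1 / x i) (2 * \<tau>)) d'" "\<not> has_dim (cone W' N B (\<lambda>i. 1 / x i) (H / 2)) (Suc d')"
    "\<not> has_dim (cone W B N xh (H / 4)) (Suc d)" "\<not> has_dim (cone W' N B sh (H / 4)) (Suc d')"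
    "\<And>t. 0 \<le> t \<Longrightarrow> cone W B N x t \<subseteq> cone W B N xh (2 * t)"
    "\<And>t. 0 \<le> t \<Longrightarrow> cone W' N B (\<lambda>i. 1 / x i) t \<subseteq> cone W' N B sh (2 * t)"
proof -
  have p': "N \<union> B = {..<n}" "N \<inter> B = {}" using p by auto
  have Xp: "0 < X i" if "i < n" for i using path feas_pos(1) that by (auto simp: on_path_def)
  have near_X: "0 < X i \<and> 0 < x i \<and> X i \<le> 5/4 * x i \<and> x i \<le> 5/4 * X i" if "i < n" for i
    using near_path(1,2)[OF x s mean \<mu> near path that] Xp[OF that] xpos[OF that] by simp
  have near_h: "0 < x i \<and> 0 < xh i \<and> x i \<le> 5/4 * xh i \<and> xh i \<le> 5/4 * x i" if "i < n" for i
  proof -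
    have "x i \<le> 5/4 * xh i" unfolding x_om[OF that] using om_bounds(2)[OF that] hpos(1)[OF that] by simp
    moreover have "xh i * 1 \<le> xh i * (5/4 * om i)" using om_bounds(1)[OF that] hpos(1)[OF that] by (intro mult_left_mono) auto
    ultimately show ?thesis using x_om[OF that] hpos(1)[OF that] xpos[OF that] by (simp add: mult_ac)
  qed
  have near_i: "0 < 1 / x i \<and> 0 < 1 / xh i \<and> 1 / x i \<le> 5/4 * (1 / xh i) \<and> 1 / xh i \<le> 5/4 * (1 / x i)" if "i < n" for i
    using near_h[OF that] by (auto simp: field_simps)
  have X_x: "cone W B N X t \<subseteq> cone W B N x (2 * t)" and x_X: "cone W B N x t \<subseteq> cone W B N X (2 * t)"
    and x_h: "cone W B N x t \<subseteq> cone W B N xh (2 * t)" and h_x: "cone W B N xh t \<subseteq> cone W B N x (2 * t)" if "0 \<le> t" for t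
    using near_X near_h by (auto intro!: cone_nearby[OF p(1) that])
  have sh_eq: "cone W' N B sh t = cone W' N B (\<lambda>i. 1 / xh i) t" for t
  proof -
    have "L2_set (\<lambda>i. f i / sh i) I = L2_set (\<lambda>i. f i / (1 / xh i * \<mu>)) I" if "I \<subseteq> {..<n}" for f I
    proof (intro L2_set_cong refl)
      fix i assume "i \<in> I"
      then have "i < n" using that by auto
      then have "sh i = 1 / xh i * \<mu>" using xs_h hpos(1)[of i] by (simp add: eq_divide_eq mult.commute)
      then show "f i / sh i = f i / (1 / xh i * \<mu>)" by (simp only:)
    qed
    moreover have "B \<subseteq> {..<n}" "N \<subseteq> {..<n}" using p by auto
    ultimately have "cone W' N B sh t = cone W' N B (\<lambda>i. 1 / xh i * \<mu>) t" by (simp only: cone_def)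
    then show ?thesis using cone_scale_const[OF \<mu>, of W' N B "\<lambda>i. 1 / xh i" t] by simp
  qed
  have i_s: "cone W' N B (\<lambda>i. 1 / x i) t \<subseteq> cone W' N B sh (2 * t)" and s_i: "cone W' N B sh t \<subseteq> cone W' N B (\<lambda>i. 1 / x i) (2 * t)" if "0 \<le> t" for t
    unfolding sh_eq using near_i by (auto intro!: cone_nearby[OF p'(1) that])
  have xn: "x i \<noteq> 0" if "i < n" for i using xpos[OF that] by simp
  have xn': "1 / x i \<noteq> 0" if "i < n" for i using xn[OF that] by simp
  interpret sp: orth_pair n "scl x W" "scl (\<lambda>i. 1 / x i) W'"
    using xn by (intro orth_pair_scl[OF orth_pair_axioms, where \<mu>=1]) auto
  interpret spd: orth_pair n "scl (\<lambda>i. 1 / x i) W'" "scl x W" by (rule sp.dual_pair)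
  note cs = has_dim_cone_scl[where y=x, OF W_supp xn] and cs' = has_dim_cone_scl[where y="\<lambda>i. 1 / x i", OF W'_supp xn']
  obtain q where q: "q \<le> n" "has_dim (scl (\<lambda>i. 1 / x i) W') q" "has_dim (scl x W) (n - q)" using sp.dims_exist by blast
  have card: "card B + card N = n" using card_Un_disjoint[of B N] p partition_finite[OF p(1)] by simp
  \<comment> \<open>The count delivered by \<open>cheap_dual\<close>. Truncation can only enlarge
    it, which is harmless for the count sent back to \<open>W\<close>.\<close>
  define d' where "d' = q + d - card N"
  have dx: "has_dim (cone W B N x (2 * \<tau>)) d" using has_dim_subset[OF d X_x[OF \<tau>]] .
  have mx1: "\<not> has_dim (cone W B N x (H / 2)) (Suc d)"
    using has_dim_subset[of "cone W B N x (H / 2)" "Suc d"] x_X[of "H / 2"] mx H by auto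
  have "has_dim (cone (scl (\<lambda>i. 1 / x i) W') N B (\<lambda>_. 1) (2 * \<tau>)) d'"
    unfolding d'_def using dx \<tau> by (intro sp.cheap_dual[OF p _ _ q(2)]) (simp_all add: cs)
  then have dd: "has_dim (cone W' N B (\<lambda>i. 1 / x i) (2 * \<tau>)) d'" by (simp add: cs')
  have mx2: "\<not> has_dim (cone W' N B (\<lambda>i. 1 / x i) (H / 2)) (Suc d')"
  proof
    assume "has_dim (cone W' N B (\<lambda>i. 1 / x i) (H / 2)) (Suc d')"
    then have "has_dim (cone (scl x W) B N (\<lambda>_. 1) (H / 2)) (n - q + Suc d' - card B)"
      using H by (intro spd.cheap_dual[OF p' _ _ q(3)]) (simp_all add: cs')
    then have "has_dim (cone W B N x (H / 2)) (n - q + Suc d' - card B)" by (simp add: cs)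
    moreover have "Suc d \<le> n - q + Suc d' - card B" using q(1) card unfolding d'_def by linarith
    ultimately show False using has_dim_mono mx1 by blast
  qed
  have mx3: "\<not> has_dim (cone W B N xh (H / 4)) (Suc d)"
    using has_dim_subset[of "cone W B N xh (H / 4)" "Suc d"] h_x[of "H / 4"] mx1 H by auto
  have mx4: "\<not> has_dim (cone W' N B sh (H / 4)) (Suc d')"
    using has_dim_subset[of "cone W' N B sh (H / 4)" "Suc d'"] s_i[of "H / 4"] mx2 H by auto
  show thesis by (rule that[OF dx mx1 dd mx2 mx3 mx4 x_h i_s])
qed

end

section \<open>Soundness, progress and decrease of one iteration\<close>

context slls begin

text \<open>The corrector leaves \<open>mubar\<close> unchanged, so the rest of the iteration can be
  described with the value at the incoming point.\<close>

lemma slls_stepE: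
  assumes z: "z \<in> nbhd A b c \<beta>" and st: "slls_step svd A \<beta> z z'"
  obtains x s dxa dsa aa B N V U dxl dsl al where "central x s (mubar z)"
    "newton_dir A x s (- (x \<odot> s)) dxa dsa" "affine_step_length n \<beta> (mubar z) dxa dsa aa"
    "B = partition_B n x s dxa dsa" "N = {..<n} - B" "lift_subspaces svd A x B N V U"
    "layered_dirs x s (mubar z) B N V U dxl dsl" "layered_step_length \<beta> (mubar z) x s dxl dsl al"
    "z' = (if mubar (x + aa \<cdot>\<^sub>v dxa, s + aa \<cdot>\<^sub>v dsa) < mubar (x + al \<cdot>\<^sub>v dxl, s + al \<cdot>\<^sub>v dsl)
      then (x + aa \<cdot>\<^sub>v dxa, s + aa \<cdot>\<^sub>v dsa) else (x + al \<cdot>\<^sub>v dxl, s + al \<cdot>\<^sub>v dsl))"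
proof -
  obtain x0 s0 where zz: "z = (x0, s0)" by (cases z)
  obtain dxc dsc dxa dsa aa V U dxl dsl al where
    nc: "newton_dir A x0 s0 (mubar (x0, s0) \<cdot>\<^sub>v ones n - x0 \<odot> s0) dxc dsc" and
    rest: "newton_dir A (x0 + dxc) (s0 + dsc) (- ((x0 + dxc) \<odot> (s0 + dsc))) dxa dsa"
    "affine_step_length n \<beta> (mubar (x0 + dxc, s0 + dsc)) dxa dsa aa"
    "lift_subspaces svd A (x0 + dxc) (partition_B n (x0 + dxc) (s0 + dsc) dxa dsa) ({..<n} - partition_B n (x0 + dxc) (s0 + dsc) dxa dsa) V U"
    "layered_dirs (x0 + dxc) (s0 + dsc) (mubar (x0 + dxc, s0 + dsc)) (partition_B n (x0 + dxc) (s0 + dsc) dxa dsa) ({..<n} - partition_B n (x0 + dxc) (s0 + dsc) dxa dsa) V U dxl dsl"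
    "layered_step_length \<beta> (mubar (x0 + dxc, s0 + dsc)) (x0 + dxc) (s0 + dsc) dxl dsl al"
    "z' = (if mubar ((x0 + dxc) + aa \<cdot>\<^sub>v dxa, (s0 + dsc) + aa \<cdot>\<^sub>v dsa) < mubar ((x0 + dxc) + al \<cdot>\<^sub>v dxl, (s0 + dsc) + al \<cdot>\<^sub>v dsl)
      then ((x0 + dxc) + aa \<cdot>\<^sub>v dxa, (s0 + dsc) + aa \<cdot>\<^sub>v dsa) else ((x0 + dxc) + al \<cdot>\<^sub>v dxl, (s0 + dsc) + al \<cdot>\<^sub>v dsl))"
    using st unfolding slls_step_def Let_def dimA zz fst_conv snd_conv by (elim exE conjE) rule
  have C: "central (x0 + dxc) (s0 + dsc) (mubar z)" using corrector[OF z[unfolded zz] nc] unfolding zz .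
  note m = centralD(8)[OF C]
  show thesis by (rule that[OF C rest(1) rest(2)[unfolded m] refl refl rest(3) rest(4)[unfolded m] rest(5)[unfolded m] rest(6)])
qed

lemma vnorm_nonneg: "0 \<le> vnorm v"
  by (simp add: vnorm_def scalar_prod_def sum_nonneg)

lemma affine_rate: "1 \<le> sqrt n" "0 < \<beta> / (3 * sqrt n)" "\<beta> / (3 * sqrt n) \<le> 1"
proof -
  show n1: "1 \<le> sqrt n" using n_pos by simp
  then have "0 < 3 * sqrt n" "\<beta> \<le> 3 * sqrt n" using \<beta> by linarith+
  then show "0 < \<beta> / (3 * sqrt n)" "\<beta> / (3 * sqrt n) \<le> 1" using \<beta> by (auto simp: pos_divide_le_eq)
qed

lemma partition_B_props: "N = {..<n} - partition_B n x s dxa dsa \<Longrightarrow> partition_B n x s dxa dsa \<union> N = {..<n}"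
  "N = {..<n} - partition_B n x s dxa dsa \<Longrightarrow> partition_B n x s dxa dsa \<inter> N = {}"
  by (auto simp: partition_B_def)

lemma layered_mem:
  assumes "central x s \<mu>" "B \<union> N = {..<n}" "B \<inter> N = {}" "lift_subspaces svd A x B N V U" "layered_dirs x s \<mu> B N V U dxl dsl"
  shows "dxl \<in> V" "dsl \<in> U" "V \<subseteq> kerW A" "U \<subseteq> kerW_perp A"
  using lift_subspaces_props(1,2)[OF centralD(1)[OF assms(1)] assms(2,3,4)] assms(5)
  by (auto simp: layered_dirs_def Let_def is_arg_min_def)

text \<open>The chosen candidate is at least as good as the affine one, whose length is at least
  \<open>\<beta> / (3 sqrt n)\<close>; this decrease holds whatever the spectrum looks like. Only a
  step of length 1 can lead out of the neighbourhood, and then to a limit point with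
  \<open>mubar\<close> zero.\<close>

lemma step_sound:
  assumes z: "z \<in> nbhd A b c \<beta>" and st: "slls_step svd A \<beta> z z'"
  shows "z' \<in> nbhd A b c \<beta> \<or> mubar z' = 0 \<and> z' \<in> nbhd_closure A b c \<beta>"
    and "mubar z' \<le> (1 - \<beta> / (3 * sqrt n)) * mubar z"
proof -
  obtain x s dxa dsa aa B N V U dxl dsl al where C: "central x s (mubar z)"
    and na: "newton_dir A x s (- (x \<odot> s)) dxa dsa" and la: "affine_step_length n \<beta> (mubar z) dxa dsa aa"
    and B: "B = partition_B n x s dxa dsa" "N = {..<n} - B" and VU: "lift_subspaces svd A x B N V U"
    and ld: "layered_dirs x s (mubar z) B N V U dxl dsl" and ll: "layered_step_length \<beta> (mubar z) x s dxl dsl al"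
    and z': "z' = (if mubar (x + aa \<cdot>\<^sub>v dxa, s + aa \<cdot>\<^sub>v dsa) < mubar (x + al \<cdot>\<^sub>v dxl, s + al \<cdot>\<^sub>v dsl)
      then (x + aa \<cdot>\<^sub>v dxa, s + aa \<cdot>\<^sub>v dsa) else (x + al \<cdot>\<^sub>v dxl, s + al \<cdot>\<^sub>v dsl))"
    by (rule slls_stepE[OF z st])
  define \<mu> where "\<mu> = mubar z"
  note c = centralD[OF C, folded \<mu>_def]
  have p: "B \<union> N = {..<n}" "B \<inter> N = {}" using partition_B_props B by auto
  note mem = layered_mem[OF C p VU ld]
  have dd: "dxl \<in> kerW A" "dsl \<in> kerW_perp A" using mem by auto
  note a = affine[OF C na, folded \<mu>_def]
  have aa: "0 < aa" "aa \<le> 1" "\<beta> / (3 * sqrt n) \<le> aa" "aa \<le> max (\<beta> / (2 * sqrt n)) (1 - 2 * vnorm (dxa \<odot> dsa) / (\<beta> * \<mu>))"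
    using la by (auto simp: affine_step_length_def \<mu>_def)
  have "mubar z' \<le> mubar (x + aa \<cdot>\<^sub>v dxa, s + aa \<cdot>\<^sub>v dsa)" unfolding z' by auto
  also have "\<dots> = (1 - aa) * \<mu>" by (rule a(4))
  also have "\<dots> \<le> (1 - \<beta> / (3 * sqrt n)) * \<mu>" using aa c(5) by (intro mult_right_mono) auto
  finally show "mubar z' \<le> (1 - \<beta> / (3 * sqrt n)) * mubar z" unfolding \<mu>_def .
  show "z' \<in> nbhd A b c \<beta> \<or> mubar z' = 0 \<and> z' \<in> nbhd_closure A b c \<beta>"
  proof (cases "mubar (x + aa \<cdot>\<^sub>v dxa, s + aa \<cdot>\<^sub>v dsa) < mubar (x + al \<cdot>\<^sub>v dxl, s + al \<cdot>\<^sub>v dsl)")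
    case True
    then have z1: "z' = (x + aa \<cdot>\<^sub>v dxa, s + aa \<cdot>\<^sub>v dsa)" by (simp add: z')
    show ?thesis
    proof (cases "aa = 1")
      case False
      then show ?thesis using a(5)[of aa] aa unfolding z1 by simp
    next
      case True
      have "(x + 1 \<cdot>\<^sub>v dxa, s + 1 \<cdot>\<^sub>v dsa) \<in> nbhd_closure A b c \<beta>"
        using a(5) aa True W_car[OF a(1)] W'_car[OF a(2)] c(3,4) by (intro closure_limit) auto
      moreover have "mubar (x + 1 \<cdot>\<^sub>v dxa, s + 1 \<cdot>\<^sub>v dsa) = 0" using a(4)[of 1] by simp
      ultimately show ?thesis unfolding z1 True by blast
    qed
  next
    case False
    then have z1: "z' = (x + al \<cdot>\<^sub>v dxl, s + al \<cdot>\<^sub>v dsl)" by (simp add: z')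
    define \<epsilon> where "\<epsilon> = vnorm ((x + dxl) \<odot> (s + dsl)) / \<mu>"
    have "(1 - aa) * \<mu> < \<mu>" using aa c(5) by simp
    then have less: "mubar (x + al \<cdot>\<^sub>v dxl, s + al \<cdot>\<^sub>v dsl) < \<mu>" using False a(4)[of aa] by linarith
    \<comment> \<open>Length 0 would keep the point, which cannot compete with the strict decrease
      of the affine step. So the layered candidate is chosen only when the test on its products
      succeeded.\<close>
    have "al \<noteq> 0"
    proof
      assume "al = 0"
      moreover have "x + 0 \<cdot>\<^sub>v dxl = x" "s + 0 \<cdot>\<^sub>v dsl = s" using c(3,4) W_car[OF dd(1)] W'_car[OF dd(2)] by auto
      ultimately show False using less c(8) by simp
    qed
    then have mx: "max (vnorm (dxl \<odot> dsl) / \<mu>) \<epsilon> \<le> \<beta> / 9"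
      using ll unfolding layered_step_length_def Let_def \<mu>_def[symmetric] \<epsilon>_def[symmetric] by argo
    then have ok: "vnorm (dxl \<odot> dsl) / \<mu> \<le> \<beta> / 9" "\<epsilon> \<le> \<beta> / 9" by (simp_all only: max.bounded_iff)
    have ok: "vnorm (dxl \<odot> dsl) / \<mu> \<le> \<beta> / 9" "\<epsilon> \<le> \<beta> / 9" "1 - 9 * \<epsilon> / \<beta> \<le> al" "al \<le> 1 - 8 * \<epsilon> / \<beta>"
      using ll ok unfolding layered_step_length_def Let_def \<mu>_def[symmetric] \<epsilon>_def[symmetric] by (simp_all only: mx if_True atLeastAtMost_iff)
    have e0: "0 \<le> \<epsilon>" using c(5) by (simp add: \<epsilon>_def vnorm_nonneg)
    have pr: "vnorm (dxl \<odot> dsl) \<le> \<beta> / 9 * \<mu>" using ok(1) c(5) by (simp add: pos_divide_le_eq)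
    note L = layered[OF C dd, folded \<mu>_def, OF pr, folded \<epsilon>_def]
    have "9 * \<epsilon> / \<beta> \<le> 1" using ok(2) \<beta> by (simp add: pos_divide_le_eq)
    then have al: "0 \<le> al" using ok(3) by linarith
    show ?thesis
    proof (cases "al < 1")
      case True
      then show ?thesis using L(1)[OF al True ok(4)] unfolding z1 by blast
    next
      case False
      have "8 * \<epsilon> / \<beta> \<le> 0" using False ok(4) by linarith
      then have "\<epsilon> \<le> 0" using \<beta> by (simp add: divide_le_0_iff)
      then have e: "\<epsilon> = 0" and al1: "al = 1" using e0 False ok(4) by auto
      have "(x + 1 \<cdot>\<^sub>v dxl, s + 1 \<cdot>\<^sub>v dsl) \<in> nbhd_closure A b c \<beta>"
        using L(1) e W_car[OF dd(1)] W'_car[OF dd(2)] c(3,4) by (intro closure_limit) auto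
      then show ?thesis using L(2)[OF e] unfolding z1 al1 by blast
    qed
  qed
qed


lemma vnorm_on_ratio:
  assumes "x \<in> carrier_vec n" "s \<in> carrier_vec n" "\<delta> \<in> carrier_vec n" "N \<subseteq> {..<n}"
  shows "vnorm_on N ((x + \<delta>) \<oslash> vsqrt (\<mu> \<cdot>\<^sub>v (x \<oslash> s))) = L2_set (\<lambda>i. (fn x i + fn \<delta> i) / sqrt (\<mu> * (fn x i / fn s i))) N"
  unfolding vnorm_on_def L2_set_def using assms
  by (intro arg_cong[where f=sqrt] sum.cong) (auto simp: fn_def cdiv_def cinv_def vsqrt_def component_mult_def divide_inverse)

lemma lift_subspaces_exist: "\<exists>V U. lift_subspaces svd A x B N V U"
proof -
  obtain C t C' t' where Ct: "(C, t) \<in> svd (submatrix (lift_mat (orth_proj n (cscale (cinv x) (kerW A))) N) B UNIV)"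
    "(C', t') \<in> svd (submatrix (lift_mat (1\<^sub>m n - orth_proj n (cscale (cinv x) (kerW A))) B) N UNIV)"
    using svd_nonempty by metis
  show ?thesis
  proof (cases "B = {} \<or> N = {}")
    case True
    then show ?thesis unfolding lift_subspaces_def Let_def by (cases "B = {}") auto
  next
    case False
    then have "B \<noteq> {}" "N \<noteq> {}" by auto
    then show ?thesis unfolding lift_subspaces_def Let_def dimA
      by (simp only: if_False) (rule exI, rule exI, rule bexI[OF _ Ct(1)], unfold prod.case, rule bexI[OF _ Ct(2)], unfold prod.case, rule conjI, rule refl, rule refl)
  qed
qed

lemma layered_dirs_exist:
  assumes C: "central x s \<mu>" and p: "B \<union> N = {..<n}" "B \<inter> N = {}" and VU: "lift_subspaces svd A x B N V U"
  shows "\<exists>dxl dsl. layered_dirs x s \<mu> B N V U dxl dsl"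
proof -
  note c = centralD[OF C]
  note l = lift_subspaces_props(1-4)[OF c(1) p VU]
  obtain d vs e us where V: "fn ` V = range (\<lambda>c. comb d c vs)" and U: "fn ` U = range (\<lambda>c. comb e c us)" using l(3,4) by blast
  have sub: "N \<subseteq> {..<n}" "B \<subseteq> {..<n}" and fin: "finite N" "finite B" using p partition_finite[OF p(1)] by auto
  have cV: "\<delta> \<in> V \<Longrightarrow> \<delta> \<in> carrier_vec n" and cU: "\<delta> \<in> U \<Longrightarrow> \<delta> \<in> carrier_vec n" for \<delta> using l(1,2) W_car W'_car by auto
  obtain dx where dx: "dx \<in> V" "\<forall>\<delta>'\<in>V. L2_set (\<lambda>i. (fn x i + fn dx i) / sqrt (\<mu> * (fn x i / fn s i))) N \<le> L2_set (\<lambda>i. (fn x i + fn \<delta>' i) / sqrt (\<mu> * (fn x i / fn s i))) N"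
    using L2_set_argmin[OF V fin(1), of "fn x" "\<lambda>i. sqrt (\<mu> * (fn x i / fn s i))"] by blast
  obtain ds where ds: "ds \<in> U" "\<forall>\<delta>'\<in>U. L2_set (\<lambda>i. (fn s i + fn ds i) / sqrt (\<mu> * (fn s i / fn x i))) B \<le> L2_set (\<lambda>i. (fn s i + fn \<delta>' i) / sqrt (\<mu> * (fn s i / fn x i))) B"
    using L2_set_argmin[OF U fin(2), of "fn s" "\<lambda>i. sqrt (\<mu> * (fn s i / fn x i))"] by blast
  have "layered_dirs x s \<mu> B N V U dx ds"
    unfolding layered_dirs_def Let_def is_arg_min_linorder
    using dx ds vnorm_on_ratio[OF c(3,4) cV sub(1)] vnorm_on_ratio[OF c(4,3) cU sub(2)] by simp
  then show ?thesis by blast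
qed

text \<open>The algorithm cannot get stuck: Newton directions exist, the solver returns some output,
  the least squares problems have minimizers, and the lower ends of the two intervals are admissible
  step lengths.\<close>

lemma step_exists:
  assumes z: "z \<in> nbhd A b c \<beta>"
  shows "\<exists>z'. slls_step svd A \<beta> z z'"
proof -
  obtain x0 s0 where zz: "z = (x0, s0)" by (cases z)
  have P: "x0 \<in> primal_pos A b" "s0 \<in> dual_pos A c" using z by (auto simp: zz nbhd_iff)
  have rc: "mubar z \<cdot>\<^sub>v ones n - x0 \<odot> s0 \<in> carrier_vec n" using cmult_carrier[OF primal_car[OF P(1)] dual_car[OF P(2)]] by (simp add: ones_def)
  obtain dxc dsc where nc: "newton_dir A x0 s0 (mubar z \<cdot>\<^sub>v ones n - x0 \<odot> s0) dxc dsc" using newton_dir_exists[OF P rc] by blast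
  define x s \<mu> where "x = x0 + dxc" and "s = s0 + dsc" and "\<mu> = mubar z"
  have C: "central x s \<mu>" using corrector[of x0 s0 dxc dsc] z nc by (simp add: zz x_def s_def \<mu>_def)
  note c = centralD[OF C]
  have ra: "- (x \<odot> s) \<in> carrier_vec n" using cmult_carrier[OF c(3,4)] by simp
  obtain dxa dsa where na: "newton_dir A x s (- (x \<odot> s)) dxa dsa" using newton_dir_exists[OF c(1,2) ra] by blast
  define w where "w = vnorm (dxa \<odot> dsa)"
  have w: "0 \<le> w / (\<beta> * \<mu>)" using \<beta> c(5) by (simp add: w_def vnorm_nonneg)
  define aa where "aa = max (\<beta> / (3 * sqrt n)) (1 - 3 * w / (\<beta> * \<mu>))"
  have "\<beta> / (3 * sqrt n) \<le> \<beta> / (2 * sqrt n)" using n_pos \<beta> by (intro divide_left_mono) auto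
  then have b1: "0 < \<beta> / (3 * sqrt n)" "\<beta> / (3 * sqrt n) \<le> \<beta> / (2 * sqrt n)" "\<beta> / (3 * sqrt n) \<le> 1"
    using affine_rate by auto
  have "1 - 3 * w / (\<beta> * \<mu>) \<le> 1 - 2 * w / (\<beta> * \<mu>)" "1 - 3 * w / (\<beta> * \<mu>) \<le> 1"
    using w by (auto simp: divide_right_mono)
  then have la: "affine_step_length n \<beta> \<mu> dxa dsa aa"
    using b1 unfolding affine_step_length_def w_def[symmetric] aa_def by auto
  define B N where "B = partition_B n x s dxa dsa" and "N = {..<n} - B"
  have p: "B \<union> N = {..<n}" "B \<inter> N = {}" using partition_B_props B_def N_def by auto
  obtain V U where VU: "lift_subspaces svd A x B N V U" using lift_subspaces_exist by blast
  obtain dxl dsl where ld: "layered_dirs x s \<mu> B N V U dxl dsl" using layered_dirs_exist[OF C p VU] by blast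
  define \<epsilon> where "\<epsilon> = vnorm ((x + dxl) \<odot> (s + dsl)) / \<mu>"
  have "0 \<le> \<epsilon>" using c(5) by (simp add: \<epsilon>_def vnorm_nonneg)
  then have "1 - 9 * \<epsilon> / \<beta> \<in> {1 - 9 * \<epsilon> / \<beta>..1 - 8 * \<epsilon> / \<beta>}" using \<beta> by (simp add: divide_right_mono)
  then have "\<exists>al. layered_step_length \<beta> \<mu> x s dxl dsl al"
    unfolding layered_step_length_def Let_def \<epsilon>_def[symmetric] by (cases "max (vnorm (dxl \<odot> dsl) / \<mu>) \<epsilon> \<le> \<beta> / 9") auto
  then obtain al where ll: "layered_step_length \<beta> \<mu> x s dxl dsl al" by blast
  have "slls_step svd A \<beta> z (if mubar (x + aa \<cdot>\<^sub>v dxa, s + aa \<cdot>\<^sub>v dsa) < mubar (x + al \<cdot>\<^sub>v dxl, s + al \<cdot>\<^sub>v dsl)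
      then (x + aa \<cdot>\<^sub>v dxa, s + aa \<cdot>\<^sub>v dsa) else (x + al \<cdot>\<^sub>v dxl, s + al \<cdot>\<^sub>v dsl))"
    unfolding slls_step_def Let_def dimA
    apply (rule exI[of _ dxc], rule exI[of _ dsc])
    apply (intro conjI)
     apply (use nc in \<open>simp add: zz\<close>)
    unfolding zz fst_conv snd_conv x_def[symmetric] s_def[symmetric] c(8)
    apply (rule exI[of _ dxa], rule exI[of _ dsa], rule exI[of _ aa], intro conjI na la)
    unfolding B_def[symmetric] N_def[symmetric]
    by (rule exI[of _ V], rule exI[of _ U], rule exI[of _ dxl], rule exI[of _ dsl], rule exI[of _ al], intro conjI VU ld ll refl)
  then show ?thesis by blast
qed

text \<open>If the claimed bound is not below \<open>\<mu>\<close> itself, it is implied by monotonicity; otherwise the partition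
  computed from the affine scaling direction is the polarizing one.\<close>

lemma gap_step:
  assumes z: "z \<in> nbhd A b c \<beta>" and st: "slls_step svd A \<beta> z z'"
    and p: "B \<union> N = {..<n}" "B \<inter> N = {}" and path: "on_path (mubar z) X S" "on_path \<nu> Y T" and \<nu>: "0 < \<nu>" "\<nu> \<le> mubar z"
    and small: "\<And>i. i \<in> N \<Longrightarrow> Y i \<le> \<Gamma> * (\<nu> / mubar z) * X i" "\<And>i. i \<in> B \<Longrightarrow> T i \<le> \<Gamma> * (\<nu> / mubar z) * S i" and \<Gamma>: "0 \<le> \<Gamma>"
    and d: "has_dim (cone W B N X (\<beta> / (1000 * \<rho> * sqrt n))) d" and mx: "\<not> has_dim (cone W B N X H) (Suc d)" and H: "8 \<le> H"
  shows "mubar z' \<le> 40 / \<beta> * (2 * \<Gamma> * sqrt n * (\<nu> / mubar z) + 96 * n * sqrt n / H) * mubar z"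
proof -
  define \<eta> where "\<eta> = 2 * \<Gamma> * sqrt n * (\<nu> / mubar z) + 96 * n * sqrt n / H"
  define \<mu> where "\<mu> = mubar z"
  obtain x s dxa dsa aa B' N' V U dxl dsl al where C: "central x s (mubar z)"
    and na: "newton_dir A x s (- (x \<odot> s)) dxa dsa"
    and B': "B' = partition_B n x s dxa dsa" "N' = {..<n} - B'" and VU': "lift_subspaces svd A x B' N' V U"
    and ld': "layered_dirs x s (mubar z) B' N' V U dxl dsl" and ll: "layered_step_length \<beta> (mubar z) x s dxl dsl al"
    and z': "z' = (if mubar (x + aa \<cdot>\<^sub>v dxa, s + aa \<cdot>\<^sub>v dsa) < mubar (x + al \<cdot>\<^sub>v dxl, s + al \<cdot>\<^sub>v dsl)
      then (x + aa \<cdot>\<^sub>v dxa, s + aa \<cdot>\<^sub>v dsa) else (x + al \<cdot>\<^sub>v dxl, s + al \<cdot>\<^sub>v dsl))"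
    by (rule slls_stepE[OF z st])
  note c = centralD[OF C, folded \<mu>_def]
  have \<eta>0: "0 \<le> \<eta>" using \<Gamma> \<nu> H by (simp add: \<eta>_def)
  show ?thesis
  proof (cases "\<eta> \<le> \<beta> / 40")
    case False
    have "0 \<le> \<beta> / (3 * sqrt n)" using \<beta> by simp
    then have "(1 - \<beta> / (3 * sqrt n)) * \<mu> \<le> 1 * \<mu>" using c(5) by (intro mult_right_mono) auto
    then have "mubar z' \<le> 1 * \<mu>" using step_sound(2)[OF z st] by (simp add: \<mu>_def)
    also have "1 * \<mu> \<le> 40 / \<beta> * \<eta> * \<mu>" using False \<beta> c(5) by (intro mult_right_mono) (auto simp: field_simps)
    finally show ?thesis unfolding \<eta>_def \<mu>_def .
  next
    case True
    interpret it: lp_iterate n W W' "fn xv" "fn sv" "fn x" "fn s" \<mu> using central_iterate[OF C] unfolding \<mu>_def .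
    interpret du: lp_iterate n W' W "fn sv" "fn xv" "fn s" "fn x" \<mu> by (rule it.dual_iterate)
    have p': "N \<union> B = {..<n}" "N \<inter> B = {}" using p by auto
    have n1: "1 \<le> sqrt n" using n_pos by simp
    \<comment> \<open>The levels lose a factor 2 from path point to iterate, \<rho> in the solver
      and 2 again to the scaled iterate, so the returned subspaces have level
      \<open>4 \<rho> \<tau>\<close>. Multiplied by \<open>2 sqrt n\<close> from
      \<open>cone_small\<close> this is \<open>\<beta> / 125\<close>.\<close>
    define \<tau> where "\<tau> = \<beta> / (1000 * \<rho> * sqrt n)"
    have \<tau>: "0 \<le> \<tau>" using \<beta> \<rho> by (simp add: \<tau>_def)
    have rt: "\<rho> * \<tau> * sqrt n = \<beta> / 1000" using \<rho> n1 by (simp add: \<tau>_def)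
    have "\<rho> * \<tau> * 1 \<le> \<rho> * \<tau> * sqrt n" using n1 \<rho> \<tau> by (intro mult_left_mono) auto
    then have rt1: "\<rho> * \<tau> \<le> \<beta> / 1000" using rt by simp
    have "1 * \<tau> \<le> \<rho> * \<tau>" using \<rho> \<tau> by (intro mult_right_mono) auto
    then have tle: "\<tau> \<le> \<rho> * \<tau>" by simp
    have rt0: "0 \<le> \<rho> * \<tau>" using \<rho> \<tau> by simp
    have H0: "0 \<le> H" using H by simp
    obtain d' where D: "has_dim (cone W B N (fn x) (2 * \<tau>)) d" "\<not> has_dim (cone W B N (fn x) (H / 2)) (Suc d)"
      "has_dim (cone W' N B (\<lambda>i. 1 / fn x i) (2 * \<tau>)) d'" "\<not> has_dim (cone W' N B (\<lambda>i. 1 / fn x i) (H / 2)) (Suc d')"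
      "\<not> has_dim (cone W B N it.xh (H / 4)) (Suc d)" "\<not> has_dim (cone W' N B it.sh (H / 4)) (Suc d')"
      and tr: "\<And>t. 0 \<le> t \<Longrightarrow> cone W B N (fn x) t \<subseteq> cone W B N it.xh (2 * t)"
      "\<And>t. 0 \<le> t \<Longrightarrow> cone W' N B (\<lambda>i. 1 / fn x i) t \<subseteq> cone W' N B it.sh (2 * t)"
      by (rule it.cheap_levels[OF p path(1)[folded \<mu>_def] d[folded \<tau>_def] \<tau> mx H0], rule that; assumption)
    have hd: "du.xh = it.sh" "du.sh = it.xh" by (rule it.dual_scaling)+
    have H4: "2 \<le> H / 4" using H by simp
    have eqH: "24 * n * sqrt n / (H / 4) = 96 * n * sqrt n / H" by simp
    have res: "\<exists>v\<in>V. L2_set (\<lambda>i. (fn x i + v i) / it.xh i) N \<le> \<eta>" if "has_dim V d" "V \<subseteq> cone W B N it.xh 1" for V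
      using it.residual[OF p that D(5) H4 path[folded \<mu>_def] \<nu>[folded \<mu>_def] small(1)[folded \<mu>_def] \<Gamma>]
      unfolding \<eta>_def \<mu>_def[symmetric] eqH by simp
    have res': "\<exists>u\<in>U. L2_set (\<lambda>i. (fn s i + u i) / it.sh i) B \<le> \<eta>" if "has_dim U d'" "U \<subseteq> cone W' N B it.sh 1" for U
      using du.residual[OF p' that(1) that(2)[folded hd] D(6)[folded hd] H4 on_path_dual[OF path(1), folded \<mu>_def] on_path_dual[OF path(2)] \<nu>[folded \<mu>_def] small(2)[folded \<mu>_def] \<Gamma>]
      unfolding \<eta>_def \<mu>_def[symmetric] eqH hd by simp
    have sm: "L2_set (\<lambda>i. v i / it.xh i) B \<le> \<beta> / 125" if "v \<in> cone W B N it.xh (4 * (\<rho> * \<tau>))" "L2_set (\<lambda>i. (fn x i + v i) / it.xh i) N \<le> \<eta>" for v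
    proof -
      have "L2_set (\<lambda>i. v i / it.xh i) B \<le> 2 * sqrt n * (4 * (\<rho> * \<tau>))"
        using it.cone_small[OF p(1) that(1)] rt0 that(2) True \<beta> by simp
      also have "\<dots> = 8 * (\<rho> * \<tau> * sqrt n)" by simp
      finally show ?thesis unfolding rt by simp
    qed
    have sm': "L2_set (\<lambda>i. u i / it.sh i) N \<le> \<beta> / 125" if "u \<in> cone W' N B it.sh (4 * (\<rho> * \<tau>))" "L2_set (\<lambda>i. (fn s i + u i) / it.sh i) B \<le> \<eta>" for u
    proof -
      have "L2_set (\<lambda>i. u i / it.sh i) N \<le> 2 * sqrt n * (4 * (\<rho> * \<tau>))"
        using du.cone_small[OF p'(1), unfolded hd, OF that(1)] rt0 that(2) True \<beta> by simp
      also have "\<dots> = 8 * (\<rho> * \<tau> * sqrt n)" by simp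
      finally show ?thesis unfolding rt by simp
    qed
    have e41: "4 * (\<rho> * \<tau>) \<le> 1" using rt1 \<beta> by simp
    have lift1: "cone W B N (fn x) (2 * \<tau>) \<subseteq> cone W B N it.xh (4 * (\<rho> * \<tau>))"
      using tr(1)[of "2 * \<tau>"] cone_mono[of "2 * (2 * \<tau>)" "4 * (\<rho> * \<tau>)" W B N it.xh] \<tau> tle by auto
    have lift2: "cone W' N B (\<lambda>i. 1 / fn x i) (2 * \<tau>) \<subseteq> cone W' N B it.sh (4 * (\<rho> * \<tau>))"
      using tr(2)[of "2 * \<tau>"] cone_mono[of "2 * (2 * \<tau>)" "4 * (\<rho> * \<tau>)" W' N B it.sh] \<tau> tle by auto
    note one1 = cone_mono[OF e41, of W B N it.xh] and one2 = cone_mono[OF e41, of W' N B it.sh]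
    \<comment> \<open>These witnesses are taken from the cheap cones of the polarizing partition, as
      nothing is known yet about the partition and the subspaces of the algorithm.\<close>
    obtain v where v: "v \<in> cone W B N it.xh (4 * (\<rho> * \<tau>))" "L2_set (\<lambda>i. (fn x i + v i) / it.xh i) N \<le> \<eta>"
      using res[OF has_dim_subset[OF D(1) lift1] one1] by blast
    obtain u where u: "u \<in> cone W' N B it.sh (4 * (\<rho> * \<tau>))" "L2_set (\<lambda>i. (fn s i + u i) / it.sh i) B \<le> \<eta>"
      using res'[OF has_dim_subset[OF D(3) lift2] one2] by blast
    have vW: "v \<in> W" "u \<in> W'" using v(1) u(1) by (auto simp: cone_def)
    have le32: "\<eta> \<le> 1/32" "\<beta> / 125 \<le> 1/32" using True \<beta> by auto
    note a = affine(1-3)[OF C na]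
    have iB: "\<bar>fn dxa i / fn x i\<bar> < \<bar>fn dsa i / fn s i\<bar> \<longleftrightarrow> i \<in> B" if "i < n" for i
      using it.partition_identified[OF p imageI[OF a(1)] imageI[OF a(2)] a(3) vW(1) order_trans[OF v(2) le32(1)] order_trans[OF sm[OF v] le32(2)]
        vW(2) order_trans[OF u(2) le32(1)] order_trans[OF sm'[OF u] le32(2)] that] .
    have dcar: "dxa \<in> carrier_vec n" "dsa \<in> carrier_vec n" using W_car[OF a(1)] W'_car[OF a(2)] .
    have BB: "B' = B"
    proof (rule Set.set_eqI)
      fix i show "i \<in> B' \<longleftrightarrow> i \<in> B"
        using iB[of i] c(3,4) dcar p unfolding B' partition_B_def by (cases "i < n") (auto simp: fn_def)
    qed
    have NN: "N' = N" unfolding B'(2) BB using p by auto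
    note VU = VU'[unfolded BB NN] and ld = ld'[unfolded BB NN]
    note mem = layered_mem[OF C p VU ld]
    have h1: "1 \<le> H / 2" using H by simp
    have mx1: "\<not> has_dim (cone W B N (fn x) 1) (Suc d)" "\<not> has_dim (cone W' N B (\<lambda>i. 1 / fn x i) 1) (Suc d')"
      by (rule notI, rule notE[OF D(2)], erule has_dim_subset[OF _ cone_mono[OF h1]])
         (rule notI, rule notE[OF D(4)], erule has_dim_subset[OF _ cone_mono[OF h1]])
    have t2: "0 \<le> 2 * \<tau>" "\<rho> * (2 * \<tau>) \<le> 1" using \<tau> rt1 \<beta> by auto
    note LV = lift_subspaces_props(5)[OF c(1) p VU D(1) mx1(1) t2] and LU = lift_subspaces_props(6)[OF c(1) p VU D(3) mx1(2) t2]
    have V4: "fn ` V \<subseteq> cone W B N it.xh (4 * (\<rho> * \<tau>))" using LV tr(1)[of "\<rho> * (2 * \<tau>)"] rt0 by (auto simp: mult_ac)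
    have U4: "fn ` U \<subseteq> cone W' N B it.sh (4 * (\<rho> * \<tau>))" using LU tr(2)[of "\<rho> * (2 * \<tau>)"] rt0 by (auto simp: mult_ac)
    \<comment> \<open>With the partitions identified, the subspaces of the algorithm are cheap and
      of full dimension, so they contain vectors with small residual; the minimizers can only do
      better.\<close>
    obtain dv where dv: "dv \<in> V" "L2_set (\<lambda>i. (fn x i + fn dv i) / it.xh i) N \<le> \<eta>"
      using res[of "fn ` V"] LV order_trans[OF V4 one1] by blast
    obtain du' where du': "du' \<in> U" "L2_set (\<lambda>i. (fn s i + fn du' i) / it.sh i) B \<le> \<eta>"
      using res'[of "fn ` U"] LU order_trans[OF U4 one2] by blast
    have sub: "N \<subseteq> {..<n}" "B \<subseteq> {..<n}" using p by auto
    have cV: "\<delta> \<in> V \<Longrightarrow> \<delta> \<in> carrier_vec n" and cU: "\<delta> \<in> U \<Longrightarrow> \<delta> \<in> carrier_vec n" for \<delta> using mem(3,4) W_car W'_car by auto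
    have am: "vnorm_on N ((x + dxl) \<oslash> vsqrt (\<mu> \<cdot>\<^sub>v (x \<oslash> s))) \<le> vnorm_on N ((x + dv) \<oslash> vsqrt (\<mu> \<cdot>\<^sub>v (x \<oslash> s)))"
      "vnorm_on B ((s + dsl) \<oslash> vsqrt (\<mu> \<cdot>\<^sub>v (s \<oslash> x))) \<le> vnorm_on B ((s + du') \<oslash> vsqrt (\<mu> \<cdot>\<^sub>v (s \<oslash> x)))"
      using ld dv(1) du'(1) unfolding layered_dirs_def Let_def is_arg_min_linorder \<mu>_def by auto
    have xhd: "it.xh i = sqrt (\<mu> * (fn x i / fn s i))" "it.sh i = sqrt (\<mu> * (fn s i / fn x i))" for i
      by (simp_all add: it.xh_def it.sh_def)
    have Lx: "L2_set (\<lambda>i. (fn x i + fn dxl i) / it.xh i) N \<le> \<eta>"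
      using am(1) dv(2) unfolding vnorm_on_ratio[OF c(3,4) cV[OF mem(1)] sub(1)] vnorm_on_ratio[OF c(3,4) cV[OF dv(1)] sub(1)] xhd by simp
    have Ls: "L2_set (\<lambda>i. (fn s i + fn dsl i) / it.sh i) B \<le> \<eta>"
      using am(2) du'(2) unfolding vnorm_on_ratio[OF c(4,3) cU[OF mem(2)] sub(2)] vnorm_on_ratio[OF c(4,3) cU[OF du'(1)] sub(2)] xhd by simp
    have mV: "fn dxl \<in> cone W B N it.xh (4 * (\<rho> * \<tau>))" using V4 mem(1) by blast
    have mU: "fn dsl \<in> cone W' N B it.sh (4 * (\<rho> * \<tau>))" using U4 mem(2) by blast
    have le2: "\<beta> / 125 \<le> 1/2" "\<eta> \<le> 1/2" using \<beta> True by auto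
    note LP = it.layered_products[OF p le2 Lx sm[OF mV Lx] Ls sm'[OF mU Ls]]
    have dd: "dxl \<in> kerW A" "dsl \<in> kerW_perp A" using mem by auto
    have lc: "dxl \<in> carrier_vec n" "dsl \<in> carrier_vec n" "x + dxl \<in> carrier_vec n" "s + dsl \<in> carrier_vec n"
      using cV[OF mem(1)] cU[OF mem(2)] c(3,4) by auto
    have vn: "vnorm (dxl \<odot> dsl) = nrm n (\<lambda>i. fn dxl i * fn dsl i)"
      using vnorm_nrm[OF cmult_carrier[OF lc(1,2)]] fn_cmult[OF lc(1,2)] by simp
    have ve: "vnorm ((x + dxl) \<odot> (s + dsl)) = nrm n (\<lambda>i. (fn x i + fn dxl i) * (fn s i + fn dsl i))"
      using vnorm_nrm[OF cmult_carrier[OF lc(3,4)]] fn_cmult[OF lc(3,4)] fn_add[OF c(3) lc(1)] fn_add[OF c(4) lc(2)] by simp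
    define \<epsilon> where "\<epsilon> = vnorm ((x + dxl) \<odot> (s + dsl)) / \<mu>"
    have e4: "\<epsilon> \<le> 4 * \<eta>" using LP(1) c(5) unfolding \<epsilon>_def ve by (simp add: pos_divide_le_eq)
    have e0: "0 \<le> \<epsilon>" using c(5) by (simp add: \<epsilon>_def vnorm_nonneg)
    have "4 * (\<beta> / 125) * \<mu> \<le> \<beta> / 9 * \<mu>" using \<beta> c(5) by (intro mult_right_mono) auto
    then have pr: "vnorm (dxl \<odot> dsl) \<le> \<beta> / 9 * \<mu>" using LP(2) vn by linarith
    have "vnorm (dxl \<odot> dsl) / \<mu> \<le> \<beta> / 9" using pr c(5) by (simp add: pos_divide_le_eq)
    moreover have e9: "\<epsilon> \<le> \<beta> / 9" using e4 True \<beta> by linarith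
    ultimately have mx: "max (vnorm (dxl \<odot> dsl) / \<mu>) \<epsilon> \<le> \<beta> / 9" by (simp only: max.bounded_iff)
    have al: "1 - 9 * \<epsilon> / \<beta> \<le> al" "al \<le> 1 - 8 * \<epsilon> / \<beta>"
      using ll unfolding layered_step_length_def Let_def \<mu>_def[symmetric] \<epsilon>_def[symmetric] by (simp_all only: mx if_True atLeastAtMost_iff)
    have "9 * \<epsilon> / \<beta> \<le> 1" using e9 \<beta> by (simp add: pos_divide_le_eq)
    then have al0: "0 \<le> al" using al(1) by linarith
    note L = layered[OF C dd, folded \<mu>_def, OF pr, folded \<epsilon>_def]
    have "mubar z' \<le> mubar (x + al \<cdot>\<^sub>v dxl, s + al \<cdot>\<^sub>v dsl)" unfolding z' by auto
    \<comment> \<open>The choice of the length gives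
      \<open>1 - al \<le> 9 \<epsilon> / \<beta>\<close>, and the products of the full step add at
      most \<open>\<epsilon> \<le> \<epsilon> / \<beta>\<close>.\<close>
    also have "\<dots> \<le> 10 / \<beta> * \<epsilon> * \<mu>"
    proof (cases "al < 1")
      case True
      have "mubar (x + al \<cdot>\<^sub>v dxl, s + al \<cdot>\<^sub>v dsl) \<le> (1 - al) * \<mu> + \<epsilon> * \<mu>" using L(1)[OF al0 True al(2)] by blast
      also have "\<dots> = (1 - al + \<epsilon>) * \<mu>" by (simp add: algebra_simps)
      also have "\<dots> \<le> 10 / \<beta> * \<epsilon> * \<mu>"
      proof (intro mult_right_mono)
        have "\<epsilon> * \<beta> \<le> \<epsilon> * 1" using \<beta> e0 by (intro mult_left_mono) auto
        then have "\<epsilon> \<le> 1 / \<beta> * \<epsilon>" using \<beta> by (simp add: pos_le_divide_eq)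
        moreover have "1 - al \<le> 9 / \<beta> * \<epsilon>" using al(1) by simp
        moreover have "10 / \<beta> * \<epsilon> = 9 / \<beta> * \<epsilon> + 1 / \<beta> * \<epsilon>" by (simp add: add_divide_distrib[symmetric] algebra_simps)
        ultimately show "1 - al + \<epsilon> \<le> 10 / \<beta> * \<epsilon>" by linarith
      qed (use c(5) in simp)
      finally show ?thesis .
    next
      case False
      have "8 * \<epsilon> / \<beta> \<le> 0" using False al(2) by linarith
      then have "\<epsilon> \<le> 0" using \<beta> by (simp add: divide_le_0_iff)
      then have e: "\<epsilon> = 0" and al1: "al = 1" using e0 False al(2) by auto
      show ?thesis using L(2)[OF e] unfolding al1 e by simp
    qed
    also have "\<dots> \<le> 10 / \<beta> * (4 * \<eta>) * \<mu>" using e4 \<beta> c(5) by (intro mult_right_mono mult_left_mono) auto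
    also have "\<dots> = 40 / \<beta> * \<eta> * \<mu>" by simp
    finally show ?thesis unfolding \<eta>_def \<mu>_def .
  qed
qed

end

subsection \<open>Counting iterations\<close>

locale slls_run = slls +
  fixes T :: nat and \<mu>s :: "nat \<Rightarrow> real" and \<gamma> :: real and Bs Ns :: "nat \<Rightarrow> nat set"
  assumes \<gamma>: "0 < \<gamma>" "\<gamma> \<le> 1" and target: "0 \<le> \<mu>s T"
    and decreasing: "\<And>l. l \<in> {1..T} \<Longrightarrow> \<mu>s l < \<mu>s (l - 1)"
    and polar: "\<And>l. l \<in> {1..T} \<Longrightarrow> polarized A b c \<gamma> (\<mu>s l) (\<mu>s (l - 1)) (Bs l) (Ns l)"
begin

section \<open>Comparison of path points and cheapness along a polarized segment\<close>

definition "Xp \<mu> = fn (fst (cp A b c \<mu>))"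
definition "Sp \<mu> = fn (snd (cp A b c \<mu>))"
text \<open>The factor \<open>2 n\<close> comes from the near-monotonicity \<open>path_le\<close>,
  the factor \<open>1 / \<gamma>\<close> from polarization.\<close>

definition "\<Gamma> = 2 * real n / \<gamma>"
text \<open>Positivity is demanded separately because a segment may end at 0, where the path is a
  limit and cannot serve as a scaling.\<close>

definition "in_seg l \<mu> \<longleftrightarrow> l \<in> {1..T} \<and> 0 < \<mu> \<and> \<mu>s l \<le> \<mu> \<and> \<mu> \<le> \<mu>s (l - 1)"

lemma path: "0 < \<mu> \<Longrightarrow> on_path \<mu> (Xp \<mu>) (Sp \<mu>)"
  unfolding Xp_def Sp_def by (rule cp_on_path(1))

lemma Xp_pos: "0 < \<mu> \<Longrightarrow> i < n \<Longrightarrow> 0 < Xp \<mu> i" and Sp_pos: "0 < \<mu> \<Longrightarrow> i < n \<Longrightarrow> 0 < Sp \<mu> i"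
  and XpSp: "0 < \<mu> \<Longrightarrow> i < n \<Longrightarrow> Xp \<mu> i * Sp \<mu> i = \<mu>"
  using path[of \<mu>] feas_pos by (auto simp: on_path_def)

lemma partition: "l \<in> {1..T} \<Longrightarrow> Bs l \<union> Ns l = {..<n}" "l \<in> {1..T} \<Longrightarrow> Bs l \<inter> Ns l = {}"
  using polar[of l] by (auto simp: polarized_def dimA)

lemma \<mu>s_nonneg: "l \<le> T \<Longrightarrow> 0 \<le> \<mu>s l"
proof (induction rule: inc_induct)
  case base
  show ?case by (rule target)
next
  case (step l)
  then show ?case using decreasing[of "Suc l"] by simp
qed

lemma \<mu>s_pos: "l < T \<Longrightarrow> 0 < \<mu>s l"
  using \<mu>s_nonneg[of "Suc l"] decreasing[of "Suc l"] by simp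

lemma \<Gamma>_ge: "2 * real n \<le> \<Gamma>" "2 \<le> \<Gamma>"
proof -
  have "2 * real n * \<gamma> \<le> 2 * real n * 1" using \<gamma> by (intro mult_left_mono) auto
  then show g: "2 * real n \<le> \<Gamma>" using \<gamma> by (simp add: \<Gamma>_def pos_le_divide_eq)
  have "1 \<le> real n" using n_pos by simp
  then show "2 \<le> \<Gamma>" using g by linarith
qed

text \<open>Both points are compared with the start of the segment: \<open>path_le\<close> bounds
  the one at \<open>\<mu>\<close> from above, polarization the one at \<open>\<nu>\<close> from
  below. Hence the order of \<open>\<mu>\<close> and \<open>\<nu>\<close> is arbitrary.\<close>

lemma seg_compare:
  assumes "in_seg l \<mu>" "in_seg l \<nu>"
  shows "i \<in> Bs l \<Longrightarrow> Xp \<mu> i \<le> \<Gamma> * Xp \<nu> i" "i \<in> Ns l \<Longrightarrow> Sp \<mu> i \<le> \<Gamma> * Sp \<nu> i"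
proof -
  define m where "m = \<mu>s (l - 1)"
  have l: "l \<in> {1..T}" and \<mu>: "0 < \<mu>" "\<mu> \<le> m" and \<nu>: "0 < \<nu>" "\<mu>s l \<le> \<nu>" "\<nu> \<le> m" using assms by (auto simp: in_seg_def m_def)
  have m: "0 < m" using \<mu> by simp
  have car: "cp A b c \<nu> \<in> carrier_vec n \<times> carrier_vec n" "cp A b c m \<in> carrier_vec n \<times> carrier_vec n" using cp_on_path(2) \<nu> m by auto
  have P: "\<gamma> * Xp m i \<le> Xp \<nu> i" if "i \<in> Bs l" for i
    using polar[OF l] \<nu> that partition[OF l] car unfolding polarized_def m_def[symmetric] by (auto simp: Xp_def fn_def mem_Times_iff)
  have Q: "\<gamma> * Sp m i \<le> Sp \<nu> i" if "i \<in> Ns l" for i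
    using polar[OF l] \<nu> that partition[OF l] car unfolding polarized_def m_def[symmetric] by (auto simp: Sp_def fn_def mem_Times_iff)
  have g: "2 * real n * y \<le> \<Gamma> * z" if "\<gamma> * y \<le> z" for y z
  proof -
    have "\<Gamma> * (\<gamma> * y) \<le> \<Gamma> * z" using that \<Gamma>_ge by (intro mult_left_mono) auto
    then show ?thesis using \<gamma> by (simp add: \<Gamma>_def)
  qed
  have lt: "i < n" if "i \<in> Bs l \<union> Ns l" using partition(1)[OF l] that by blast
  show "Xp \<mu> i \<le> \<Gamma> * Xp \<nu> i" if i: "i \<in> Bs l"
    by (rule order_trans[OF path_le(1)[OF path[OF m] path[OF \<mu>(1)] \<mu> lt] g[OF P[OF i]]]) (use i in blast)
  show "Sp \<mu> i \<le> \<Gamma> * Sp \<nu> i" if i: "i \<in> Ns l"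
    by (rule order_trans[OF path_le(2)[OF path[OF m] path[OF \<mu>(1)] \<mu> lt] g[OF Q[OF i]]]) (use i in blast)
qed

text \<open>On the central path the products are equal to the parameter, so a coordinate is
  proportional to it up to \<open>\<Gamma>\<close> when its partner is constant up to
  \<open>\<Gamma>\<close>.\<close>

lemma seg_small:
  assumes "in_seg l \<mu>" "in_seg l \<nu>"
  shows "i \<in> Ns l \<Longrightarrow> Xp \<nu> i \<le> \<Gamma> * (\<nu> / \<mu>) * Xp \<mu> i" "i \<in> Bs l \<Longrightarrow> Sp \<nu> i \<le> \<Gamma> * (\<nu> / \<mu>) * Sp \<mu> i"
proof -
  have l: "l \<in> {1..T}" and \<mu>: "0 < \<mu>" and \<nu>: "0 < \<nu>" using assms by (auto simp: in_seg_def)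
  have flip: "v \<le> \<Gamma> * (\<nu> / \<mu>) * u" if "u * a = \<mu>" "v * e = \<nu>" "0 < u" "0 < v" "a \<le> \<Gamma> * e" for u v a e
  proof -
    have "v * (u * a) \<le> v * (u * (\<Gamma> * e))" using that by (intro mult_left_mono) auto
    also have "\<dots> = \<Gamma> * \<nu> * u" using that(2)[symmetric] by simp
    finally have "v * \<mu> \<le> \<Gamma> * \<nu> * u" using that(1) by simp
    then show ?thesis using \<mu> by (simp add: field_simps)
  qed
  show "Xp \<nu> i \<le> \<Gamma> * (\<nu> / \<mu>) * Xp \<mu> i" if i: "i \<in> Ns l"
  proof -
    have "i < n" using partition(1)[OF l] i by auto
    then show ?thesis using seg_compare(2)[OF assms i] Xp_pos XpSp \<mu> \<nu> by (intro flip[of "Xp \<mu> i" "Sp \<mu> i" _ "Sp \<nu> i"]) auto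
  qed
  show "Sp \<nu> i \<le> \<Gamma> * (\<nu> / \<mu>) * Sp \<mu> i" if i: "i \<in> Bs l"
  proof -
    have "i < n" using partition(1)[OF l] i by auto
    then show ?thesis using seg_compare(1)[OF assms i] Sp_pos XpSp \<mu> \<nu> by (intro flip[of "Sp \<mu> i" "Xp \<mu> i" _ "Xp \<nu> i"]) (auto simp: mult.commute)
  qed
qed

abbreviation "Cn l \<mu> t \<equiv> cone W (Bs l) (Ns l) (Xp \<mu>) t"

text \<open>The scaling on \<open>B\<close> changes by at most \<open>\<Gamma>\<close> and that on
  \<open>N\<close> follows the parameter up to \<open>\<Gamma>\<close>; the level changes by the
  product of the two factors.\<close>

lemma seg_cone:
  assumes "in_seg l \<mu>" "in_seg l \<nu>" and t: "0 \<le> t" and u: "\<Gamma>\<^sup>2 * (\<nu> / \<mu>) * t \<le> u"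
  shows "Cn l \<mu> t \<subseteq> Cn l \<nu> u"
proof
  fix f assume f: "f \<in> Cn l \<mu> t"
  have l: "l \<in> {1..T}" and \<mu>: "0 < \<mu>" and \<nu>: "0 < \<nu>" using assms by (auto simp: in_seg_def)
  have lt: "i < n" if "i \<in> Bs l \<or> i \<in> Ns l" for i using partition(1)[OF l] that by auto
  have G: "0 \<le> \<Gamma>" "0 \<le> \<Gamma> * (\<nu> / \<mu>)" using \<Gamma>_ge \<mu> \<nu> by auto
  have "f \<in> Cn l \<nu> (\<Gamma> * (\<Gamma> * (\<nu> / \<mu>)) * t)"
    using lt Xp_pos \<mu> \<nu> seg_compare(1)[OF assms(1,2)] seg_small(1)[OF assms(1,2)]
    by (intro cone_rescale[OF f t G]) auto
  moreover have "\<Gamma> * (\<Gamma> * (\<nu> / \<mu>)) * t \<le> u" using u by (simp add: power2_eq_square)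
  ultimately show "f \<in> Cn l \<nu> u" using cone_mono by blast
qed

section \<open>Constants of the iteration count\<close>

definition "\<Lambda> = real n * \<rho> / (\<beta> * \<gamma>)"
text \<open>The exponent is dictated by \<open>7680 \<Lambda>^2 \<le> K\<close>: five powers pay for
  the constant, since \<open>\<Lambda> \<ge> 6\<close> and \<open>6^5 = 7776\<close>.\<close>

definition "K = \<Lambda> ^ 7"
text \<open>Enough iterations to divide \<mu> by \<open>K^3\<close> at the guaranteed rate
  \<open>\<beta> / (3 sqrt n)\<close>.\<close>

definition "L = nat \<lceil>9 * sqrt n / \<beta> * ln K\<rceil>"

lemma \<Lambda>_bounds: "6 \<le> \<Lambda>" "\<Gamma> \<le> 2 * \<Lambda>" "\<rho> * real n / \<beta> \<le> \<Lambda>" "real n / (\<beta> * \<gamma>) \<le> \<Lambda>"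
proof -
  have n1: "1 \<le> real n" using n_pos by simp
  have bg: "0 < \<beta> * \<gamma>" "\<beta> * \<gamma> \<le> \<beta>" "\<beta> * \<gamma> \<le> \<gamma>" 
    using \<beta> \<gamma> mult_left_le[of \<gamma> \<beta>] mult_left_le_one_le[of \<gamma> \<beta>] by simp_all
  have nr: "real n * 1 \<le> real n * \<rho>" using \<rho> by (intro mult_left_mono) auto
  show "\<rho> * real n / \<beta> \<le> \<Lambda>" unfolding \<Lambda>_def using bg nr n1 \<beta> by (simp add: mult.commute frac_le)
  show "real n / (\<beta> * \<gamma>) \<le> \<Lambda>" unfolding \<Lambda>_def using bg nr by (simp add: divide_right_mono)
  have "real n / \<gamma> \<le> real n * \<rho> / (\<beta> * \<gamma>)" using bg nr n1 by (intro frac_le) auto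
  then show "\<Gamma> \<le> 2 * \<Lambda>" by (simp add: \<Gamma>_def \<Lambda>_def)
  have h: "1 \<le> real n * \<rho>" using nr n1 by linarith
  have "6 * (\<beta> * \<gamma>) \<le> 6 * \<beta>" using bg(2) by simp
  also have "6 * \<beta> \<le> 1" using \<beta>(2) by simp
  also note h
  finally show "6 \<le> \<Lambda>" unfolding \<Lambda>_def pos_le_divide_eq[OF bg(1)] .
qed

text \<open>One inequality per use: a power of \<open>K\<close> absorbs a transfer along a segment,
  the second pays for the loss of a layered step, the third for the condition
  \<open>8 \<le> H\<close> of \<open>gap_step\<close>, and by the fourth a decrease of \<mu> by
  \<open>K^3\<close> turns level 1 into the cheapness that \<open>gap_step\<close> asks for.\<close>

lemma K_bounds: "\<Gamma>\<^sup>2 \<le> K" "7680 * \<Lambda>\<^sup>2 \<le> K" "8 \<le> K" "\<Gamma>\<^sup>2 / K ^ 3 \<le> \<beta> / (1000 * \<rho> * sqrt n)"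
proof -
  note b = \<Lambda>_bounds
  have L0: "0 < \<Lambda>" "1 \<le> \<Lambda>" using b by auto
  have pw: "6 ^ k \<le> \<Lambda> ^ k" for k using b by (intro power_mono) auto
  have GL: "\<Gamma>\<^sup>2 \<le> 4 * \<Lambda>\<^sup>2" using power_mono[OF b(2), of 2] \<Gamma>_ge(2) by (simp add: power_mult_distrib)
  have "7776 * \<Lambda>\<^sup>2 \<le> \<Lambda> ^ 5 * \<Lambda>\<^sup>2" using pw[of 5] by (intro mult_right_mono) auto
  then have K7: "7776 * \<Lambda>\<^sup>2 \<le> K" by (simp add: K_def power_add[symmetric])
  have L2: "36 \<le> \<Lambda>\<^sup>2" using pw[of 2] by simp
  show "\<Gamma>\<^sup>2 \<le> K" "7680 * \<Lambda>\<^sup>2 \<le> K" and K8: "8 \<le> K" using GL K7 L2 by linarith+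
  have n1: "1 \<le> sqrt n" "sqrt n \<le> real n"
  proof -
    show "1 \<le> sqrt n" using n_pos by simp
    then have "sqrt n * 1 \<le> sqrt n * sqrt n" by (intro mult_left_mono) auto
    then show "sqrt n \<le> real n" by simp
  qed
  have "\<rho> * sqrt n / \<beta> \<le> \<rho> * real n / \<beta>" using n1 \<rho> \<beta> by (intro divide_right_mono mult_left_mono) auto
  then have rb: "\<rho> * sqrt n \<le> \<Lambda> * \<beta>" using b(3) \<beta> by (simp add: pos_divide_le_eq)
  have rb': "1000 * (\<rho> * sqrt n) \<le> 1000 * (\<Lambda> * \<beta>)" using rb by simp
  have "\<Gamma>\<^sup>2 * (1000 * (\<rho> * sqrt n)) \<le> 4 * \<Lambda>\<^sup>2 * (1000 * (\<Lambda> * \<beta>))"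
    by (rule mult_mono[OF GL rb']) (use \<rho> in auto)
  also have "\<dots> = \<beta> * (4000 * \<Lambda> ^ 3)" by (simp add: power3_eq_cube power2_eq_square)
  also have "\<dots> \<le> \<beta> * K ^ 3"
  proof (intro mult_left_mono)
    have "4000 * \<Lambda> ^ 3 \<le> \<Lambda> ^ 5 * \<Lambda> ^ 3" using pw[of 5] L0 by (intro mult_right_mono) auto
    also have "\<dots> = \<Lambda> ^ 8" by (simp add: power_add[symmetric])
    also have "\<dots> \<le> \<Lambda> ^ 21" using L0 by (intro power_increasing) auto
    also have "\<dots> = K ^ 3" by (simp add: K_def power_mult[symmetric])
    finally show "4000 * \<Lambda> ^ 3 \<le> K ^ 3" .
  qed (use \<beta> in simp)
  finally have "\<Gamma>\<^sup>2 * (1000 * \<rho> * sqrt n) \<le> \<beta> * K ^ 3" by (simp add: mult.assoc)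
  then show "\<Gamma>\<^sup>2 / K ^ 3 \<le> \<beta> / (1000 * \<rho> * sqrt n)" using K8 \<rho> n1 by (simp add: frac_le_eq divide_le_eq le_divide_eq mult_ac)
qed

text \<open>\<open>h\<close> is a reference value at which cheapness is known. The iterate only has
  to lie below it and may already have passed the end of the segment.\<close>

definition "state l d j h z \<longleftrightarrow> in_seg l h \<and> mubar z \<le> h \<and> has_dim (Cn l h (K ^ j)) d"

text \<open>Here \<open>j\<close> is the number of further decreases of \<open>\<mu>\<close> by the factor \<open>K\<^sup>3\<close> that restore level 1. A new cheap
  dimension appears with \<open>j \<le> 2\<close>, so the weight 3 makes the measure decrease in every phase.\<close>

definition "measure_of l d j = 3 * (card (Ns l) - d) + j +
  (\<Sum>i = Suc l..T. 3 * card ((Ns i - Ns (i - 1)) \<union> (Ns (i - 1) - Ns i)) + 2)"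

lemma state_dim: "state l d j h z \<Longrightarrow> d \<le> card (Ns l)"
proof -
  assume s: "state l d j h z"
  then have l: "l \<in> {1..T}" "0 < h" by (auto simp: state_def in_seg_def)
  have ne: "Xp h i \<noteq> 0" if "i < n" for i using Xp_pos[OF l(2) that] by simp
  show ?thesis using cone_dim_le[of W "Bs l" "Ns l" "Xp h" "K ^ j" d n] s W_supp partition(1)[OF l(1)] ne by (simp add: state_def)
qed

text \<open>Moving to the end of the segment costs one power of \<open>K\<close>, and the indices
  leaving \<open>N\<close> cost dimensions. The number of missing dimensions thus grows by at most
  the number of indices entering \<open>N\<close>; three times that plus one is less than the
  summand released by crossing into the next segment.\<close>

lemma state_leave:
  assumes s: "state l d j h z" and l: "l < T" and z: "mubar z' \<le> \<mu>s l"
  shows "\<exists>d'. state (Suc l) d' (Suc j) (\<mu>s l) z' \<and> measure_of (Suc l) d' (Suc j) < measure_of l d j"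
proof -
  define d' where "d' = d - card (Ns l - Ns (Suc l))"
  have h: "in_seg l h" and d: "has_dim (Cn l h (K ^ j)) d" using s by (auto simp: state_def)
  have l1: "l \<in> {1..T}" "Suc l \<in> {1..T}" and \<mu>: "0 < \<mu>s l" "0 < h" "\<mu>s l \<le> h" using h l \<mu>s_pos[OF l] by (auto simp: in_seg_def)
  have e: "in_seg l (\<mu>s l)" "in_seg (Suc l) (\<mu>s l)" using l1 \<mu> decreasing[OF l1(1)] decreasing[OF l1(2)] by (auto simp: in_seg_def)
  have K1: "1 \<le> K" using K_bounds(3) by simp
  have "\<Gamma>\<^sup>2 * (\<mu>s l / h) * K ^ j \<le> K * 1 * K ^ j"
    using K_bounds(1) \<mu> K1 by (intro mult_right_mono mult_mono) auto
  then have "Cn l h (K ^ j) \<subseteq> Cn l (\<mu>s l) (K ^ Suc j)" using K1 by (intro seg_cone[OF h e(1)]) auto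
  then have d2: "has_dim (Cn l (\<mu>s l) (K ^ Suc j)) d" using has_dim_subset[OF d] by blast
  have "has_dim (Cn (Suc l) (\<mu>s l) (K ^ Suc j)) d'"
    unfolding d'_def by (rule cone_switch[OF d2 _ partition[OF l1(1)] partition[OF l1(2)]]) (use K1 in simp)
  then have st: "state (Suc l) d' (Suc j) (\<mu>s l) z'" using e(2) z by (simp add: state_def)
  have fin: "finite (Ns l)" "finite (Ns (Suc l))"
    using partition_finite[OF partition(1)[OF l1(1)]] partition_finite[OF partition(1)[OF l1(2)]] by auto
  let ?a = "card (Ns l - Ns (Suc l))" and ?c = "card (Ns (Suc l) - Ns l)" and ?i = "card (Ns l \<inter> Ns (Suc l))"
  have cards: "card (Ns l) = ?i + ?a" "card (Ns (Suc l)) = ?i + ?c"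
    "card ((Ns (Suc l) - Ns l) \<union> (Ns l - Ns (Suc l))) = ?c + ?a"
    using fin card_Int_Diff[of "Ns l" "Ns (Suc l)"] card_Int_Diff[of "Ns (Suc l)" "Ns l"]
    by (auto simp: Int_commute intro!: card_Un_disjoint)
  have "d \<le> card (Ns l)" by (rule state_dim[OF s])
  then have drop: "card (Ns (Suc l)) - d' \<le> card (Ns l) - d + ?c" unfolding d'_def cards(1,2) by linarith
  define rest where "rest k = (\<Sum>i = Suc k..T. 3 * card ((Ns i - Ns (i - 1)) \<union> (Ns (i - 1) - Ns i)) + 2)" for k
  have rest: "rest l = (3 * (?c + ?a) + 2) + rest (Suc l)"
    unfolding rest_def using l by (subst sum.atLeast_Suc_atMost) (auto simp: cards(3))
  have sum_less: "3 * u + Suc j + r < 3 * v + j + (3 * (e + f) + 2 + r)" if "u \<le> v + e" for u v e f r :: nat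
    using that by presburger
  have "measure_of (Suc l) d' (Suc j) < measure_of l d j"
    unfolding measure_of_def rest_def[symmetric] rest by (rule sum_less[OF drop])
  then show ?thesis using st by blast
qed

lemma nbhd_mubar_pos: "z \<in> nbhd A b c \<beta> \<Longrightarrow> 0 < mubar z"
  using mubar_pos[of "fst z" "snd z"] nbhd_iff[of "fst z" "snd z"] by simp

lemma nbhd_subset_closure: "nbhd A b c \<beta> \<subseteq> nbhd_closure A b c \<beta>"
proof
  fix z assume z: "z \<in> nbhd A b c \<beta>"
  obtain x s where zz: "z = (x, s)" by (cases z)
  have car: "x \<in> carrier_vec n" "s \<in> carrier_vec n" using z primal_car dual_car by (auto simp: zz nbhd_iff)
  have v0: "vnorm (x - x) = 0" "vnorm (s - s) = 0" using car by (simp_all add: vnorm_def)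
  show "z \<in> nbhd_closure A b c \<beta>"
    unfolding nbhd_closure_def closure2_def dimA zz
    using car z[unfolded zz] v0 by (auto intro!: bexI[of _ "(x, s)"])
qed

section \<open>Runs of the algorithm and their phases\<close>

definition "run w k \<longleftrightarrow> w 0 \<in> nbhd A b c \<beta> \<and> (\<forall>i<k. slls_iter svd A \<beta> (\<mu>s T) (w i) (w (Suc i)))"

text \<open>Another iteration is made only above the target, which is nonnegative. So no
  intermediate point is one of the limit points with \<open>mubar\<close> zero.\<close>

lemma run_shift: "run w k \<Longrightarrow> p < k \<Longrightarrow> w p \<in> nbhd A b c \<beta> \<and> \<mu>s T < mubar (w p)"
proof (induction p)
  case 0
  then show ?case by (auto simp: run_def slls_iter_def)
next
  case (Suc p)
  then have "w p \<in> nbhd A b c \<beta>" "slls_step svd A \<beta> (w p) (w (Suc p))" "\<mu>s T < mubar (w (Suc p))"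
    by (auto simp: run_def slls_iter_def)
  then show ?case using step_sound(1) target by fastforce
qed

lemma run_suffix: "run w k \<Longrightarrow> p < k \<Longrightarrow> run (\<lambda>i. w (p + i)) (k - p)"
  using run_shift[of w k p] by (auto simp: run_def)

lemma run_last: "run w k \<Longrightarrow> w k \<in> nbhd A b c \<beta> \<or> mubar (w k) = 0 \<and> w k \<in> nbhd_closure A b c \<beta>"
proof (cases k)
  case (Suc p)
  assume r: "run w k"
  then show ?thesis using run_shift[OF r, of p] step_sound(1)[of "w p" "w k"] Suc by (auto simp: run_def slls_iter_def)
qed (auto simp: run_def)

lemma run_decay: "run w k \<Longrightarrow> q + p < k \<Longrightarrow> mubar (w (q + p)) \<le> (1 - \<beta> / (3 * sqrt n)) ^ p * mubar (w q)"
proof (induction p)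
  case 0
  then show ?case by simp
next
  case (Suc p)
  have th: "0 \<le> 1 - \<beta> / (3 * sqrt n)" using affine_rate by simp
  have "w (q + p) \<in> nbhd A b c \<beta>" "slls_step svd A \<beta> (w (q + p)) (w (Suc (q + p)))"
    using run_shift[of w k "q + p"] Suc.prems by (auto simp: run_def slls_iter_def)
  then have "mubar (w (Suc (q + p))) \<le> (1 - \<beta> / (3 * sqrt n)) * mubar (w (q + p))" by (rule step_sound(2))
  also have "\<dots> \<le> (1 - \<beta> / (3 * sqrt n)) * ((1 - \<beta> / (3 * sqrt n)) ^ p * mubar (w q))"
    using Suc th by (intro mult_left_mono) auto
  finally show ?case by (simp add: mult.assoc)
qed

lemma run_mono: assumes "run w k" "q + p < k" shows "mubar (w (q + p)) \<le> mubar (w q)"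
proof -
  have "0 \<le> 1 - \<beta> / (3 * sqrt n)" "1 - \<beta> / (3 * sqrt n) \<le> 1" using affine_rate by auto
  then have "(1 - \<beta> / (3 * sqrt n)) ^ p \<le> 1" by (intro power_le_one) auto
  moreover have "0 < mubar (w q)" using run_shift[OF assms(1), of q] assms(2) nbhd_mubar_pos by auto
  ultimately have "(1 - \<beta> / (3 * sqrt n)) ^ p * mubar (w q) \<le> 1 * mubar (w q)" by (intro mult_right_mono) auto
  then show ?thesis using run_decay[OF assms] by simp
qed

lemma L_decay: "(1 - \<beta> / (3 * sqrt n)) ^ L \<le> 1 / K ^ 3"
proof -
  have n1: "1 \<le> sqrt n" using n_pos by simp
  have K0: "0 < K" using K_bounds(3) by simp
  define \<theta> where "\<theta> = \<beta> / (3 * sqrt n)"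
  have th: "0 < \<theta>" "\<theta> \<le> 1" using affine_rate by (auto simp: \<theta>_def)
  have "9 * sqrt n / \<beta> * ln K \<le> real L" unfolding L_def by linarith
  then have "\<theta> * (9 * sqrt n / \<beta> * ln K) \<le> \<theta> * real L" using th by (intro mult_left_mono) auto
  moreover have "\<theta> * (9 * sqrt n / \<beta> * ln K) = 3 * ln K" using n1 \<beta> by (simp add: \<theta>_def)
  ultimately have lk: "3 * ln K \<le> real L * \<theta>" by (simp add: mult.commute)
  have "(1 - \<theta>) ^ L \<le> exp (- \<theta>) ^ L" using th exp_ge_add_one_self[of "- \<theta>"] by (intro power_mono) auto
  also have "\<dots> = exp (- (real L * \<theta>))" by (simp add: exp_of_nat_mult[symmetric])
  also have "\<dots> \<le> exp (- (3 * ln K))" using lk by simp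
  also have "\<dots> = 1 / K ^ 3" using K0 exp_of_nat_mult[of 3 "ln K"] by (simp add: exp_minus divide_inverse)
  finally show ?thesis unfolding \<theta>_def .
qed

lemma run_L: assumes "run w k" "q + L < k" shows "mubar (w (q + L)) \<le> mubar (w q) / K ^ 3"
proof -
  have "0 < mubar (w q)" using run_shift[OF assms(1), of q] assms(2) nbhd_mubar_pos by auto
  then have "(1 - \<beta> / (3 * sqrt n)) ^ L * mubar (w q) \<le> 1 / K ^ 3 * mubar (w q)" using L_decay by (intro mult_right_mono) auto
  then show ?thesis using run_decay[OF assms] by simp
qed

text \<open>The segment cannot be the last one, because the loop stops once the lower end of that
  one is reached.\<close>

lemma leave:
  assumes s: "state l d j h (w 0)" and r: "run w k" and p: "p < k" and e: "mubar (w p) \<le> \<mu>s l"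
  shows "\<exists>l' d' j' h'. state l' d' j' h' (w p) \<and> measure_of l' d' j' < measure_of l d j"
proof -
  have "l \<noteq> T" using run_shift[OF r p] e by auto
  then have "l < T" using s by (auto simp: state_def in_seg_def)
  from state_leave[OF s this e] show ?thesis by blast
qed

text \<open>The first \<open>L\<close> iterations lower the level by \<open>K^3\<close>, and for
  positive \<open>j\<close> this alone lowers \<open>j\<close>. For \<open>j = 0\<close> the cheap
  subspace is then cheap enough for \<open>gap_step\<close>, and the next iteration, from
  \<open>a\<close> to \<open>e\<close>, decides: without a gap a further dimension is cheap, with a
  gap \<open>e\<close> is within a factor \<open>K\<close> of the end of the segment, which the last
  \<open>L\<close> iterations remove.\<close>

lemma phase:
  assumes s: "state l d j h (w 0)" and r: "run w k" and k: "2 * L + 1 < k"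
  shows "\<exists>p\<le>2 * L + 1. \<exists>l' d' j' h'. state l' d' j' h' (w p) \<and> measure_of l' d' j' < measure_of l d j"
proof -
  define a where "a = mubar (w L)"
  have h: "in_seg l h" "mubar (w 0) \<le> h" and d: "has_dim (Cn l h (K ^ j)) d" using s by (auto simp: state_def)
  have l: "l \<in> {1..T}" and m0: "0 < h" "h \<le> \<mu>s (l - 1)" using h by (auto simp: in_seg_def)
  have K: "0 < K" "1 \<le> K" using K_bounds(3) by auto
  have pos: "0 < mubar (w p)" if "p < k" for p using run_shift[OF r that] nbhd_mubar_pos by blast
  have "mubar (w 0) / K ^ 3 \<le> h / K ^ 3" using h K by (intro divide_right_mono) auto
  then have a3: "a \<le> h / K ^ 3" using run_L[OF r, of 0] k by (simp add: a_def)
  have a0: "0 < a" using pos[of L] k by (simp add: a_def)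
  have "h / K ^ 3 \<le> h / 1" using K m0 by (intro divide_left_mono) auto
  then have am: "a \<le> h" using a3 by simp
  have lv: ?thesis if "p \<le> 2 * L + 1" "mubar (w p) \<le> \<mu>s l" for p
  proof -
    have "p < k" using that(1) k by simp
    from leave[OF s r this that(2)] that(1) show ?thesis by blast
  qed
  show ?thesis
  proof (cases "a \<le> \<mu>s l")
    case True
    then show ?thesis using lv[of L] by (simp add: a_def)
  next
    case False
    have sa: "in_seg l a" using False l a0 am m0 by (auto simp: in_seg_def)
    have g: "\<Gamma>\<^sup>2 * (a / h) \<le> \<Gamma>\<^sup>2 / K ^ 3"
    proof -
      have "a / h \<le> 1 / K ^ 3" using a3 m0 by (simp add: pos_divide_le_eq)
      then have "\<Gamma>\<^sup>2 * (a / h) \<le> \<Gamma>\<^sup>2 * (1 / K ^ 3)" by (intro mult_left_mono) auto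
      then show ?thesis by simp
    qed
    show ?thesis
    proof (cases j)
      case (Suc i)
      have "\<Gamma>\<^sup>2 / K ^ 3 \<le> K / K ^ 3" using K_bounds(1) K by (intro divide_right_mono) auto
      also have "\<dots> = 1 / K\<^sup>2" using K by (simp add: power2_eq_square power3_eq_cube)
      also have "\<dots> \<le> 1 / K" using K by (intro divide_left_mono) (auto simp: power2_eq_square)
      finally have "\<Gamma>\<^sup>2 * (a / h) \<le> 1 / K" using g by simp
      then have "\<Gamma>\<^sup>2 * (a / h) * K ^ j \<le> 1 / K * K ^ j" using K by (intro mult_right_mono) auto
      also have "\<dots> = K ^ i" using K Suc by simp
      finally have "Cn l h (K ^ j) \<subseteq> Cn l a (K ^ i)" using K by (intro seg_cone[OF h(1) sa]) auto
      then have "state l d i a (w L)" using has_dim_subset[OF d] sa by (simp add: state_def a_def)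
      moreover have "measure_of l d i < measure_of l d j" by (simp add: measure_of_def Suc)
      moreover have "L \<le> 2 * L + 1" by simp
      ultimately show ?thesis by blast
    next
      case 0
      define e where "e = mubar (w (L + 1))"
      show ?thesis
      proof (cases "e \<le> \<mu>s l")
        case True
        then show ?thesis using lv[of "L + 1"] by (simp add: e_def)
      next
        case le: False
        have e0: "0 < e" using pos[of "L + 1"] k by (simp add: e_def)
        have ea: "e \<le> a" using run_mono[OF r, of L 1] k by (simp add: e_def a_def)
        have se: "in_seg l e" using le l e0 ea am m0 by (auto simp: in_seg_def)
        have r1: "1 \<le> a / e" using e0 ea by simp
        show ?thesis
        \<comment> \<open>The level depends on the value \<open>e\<close> actually reached. Moving
          from \<open>a\<close> to \<open>e\<close> multiplies it by
          \<open>\<Gamma>^2 e / a\<close>, so at most \<open>K^2\<close> is left however long the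
          step was.\<close>
        proof (cases "has_dim (Cn l a (K * (a / e))) (Suc d)")
          case True
          have "\<Gamma>\<^sup>2 * (e / a) * (K * (a / e)) = \<Gamma>\<^sup>2 * K" using e0 a0 by simp
          also have "\<dots> \<le> K ^ 2" using K_bounds(1) K by (simp add: power2_eq_square)
          finally have g2: "\<Gamma>\<^sup>2 * (e / a) * (K * (a / e)) \<le> K ^ 2" .
          have "0 \<le> K * (a / e)" using K r1 by (intro mult_nonneg_nonneg) linarith+
          from seg_cone[OF sa se this g2] have "Cn l a (K * (a / e)) \<subseteq> Cn l e (K ^ 2)" .
          then have st: "state l (Suc d) 2 e (w (L + 1))" using has_dim_subset[OF True] se by (simp add: state_def e_def)
          have "3 * (card (Ns l) - Suc d) + 2 < 3 * (card (Ns l) - d) + j" using state_dim[OF st] by linarith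
          then have "measure_of l (Suc d) 2 < measure_of l d j" unfolding measure_of_def by (rule add_strict_right_mono)
          moreover have "L + 1 \<le> 2 * L + 1" by simp
          ultimately show ?thesis using st by meson
        next
          case False
          have L1: "L < k" "L + 1 < k" using k by auto
          have zL: "w L \<in> nbhd A b c \<beta>" "slls_step svd A \<beta> (w L) (w (L + 1))"
            using run_shift[OF r L1(1)] r L1 by (auto simp: run_def slls_iter_def)
          have tau: "\<Gamma>\<^sup>2 * (a / h) * K ^ j \<le> \<beta> / (1000 * \<rho> * sqrt n)" using g K_bounds(4) 0 by simp
          have cheap: "has_dim (Cn l a (\<beta> / (1000 * \<rho> * sqrt n))) d"
            using has_dim_subset[OF d seg_cone[OF h(1) sa _ tau]] K by simp
          have K8: "8 \<le> K * (a / e)" using mult_mono[of 8 K 1 "a / e"] K_bounds(3) r1 by simp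
          \<comment> \<open>With \<open>H = K a / e\<close> the second summand of
            \<open>gap_step\<close> is proportional to \<open>e\<close> itself, with the small
            factor \<open>1 / K\<close>, and can be absorbed on the left.\<close>
          have gap: "e \<le> 3840 * \<Lambda>\<^sup>2 * (\<nu> + e / K)" if "in_seg l \<nu>" "\<nu> \<le> a" for \<nu>
          proof -
            have nu: "0 < \<nu>" using that by (simp add: in_seg_def)
            have G0: "0 \<le> \<Gamma>" using \<Gamma>_ge by simp
            have "e \<le> 40 / \<beta> * (2 * \<Gamma> * sqrt n * (\<nu> / a) + 96 * n * sqrt n / (K * (a / e))) * a"
              by (rule gap_step[OF zL partition[OF l] path[OF pos[OF L1(1)]] path[OF nu] nu that(2)[unfolded a_def]
                seg_small[OF sa that(1), unfolded a_def] G0 cheap[unfolded a_def] False[unfolded a_def] K8[unfolded a_def], folded a_def e_def])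
            also have "\<dots> = 80 * (\<Gamma> * sqrt n / \<beta>) * \<nu> + 3840 * (n * sqrt n / \<beta>) * (e / K)"
              using a0 e0 K \<beta> by (simp add: field_simps)
            also have "\<dots> \<le> 3840 * \<Lambda>\<^sup>2 * \<nu> + 3840 * \<Lambda>\<^sup>2 * (e / K)"
            proof -
              have n1: "1 \<le> sqrt n" "sqrt n \<le> real n"
              proof -
                show "1 \<le> sqrt n" using n_pos by simp
                then have "sqrt n * 1 \<le> sqrt n * sqrt n" by (intro mult_left_mono) auto
                then show "sqrt n \<le> real n" by simp
              qed
              have nb: "real n / \<beta> \<le> \<Lambda>"
              proof -
                have "1 * (real n / \<beta>) \<le> \<rho> * (real n / \<beta>)" using \<rho> \<beta> by (intro mult_right_mono) auto
                then show ?thesis using \<Lambda>_bounds(3) by simp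
              qed
              have sb: "sqrt n / \<beta> \<le> real n / \<beta>" using n1 \<beta> by (intro divide_right_mono) auto
              have nL: "real n \<le> \<Lambda>"
              proof -
                have "real n / 1 \<le> real n / \<beta>" using \<beta> by (intro divide_left_mono) auto
                then show ?thesis using nb by simp
              qed
              have "\<Gamma> * (sqrt n / \<beta>) \<le> 2 * \<Lambda> * \<Lambda>" using \<Lambda>_bounds(1,2) G0 sb nb \<beta> by (intro mult_mono) auto
              moreover have "80 * (\<Gamma> * sqrt n / \<beta>) = 80 * (\<Gamma> * (sqrt n / \<beta>))" by simp
              moreover note zero_le_square[of \<Lambda>]
              ultimately have 1: "80 * (\<Gamma> * sqrt n / \<beta>) \<le> 3840 * \<Lambda>\<^sup>2" unfolding power2_eq_square by linarith
              have "real n * (sqrt n / \<beta>) \<le> \<Lambda> * \<Lambda>" using \<Lambda>_bounds(1) nL sb nb \<beta> by (intro mult_mono) auto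
              then have 2: "3840 * (n * sqrt n / \<beta>) \<le> 3840 * \<Lambda>\<^sup>2" by (simp add: power2_eq_square)
              show ?thesis using nu e0 K by (intro add_mono mult_right_mono 1 2) auto
            qed
            finally show ?thesis by (simp add: distrib_left)
          qed
          have half: "e \<le> 7680 * \<Lambda>\<^sup>2 * \<nu>" if "in_seg l \<nu>" "\<nu> \<le> a" for \<nu>
          proof -
            have "3840 * \<Lambda>\<^sup>2 * e \<le> K / 2 * e" using K_bounds(2) e0 by (intro mult_right_mono) auto
            then have "3840 * \<Lambda>\<^sup>2 * (e / K) \<le> e / 2" using K by (simp add: field_simps)
            then show ?thesis using gap[OF that] by (simp add: distrib_left)
          qed
          have L2: "0 < \<Lambda>\<^sup>2" using \<Lambda>_bounds(1) by (intro zero_less_power) simp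
          \<comment> \<open>On a segment ending at 0 the bound would hold for every small
            \<open>\<nu>\<close>; the chosen one gives \<open>e \<le> e / 2\<close>.\<close>
          have l0: "0 < \<mu>s l"
          proof (rule ccontr)
            assume "\<not> 0 < \<mu>s l"
            then have z: "\<mu>s l \<le> 0" by simp
            define \<nu> where "\<nu> = min a (e / (15360 * \<Lambda>\<^sup>2))"
            have "0 < \<nu>" "\<nu> \<le> a" "\<nu> \<le> e / (15360 * \<Lambda>\<^sup>2)" using a0 e0 L2 by (auto simp: \<nu>_def)
            then have "in_seg l \<nu>" using l z am m0 by (auto simp: in_seg_def)
            from half[OF this \<open>\<nu> \<le> a\<close>] have "e \<le> 7680 * \<Lambda>\<^sup>2 * \<nu>" .
            also have "\<dots> \<le> 7680 * \<Lambda>\<^sup>2 * (e / (15360 * \<Lambda>\<^sup>2))" using \<open>\<nu> \<le> e / (15360 * \<Lambda>\<^sup>2)\<close> L2 by (intro mult_left_mono) auto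
            also have "\<dots> = e / 2" using L2 by simp
            finally show False using e0 by simp
          qed
          have "in_seg l (\<mu>s l)" using l l0 decreasing[OF l] by (auto simp: in_seg_def)
          then have "e \<le> 7680 * \<Lambda>\<^sup>2 * \<mu>s l" using half sa by (simp add: in_seg_def)
          also have "\<dots> \<le> K * \<mu>s l" using K_bounds(2) l0 by (intro mult_right_mono) auto
          finally have eK: "e \<le> K * \<mu>s l" .
          have "mubar (w (L + 1 + L)) \<le> e / K ^ 3" using run_L[OF r, of "L + 1"] k by (simp add: e_def)
          also have "\<dots> \<le> K * \<mu>s l / K ^ 3" using eK K by (intro divide_right_mono) auto
          also have "\<dots> = \<mu>s l / K\<^sup>2" using K by (simp add: power2_eq_square power3_eq_cube)
          also have "\<dots> \<le> \<mu>s l / 1" using K l0 by (intro divide_left_mono) auto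
          finally show ?thesis using lv[of "L + 1 + L"] by simp
        qed
      qed
    qed
  qed
qed

text \<open>Each phase ends within \<open>2 L + 1\<close> iterations with a smaller measure; the
  additional 1 pays for a last phase that is too short to be completed.\<close>

lemma run_bound: "state l d j h (w 0) \<Longrightarrow> run w k \<Longrightarrow> k \<le> (2 * L + 2) * (measure_of l d j + 1)"
proof (induction "measure_of l d j" arbitrary: l d j h w k rule: less_induct)
  case less
  show ?case
  proof (cases "2 * L + 1 < k")
    case False
    have "k \<le> (2 * L + 2) * 1" using False by simp
    also have "\<dots> \<le> (2 * L + 2) * (measure_of l d j + 1)" by (intro mult_le_mono2) simp
    finally show ?thesis .
  next
    case True
    obtain p l' d' j' h' where p: "p \<le> 2 * L + 1" and s: "state l' d' j' h' (w p)" and ms: "measure_of l' d' j' < measure_of l d j"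
      using phase[OF less.prems True] by blast
    have "p < k" using p True by simp
    have "k - p \<le> (2 * L + 2) * (measure_of l' d' j' + 1)"
      using less.hyps[OF ms, of h' "\<lambda>i. w (p + i)" "k - p"] s run_suffix[OF less.prems(2) \<open>p < k\<close>] by simp
    also have "\<dots> \<le> (2 * L + 2) * measure_of l d j" using ms by (intro mult_le_mono2) simp
    finally show ?thesis using p by (simp add: algebra_simps)
  qed
qed

text \<open>For \<open>X = (sqrt n / \<beta>) ln K \<ge> 1\<close> the rounding is covered by
  \<open>18 X + 4 \<le> 22 X\<close>, and \<open>ln K = 7 ln \<Lambda>\<close> gives
  \<open>154 = 22 * 7\<close>.\<close>

lemma L_bound: "real (2 * L + 2) \<le> 154 * (sqrt n / \<beta>) * ln \<Lambda>"
proof -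
  have n1: "1 \<le> sqrt n" using n_pos by simp
  have ln1: "1 \<le> ln K"
  proof -
    have "exp 1 \<le> (3::real)" using exp_le by simp
    then have "exp 1 \<le> K" using K_bounds(3) by linarith
    then show ?thesis using K_bounds(3) by (simp add: ln_ge_iff)
  qed
  have lnK: "ln K = 7 * ln \<Lambda>" using \<Lambda>_bounds(1) by (simp add: K_def ln_realpow)
  have "1 / (1/6) \<le> sqrt n / \<beta>" using n1 \<beta> by (intro frac_le) auto
  then have six: "6 \<le> sqrt n / \<beta>" by simp
  have "6 * 1 \<le> sqrt n / \<beta> * ln K" using six ln1 by (intro mult_mono) auto
  moreover have "real L \<le> 9 * sqrt n / \<beta> * ln K + 1"
  proof -
    have "0 \<le> 9 * sqrt n / \<beta> * ln K" using ln1 \<beta> by simp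
    then show ?thesis unfolding L_def by linarith
  qed
  moreover have "9 * sqrt n / \<beta> * ln K = 9 * (sqrt n / \<beta> * ln K)" by simp
  ultimately have "real (2 * L + 2) \<le> 22 * (sqrt n / \<beta> * ln K)" by simp
  then show ?thesis unfolding lnK by simp
qed

text \<open>The constant is \<open>462 = 3 * 154\<close>: the initial measure plus 1 is at most
  three times the sum in the claim, by the weight 3 of the measure.\<close>

lemma finds_within:
  assumes N0: "Ns 0 = {}" and z0: "z0 \<in> nbhd A b c \<beta>" "mubar z0 \<le> \<mu>s 0"
  shows "slls_finds_within svd A \<beta> (\<mu>s T) z0 (nbhd_closure A b c \<beta>)
    (462 * (sqrt n / \<beta>) * ln (n * \<rho> / (\<beta> * \<gamma>)) * (\<Sum>i = 1..T. real (card ((Ns i - Ns (i - 1)) \<union> (Ns (i - 1) - Ns i))) + 1))"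
  unfolding slls_finds_within_def
proof (intro allI impI conjI)
  fix k z assume ex: "(slls_iter svd A \<beta> (\<mu>s T) ^^ k) z0 z"
  then obtain w where w: "w 0 = z0" "w k = z" "\<forall>i<k. slls_iter svd A \<beta> (\<mu>s T) (w i) (w (Suc i))" by (auto simp: relpowp_fun_conv)
  then have r: "run w k" using z0 by (simp add: run_def)
  define D where "D = (\<Sum>i = 1..T. real (card ((Ns i - Ns (i - 1)) \<union> (Ns (i - 1) - Ns i))) + 1)"
  show "(\<exists>z'. slls_iter svd A \<beta> (\<mu>s T) z z') \<or> z \<in> nbhd_closure A b c \<beta> \<and> mubar z \<le> \<mu>s T"
    using run_last[OF r] w(2) nbhd_subset_closure step_exists[of z] target unfolding slls_iter_def by fastforce
  show "real k \<le> 462 * (sqrt n / \<beta>) * ln (n * \<rho> / (\<beta> * \<gamma>)) * (\<Sum>i = 1..T. real (card ((Ns i - Ns (i - 1)) \<union> (Ns (i - 1) - Ns i))) + 1)"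
  \<comment> \<open>Without segments the bound is 0, and the loop is not entered because the
    starting value is at most the target.\<close>
  proof (cases "T = 0")
    case True
    have "k = 0" using run_shift[OF r, of 0] w(1) z0(2) True by (cases k) auto
    then show ?thesis using True by simp
  next
    case False
    have p1: "1 \<in> {1..T}" using False by simp
    have seg: "in_seg 1 (\<mu>s 0)" using decreasing[OF p1] \<mu>s_pos[of 0] False by (auto simp: in_seg_def)
    have "0 \<le> K ^ 0" by simp
    then have zero: "(\<lambda>_. 0) \<in> Cn 1 (\<mu>s 0) (K ^ 0)" using subspD(1)[OF W] by (simp add: cone_def L2_set_0')
    have "has_dim (Cn 1 (\<mu>s 0) (K ^ 0)) 0" using zero by (auto simp: has_dim_def indep_def comb_def)
    then have "state 1 0 0 (\<mu>s 0) (w 0)" using seg z0(2) w(1) by (simp add: state_def)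
    from run_bound[OF this r] have kb: "k \<le> (2 * L + 2) * (measure_of 1 0 0 + 1)" .
    have split: "{1..T} = insert 1 {Suc 1..T}" using False by auto
    \<comment> \<open>As \<open>Ns 0\<close> is empty, the first symmetric difference is
      \<open>Ns 1\<close>, so the initial measure with \<open>d = 0\<close> fits into the same
      sum.\<close>
    have "(\<Sum>i = 1..T. 3 * card ((Ns i - Ns (i - 1)) \<union> (Ns (i - 1) - Ns i)) + 2) = 3 * card (Ns 1) + 2 + (\<Sum>i = Suc 1..T. 3 * card ((Ns i - Ns (i - 1)) \<union> (Ns (i - 1) - Ns i)) + 2)"
      unfolding split using N0 by simp
    then have "measure_of 1 0 0 + 1 \<le> (\<Sum>i = 1..T. 3 * card ((Ns i - Ns (i - 1)) \<union> (Ns (i - 1) - Ns i)) + 2)"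
      by (simp add: measure_of_def)
    also have "\<dots> \<le> (\<Sum>i = 1..T. 3 * (card ((Ns i - Ns (i - 1)) \<union> (Ns (i - 1) - Ns i)) + 1))" by (intro sum_mono) simp
    finally have "real (measure_of 1 0 0 + 1) \<le> real (\<Sum>i = 1..T. 3 * (card ((Ns i - Ns (i - 1)) \<union> (Ns (i - 1) - Ns i)) + 1))"
      by (rule of_nat_mono)
    also have "\<dots> = 3 * D" by (simp add: D_def sum_distrib_left)
    finally have mD: "real (measure_of 1 0 0 + 1) \<le> 3 * D" .
    have "real k \<le> real (2 * L + 2) * real (measure_of 1 0 0 + 1)" using kb unfolding of_nat_mult[symmetric] by (rule of_nat_mono)
    also have "\<dots> \<le> (154 * (sqrt n / \<beta>) * ln \<Lambda>) * (3 * D)"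
    proof (intro mult_mono L_bound mD)
      have "0 \<le> real (2 * L + 2)" by simp
      then show "0 \<le> 154 * (sqrt n / \<beta>) * ln \<Lambda>" using L_bound by linarith
    qed simp
    also have "\<dots> = 462 * (sqrt n / \<beta>) * ln \<Lambda> * D" by simp
    finally show ?thesis unfolding D_def \<Lambda>_def .
  qed
qed

end

theorem theorem8p1:
  shows "\<exists>C::real. 0 < C \<and>
    (\<forall>(n::nat) (m::nat) (A::real mat) (b::real vec) (c::real vec) (T::nat) (\<mu>::nat \<Rightarrow> real)
      (\<gamma>::real) (B::nat \<Rightarrow> nat set) (N::nat \<Rightarrow> nat set) (\<beta>::real) (\<rho>::real)
      (svd::real mat \<Rightarrow> (real mat \<times> real vec) set) (z0::real vec \<times> real vec).
      lp_instance n m A b c \<longrightarrow>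
      0 \<le> \<mu> T \<longrightarrow> (\<forall>i\<in>{1..T}. \<mu> i < \<mu> (i - 1)) \<longrightarrow>
      0 < \<gamma> \<longrightarrow> \<gamma> \<le> 1 \<longrightarrow>
      (\<forall>i\<in>{1..T}. polarized A b c \<gamma> (\<mu> i) (\<mu> (i - 1)) (B i) (N i)) \<longrightarrow>
      N 0 = {} \<longrightarrow>
      0 < \<beta> \<longrightarrow> \<beta> \<le> 1 / 6 \<longrightarrow> 1 \<le> \<rho> \<longrightarrow>
      rho_svd_solver \<rho> svd \<longrightarrow>
      z0 \<in> nbhd A b c \<beta> \<longrightarrow> mubar z0 \<le> \<mu> 0 \<longrightarrow>
      slls_finds_within svd A \<beta> (\<mu> T) z0 (nbhd_closure A b c \<beta>)
        (C * (sqrt (real n) / \<beta>) * ln (real n * \<rho> / (\<beta> * \<gamma>)) *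
          (\<Sum>i = 1..T. (real (card ((N i - N (i - 1)) \<union> (N (i - 1) - N i))) + 1))))"
proof (intro exI[of _ 462] conjI allI impI)
  fix n m A b c T \<gamma> \<beta> \<rho> svd z0 and \<mu> :: "nat \<Rightarrow> real" and B N :: "nat \<Rightarrow> nat set"
  assume a: "lp_instance n m A b c" "0 \<le> \<mu> T" "\<forall>i\<in>{1..T}. \<mu> i < \<mu> (i - 1)" "0 < \<gamma>" "\<gamma> \<le> 1"
    "\<forall>i\<in>{1..T}. polarized A b c \<gamma> (\<mu> i) (\<mu> (i - 1)) (B i) (N i)" "N 0 = {}"
    "0 < \<beta>" "\<beta> \<le> 1 / 6" "1 \<le> \<rho>" "rho_svd_solver \<rho> svd" "z0 \<in> nbhd A b c \<beta>" "mubar z0 \<le> \<mu> 0"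
  obtain xv sv where data: "lp_data n m A b c xv sv" using lp_instance_data[OF a(1)] by blast
  interpret slls_run n m A b c xv sv svd \<beta> \<rho> T \<mu> \<gamma> B N
  proof (intro slls_run.intro slls.intro slls_axioms.intro slls_run_axioms.intro)
    show "\<mu> l < \<mu> (l - 1)" if "l \<in> {1..T}" for l using a(3) that by blast
    show "polarized A b c \<gamma> (\<mu> l) (\<mu> (l - 1)) (B l) (N l)" if "l \<in> {1..T}" for l using a(6) that by blast
  qed (rule data a(2) a(4) a(5) a(8) a(9) a(10) a(11))+
  show "slls_finds_within svd A \<beta> (\<mu> T) z0 (nbhd_closure A b c \<beta>)
        (462 * (sqrt (real n) / \<beta>) * ln (real n * \<rho> / (\<beta> * \<gamma>)) *
          (\<Sum>i = 1..T. (real (card ((N i - N (i - 1)) \<union> (N (i - 1) - N i))) + 1)))"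
    by (rule finds_within[OF a(7,12,13)])
qed simp

end
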